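(* Let $P(D)=\sum_{|\alpha|\le m}c_\alpha D^\alpha$ be a differential operator on $\mathbb{R}^n$ with coefficients in $\widetilde{\mathbb{C}}$ such that $\widetilde{P}(\xi_0)$ is invertible in $\widetilde{\mathbb{R}}$ for some $\xi_0\in\mathbb{R}^n$, let $(P_\varepsilon)_\varepsilon$ be a representative of $P$, let $k\in\mathcal{K}$, $1\le p\le\infty$, and let $v\in\mathcal{L}_{\rm b}(\mathcal{G}(\mathbb{R}^n),\widetilde{\mathbb{C}})$. If $v$ is defined by a $B_{p,k}$-moderate net $(v_\varepsilon)_\varepsilon$, then the equation $$P(D)u=v$$ has a solution $u\in\mathcal{L}_{\rm b}(\mathcal{G}_c(\mathbb{R}^n),\widetilde{\mathbb{C}})$ which is given by a $(B^{\rm loc}_{p,k\widetilde{P_\varepsilon}})_\varepsilon$-moderate net $(u_\varepsilon)_\varepsilon$.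
   Context: All nets are indexed by $\varepsilon\in(0,1]$; $O(\cdot)$ is as $\varepsilon\to0$. $\widetilde{\mathbb{C}}$ (resp. $\widetilde{\mathbb{R}}$) is the ring of complex (resp. real) nets that are moderate ($\exists N\in\mathbb{N}$: $|r_\varepsilon|=O(\varepsilon^{-N})$) modulo negligible nets ($\forall q\in\mathbb{N}$: $|r_\varepsilon|=O(\varepsilon^{q})$). $\mathcal{G}(\mathbb{R}^n)$ is the Colombeau algebra: nets $(u_\varepsilon)_\varepsilon$ in $C^\infty(\mathbb{R}^n)$ with $\forall K\Subset\mathbb{R}^n\,\forall\alpha\,\exists N$: $\sup_K|\partial^\alpha u_\varepsilon|=O(\varepsilon^{-N})$, modulo nets with $\forall K\,\forall\alpha\,\forall q$: $\sup_K|\partial^\alpha u_\varepsilon|=O(\varepsilon^q)$. $\mathcal{G}_c(\mathbb{R}^n)$ consists of the elements with compact support (representatives are chosen with supports in one compact set independent of $\varepsilon$). $\mathcal{L}_{\rm b}(\mathcal{G}_c(\mathbb{R}^n),\widetilde{\mathbb{C}})$ (basic functionals) is the set of maps $T:\mathcal{G}_c(\mathbb{R}^n)\to\widetilde{\mathbb{C}}$ of the form $T(u)=[(T_\varepsilon(u_\varepsilon))_\varepsilon]$ for a net $(T_\varepsilon)_\varepsilon$ in $\mathcal{D}'(\mathbb{R}^n)$ such that $\forall K\Subset\mathbb{R}^n\ \exists j,N\in\mathbb{N},c>0,\eta\in(0,1]$: $|T_\varepsilon(f)|\le c\,\varepsilon^{-N}\sup_{x\in K,|\alpha|\le j}|\partial^\alpha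 f(x)|$ for all $f\in C^\infty_K(\mathbb{R}^n)$, $\varepsilon\in(0,\eta]$ (these are automatically continuous for the natural topology of $\mathcal{G}_c(\mathbb{R}^n)$). $\mathcal{L}_{\rm b}(\mathcal{G}(\mathbb{R}^n),\widetilde{\mathbb{C}})$ is the set of maps $T:\mathcal{G}(\mathbb{R}^n)\to\widetilde{\mathbb{C}}$, $T(u)=[(T_\varepsilon(u_\varepsilon))_\varepsilon]$, for a net $(T_\varepsilon)_\varepsilon$ in $\mathcal{E}'(\mathbb{R}^n)$ for which there are $K\Subset\mathbb{R}^n$, $j,N\in\mathbb{N}$, $c>0$, $\eta\in(0,1]$ such that the same estimate holds for all $f\in C^\infty(\mathbb{R}^n)$, $\varepsilon\in(0,\eta]$; it is identified by restriction with a set of compactly supported functionals on $\mathcal{G}_c(\mathbb{R}^n)$. A functional $T$ is defined (given) by a net $(T_\varepsilon)_\varepsilon$ of distributions if $T(u)=[(T_\varepsilon(u_\varepsilon))_\varepsilon]$ for $u\in\mathcal{G}_c(\mathbb{R}^n)$. $D^\alpha=(-i)^{|\alpha|}\partial^\alpha$; $P(D)T(u)=T({}^tP(D)u)$ with ${}^tP(D)=\sum(-1)^{|\alpha|}c_\alpha D^\alpha$. A representative of $P$ is a net $P_\varepsilon(\xi)=\sum_{|\alpha|\le m}c_{\alpha,\varepsilon}\xi^\alpha$ with $(c_{\alpha,\varepsilon})_\varepsilon$ representatives of $c_\alpha$; $\widetilde{P_\varepsilon}(\xi)=(\sum_{|\alpha|\le m}|\partial^\alpha P_\varepsilon(\xi)|^2)^{1/2}$,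 $\widetilde{P}(\xi)=[(\widetilde{P_\varepsilon}(\xi))_\varepsilon]\in\widetilde{\mathbb{R}}$. $\mathcal{K}$ is the set of tempered weight functions: positive functions $k$ on $\mathbb{R}^n$ such that for some $C>0$, $N\in\mathbb{N}$, $k(\xi+\eta)\le(1+C|\xi|)^Nk(\eta)$ for all $\xi,\eta\in\mathbb{R}^n$. A net $(T_\varepsilon)_\varepsilon$ in $\mathscr{S}'(\mathbb{R}^n)$ is $(B_{p,k\widetilde{P_\varepsilon}})_\varepsilon$-moderate if every $\widehat{T_\varepsilon}$ is a function and there is $b\in\mathbb{R}$ with $\Vert k\widetilde{P_\varepsilon}\widehat{T_\varepsilon}\Vert_{L^p}=O(\varepsilon^b)$; it is $B_{p,k}$-moderate if the same holds with $\widetilde{P_\varepsilon}$ replaced by $1$. A net $(T_\varepsilon)_\varepsilon$ in $\mathcal{D}'(\mathbb{R}^n)$ is $(B^{\rm loc}_{p,k\widetilde{P_\varepsilon}})_\varepsilon$-moderate if $(\varphi T_\varepsilon)_\varepsilon$ is $(B_{p,k\widetilde{P_\varepsilon}})_\varepsilon$-moderate for every $\varphi\in C^\infty_c(\mathbb{R}^n)$. *)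

theory Defs
  imports "HOL-Analysis.Analysis" "HOL-Probability.Essential_Supremum"
begin

section \<open>Multi-indices and partial derivatives\<close>

type_synonym 'n multiindex = "'n \<Rightarrow> nat"

definition mi_order :: "'n::finite multiindex \<Rightarrow> nat" where
  "mi_order \<alpha> = (\<Sum>i\<in>UNIV. \<alpha> i)"

definition monomial :: "'n::finite multiindex \<Rightarrow> real ^ 'n \<Rightarrow> real" where
  "monomial \<alpha> x = (\<Prod>i\<in>UNIV. (x $ i) ^ \<alpha> i)"

definition partial_deriv :: "'n::finite \<Rightarrow> (real ^ 'n \<Rightarrow> complex) \<Rightarrow> real ^ 'n \<Rightarrow> complex" where
  "partial_deriv i f x = frechet_derivative f (at x) (axis i 1)"

text \<open>All iterated partial derivatives exist and are differentiable (hence continuous); this is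
  \<open>C\<^sup>\<infinity>\<close>.\<close>

definition smooth :: "(real ^ 'n::finite \<Rightarrow> complex) \<Rightarrow> bool" where
  "smooth f \<longleftrightarrow> (\<forall>is x. foldr partial_deriv is f differentiable (at x))"

text \<open>The order of differentiation is left open; it is immaterial for smooth functions, see
  \<open>foldr_partial_deriv\<close> below.\<close>

definition mpartial :: "'n::finite multiindex \<Rightarrow> (real ^ 'n \<Rightarrow> complex) \<Rightarrow> real ^ 'n \<Rightarrow> complex" where
  "mpartial \<alpha> f = foldr partial_deriv (SOME is. \<forall>i. count_list is i = \<alpha> i) f"

lemma finite_mi_order_le: "finite {\<alpha> :: 'n::finite multiindex. mi_order \<alpha> \<le> m}"
proof (rule finite_subset)
  show "{\<alpha> :: 'n multiindex. mi_order \<alpha> \<le> m} \<subseteq> (UNIV :: 'n set) \<rightarrow>\<^sub>E {..m}"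
  proof
    fix \<alpha> :: "'n multiindex" assume "\<alpha> \<in> {\<alpha>. mi_order \<alpha> \<le> m}"
    moreover have "\<alpha> i \<le> mi_order \<alpha>" for i
      unfolding mi_order_def by (rule member_le_sum) auto
    ultimately show "\<alpha> \<in> (UNIV :: 'n set) \<rightarrow>\<^sub>E {..m}"
      by (auto simp: PiE_def intro: order_trans)
  qed
  show "finite ((UNIV :: 'n set) \<rightarrow>\<^sub>E {..m})"
    by (intro finite_PiE) auto
qed

lemma smooth_differentiable: "smooth f \<Longrightarrow> f differentiable (at x)"
  unfolding smooth_def by (metis foldr.simps(1) id_apply)

lemma smooth_foldr: "smooth f \<Longrightarrow> smooth (foldr partial_deriv is f)"
  unfolding smooth_def by (metis foldr_append comp_apply)

lemma smooth_partial_deriv: "smooth f \<Longrightarrow> smooth (partial_deriv i f)"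
  using smooth_foldr[of f "[i]"] by simp

lemma smooth_mpartial: "smooth f \<Longrightarrow> smooth (mpartial \<alpha> f)"
  unfolding mpartial_def by (rule smooth_foldr)

lemma partial_deriv_0: "partial_deriv i (\<lambda>x. 0) = (\<lambda>x. 0)"
  by (simp add: partial_deriv_def fun_eq_iff)

lemma partial_deriv_add:
  assumes "\<And>x. f differentiable (at x)" "\<And>x. g differentiable (at x)"
  shows "partial_deriv i (\<lambda>x. f x + g x) = (\<lambda>x. partial_deriv i f x + partial_deriv i g x)"
proof
  fix x
  have "((\<lambda>x. f x + g x) has_derivative
      (\<lambda>h. frechet_derivative f (at x) h + frechet_derivative g (at x) h)) (at x)"
    using assms by (intro has_derivative_add) (auto simp: frechet_derivative_works[symmetric])
  from frechet_derivative_at[OF this]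
  show "partial_deriv i (\<lambda>x. f x + g x) x = partial_deriv i f x + partial_deriv i g x"
    unfolding partial_deriv_def by (metis (no_types, lifting))
qed

lemma partial_deriv_cmult:
  assumes "\<And>x. f differentiable (at x)"
  shows "partial_deriv i (\<lambda>x. c * f x) = (\<lambda>x. c * partial_deriv i f x)"
proof
  fix x
  have "((\<lambda>x. c * f x) has_derivative (\<lambda>h. c * frechet_derivative f (at x) h)) (at x)"
    using assms by (intro has_derivative_mult_right) (auto simp: frechet_derivative_works[symmetric])
  from frechet_derivative_at[OF this]
  show "partial_deriv i (\<lambda>x. c * f x) x = c * partial_deriv i f x"
    unfolding partial_deriv_def by (metis (no_types, lifting))
qed

lemma foldr_partial_deriv_0: "foldr partial_deriv is (\<lambda>x. 0) = (\<lambda>x. 0)"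
  by (induction "is") (auto simp: partial_deriv_0)

lemma foldr_partial_deriv_add:
  assumes "smooth f" "smooth g"
  shows "foldr partial_deriv is (\<lambda>x. f x + g x)
       = (\<lambda>x. foldr partial_deriv is f x + foldr partial_deriv is g x)"
  using assms by (induction "is") (auto simp: smooth_def partial_deriv_add)

lemma foldr_partial_deriv_cmult:
  assumes "smooth f"
  shows "foldr partial_deriv is (\<lambda>x. c * f x) = (\<lambda>x. c * foldr partial_deriv is f x)"
  using assms by (induction "is") (auto simp: smooth_def partial_deriv_cmult)

lemma smooth_0: "smooth (\<lambda>x. 0)"
  by (simp add: smooth_def foldr_partial_deriv_0)

lemma smooth_add: "smooth f \<Longrightarrow> smooth g \<Longrightarrow> smooth (\<lambda>x. f x + g x)"
  unfolding smooth_def[of "\<lambda>x. f x + g x"] by (auto simp: foldr_partial_deriv_add) (auto simp: smooth_def)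

lemma smooth_cmult: "smooth f \<Longrightarrow> smooth (\<lambda>x. c * f x)"
  unfolding smooth_def[of "\<lambda>x. c * f x"] by (auto simp: foldr_partial_deriv_cmult)
    (auto simp: smooth_def intro!: differentiable_mult)

lemma smooth_diff: "smooth f \<Longrightarrow> smooth g \<Longrightarrow> smooth (\<lambda>x. f x - g x)"
  using smooth_add[of f "\<lambda>x. -1 * g x"] smooth_cmult[of g "-1"] by simp

lemma mpartial_0: "mpartial \<alpha> (\<lambda>x. 0) = (\<lambda>x. 0)"
  unfolding mpartial_def by (rule foldr_partial_deriv_0)

lemma mpartial_add:
  "smooth f \<Longrightarrow> smooth g \<Longrightarrow> mpartial \<alpha> (\<lambda>x. f x + g x) = (\<lambda>x. mpartial \<alpha> f x + mpartial \<alpha> g x)"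
  unfolding mpartial_def by (rule foldr_partial_deriv_add)

lemma mpartial_cmult: "smooth f \<Longrightarrow> mpartial \<alpha> (\<lambda>x. c * f x) = (\<lambda>x. c * mpartial \<alpha> f x)"
  unfolding mpartial_def by (rule foldr_partial_deriv_cmult)

lemma mpartial_uminus: "smooth f \<Longrightarrow> mpartial \<alpha> (\<lambda>x. - f x) = (\<lambda>x. - mpartial \<alpha> f x)"
  using mpartial_cmult[of f \<alpha> "-1"] by simp

lemma mpartial_diff:
  "smooth f \<Longrightarrow> smooth g \<Longrightarrow> mpartial \<alpha> (\<lambda>x. f x - g x) = (\<lambda>x. mpartial \<alpha> f x - mpartial \<alpha> g x)"
  using mpartial_add[of f "\<lambda>x. -1 * g x" \<alpha>] smooth_cmult[of g "-1"] mpartial_uminus[of g \<alpha>] by simp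

lemma second_difference_bound:
  fixes f :: "real ^ 'n::finite \<Rightarrow> complex"
  assumes f: "\<And>x. f differentiable (at x)" and g: "partial_deriv i f differentiable (at x)" and "e > 0"
  shows "\<exists>d>0. \<forall>h. 0 < h \<and> h < d \<longrightarrow>
    norm (f (x + h *\<^sub>R axis i 1 + h *\<^sub>R axis j 1) - f (x + h *\<^sub>R axis i 1) - f (x + h *\<^sub>R axis j 1) + f x
          - of_real (h^2) * partial_deriv j (partial_deriv i f) x) \<le> e * h\<^sup>2"
proof -
  let ?a = "axis i 1 :: real ^ 'n" and ?b = "axis j 1 :: real ^ 'n"
  let ?g = "partial_deriv i f"
  define L where "L = frechet_derivative ?g (at x)"
  have L: "(?g has_derivative L) (at x)"
    using g unfolding L_def by (simp add: frechet_derivative_works[symmetric])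
  interpret L: bounded_linear L using L by (rule has_derivative_bounded_linear)
  define e' where "e' = e / 3"
  have "e' > 0" using assms by (simp add: e'_def)
  with L obtain d where d: "d > 0"
    "\<And>y. norm (y - x) < d \<Longrightarrow> norm (?g y - ?g x - L (y - x)) \<le> e' * norm (y - x)"
    unfolding has_derivative_at_alt by blast
  have "norm (f (x + h *\<^sub>R ?a + h *\<^sub>R ?b) - f (x + h *\<^sub>R ?a) - f (x + h *\<^sub>R ?b) + f x
          - of_real (h^2) * L ?b) \<le> e * h\<^sup>2" if h: "0 < h" "h < d / 2" for h
  proof -
    define \<phi> where "\<phi> t = f (x + h *\<^sub>R ?b + t *\<^sub>R ?a) - f (x + t *\<^sub>R ?a) - of_real (t * h) * L ?b" for t
    define \<phi>' where "\<phi>' t = ?g (x + h *\<^sub>R ?b + t *\<^sub>R ?a) - ?g (x + t *\<^sub>R ?a) - of_real h * L ?b" for t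
    have vd: "((\<lambda>t. f (y + t *\<^sub>R ?a)) has_vector_derivative ?g (y + t *\<^sub>R ?a)) (at t within S)" for y t S
    proof -
      have "((\<lambda>t. y + t *\<^sub>R ?a) has_vector_derivative ?a) (at t)"
        by (auto intro!: derivative_eq_intros simp: has_vector_derivative_def)
      moreover have "(f has_derivative frechet_derivative f (at (y + t *\<^sub>R ?a))) (at (y + t *\<^sub>R ?a))"
        using f by (simp add: frechet_derivative_works[symmetric])
      ultimately have "((\<lambda>t. f (y + t *\<^sub>R ?a)) has_vector_derivative ?g (y + t *\<^sub>R ?a)) (at t)"
        using vector_derivative_diff_chain_within[of "\<lambda>t. y + t *\<^sub>R ?a" ?a t UNIV f]
        by (simp add: o_def partial_deriv_def has_derivative_at_withinI)
      thus ?thesis by (rule has_vector_derivative_at_within)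
    qed
    have der: "(\<phi> has_vector_derivative \<phi>' t) (at t within {0..h})" for t
    proof -
      have "((\<lambda>t. of_real (t * h) * L ?b) has_vector_derivative of_real h * L ?b) (at t within {0..h})"
        by (auto intro!: derivative_eq_intros simp: has_vector_derivative_def scaleR_conv_of_real)
      thus ?thesis unfolding \<phi>_def \<phi>'_def
        by (intro has_vector_derivative_diff vd)
    qed
    have bnd: "norm (\<phi>' t) \<le> e * h" if t: "t \<in> {0..h}" for t
    proof -
      have n1: "norm (h *\<^sub>R ?b + t *\<^sub>R ?a) \<le> 2 * h"
        using norm_triangle_ineq[of "h *\<^sub>R ?b" "t *\<^sub>R ?a"] t h by simp
      have n2: "norm (t *\<^sub>R ?a) \<le> h" using t by simp
      have A: "norm (?g (x + h *\<^sub>R ?b + t *\<^sub>R ?a) - ?g x - L (h *\<^sub>R ?b + t *\<^sub>R ?a)) \<le> e' * (2 * h)"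
      proof -
        have "norm (?g (x + (h *\<^sub>R ?b + t *\<^sub>R ?a)) - ?g x - L (h *\<^sub>R ?b + t *\<^sub>R ?a))
            \<le> e' * norm (h *\<^sub>R ?b + t *\<^sub>R ?a)"
          using d(2)[of "x + (h *\<^sub>R ?b + t *\<^sub>R ?a)"] n1 h by simp
        also have "\<dots> \<le> e' * (2 * h)" using n1 \<open>e' > 0\<close> by (intro mult_left_mono) auto
        finally show ?thesis by (simp add: add.assoc)
      qed
      have B: "norm (?g (x + t *\<^sub>R ?a) - ?g x - L (t *\<^sub>R ?a)) \<le> e' * h"
      proof -
        have "norm (?g (x + t *\<^sub>R ?a) - ?g x - L (t *\<^sub>R ?a)) \<le> e' * norm (t *\<^sub>R ?a)"
          using d(2)[of "x + t *\<^sub>R ?a"] n2 h by simp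
        also have "\<dots> \<le> e' * h" using n2 \<open>e' > 0\<close> by (intro mult_left_mono) auto
        finally show ?thesis .
      qed
      have "\<phi>' t = (?g (x + h *\<^sub>R ?b + t *\<^sub>R ?a) - ?g x - L (h *\<^sub>R ?b + t *\<^sub>R ?a))
                  - (?g (x + t *\<^sub>R ?a) - ?g x - L (t *\<^sub>R ?a))"
        by (simp add: \<phi>'_def L.add L.scaleR scaleR_conv_of_real[where 'a = complex])
      also have "norm \<dots> \<le> e' * (2 * h) + e' * h"
        by (rule order_trans[OF norm_triangle_ineq4 add_mono[OF A B]])
      finally show ?thesis by (simp add: e'_def)
    qed
    have "norm (\<phi> h - \<phi> 0) \<le> e * h * norm (h - 0)"
    proof (rule differentiable_bound[where S = "{0..h}" and f' = "\<lambda>t s. s *\<^sub>R \<phi>' t"])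
      show "onorm (\<lambda>s. s *\<^sub>R \<phi>' t) \<le> e * h" if "t \<in> {0..h}" for t
        using bnd[OF that] by (intro onorm_le) (auto simp: mult.commute intro: mult_left_mono)
    qed (use der h in \<open>auto simp: has_vector_derivative_def\<close>)
    thus ?thesis using h
      by (simp add: \<phi>_def power2_eq_square algebra_simps)
  qed
  thus ?thesis using \<open>d > 0\<close>
    by (intro exI[of _ "d / 2"]) (auto simp: partial_deriv_def L_def)
qed

lemma partial_deriv_commute:
  fixes f :: "real ^ 'n::finite \<Rightarrow> complex"
  assumes f: "\<And>x. f differentiable (at x)" "\<And>i x. partial_deriv i f differentiable (at x)"
  shows "partial_deriv j (partial_deriv i f) = partial_deriv i (partial_deriv j f)"
proof
  fix x
  let ?A = "partial_deriv j (partial_deriv i f) x" and ?B = "partial_deriv i (partial_deriv j f) x"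
  have "norm (?A - ?B) \<le> 2 * e" if "e > 0" for e
  proof -
    obtain d1 where d1: "d1 > 0" "\<And>h. 0 < h \<and> h < d1 \<Longrightarrow>
      norm (f (x + h *\<^sub>R axis i 1 + h *\<^sub>R axis j 1) - f (x + h *\<^sub>R axis i 1) - f (x + h *\<^sub>R axis j 1) + f x
          - of_real (h^2) * ?A) \<le> e * h\<^sup>2"
      using second_difference_bound[OF f(1) f(2) \<open>e > 0\<close>] by blast
    obtain d2 where d2: "d2 > 0" "\<And>h. 0 < h \<and> h < d2 \<Longrightarrow>
      norm (f (x + h *\<^sub>R axis j 1 + h *\<^sub>R axis i 1) - f (x + h *\<^sub>R axis j 1) - f (x + h *\<^sub>R axis i 1) + f x
          - of_real (h^2) * ?B) \<le> e * h\<^sup>2"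
      using second_difference_bound[OF f(1) f(2) \<open>e > 0\<close>] by blast
    define h where "h = min d1 d2 / 2"
    have h: "0 < h \<and> h < d1" "0 < h \<and> h < d2" using d1 d2 by (auto simp: h_def)
    let ?D = "f (x + h *\<^sub>R axis i 1 + h *\<^sub>R axis j 1) - f (x + h *\<^sub>R axis i 1) - f (x + h *\<^sub>R axis j 1) + f x"
    have 1: "norm (?D - of_real (h^2) * ?A) \<le> e * h\<^sup>2" using d1(2)[OF h(1)] .
    have 2: "norm (?D - of_real (h^2) * ?B) \<le> e * h\<^sup>2" using d2(2)[OF h(2)] by (simp add: algebra_simps)
    have "of_real (h^2) * (?A - ?B) = (?D - of_real (h^2) * ?B) - (?D - of_real (h^2) * ?A)"
      by (simp add: algebra_simps)
    also have "norm \<dots> \<le> e * h\<^sup>2 + e * h\<^sup>2"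
      by (rule order_trans[OF norm_triangle_ineq4 add_mono[OF 2 1]])
    finally have "h\<^sup>2 * norm (?A - ?B) \<le> h\<^sup>2 * (2 * e)"
      by (simp only: norm_mult norm_of_real abs_power2) (simp add: mult.commute)
    thus ?thesis using h by simp
  qed
  from this[of "e / 2" for e] have "norm (?A - ?B) \<le> 0 + e" if "e > 0" for e using that by simp
  hence "norm (?A - ?B) \<le> 0" by (rule field_le_epsilon)
  thus "?A = ?B" by simp
qed

lemma foldr_partial_deriv_remove1:
  assumes "smooth f" "i \<in> set is"
  shows "foldr partial_deriv is f = partial_deriv i (foldr partial_deriv (remove1 i is) f)"
  using assms(2)
proof (induction "is")
  case (Cons a "is")
  show ?case
  proof (cases "i = a")
    case False
    with Cons have "foldr partial_deriv (a # is) f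
        = partial_deriv a (partial_deriv i (foldr partial_deriv (remove1 i is) f))" by simp
    also have "\<dots> = partial_deriv i (partial_deriv a (foldr partial_deriv (remove1 i is) f))"
      by (intro partial_deriv_commute smooth_differentiable smooth_partial_deriv smooth_foldr assms(1))
    finally show ?thesis using False by simp
  qed simp
qed simp

lemma count_list_remove1: "i \<in> set is \<Longrightarrow> count_list (remove1 i is) j = count_list is j - (if i = j then 1 else 0)"
  by (induction "is") (auto simp: count_list_0_iff Suc_diff_1)

lemma foldr_partial_deriv_perm:
  assumes "smooth f" "\<forall>i. count_list is i = count_list js i"
  shows "foldr partial_deriv is f = foldr partial_deriv js f"
  using assms(2)
proof (induction "is" arbitrary: js)
  case Nil
  hence "set js = {}" by (metis count_list.simps(1) count_list_0_iff equals0I)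
  thus ?case by simp
next
  case (Cons i "is")
  hence i: "i \<in> set js" by (metis count_list_0_iff count_list.simps(2) add_is_0 one_neq_zero)
  have "\<forall>j. count_list is j = count_list (remove1 i js) j"
  proof
    fix j show "count_list is j = count_list (remove1 i js) j"
      using Cons.prems[rule_format, of j] i by (auto simp: count_list_remove1 split: if_splits)
  qed
  from Cons.IH[OF this] show ?case
    using foldr_partial_deriv_remove1[OF assms(1) i] by simp
qed

lemma ex_list_of_multiindex: "\<exists>is. \<forall>i. count_list is i = (\<alpha> :: 'n::finite multiindex) i"
proof (induction "mi_order \<alpha>" arbitrary: \<alpha>)
  case 0
  hence "\<alpha> i = 0" for i by (simp add: mi_order_def)
  thus ?case by (intro exI[of _ "[]"]) simp
next
  case (Suc k)
  then obtain i where i: "\<alpha> i > 0" by (metis mi_order_def sum.neutral zero_less_iff_neq_zero nat.distinct(1))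
  define \<beta> where "\<beta> = \<alpha>(i := \<alpha> i - 1)"
  have "mi_order \<alpha> = \<alpha> i + (\<Sum>j\<in>UNIV - {i}. \<alpha> j)" "mi_order \<beta> = \<beta> i + (\<Sum>j\<in>UNIV - {i}. \<beta> j)"
    unfolding mi_order_def by (subst sum.remove[of _ i]; simp)+
  moreover have "(\<Sum>j\<in>UNIV - {i}. \<beta> j) = (\<Sum>j\<in>UNIV - {i}. \<alpha> j)"
    by (rule sum.cong) (auto simp: \<beta>_def)
  ultimately have "k = mi_order \<beta>" using Suc(2) i by (simp add: \<beta>_def)
  with Suc(1) obtain "is" where "\<forall>j. count_list is j = \<beta> j" by blast
  with i show ?case by (intro exI[of _ "i # is"]) (auto simp: \<beta>_def)
qed

lemma foldr_partial_deriv: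
  assumes "smooth f"
  shows "foldr partial_deriv is f = mpartial (count_list is) f"
  unfolding mpartial_def
  using someI_ex[OF ex_list_of_multiindex[of "count_list is"]]
  by (intro foldr_partial_deriv_perm assms) auto

lemma mpartial_mpartial:
  assumes "smooth f"
  shows "mpartial \<alpha> (mpartial \<beta> f) = mpartial (\<lambda>i. \<alpha> i + \<beta> i) f"
proof -
  obtain "is" js where "count_list is = \<alpha>" "count_list js = \<beta>"
    using ex_list_of_multiindex[of \<alpha>] ex_list_of_multiindex[of \<beta>] by blast
  moreover have "foldr partial_deriv is (foldr partial_deriv js f) = foldr partial_deriv (is @ js) f"
    by simp
  moreover have "count_list (is @ js) = (\<lambda>i. count_list is i + count_list js i)"
    by (simp add: fun_eq_iff)
  ultimately show ?thesis
    using assms by (metis foldr_partial_deriv smooth_foldr)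
qed


section \<open>Orders of growth and generalized numbers\<close>

text \<open>
  Nets indexed by \<open>\<epsilon> \<in> (0,1]\<close> are functions on the reals; their values for \<open>\<epsilon> \<notin> (0,1]\<close> are
  irrelevant. \<open>net_O r b\<close> says \<open>r\<^sub>\<epsilon> = O(\<epsilon>\<^sup>b)\<close> as \<open>\<epsilon> \<rightarrow> 0\<close>, for nets of norms or suprema, which may
  be infinite for large \<open>\<epsilon>\<close>.
\<close>

definition net_O :: "(real \<Rightarrow> ennreal) \<Rightarrow> real \<Rightarrow> bool" where
  "net_O r b \<longleftrightarrow> (\<exists>C. \<forall>\<^sub>F \<epsilon> in at_right 0. r \<epsilon> \<le> ennreal (C * \<epsilon> powr b))"

lemma eventually_at_right_01: "\<forall>\<^sub>F \<epsilon> in at_right (0::real). \<epsilon> \<in> {0<..1}"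
  unfolding eventually_at_right_field by (intro exI[of _ 1]) auto

lemma net_O_le:
  assumes "net_O s b" "\<And>\<epsilon>. \<epsilon> \<in> {0<..1} \<Longrightarrow> r \<epsilon> \<le> s \<epsilon>"
  shows "net_O r b"
proof -
  obtain C where "\<forall>\<^sub>F \<epsilon> in at_right 0. s \<epsilon> \<le> ennreal (C * \<epsilon> powr b)"
    using assms(1) unfolding net_O_def by blast
  with eventually_at_right_01 have "\<forall>\<^sub>F \<epsilon> in at_right 0. r \<epsilon> \<le> ennreal (C * \<epsilon> powr b)"
    by eventually_elim (use assms(2) order_trans in blast)
  thus ?thesis unfolding net_O_def by blast
qed

lemma net_O_mono:
  assumes "net_O r b" "b' \<le> b"
  shows "net_O r b'"
proof -
  obtain C where "\<forall>\<^sub>F \<epsilon> in at_right 0. r \<epsilon> \<le> ennreal (C * \<epsilon> powr b)"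
    using assms(1) unfolding net_O_def by blast
  with eventually_at_right_01 have "\<forall>\<^sub>F \<epsilon> in at_right 0. r \<epsilon> \<le> ennreal (\<bar>C\<bar> * \<epsilon> powr b')"
  proof eventually_elim
    case (elim \<epsilon>)
    have "C * \<epsilon> powr b \<le> \<bar>C\<bar> * \<epsilon> powr b'"
      using elim(1) assms(2) by (intro mult_mono powr_mono') auto
    thus ?case using elim(2) by (meson ennreal_leI order_trans)
  qed
  thus ?thesis unfolding net_O_def by blast
qed

lemma net_O_add:
  assumes "net_O r b" "net_O s b"
  shows "net_O (\<lambda>\<epsilon>. r \<epsilon> + s \<epsilon>) b"
proof -
  obtain C D where "\<forall>\<^sub>F \<epsilon> in at_right 0. r \<epsilon> \<le> ennreal (C * \<epsilon> powr b)"
      "\<forall>\<^sub>F \<epsilon> in at_right 0. s \<epsilon> \<le> ennreal (D * \<epsilon> powr b)"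
    using assms unfolding net_O_def by blast
  hence "\<forall>\<^sub>F \<epsilon> in at_right 0. r \<epsilon> + s \<epsilon> \<le> ennreal ((\<bar>C\<bar> + \<bar>D\<bar>) * \<epsilon> powr b)"
  proof eventually_elim
    case (elim \<epsilon>)
    have "C * \<epsilon> powr b \<le> \<bar>C\<bar> * \<epsilon> powr b" "D * \<epsilon> powr b \<le> \<bar>D\<bar> * \<epsilon> powr b"
      by (auto intro: mult_right_mono)
    hence "r \<epsilon> + s \<epsilon> \<le> ennreal (\<bar>C\<bar> * \<epsilon> powr b) + ennreal (\<bar>D\<bar> * \<epsilon> powr b)"
      using elim by (intro add_mono) (meson ennreal_leI order_trans)+
    thus ?case by (simp add: ennreal_plus[symmetric] distrib_right del: ennreal_plus)
  qed
  thus ?thesis unfolding net_O_def by blast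
qed

lemma net_O_mult:
  assumes "net_O r b" "net_O s b'"
  shows "net_O (\<lambda>\<epsilon>. r \<epsilon> * s \<epsilon>) (b + b')"
proof -
  obtain C D where "\<forall>\<^sub>F \<epsilon> in at_right 0. r \<epsilon> \<le> ennreal (C * \<epsilon> powr b)"
      "\<forall>\<^sub>F \<epsilon> in at_right 0. s \<epsilon> \<le> ennreal (D * \<epsilon> powr b')"
    using assms unfolding net_O_def by blast
  hence "\<forall>\<^sub>F \<epsilon> in at_right 0. r \<epsilon> * s \<epsilon> \<le> ennreal ((\<bar>C\<bar> * \<bar>D\<bar>) * \<epsilon> powr (b + b'))"
  proof eventually_elim
    case (elim \<epsilon>)
    have "C * \<epsilon> powr b \<le> \<bar>C\<bar> * \<epsilon> powr b" "D * \<epsilon> powr b' \<le> \<bar>D\<bar> * \<epsilon> powr b'"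
      by (auto intro: mult_right_mono)
    hence "r \<epsilon> * s \<epsilon> \<le> ennreal (\<bar>C\<bar> * \<epsilon> powr b) * ennreal (\<bar>D\<bar> * \<epsilon> powr b')"
      using elim by (intro mult_mono) (auto elim: order_trans intro: ennreal_leI)
    thus ?case by (simp add: ennreal_mult[symmetric] powr_add mult_ac)
  qed
  thus ?thesis unfolding net_O_def by blast
qed

lemma net_O_const: "b \<le> 0 \<Longrightarrow> net_O (\<lambda>\<epsilon>. ennreal c) b"
  by (rule net_O_mono[of _ 0], unfold net_O_def, rule exI[of _ c])
     (rule eventually_mono[OF eventually_at_right_01], simp)

lemma net_O_0: "net_O (\<lambda>\<epsilon>. 0) b"
  unfolding net_O_def by simp

definition moderate_net :: "(real \<Rightarrow> 'a::real_normed_field) \<Rightarrow> bool" where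
  "moderate_net r \<longleftrightarrow> (\<exists>N::nat. net_O (\<lambda>\<epsilon>. ennreal (norm (r \<epsilon>))) (- real N))"

definition negligible_net :: "(real \<Rightarrow> 'a::real_normed_field) \<Rightarrow> bool" where
  "negligible_net r \<longleftrightarrow> (\<forall>q::nat. net_O (\<lambda>\<epsilon>. ennreal (norm (r \<epsilon>))) (real q))"

definition gnum_rel :: "(real \<Rightarrow> 'a::real_normed_field) \<Rightarrow> (real \<Rightarrow> 'a) \<Rightarrow> bool" where
  "gnum_rel r s \<longleftrightarrow> moderate_net r \<and> moderate_net s \<and> negligible_net (\<lambda>\<epsilon>. r \<epsilon> - s \<epsilon>)"

lemma moderate_net_const: "moderate_net (\<lambda>\<epsilon>. c)"
  unfolding moderate_net_def by (intro exI[of _ 0] net_O_const) simp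

lemma moderate_net_add:
  assumes "moderate_net r" "moderate_net s"
  shows "moderate_net (\<lambda>\<epsilon>. r \<epsilon> + s \<epsilon>)"
proof -
  obtain N M where N: "net_O (\<lambda>\<epsilon>. ennreal (norm (r \<epsilon>))) (- real N)"
      and M: "net_O (\<lambda>\<epsilon>. ennreal (norm (s \<epsilon>))) (- real M)"
    using assms unfolding moderate_net_def by blast
  have "net_O (\<lambda>\<epsilon>. ennreal (norm (r \<epsilon>)) + ennreal (norm (s \<epsilon>))) (- real (max N M))"
    by (intro net_O_add net_O_mono[OF N] net_O_mono[OF M]) auto
  hence "net_O (\<lambda>\<epsilon>. ennreal (norm (r \<epsilon> + s \<epsilon>))) (- real (max N M))"
    by (rule net_O_le)
       (simp add: ennreal_plus[symmetric] norm_triangle_ineq ennreal_leI del: ennreal_plus)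
  thus ?thesis unfolding moderate_net_def by blast
qed


lemma moderate_net_mult:
  assumes "moderate_net r" "moderate_net s"
  shows "moderate_net (\<lambda>\<epsilon>. r \<epsilon> * s \<epsilon>)"
proof -
  obtain N M where N: "net_O (\<lambda>\<epsilon>. ennreal (norm (r \<epsilon>))) (- real N)"
      and M: "net_O (\<lambda>\<epsilon>. ennreal (norm (s \<epsilon>))) (- real M)"
    using assms unfolding moderate_net_def by blast
  from net_O_mult[OF N M] show ?thesis unfolding moderate_net_def
    by (intro exI[of _ "N + M"]) (simp add: norm_mult ennreal_mult)
qed

lemma moderate_net_uminus: "moderate_net r \<Longrightarrow> moderate_net (\<lambda>\<epsilon>. - r \<epsilon>)"
  by (simp add: moderate_net_def)

lemma moderate_net_diff:
  "moderate_net r \<Longrightarrow> moderate_net s \<Longrightarrow> moderate_net (\<lambda>\<epsilon>. r \<epsilon> - s \<epsilon>)"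
  using moderate_net_add[of r "\<lambda>\<epsilon>. - s \<epsilon>"] moderate_net_uminus[of s] by simp

lemma negligible_net_0: "negligible_net (\<lambda>\<epsilon>. 0)"
  by (simp add: negligible_net_def net_O_0)

lemma negligible_net_uminus: "negligible_net r \<Longrightarrow> negligible_net (\<lambda>\<epsilon>. - r \<epsilon>)"
  by (simp add: negligible_net_def)

lemma negligible_net_add:
  assumes "negligible_net r" "negligible_net s"
  shows "negligible_net (\<lambda>\<epsilon>. r \<epsilon> + s \<epsilon>)"
  unfolding negligible_net_def
proof
  fix q :: nat
  have "net_O (\<lambda>\<epsilon>. ennreal (norm (r \<epsilon>)) + ennreal (norm (s \<epsilon>))) (real q)"
    using assms unfolding negligible_net_def by (intro net_O_add) auto
  thus "net_O (\<lambda>\<epsilon>. ennreal (norm (r \<epsilon> + s \<epsilon>))) (real q)"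
    by (elim net_O_le)
       (simp add: ennreal_plus[symmetric] norm_triangle_ineq ennreal_leI del: ennreal_plus)
qed

lemma negligible_net_mult:
  assumes "moderate_net r" "negligible_net s"
  shows "negligible_net (\<lambda>\<epsilon>. r \<epsilon> * s \<epsilon>)"
  unfolding negligible_net_def
proof
  fix q :: nat
  obtain N where N: "net_O (\<lambda>\<epsilon>. ennreal (norm (r \<epsilon>))) (- real N)"
    using assms unfolding moderate_net_def by blast
  moreover have "net_O (\<lambda>\<epsilon>. ennreal (norm (s \<epsilon>))) (real (q + N))"
    using assms unfolding negligible_net_def by blast
  ultimately have "net_O (\<lambda>\<epsilon>. ennreal (norm (r \<epsilon>)) * ennreal (norm (s \<epsilon>))) (- real N + real (q + N))"
    by (rule net_O_mult)
  thus "net_O (\<lambda>\<epsilon>. ennreal (norm (r \<epsilon> * s \<epsilon>))) (real q)"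
    by (simp add: norm_mult ennreal_mult)
qed

lemma part_equivp_gnum_rel: "part_equivp (gnum_rel :: (real \<Rightarrow> 'a::real_normed_field) \<Rightarrow> _)"
proof (rule part_equivpI)
  show "\<exists>x :: real \<Rightarrow> 'a. gnum_rel x x"
    by (intro exI[of _ "\<lambda>_. 0"]) (simp add: gnum_rel_def moderate_net_const negligible_net_0)
  show "symp (gnum_rel :: (real \<Rightarrow> 'a) \<Rightarrow> _)"
    unfolding symp_def gnum_rel_def by (auto dest: negligible_net_uminus)
  show "transp (gnum_rel :: (real \<Rightarrow> 'a) \<Rightarrow> _)"
    unfolding transp_def gnum_rel_def by (auto dest: negligible_net_add)
qed

lemma gnum_rel_eqI: "moderate_net r \<Longrightarrow> r = s \<Longrightarrow> gnum_rel r s"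
  by (simp add: gnum_rel_def negligible_net_0)

text \<open>\<open>complex gnum\<close> and \<open>real gnum\<close> are the rings of complex and real generalized numbers.\<close>

quotient_type (overloaded) 'a gnum = "real \<Rightarrow> 'a::real_normed_field" / partial: gnum_rel
  by (rule part_equivp_gnum_rel)

definition represents :: "(real \<Rightarrow> 'a::real_normed_field) \<Rightarrow> 'a gnum \<Rightarrow> bool" where
  "represents r x \<longleftrightarrow> moderate_net r \<and> abs_gnum r = x"

instantiation gnum :: (real_normed_field) comm_ring_1
begin

lift_definition zero_gnum :: "'a gnum" is "\<lambda>_. 0"
  by (simp add: gnum_rel_def moderate_net_const negligible_net_0)

lift_definition one_gnum :: "'a gnum" is "\<lambda>_. 1"
  by (simp add: gnum_rel_def moderate_net_const negligible_net_0)

lift_definition plus_gnum :: "'a gnum \<Rightarrow> 'a gnum \<Rightarrow> 'a gnum" is "\<lambda>r s \<epsilon>. r \<epsilon> + s \<epsilon>"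
proof -
  fix r r' s s' :: "real \<Rightarrow> 'a" assume *: "gnum_rel r r'" "gnum_rel s s'"
  hence "negligible_net (\<lambda>\<epsilon>. (r \<epsilon> - r' \<epsilon>) + (s \<epsilon> - s' \<epsilon>))"
    unfolding gnum_rel_def by (intro negligible_net_add) auto
  with * show "gnum_rel (\<lambda>\<epsilon>. r \<epsilon> + s \<epsilon>) (\<lambda>\<epsilon>. r' \<epsilon> + s' \<epsilon>)"
    unfolding gnum_rel_def by (auto intro: moderate_net_add simp: algebra_simps)
qed

lift_definition uminus_gnum :: "'a gnum \<Rightarrow> 'a gnum" is "\<lambda>r \<epsilon>. - r \<epsilon>"
  unfolding gnum_rel_def by (auto intro: moderate_net_uminus dest: negligible_net_uminus)

lift_definition minus_gnum :: "'a gnum \<Rightarrow> 'a gnum \<Rightarrow> 'a gnum" is "\<lambda>r s \<epsilon>. r \<epsilon> - s \<epsilon>"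
proof -
  fix r r' s s' :: "real \<Rightarrow> 'a" assume *: "gnum_rel r r'" "gnum_rel s s'"
  hence "negligible_net (\<lambda>\<epsilon>. (r \<epsilon> - r' \<epsilon>) + - (s \<epsilon> - s' \<epsilon>))"
    unfolding gnum_rel_def by (intro negligible_net_add negligible_net_uminus) auto
  with * show "gnum_rel (\<lambda>\<epsilon>. r \<epsilon> - s \<epsilon>) (\<lambda>\<epsilon>. r' \<epsilon> - s' \<epsilon>)"
    unfolding gnum_rel_def by (auto intro: moderate_net_diff simp: algebra_simps)
qed

lift_definition times_gnum :: "'a gnum \<Rightarrow> 'a gnum \<Rightarrow> 'a gnum" is "\<lambda>r s \<epsilon>. r \<epsilon> * s \<epsilon>"
proof -
  fix r r' s s' :: "real \<Rightarrow> 'a" assume *: "gnum_rel r r'" "gnum_rel s s'"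
  hence "negligible_net (\<lambda>\<epsilon>. s \<epsilon> * (r \<epsilon> - r' \<epsilon>) + r' \<epsilon> * (s \<epsilon> - s' \<epsilon>))"
    unfolding gnum_rel_def by (intro negligible_net_add negligible_net_mult) auto
  with * show "gnum_rel (\<lambda>\<epsilon>. r \<epsilon> * s \<epsilon>) (\<lambda>\<epsilon>. r' \<epsilon> * s' \<epsilon>)"
    unfolding gnum_rel_def by (auto intro: moderate_net_mult simp: algebra_simps)
qed

lemma not_negligible_net_1: "\<not> negligible_net (\<lambda>\<epsilon>. 1 :: 'a)"
proof
  assume "negligible_net (\<lambda>\<epsilon>. 1 :: 'a)"
  hence "net_O (\<lambda>\<epsilon>. ennreal (norm (1 :: 'a))) (real 1)" unfolding negligible_net_def by blast
  then obtain C where C: "\<forall>\<^sub>F \<epsilon> in at_right 0. 1 \<le> ennreal (C * \<epsilon> powr 1)"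
    unfolding net_O_def by auto
  have "((\<lambda>\<epsilon>. C * \<epsilon>) \<longlongrightarrow> C * 0) (at_right 0)" by (intro tendsto_intros)
  hence "\<forall>\<^sub>F \<epsilon> in at_right 0. C * \<epsilon> < 1" by (rule order_tendstoD) simp
  with C eventually_at_right_01 have "\<forall>\<^sub>F \<epsilon> in at_right (0::real). False"
    by eventually_elim (auto simp: ennreal_ge_1)
  thus False by simp
qed

instance
proof
  show "(0 :: 'a gnum) \<noteq> 1"
    by transfer (use not_negligible_net_1 negligible_net_uminus[of "\<lambda>_. -1 :: 'a"] in
      \<open>auto simp: gnum_rel_def\<close>)
qed (transfer; rule gnum_rel_eqI;
     auto simp: gnum_rel_def algebra_simps
       intro!: moderate_net_add moderate_net_mult moderate_net_uminus moderate_net_diff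
         moderate_net_const)+

end


section \<open>The Colombeau algebra\<close>

definition sup_on :: "'a set \<Rightarrow> ('a \<Rightarrow> complex) \<Rightarrow> ennreal" where
  "sup_on K f = (SUP x\<in>K. ennreal (cmod (f x)))"

definition moderate_fun :: "(real \<Rightarrow> real ^ 'n::finite \<Rightarrow> complex) \<Rightarrow> bool" where
  "moderate_fun u \<longleftrightarrow> (\<forall>\<epsilon>\<in>{0<..1}. smooth (u \<epsilon>)) \<and>
     (\<forall>K \<alpha>. compact K \<longrightarrow> (\<exists>N::nat. net_O (\<lambda>\<epsilon>. sup_on K (mpartial \<alpha> (u \<epsilon>))) (- real N)))"

text \<open>For moderate nets, membership in the ideal defining the algebra on the open set \<open>V\<close>.\<close>

definition negligible_fun_on ::
    "(real ^ 'n::finite) set \<Rightarrow> (real \<Rightarrow> real ^ 'n \<Rightarrow> complex) \<Rightarrow> bool" where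
  "negligible_fun_on V u \<longleftrightarrow>
     (\<forall>K \<alpha>. compact K \<and> K \<subseteq> V \<longrightarrow> (\<forall>q::nat. net_O (\<lambda>\<epsilon>. sup_on K (mpartial \<alpha> (u \<epsilon>))) (real q)))"

definition gfun_rel ::
    "(real \<Rightarrow> real ^ 'n::finite \<Rightarrow> complex) \<Rightarrow> (real \<Rightarrow> real ^ 'n \<Rightarrow> complex) \<Rightarrow> bool" where
  "gfun_rel u v \<longleftrightarrow> moderate_fun u \<and> moderate_fun v \<and> negligible_fun_on UNIV (\<lambda>\<epsilon> x. u \<epsilon> x - v \<epsilon> x)"

lemma sup_on_add: "sup_on K (\<lambda>x. f x + g x) \<le> sup_on K f + sup_on K g"
  unfolding sup_on_def
proof (rule SUP_least)
  fix x assume x: "x \<in> K"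
  have "ennreal (cmod (f x + g x)) \<le> ennreal (cmod (f x)) + ennreal (cmod (g x))"
    by (simp add: ennreal_plus[symmetric] norm_triangle_ineq ennreal_leI del: ennreal_plus)
  also have "\<dots> \<le> (SUP x\<in>K. ennreal (cmod (f x))) + (SUP x\<in>K. ennreal (cmod (g x)))"
    using x by (intro add_mono SUP_upper)
  finally show "ennreal (cmod (f x + g x)) \<le> \<dots>" .
qed

lemma sup_on_cmult: "sup_on K (\<lambda>x. c * f x) \<le> ennreal (cmod c) * sup_on K f"
  unfolding sup_on_def
  by (rule SUP_least) (auto simp: norm_mult ennreal_mult intro!: mult_left_mono SUP_upper)

lemma sup_on_0: "sup_on K (\<lambda>x. 0) = 0"
  by (cases "K = {}") (auto simp: sup_on_def bot_ennreal)

lemma moderate_fun_0: "moderate_fun (\<lambda>\<epsilon> x. 0)"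
  by (simp add: moderate_fun_def smooth_0 mpartial_0 sup_on_0 net_O_0)

lemma negligible_fun_0: "negligible_fun_on V (\<lambda>\<epsilon> x. 0)"
  by (simp add: negligible_fun_on_def mpartial_0 sup_on_0 net_O_0)

lemma moderate_fun_smooth: "moderate_fun u \<Longrightarrow> \<epsilon> \<in> {0<..1} \<Longrightarrow> smooth (u \<epsilon>)"
  by (simp add: moderate_fun_def)

lemma moderate_fun_add:
  assumes "moderate_fun u" "moderate_fun v"
  shows "moderate_fun (\<lambda>\<epsilon> x. u \<epsilon> x + v \<epsilon> x)"
  unfolding moderate_fun_def
proof (intro conjI allI impI ballI)
  fix \<epsilon> :: real assume "\<epsilon> \<in> {0<..1}"
  with assms show "smooth (\<lambda>x. u \<epsilon> x + v \<epsilon> x)" by (intro smooth_add moderate_fun_smooth)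
next
  fix K \<alpha> assume "compact (K :: (real ^ 'a) set)"
  then obtain N M where N: "net_O (\<lambda>\<epsilon>. sup_on K (mpartial \<alpha> (u \<epsilon>))) (- real N)"
      and M: "net_O (\<lambda>\<epsilon>. sup_on K (mpartial \<alpha> (v \<epsilon>))) (- real M)"
    using assms unfolding moderate_fun_def by blast
  have "net_O (\<lambda>\<epsilon>. sup_on K (mpartial \<alpha> (u \<epsilon>)) + sup_on K (mpartial \<alpha> (v \<epsilon>))) (- real (max N M))"
    by (intro net_O_add net_O_mono[OF N] net_O_mono[OF M]) auto
  hence "net_O (\<lambda>\<epsilon>. sup_on K (mpartial \<alpha> (\<lambda>x. u \<epsilon> x + v \<epsilon> x))) (- real (max N M))"
    by (rule net_O_le) (simp only: mpartial_add moderate_fun_smooth assms sup_on_add)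
  thus "\<exists>N::nat. net_O (\<lambda>\<epsilon>. sup_on K (mpartial \<alpha> (\<lambda>x. u \<epsilon> x + v \<epsilon> x))) (- real N)" by blast
qed

lemma negligible_fun_add:
  assumes "\<And>\<epsilon>. \<epsilon> \<in> {0<..1} \<Longrightarrow> smooth (u \<epsilon>)" "\<And>\<epsilon>. \<epsilon> \<in> {0<..1} \<Longrightarrow> smooth (v \<epsilon>)"
    and "negligible_fun_on V u" "negligible_fun_on V v"
  shows "negligible_fun_on V (\<lambda>\<epsilon> x. u \<epsilon> x + v \<epsilon> x)"
  unfolding negligible_fun_on_def
proof (intro allI impI)
  fix K \<alpha> and q :: nat assume "compact K \<and> K \<subseteq> V"
  hence "net_O (\<lambda>\<epsilon>. sup_on K (mpartial \<alpha> (u \<epsilon>)) + sup_on K (mpartial \<alpha> (v \<epsilon>))) (real q)"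
    using assms(3,4) unfolding negligible_fun_on_def by (intro net_O_add) auto
  thus "net_O (\<lambda>\<epsilon>. sup_on K (mpartial \<alpha> (\<lambda>x. u \<epsilon> x + v \<epsilon> x))) (real q)"
    by (rule net_O_le) (simp only: mpartial_add assms sup_on_add)
qed

lemma moderate_fun_scale:
  assumes "moderate_net c" "moderate_fun u"
  shows "moderate_fun (\<lambda>\<epsilon> x. c \<epsilon> * u \<epsilon> x)"
  unfolding moderate_fun_def
proof (intro conjI allI impI ballI)
  fix \<epsilon> :: real assume "\<epsilon> \<in> {0<..1}"
  with assms show "smooth (\<lambda>x. c \<epsilon> * u \<epsilon> x)" by (intro smooth_cmult moderate_fun_smooth)
next
  fix K \<alpha> assume "compact (K :: (real ^ 'a) set)"
  then obtain N M where N: "net_O (\<lambda>\<epsilon>. ennreal (cmod (c \<epsilon>))) (- real N)"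
      and M: "net_O (\<lambda>\<epsilon>. sup_on K (mpartial \<alpha> (u \<epsilon>))) (- real M)"
    using assms unfolding moderate_fun_def moderate_net_def by blast
  have "net_O (\<lambda>\<epsilon>. ennreal (cmod (c \<epsilon>)) * sup_on K (mpartial \<alpha> (u \<epsilon>))) (- real (N + M))"
    using net_O_mult[OF N M] by simp
  hence "net_O (\<lambda>\<epsilon>. sup_on K (mpartial \<alpha> (\<lambda>x. c \<epsilon> * u \<epsilon> x))) (- real (N + M))"
    by (rule net_O_le) (simp only: mpartial_cmult moderate_fun_smooth assms sup_on_cmult)
  thus "\<exists>N::nat. net_O (\<lambda>\<epsilon>. sup_on K (mpartial \<alpha> (\<lambda>x. c \<epsilon> * u \<epsilon> x))) (- real N)" by blast
qed

lemma negligible_fun_scale: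
  assumes "\<And>\<epsilon>. \<epsilon> \<in> {0<..1} \<Longrightarrow> smooth (u \<epsilon>)" "moderate_net c" "negligible_fun_on V u"
  shows "negligible_fun_on V (\<lambda>\<epsilon> x. c \<epsilon> * u \<epsilon> x)"
  unfolding negligible_fun_on_def
proof (intro allI impI)
  fix K \<alpha> and q :: nat assume K: "compact K \<and> K \<subseteq> V"
  obtain N where N: "net_O (\<lambda>\<epsilon>. ennreal (cmod (c \<epsilon>))) (- real N)"
    using assms unfolding moderate_net_def by blast
  have "net_O (\<lambda>\<epsilon>. sup_on K (mpartial \<alpha> (u \<epsilon>))) (real (q + N))"
    using assms K unfolding negligible_fun_on_def by blast
  from net_O_mult[OF N this]
  have "net_O (\<lambda>\<epsilon>. ennreal (cmod (c \<epsilon>)) * sup_on K (mpartial \<alpha> (u \<epsilon>))) (real q)" by simp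
  thus "net_O (\<lambda>\<epsilon>. sup_on K (mpartial \<alpha> (\<lambda>x. c \<epsilon> * u \<epsilon> x))) (real q)"
    by (rule net_O_le) (simp only: mpartial_cmult assms sup_on_cmult)
qed

lemma negligible_net_scale:
  assumes "negligible_net c" "moderate_fun u"
  shows "negligible_fun_on V (\<lambda>\<epsilon> x. c \<epsilon> * u \<epsilon> x)"
  unfolding negligible_fun_on_def
proof (intro allI impI)
  fix K \<alpha> and q :: nat assume K: "compact K \<and> K \<subseteq> V"
  then obtain M where M: "net_O (\<lambda>\<epsilon>. sup_on K (mpartial \<alpha> (u \<epsilon>))) (- real M)"
    using assms unfolding moderate_fun_def by blast
  have "net_O (\<lambda>\<epsilon>. ennreal (cmod (c \<epsilon>))) (real (q + M))"
    using assms unfolding negligible_net_def by blast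
  from net_O_mult[OF this M]
  have "net_O (\<lambda>\<epsilon>. ennreal (cmod (c \<epsilon>)) * sup_on K (mpartial \<alpha> (u \<epsilon>))) (real q)" by simp
  thus "net_O (\<lambda>\<epsilon>. sup_on K (mpartial \<alpha> (\<lambda>x. c \<epsilon> * u \<epsilon> x))) (real q)"
    by (rule net_O_le) (simp only: mpartial_cmult moderate_fun_smooth assms sup_on_cmult)
qed

lemma moderate_fun_uminus: "moderate_fun u \<Longrightarrow> moderate_fun (\<lambda>\<epsilon> x. - u \<epsilon> x)"
  using moderate_fun_scale[OF moderate_net_const[of "-1"], of u] by simp

lemma moderate_fun_diff:
  "moderate_fun u \<Longrightarrow> moderate_fun v \<Longrightarrow> moderate_fun (\<lambda>\<epsilon> x. u \<epsilon> x - v \<epsilon> x)"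
  using moderate_fun_add[of u "\<lambda>\<epsilon> x. - v \<epsilon> x"] moderate_fun_uminus[of v] by simp

lemma negligible_fun_uminus:
  assumes "\<And>\<epsilon>. \<epsilon> \<in> {0<..1} \<Longrightarrow> smooth (u \<epsilon>)" "negligible_fun_on V u"
  shows "negligible_fun_on V (\<lambda>\<epsilon> x. - u \<epsilon> x)"
  using negligible_fun_scale[OF assms(1) moderate_net_const[of "-1"] assms(2)] by simp

lemma mpartial_net_O_cong:
  assumes "\<And>\<epsilon>. \<epsilon> \<in> {0<..1} \<Longrightarrow> smooth (u \<epsilon>)"
    and "net_O (\<lambda>\<epsilon>. sup_on K (mpartial (\<lambda>i. \<beta> i + \<alpha> i) (u \<epsilon>))) b"
  shows "net_O (\<lambda>\<epsilon>. sup_on K (mpartial \<beta> (mpartial \<alpha> (u \<epsilon>)))) b"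
  using assms(2) by (rule net_O_le) (simp add: mpartial_mpartial assms(1))

lemma moderate_fun_mpartial:
  assumes "moderate_fun u"
  shows "moderate_fun (\<lambda>\<epsilon>. mpartial \<alpha> (u \<epsilon>))"
  unfolding moderate_fun_def
proof (intro conjI allI impI ballI)
  fix \<epsilon> :: real assume "\<epsilon> \<in> {0<..1}"
  with assms show "smooth (mpartial \<alpha> (u \<epsilon>))" by (intro smooth_mpartial moderate_fun_smooth)
next
  fix K \<beta> assume "compact (K :: (real ^ 'a) set)"
  then obtain N where "net_O (\<lambda>\<epsilon>. sup_on K (mpartial (\<lambda>i. \<beta> i + \<alpha> i) (u \<epsilon>))) (- real N)"
    using assms unfolding moderate_fun_def by blast
  from mpartial_net_O_cong[OF moderate_fun_smooth[OF assms] this]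
  show "\<exists>N::nat. net_O (\<lambda>\<epsilon>. sup_on K (mpartial \<beta> (mpartial \<alpha> (u \<epsilon>)))) (- real N)"
    by (intro exI)
qed

lemma negligible_fun_mpartial:
  assumes "\<And>\<epsilon>. \<epsilon> \<in> {0<..1} \<Longrightarrow> smooth (u \<epsilon>)" "negligible_fun_on V u"
  shows "negligible_fun_on V (\<lambda>\<epsilon>. mpartial \<alpha> (u \<epsilon>))"
  unfolding negligible_fun_on_def
proof (intro allI impI)
  fix K \<beta> and q :: nat assume "compact K \<and> K \<subseteq> V"
  hence "net_O (\<lambda>\<epsilon>. sup_on K (mpartial (\<lambda>i. \<beta> i + \<alpha> i) (u \<epsilon>))) (real q)"
    using assms(2) unfolding negligible_fun_on_def by blast
  from mpartial_net_O_cong[OF assms(1) this]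
  show "net_O (\<lambda>\<epsilon>. sup_on K (mpartial \<beta> (mpartial \<alpha> (u \<epsilon>)))) (real q)" by simp
qed

lemma negligible_fun_on_cong:
  assumes "\<And>\<epsilon>. \<epsilon> \<in> {0<..1} \<Longrightarrow> u \<epsilon> = v \<epsilon>" "negligible_fun_on V u"
  shows "negligible_fun_on V v"
  unfolding negligible_fun_on_def
proof (intro allI impI)
  fix K \<alpha> and q :: nat assume "compact K \<and> K \<subseteq> V"
  hence "net_O (\<lambda>\<epsilon>. sup_on K (mpartial \<alpha> (u \<epsilon>))) (real q)"
    using assms(2) unfolding negligible_fun_on_def by blast
  thus "net_O (\<lambda>\<epsilon>. sup_on K (mpartial \<alpha> (v \<epsilon>))) (real q)"
    by (rule net_O_le) (simp add: assms(1))
qed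

lemma gfun_rel_sym:
  assumes "gfun_rel u v" shows "gfun_rel v u"
proof -
  have "negligible_fun_on UNIV (\<lambda>\<epsilon> x. - (u \<epsilon> x - v \<epsilon> x))"
    using assms unfolding gfun_rel_def
    by (intro negligible_fun_uminus smooth_diff moderate_fun_smooth) auto
  thus ?thesis using assms by (simp add: gfun_rel_def)
qed

lemma gfun_rel_trans:
  assumes "gfun_rel u v" "gfun_rel v w" shows "gfun_rel u w"
proof -
  have "negligible_fun_on UNIV (\<lambda>\<epsilon> x. (u \<epsilon> x - v \<epsilon> x) + (v \<epsilon> x - w \<epsilon> x))"
    using assms unfolding gfun_rel_def
    by (intro negligible_fun_add smooth_diff moderate_fun_smooth) auto
  thus ?thesis using assms by (simp add: gfun_rel_def)
qed

lemma gfun_rel_eqI: "moderate_fun u \<Longrightarrow> u = v \<Longrightarrow> gfun_rel u v"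
  by (simp add: gfun_rel_def negligible_fun_0)

lemma part_equivp_gfun_rel: "part_equivp (gfun_rel :: (real \<Rightarrow> real ^ 'n::finite \<Rightarrow> complex) \<Rightarrow> _)"
proof (rule part_equivpI)
  show "\<exists>u :: real \<Rightarrow> real ^ 'n \<Rightarrow> complex. gfun_rel u u"
    by (intro exI[of _ "\<lambda>_ _. 0"] gfun_rel_eqI moderate_fun_0 refl)
  show "symp (gfun_rel :: (real \<Rightarrow> real ^ 'n \<Rightarrow> complex) \<Rightarrow> _)"
    by (rule sympI) (rule gfun_rel_sym)
  show "transp (gfun_rel :: (real \<Rightarrow> real ^ 'n \<Rightarrow> complex) \<Rightarrow> _)"
    by (rule transpI) (rule gfun_rel_trans)
qed

quotient_type 'n gfun = "real \<Rightarrow> real ^ ('n::finite) \<Rightarrow> complex" / partial: gfun_rel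
  by (rule part_equivp_gfun_rel)

definition represents_fun :: "(real \<Rightarrow> real ^ 'n::finite \<Rightarrow> complex) \<Rightarrow> 'n gfun \<Rightarrow> bool" where
  "represents_fun r u \<longleftrightarrow> moderate_fun r \<and> abs_gfun r = u"

instantiation gfun :: (finite) ab_group_add
begin

lift_definition zero_gfun :: "'a gfun" is "\<lambda>_ _. 0"
  by (intro gfun_rel_eqI moderate_fun_0 refl)

lift_definition plus_gfun :: "'a gfun \<Rightarrow> 'a gfun \<Rightarrow> 'a gfun" is "\<lambda>u v \<epsilon> x. u \<epsilon> x + v \<epsilon> x"
proof -
  fix u u' v v' :: "real \<Rightarrow> real ^ 'a \<Rightarrow> complex" assume *: "gfun_rel u u'" "gfun_rel v v'"
  hence "negligible_fun_on UNIV (\<lambda>\<epsilon> x. (u \<epsilon> x - u' \<epsilon> x) + (v \<epsilon> x - v' \<epsilon> x))"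
    unfolding gfun_rel_def by (intro negligible_fun_add smooth_diff moderate_fun_smooth) auto
  with * show "gfun_rel (\<lambda>\<epsilon> x. u \<epsilon> x + v \<epsilon> x) (\<lambda>\<epsilon> x. u' \<epsilon> x + v' \<epsilon> x)"
    unfolding gfun_rel_def by (auto intro: moderate_fun_add simp: algebra_simps)
qed

lift_definition uminus_gfun :: "'a gfun \<Rightarrow> 'a gfun" is "\<lambda>u \<epsilon> x. - u \<epsilon> x"
proof -
  fix u u' :: "real \<Rightarrow> real ^ 'a \<Rightarrow> complex" assume *: "gfun_rel u u'"
  hence "negligible_fun_on UNIV (\<lambda>\<epsilon> x. - (u \<epsilon> x - u' \<epsilon> x))"
    unfolding gfun_rel_def by (intro negligible_fun_uminus smooth_diff moderate_fun_smooth) auto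
  with * show "gfun_rel (\<lambda>\<epsilon> x. - u \<epsilon> x) (\<lambda>\<epsilon> x. - u' \<epsilon> x)"
    unfolding gfun_rel_def by (auto intro: moderate_fun_uminus simp: algebra_simps)
qed

definition minus_gfun :: "'a gfun \<Rightarrow> 'a gfun \<Rightarrow> 'a gfun" where
  "minus_gfun u v = u + - v"

instance
proof
  fix a b c :: "'a gfun"
  show "a + b + c = a + (b + c)"
    by (transfer, rule gfun_rel_eqI) (auto simp: gfun_rel_def algebra_simps intro!: moderate_fun_add)
  show "a + b = b + a"
    by (transfer, rule gfun_rel_eqI) (auto simp: gfun_rel_def algebra_simps intro!: moderate_fun_add)
  show "0 + a = a"
    by (transfer, rule gfun_rel_eqI) (auto simp: gfun_rel_def)
  show "- a + a = 0"
    by (transfer, rule gfun_rel_eqI) (auto simp: gfun_rel_def moderate_fun_0)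
qed (rule minus_gfun_def)

end

lift_definition gscale :: "complex gnum \<Rightarrow> 'n::finite gfun \<Rightarrow> 'n gfun" is "\<lambda>c u \<epsilon> x. c \<epsilon> * u \<epsilon> x"
proof -
  fix c c' :: "real \<Rightarrow> complex" and u u' :: "real \<Rightarrow> real ^ 'n \<Rightarrow> complex"
  assume *: "gnum_rel c c'" "gfun_rel u u'"
  hence "negligible_fun_on UNIV (\<lambda>\<epsilon> x. (c \<epsilon> - c' \<epsilon>) * u \<epsilon> x + c' \<epsilon> * (u \<epsilon> x - u' \<epsilon> x))"
    unfolding gfun_rel_def gnum_rel_def
    by (intro negligible_fun_add negligible_net_scale negligible_fun_scale smooth_cmult
          smooth_diff moderate_fun_smooth) auto
  with * show "gfun_rel (\<lambda>\<epsilon> x. c \<epsilon> * u \<epsilon> x) (\<lambda>\<epsilon> x. c' \<epsilon> * u' \<epsilon> x)"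
    unfolding gfun_rel_def gnum_rel_def by (auto intro: moderate_fun_scale simp: algebra_simps)
qed

lift_definition gD :: "'n::finite multiindex \<Rightarrow> 'n gfun \<Rightarrow> 'n gfun" is
  "\<lambda>\<alpha> u \<epsilon> x. (- \<i>) ^ mi_order \<alpha> * mpartial \<alpha> (u \<epsilon>) x"
proof -
  fix \<alpha> :: "'n multiindex" and u u' :: "real \<Rightarrow> real ^ 'n \<Rightarrow> complex"
  assume *: "gfun_rel u u'"
  let ?c = "(- \<i>) ^ mi_order \<alpha>"
  have "negligible_fun_on UNIV (\<lambda>\<epsilon> x. ?c * mpartial \<alpha> (\<lambda>x. u \<epsilon> x - u' \<epsilon> x) x)"
    using * unfolding gfun_rel_def
    by (intro negligible_fun_scale negligible_fun_mpartial smooth_mpartial moderate_net_const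
          smooth_diff moderate_fun_smooth) auto
  hence "negligible_fun_on UNIV (\<lambda>\<epsilon> x. ?c * mpartial \<alpha> (u \<epsilon>) x - ?c * mpartial \<alpha> (u' \<epsilon>) x)"
    by (rule negligible_fun_on_cong[rotated])
       (use * in \<open>simp add: gfun_rel_def mpartial_diff moderate_fun_smooth right_diff_distrib\<close>)
  moreover have "moderate_fun (\<lambda>\<epsilon> x. ?c * mpartial \<alpha> (w \<epsilon>) x)" if "moderate_fun w" for w
    by (rule moderate_fun_scale[OF moderate_net_const moderate_fun_mpartial[OF that]])
  ultimately show "gfun_rel (\<lambda>\<epsilon> x. ?c * mpartial \<alpha> (u \<epsilon>) x) (\<lambda>\<epsilon> x. ?c * mpartial \<alpha> (u' \<epsilon>) x)"
    using * by (simp add: gfun_rel_def)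
qed

text \<open>\<open>vanishes_on V u\<close>: the restriction of \<open>u\<close> to \<open>V\<close> is zero.\<close>

lift_definition vanishes_on :: "(real ^ 'n::finite) set \<Rightarrow> 'n gfun \<Rightarrow> bool" is negligible_fun_on
proof -
  have *: "negligible_fun_on V u'"
    if r: "gfun_rel u u'" and n: "negligible_fun_on V u" for V u and u' :: "real \<Rightarrow> real ^ 'n \<Rightarrow> complex"
  proof -
    have "negligible_fun_on UNIV (\<lambda>\<epsilon> x. u' \<epsilon> x - u \<epsilon> x)"
      using gfun_rel_sym[OF r] by (simp add: gfun_rel_def)
    hence "negligible_fun_on V (\<lambda>\<epsilon> x. u' \<epsilon> x - u \<epsilon> x)" by (simp add: negligible_fun_on_def)
    hence "negligible_fun_on V (\<lambda>\<epsilon> x. u \<epsilon> x + (u' \<epsilon> x - u \<epsilon> x))"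
      using r n unfolding gfun_rel_def
      by (intro negligible_fun_add smooth_diff moderate_fun_smooth) auto
    thus ?thesis by simp
  qed
  fix V and u u' :: "real \<Rightarrow> real ^ 'n \<Rightarrow> complex" assume "gfun_rel u u'"
  thus "negligible_fun_on V u = negligible_fun_on V u'"
    using *[of u u'] *[of u' u] gfun_rel_sym by blast
qed

definition gsupport :: "'n::finite gfun \<Rightarrow> (real ^ 'n) set" where
  "gsupport u = - \<Union>{V. open V \<and> vanishes_on V u}"

definition Gc :: "'n::finite gfun set" where
  "Gc = {u. compact (gsupport u)}"


section \<open>Distributions\<close>

text \<open>
  Distributions are functions on the whole type \<open>real ^ 'n \<Rightarrow> complex\<close> of which only the values on the respective
  space of test functions matter. Suprema of seminorms are taken in \<^typ>\<open>ennreal\<close>, so that the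
  supremum over the empty set is 0.
\<close>

definition smooth_supported :: "(real ^ 'n::finite) set \<Rightarrow> (real ^ 'n \<Rightarrow> complex) set" where
  "smooth_supported K = {f. smooth f \<and> (\<forall>x. x \<notin> K \<longrightarrow> f x = 0)}"

definition test_functions :: "(real ^ 'n::finite \<Rightarrow> complex) set" where
  "test_functions = (\<Union>K\<in>{K. compact K}. smooth_supported K)"

definition seminorm_on :: "(real ^ 'n::finite) set \<Rightarrow> nat \<Rightarrow> (real ^ 'n \<Rightarrow> complex) \<Rightarrow> ennreal" where
  "seminorm_on K j f = (SUP \<alpha>\<in>{\<alpha>. mi_order \<alpha> \<le> j}. sup_on K (mpartial \<alpha> f))"

definition schwartz_norm :: "nat \<Rightarrow> (real ^ 'n::finite \<Rightarrow> complex) \<Rightarrow> ennreal" where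
  "schwartz_norm j f = (SUP \<alpha>\<in>{\<alpha>. mi_order \<alpha> \<le> j}. SUP \<beta>\<in>{\<beta>. mi_order \<beta> \<le> j}.
     sup_on UNIV (\<lambda>x. of_real (monomial \<beta> x) * mpartial \<alpha> f x))"

definition schwartz_functions :: "(real ^ 'n::finite \<Rightarrow> complex) set" where
  "schwartz_functions = {f. smooth f \<and> (\<forall>j. schwartz_norm j f < \<infinity>)}"

definition clinear_on ::
    "(real ^ 'n::finite \<Rightarrow> complex) set \<Rightarrow> ((real ^ 'n \<Rightarrow> complex) \<Rightarrow> complex) \<Rightarrow> bool" where
  "clinear_on V T \<longleftrightarrow> (\<forall>f\<in>V. \<forall>g\<in>V. T (\<lambda>x. f x + g x) = T f + T g) \<and>
     (\<forall>f\<in>V. \<forall>a. T (\<lambda>x. a * f x) = a * T f)"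

definition is_distribution :: "((real ^ 'n::finite \<Rightarrow> complex) \<Rightarrow> complex) \<Rightarrow> bool" where
  "is_distribution T \<longleftrightarrow> clinear_on test_functions T \<and>
     (\<forall>K. compact K \<longrightarrow> (\<exists>j c. \<forall>f\<in>smooth_supported K.
        ennreal (cmod (T f)) \<le> ennreal c * seminorm_on K j f))"

definition is_compact_distribution :: "((real ^ 'n::finite \<Rightarrow> complex) \<Rightarrow> complex) \<Rightarrow> bool" where
  "is_compact_distribution T \<longleftrightarrow> clinear_on {f. smooth f} T \<and>
     (\<exists>K j c. compact K \<and> (\<forall>f. smooth f \<longrightarrow>
        ennreal (cmod (T f)) \<le> ennreal c * seminorm_on K j f))"

definition is_tempered_distribution :: "((real ^ 'n::finite \<Rightarrow> complex) \<Rightarrow> complex) \<Rightarrow> bool" where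
  "is_tempered_distribution T \<longleftrightarrow> clinear_on schwartz_functions T \<and>
     (\<exists>j c. \<forall>f\<in>schwartz_functions. ennreal (cmod (T f)) \<le> ennreal c * schwartz_norm j f)"

definition fourier :: "(real ^ 'n::finite \<Rightarrow> complex) \<Rightarrow> real ^ 'n \<Rightarrow> complex" where
  "fourier f \<xi> = (LINT x|lborel. exp (- \<i> * of_real (x \<bullet> \<xi>)) * f x)"

text \<open>The Fourier transform of the tempered distribution \<open>T\<close> is the locally integrable function \<open>g\<close>.
  As usual, this is tested on \<open>C\<^sub>c\<^sup>\<infinity>\<close>, which is dense in the Schwartz space.\<close>

definition has_fourier ::
    "((real ^ 'n::finite \<Rightarrow> complex) \<Rightarrow> complex) \<Rightarrow> (real ^ 'n \<Rightarrow> complex) \<Rightarrow> bool" where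
  "has_fourier T g \<longleftrightarrow> g \<in> borel_measurable borel \<and>
     (\<forall>K. compact K \<longrightarrow> set_integrable lborel K g) \<and>
     (\<forall>\<phi>\<in>test_functions. T (fourier \<phi>) = (LINT \<xi>|lborel. g \<xi> * \<phi> \<xi>))"


section \<open>Weights and moderate nets of distributions\<close>

definition Lp_norm :: "ennreal \<Rightarrow> (real ^ 'n::finite \<Rightarrow> real) \<Rightarrow> ennreal" where
  "Lp_norm p f = (if p = \<infinity> then esssup lborel (\<lambda>x. ennreal \<bar>f x\<bar>)
     else let I = (\<integral>\<^sup>+x. ennreal (\<bar>f x\<bar> powr enn2real p) \<partial>lborel)
          in if I = \<infinity> then \<infinity> else ennreal (enn2real I powr (1 / enn2real p)))"

definition tempered_weights :: "(real ^ 'n::finite \<Rightarrow> real) set" where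
  "tempered_weights = {k. (\<forall>\<xi>. k \<xi> > 0) \<and>
     (\<exists>C>0. \<exists>N::nat. \<forall>\<xi> \<eta>. k (\<xi> + \<eta>) \<le> (1 + C * norm \<xi>) ^ N * k \<eta>)}"

definition B_moderate :: "ennreal \<Rightarrow> (real \<Rightarrow> real ^ 'n::finite \<Rightarrow> real) \<Rightarrow>
    (real \<Rightarrow> (real ^ 'n \<Rightarrow> complex) \<Rightarrow> complex) \<Rightarrow> bool" where
  "B_moderate p w T \<longleftrightarrow> (\<forall>\<epsilon>\<in>{0<..1}. is_tempered_distribution (T \<epsilon>)) \<and>
     (\<exists>g. (\<forall>\<epsilon>\<in>{0<..1}. has_fourier (T \<epsilon>) (g \<epsilon>)) \<and>
          (\<exists>b. net_O (\<lambda>\<epsilon>. Lp_norm p (\<lambda>\<xi>. w \<epsilon> \<xi> * cmod (g \<epsilon> \<xi>))) b))"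

definition B_loc_moderate :: "ennreal \<Rightarrow> (real \<Rightarrow> real ^ 'n::finite \<Rightarrow> real) \<Rightarrow>
    (real \<Rightarrow> (real ^ 'n \<Rightarrow> complex) \<Rightarrow> complex) \<Rightarrow> bool" where
  "B_loc_moderate p w T \<longleftrightarrow> (\<forall>\<epsilon>\<in>{0<..1}. is_distribution (T \<epsilon>)) \<and>
     (\<forall>\<phi>\<in>test_functions. B_moderate p w (\<lambda>\<epsilon> f. T \<epsilon> (\<lambda>x. \<phi> x * f x)))"


section \<open>Basic functionals\<close>

text \<open>
  Functionals on compactly supported generalized functions are maps on the whole type of which
  only the values on \<^const>\<open>Gc\<close> matter; such maps are compared on \<^const>\<open>Gc\<close> only.
  They are evaluated on representatives all of whose members are supported in one compact set.
\<close>

definition defined_by :: "('n::finite gfun \<Rightarrow> complex gnum) \<Rightarrow>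
    (real \<Rightarrow> (real ^ 'n \<Rightarrow> complex) \<Rightarrow> complex) \<Rightarrow> bool" where
  "defined_by T S \<longleftrightarrow> (\<forall>u\<in>Gc. \<forall>r K. represents_fun r u \<and> compact K \<and>
     (\<forall>\<epsilon>\<in>{0<..1}. r \<epsilon> \<in> smooth_supported K) \<longrightarrow> represents (\<lambda>\<epsilon>. S \<epsilon> (r \<epsilon>)) (T u))"

definition Lb_Gc :: "('n::finite gfun \<Rightarrow> complex gnum) set" where
  "Lb_Gc = {T. \<exists>S. (\<forall>\<epsilon>\<in>{0<..1}. is_distribution (S \<epsilon>)) \<and>
     (\<forall>K. compact K \<longrightarrow> (\<exists>(j::nat) (N::nat). \<exists>c>0. \<exists>\<eta>\<in>{0<..1}.
        \<forall>f\<in>smooth_supported K. \<forall>\<epsilon>\<in>{0<..\<eta>}.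
          ennreal (cmod (S \<epsilon> f)) \<le> ennreal (c * \<epsilon> powr - real N) * seminorm_on K j f)) \<and>
     defined_by T S}"

definition Lb_G :: "('n::finite gfun \<Rightarrow> complex gnum) set" where
  "Lb_G = {T. \<exists>S. (\<forall>\<epsilon>\<in>{0<..1}. is_compact_distribution (S \<epsilon>)) \<and>
     (\<exists>K (j::nat) (N::nat). compact K \<and> (\<exists>c>0. \<exists>\<eta>\<in>{0<..1}.
        \<forall>f. smooth f \<longrightarrow> (\<forall>\<epsilon>\<in>{0<..\<eta>}.
          ennreal (cmod (S \<epsilon> f)) \<le> ennreal (c * \<epsilon> powr - real N) * seminorm_on K j f))) \<and>
     (\<forall>u r. represents_fun r u \<longrightarrow> represents (\<lambda>\<epsilon>. S \<epsilon> (r \<epsilon>)) (T u))}"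


section \<open>Differential operators with generalized constant coefficients\<close>

text \<open>Coefficients are given as families indexed by all multi-indices, of which only those of
  order at most \<open>m\<close> are used.\<close>

definition transpose_op :: "nat \<Rightarrow> ('n::finite multiindex \<Rightarrow> complex gnum) \<Rightarrow> 'n gfun \<Rightarrow> 'n gfun" where
  "transpose_op m c w = (\<Sum>\<alpha> | mi_order \<alpha> \<le> m. gscale ((- 1) ^ mi_order \<alpha> * c \<alpha>) (gD \<alpha> w))"

definition diff_op :: "nat \<Rightarrow> ('n::finite multiindex \<Rightarrow> complex gnum) \<Rightarrow>
    ('n gfun \<Rightarrow> complex gnum) \<Rightarrow> 'n gfun \<Rightarrow> complex gnum" where
  "diff_op m c T w = T (transpose_op m c w)"

definition symbol :: "nat \<Rightarrow> ('n::finite multiindex \<Rightarrow> real \<Rightarrow> complex) \<Rightarrow>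
    real \<Rightarrow> real ^ 'n \<Rightarrow> complex" where
  "symbol m a \<epsilon> \<xi> = (\<Sum>\<alpha> | mi_order \<alpha> \<le> m. a \<alpha> \<epsilon> * of_real (monomial \<alpha> \<xi>))"

definition symbol_tilde :: "nat \<Rightarrow> ('n::finite multiindex \<Rightarrow> real \<Rightarrow> complex) \<Rightarrow>
    real \<Rightarrow> real ^ 'n \<Rightarrow> real" where
  "symbol_tilde m a \<epsilon> \<xi> = sqrt (\<Sum>\<alpha> | mi_order \<alpha> \<le> m. (cmod (mpartial \<alpha> (symbol m a \<epsilon>) \<xi>))\<^sup>2)"

text \<open>The net below is moderate, and its class does not depend on the choice of representatives,
  whenever \<open>a\<close> consists of representatives of the coefficients.\<close>

definition gsymbol_tilde :: "nat \<Rightarrow> ('n::finite multiindex \<Rightarrow> real \<Rightarrow> complex) \<Rightarrow>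
    real ^ 'n \<Rightarrow> real gnum" where
  "gsymbol_tilde m a \<xi> = abs_gnum (\<lambda>\<epsilon>. symbol_tilde m a \<epsilon> \<xi>)"

end

(* By compactness of the unit sphere in the space of polynomials of degree at most m, finitely many
   directions suffice to find, for every polynomial P and every real xi, a bounded direction w(xi)
   with |P(xi + z w(xi))| >= c P~(xi) for all |z| = 1, where R >= |w| and c > 0 depend only on m and n.
   With F f(zeta) = integral of exp(i x zeta) f(x) dx, averaging
   F f(zeta) / P(zeta) * exp(-i x zeta), zeta = xi + z w(xi), over the circle |z| = 1 and over xi
   gives an operator s, bounded between C^infinity seminorms by a multiple of 1 / P~(0).
   If f is replaced by tP(D) f, the factor P cancels; the mean value property of entire functions and
   Fourier inversion then give s(tP(D) f) = f.  Since P~ varies slowly, invertibility of P~(xi_0)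
   bounds 1 / P~_eps(0) by a power of 1 / eps, and u = v o s solves the equation.

   For regularity, v is evaluated through the given B_{p,k}-moderate net as v_eps(h s(f)), with a
   cutoff h equal to 1 near the support of v.  The Fourier transform of phi u_eps is then v_eps^
   integrated against a kernel dominated by (1 + |xi - eta|)^(-M) / P~_eps(xi), and Young's inequality
   in weighted L^p concludes. *)

theory Submission
  imports Defs "HOL-Probability.Characteristic_Functions" "HOL-Probability.Sinc_Integral"
    "HOL-Complex_Analysis.Cauchy_Integral_Formula"
begin

section \<open>Smooth functions\<close>

text \<open>The equation is only tested on \<open>^tP(D) f\<close>, so a left inverse
  \<open>s\<close> of the transposed operator on test functions suffices; no fundamental solution
  has to be identified. The obstacle is uniformity: about the polynomials nothing is known beyond
  moderate coefficients and a lower bound for P~ at one point. Hence every constant is fixed before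
  the polynomial, which enters the bounds through 1 / P~ alone. Finitely many directions also make a
  measurable choice of w possible.

  Shifting into the complex domain costs decay in x: s(f) may grow exponentially. The compactly
  supported distributions representing v accept such functions, with bounds uniform in \<epsilon>,
  but need not be B_{p,k}-moderate. The given net is B_{p,k}-moderate, but its members act on
  Schwartz functions, with constants not controlled in \<epsilon>. So u is carried by two nets, one
  for the functional bounds and one for the regularity. They define the same functional: the
  compactly supported net does not see the cutoff h, and both represent v at the class of h s(f).
  Both nets are set to 0 for large \<epsilon>, where P~ may vanish.\<close>

lemma partial_deriv_eqI:
  "(f has_derivative f') (at x) \<Longrightarrow> partial_deriv i f x = f' (axis i 1)"
  unfolding partial_deriv_def using frechet_derivative_at by metis

text \<open>Smoothness is a greatest fixed point. Later proofs only exhibit a family of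
  differentiable functions stable under partial derivatives, such as multiples of one exponential or
  quotients by powers of \<open>q\<close>, and avoid formulas for iterated derivatives.\<close>

lemma smooth_coinduct:
  assumes "f \<in> X"
    and "\<And>g x. g \<in> X \<Longrightarrow> g differentiable (at x)"
    and "\<And>g i. g \<in> X \<Longrightarrow> partial_deriv i g \<in> X"
  shows "smooth f"
proof -
  have "foldr partial_deriv is f \<in> X" for "is"
    by (induction "is") (use assms in auto)
  thus ?thesis using assms(2) by (auto simp: smooth_def)
qed

lemma partial_deriv_mult:
  assumes "\<And>x. f differentiable (at x)" "\<And>x. g differentiable (at x)"
  shows "partial_deriv i (\<lambda>x. f x * g x) = (\<lambda>x. partial_deriv i f x * g x + f x * partial_deriv i g x)"
proof
  fix x
  have "((\<lambda>x. f x * g x) has_derivative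
     (\<lambda>h. f x * frechet_derivative g (at x) h + frechet_derivative f (at x) h * g x)) (at x)"
    using assms by (intro has_derivative_mult) (auto simp: frechet_derivative_works[symmetric])
  from partial_deriv_eqI[OF this, of i]
  show "partial_deriv i (\<lambda>x. f x * g x) x = partial_deriv i f x * g x + f x * partial_deriv i g x"
    by (simp add: partial_deriv_def)
qed

text \<open>Products alone are not stable under differentiation; by the product rule their finite
  sums are. This is the family for the coinduction below.\<close>

inductive_set mult_closure :: "(real ^ 'n::finite \<Rightarrow> complex) set" where
  mult: "smooth f \<Longrightarrow> smooth g \<Longrightarrow> (\<lambda>x. f x * g x) \<in> mult_closure"
| add: "f \<in> mult_closure \<Longrightarrow> g \<in> mult_closure \<Longrightarrow> (\<lambda>x. f x + g x) \<in> mult_closure"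

lemma smooth_mult:
  assumes "smooth f" "smooth g"
  shows "smooth (\<lambda>x. f x * g x)"
proof (rule smooth_coinduct)
  show "(\<lambda>x. f x * g x) \<in> mult_closure" using assms by (rule mult_closure.mult)
  show d: "h differentiable (at x)" if "h \<in> mult_closure" for h and x :: "real ^ 'a"
    using that
  proof induction
    case (mult f g)
    thus ?case by (intro differentiable_mult) (simp_all add: smooth_differentiable)
  qed (rule differentiable_add)
  show "partial_deriv i h \<in> mult_closure" if "h \<in> mult_closure" for h and i :: 'a
    using that
  proof induction
    case (mult f g)
    thus ?case
      by (subst partial_deriv_mult)
         (auto intro!: smooth_differentiable mult_closure.intros smooth_partial_deriv)
  next
    case (add f g)
    thus ?case
      by (subst partial_deriv_add) (auto intro!: d mult_closure.intros)
  qed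
qed

lemma partial_deriv_const: "partial_deriv i (\<lambda>x. c) = (\<lambda>x. 0)"
  by (auto simp: fun_eq_iff intro!: partial_deriv_eqI[THEN trans] derivative_eq_intros)

lemma smooth_const: "smooth (\<lambda>x. c)"
  by (rule smooth_coinduct[of _ "range (\<lambda>c x. c)"]) (auto simp: partial_deriv_const)

lemma smooth_sum: "(\<And>i. i \<in> A \<Longrightarrow> smooth (f i)) \<Longrightarrow> smooth (\<lambda>x. \<Sum>i\<in>A. f i x)"
  by (induction A rule: infinite_finite_induct) (auto intro: smooth_const smooth_add)

lemma smooth_prod: "(\<And>i. i \<in> A \<Longrightarrow> smooth (f i)) \<Longrightarrow> smooth (\<lambda>x. \<Prod>i\<in>A. f i x)"
  by (induction A rule: infinite_finite_induct) (auto intro: smooth_const smooth_mult)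

lemma smooth_inverse:
  assumes "smooth q" "\<And>x. q x \<noteq> 0"
  shows "smooth (\<lambda>x. inverse (q x))"
proof (rule smooth_coinduct)
  \<comment> \<open>The quotient rule keeps this shape: it raises the exponent of \<open>q\<close>
    by one and leaves a smooth numerator.\<close>
  let ?X = "{\<lambda>x. p x / q x ^ j | p j. smooth p}"
  have q: "q differentiable (at x)" for x using assms smooth_differentiable by blast
  show "(\<lambda>x. inverse (q x)) \<in> ?X"
    by (rule CollectI, rule exI[of _ "\<lambda>x. 1"], rule exI[of _ 1]) (auto simp: smooth_const field_simps)
  show d: "h differentiable (at x)" if "h \<in> ?X" for h x
  proof -
    from that obtain p j where "h = (\<lambda>x. p x / q x ^ j)" "smooth p" by auto
    thus ?thesis
      by (simp add: differentiable_divide differentiable_power smooth_differentiable q assms(2))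
  qed
  show "partial_deriv i h \<in> ?X" if "h \<in> ?X" for h and i :: 'a
  proof -
    from that obtain p j where h: "h = (\<lambda>x. p x / q x ^ j)" and p: "smooth p" by auto
    have "partial_deriv i h = (\<lambda>x. (partial_deriv i p x * q x + (- of_nat j) * (p x * partial_deriv i q x)) / q x ^ Suc j)"
    proof
      fix x
      have 1: "(p has_derivative frechet_derivative p (at x)) (at x)"
        using smooth_differentiable[OF p] by (simp add: frechet_derivative_works[symmetric])
      have 2: "(q has_derivative frechet_derivative q (at x)) (at x)"
        using q by (simp add: frechet_derivative_works[symmetric])
      show "partial_deriv i h x = (partial_deriv i p x * q x + (- of_nat j) * (p x * partial_deriv i q x)) / q x ^ Suc j"
        unfolding h
        apply (rule trans)
         apply (rule partial_deriv_eqI)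
         apply (rule has_derivative_divide[OF 1 has_derivative_power[OF 2]])
        using assms(2)[of x]
         apply simp
        \<comment> \<open>The power rule leaves the truncated exponent \<open>j - 1\<close>, so
          \<open>j = 0\<close> is treated on its own.\<close>
        apply (cases j)
        using assms(2)[of x]
         apply (simp_all add: partial_deriv_def field_simps)
        done
    qed
    moreover have "smooth (\<lambda>x. partial_deriv i p x * q x + (- of_nat j) * (p x * partial_deriv i q x))"
      by (intro smooth_add smooth_mult smooth_const smooth_partial_deriv assms p)
    ultimately show ?thesis by (intro CollectI exI conjI)
  qed
qed

lemma smooth_continuous_on: "smooth f \<Longrightarrow> continuous_on S f"
  by (meson continuous_at_imp_continuous_on differentiable_imp_continuous_within smooth_differentiable)

lemma smooth_measurable: "smooth f \<Longrightarrow> f \<in> borel_measurable borel"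
  by (intro borel_measurable_continuous_onI smooth_continuous_on)

section \<open>Flat functions and cutoffs\<close>

lemma poly_exp_tendsto_0:
  "((\<lambda>t::real. poly p (1/t) * exp (- 1/t)) \<longlongrightarrow> 0) (at_right 0)"
proof -
  have "((\<lambda>x::real. poly p x * exp (- x)) \<longlongrightarrow> 0) at_top"
  proof (induction p)
    case (pCons a p)
    have "((\<lambda>x::real. (\<Sum>i\<le>degree (pCons a p). coeff (pCons a p) i * (x ^ i / exp x))) \<longlongrightarrow>
        (\<Sum>i\<le>degree (pCons a p). coeff (pCons a p) i * 0)) at_top"
      by (intro tendsto_intros tendsto_power_div_exp_0)
    moreover have "(\<lambda>x. poly (pCons a p) x * exp (- x)) =
        (\<lambda>x. \<Sum>i\<le>degree (pCons a p). coeff (pCons a p) i * (x ^ i / exp x))"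
      unfolding poly_altdef exp_minus sum_distrib_right by (simp add: field_simps)
    ultimately show ?case by simp
  qed simp
  moreover have "filterlim (\<lambda>t::real. 1/t) at_top (at_right 0)"
    using filterlim_inverse_at_top_right by (simp add: inverse_eq_divide)
  ultimately have "((\<lambda>t. poly p (1/t) * exp (- (1/t))) \<longlongrightarrow> 0) (at_right 0)"
    by (rule filterlim_compose[of "\<lambda>x. poly p x * exp (- x)" _ at_top "\<lambda>t. 1/t"])
  thus ?thesis by simp
qed

text \<open>\<open>flat_exp 1\<close> is the classical flat function exp(-1/t). Polynomials in 1/t
  are carried along because differentiation produces them.\<close>

definition flat_exp :: "real poly \<Rightarrow> real \<Rightarrow> real" where
  "flat_exp p t = (if t > 0 then poly p (1/t) * exp (- 1/t) else 0)"

text \<open>By the chain rule both the polynomial and the exponential contribute 1/t^2, hence the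
  factor \<open>[:0,0,1:]\<close>. At 0 the one-sided difference quotients tend to 0, because the
  exponential beats every power of 1/t.\<close>

lemma flat_exp_deriv:
  "(flat_exp p has_real_derivative flat_exp ((p - pderiv p) * [:0,0,1:]) t) (at t)"
proof -
  consider "t > 0" | "t < 0" | "t = 0" by linarith
  thus ?thesis
  proof cases
    case 1
    have "((\<lambda>t. poly p (1/t) * exp (- 1/t)) has_real_derivative flat_exp ((p - pderiv p) * [:0,0,1:]) t) (at t)"
      using 1 by (auto intro!: derivative_eq_intros simp: flat_exp_def power2_eq_square field_simps)
    thus ?thesis
      by (rule DERIV_cong_ev[THEN iffD1, rotated 3])
         (use 1 eventually_nhds_in_open[of "{0<..}" t] in \<open>auto simp: flat_exp_def elim!: eventually_mono\<close>)
  next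
    case 2
    have "((\<lambda>t. 0) has_real_derivative flat_exp ((p - pderiv p) * [:0,0,1:]) t) (at t)"
      using 2 by (auto simp: flat_exp_def)
    thus ?thesis
      by (rule DERIV_cong_ev[THEN iffD1, rotated 3])
         (use 2 eventually_nhds_in_open[of "{..<0}" t] in \<open>auto simp: flat_exp_def elim!: eventually_mono\<close>)
  next
    case 3
    \<comment> \<open>Dividing by the increment multiplies the polynomial by one more power of 1/t,
      so the difference quotient is again of the type covered by
      \<open>poly_exp_tendsto_0\<close>.\<close>
    have r: "((\<lambda>y. (flat_exp p y - flat_exp p 0) / (y - 0)) \<longlongrightarrow> 0) (at_right 0)"
    proof (rule Lim_transform_eventually[OF poly_exp_tendsto_0[of "p * [:0,1:]"]])
      show "\<forall>\<^sub>F x in at_right 0. poly (p * [:0, 1:]) (1 / x) * exp (- 1 / x) =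
          (flat_exp p x - flat_exp p 0) / (x - 0)"
        unfolding eventually_at_right_field by (intro exI[of _ 1]) (auto simp: flat_exp_def)
    qed
    have l: "((\<lambda>y. (flat_exp p y - flat_exp p 0) / (y - 0)) \<longlongrightarrow> 0) (at_left 0)"
    proof (rule Lim_transform_eventually[OF tendsto_const])
      show "\<forall>\<^sub>F x in at_left 0. 0 = (flat_exp p x - flat_exp p 0) / (x - 0)"
        unfolding eventually_at_left_field by (intro exI[of _ "-1"]) (auto simp: flat_exp_def)
    qed
    have "((\<lambda>y. (flat_exp p y - flat_exp p 0) / (y - 0)) \<longlongrightarrow> 0) (at 0)"
      using filterlim_split_at[OF l r] .
    thus ?thesis using 3 by (simp add: has_field_derivative_iff flat_exp_def)
  qed
qed

lemma smooth_flat_exp_affine: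
  "smooth (\<lambda>x. of_real (flat_exp p (c + d * x $ i)))" (is "smooth (?g p)")
proof (rule smooth_coinduct)
  show "?g p \<in> range ?g" by simp
  have D: "(?g p has_derivative (\<lambda>h. of_real (d * h $ i * flat_exp ((p - pderiv p) * [:0,0,1:]) (c + d * x $ i)))) (at x)" for p x
  proof -
    have "((\<lambda>x. c + d * x $ i) has_derivative (\<lambda>h. d * h $ i)) (at x)"
      by (auto intro!: derivative_eq_intros bounded_linear_imp_has_derivative bounded_linear_vec_nth)
    from has_derivative_of_real[OF has_derivative_compose[OF this flat_exp_deriv[of p "c + d * x $ i", THEN has_field_derivative_imp_has_derivative]]]
    show ?thesis by (simp add: mult_ac)
  qed
  show "h differentiable (at x)" if "h \<in> range ?g" for h x
    using that D unfolding differentiable_def by auto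
  show "partial_deriv j h \<in> range ?g" if "h \<in> range ?g" for h j
  proof -
    from that obtain p where p: "h = ?g p" by auto
    \<comment> \<open>The factor 0 covers the other coordinate directions, which keeps the family
      closed under all partial derivatives.\<close>
    have "partial_deriv j h = ?g (smult (if i = j then d else 0) ((p - pderiv p) * [:0,0,1:]))"
      unfolding p by (rule ext, subst partial_deriv_eqI[OF D])
        (auto simp: axis_def flat_exp_def mult_ac)
    thus ?thesis by blast
  qed
qed

text \<open>With \<open>a\<close> positive exactly on the open box of radius \<open>R + 1\<close> and \<open>b\<close> positive exactly off the
  closed box of radius \<open>R\<close>, the cutoff is \<open>a / (a + b)\<close>.\<close>

lemma ex_cutoff:
  assumes "compact (K :: (real ^ 'n::finite) set)"
  obtains \<psi> U where "\<psi> \<in> test_functions" "open U" "K \<subseteq> U" "\<And>x. x \<in> U \<Longrightarrow> \<psi> x = 1"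
proof -
  obtain R where R: "\<And>x. x \<in> K \<Longrightarrow> norm x < R"
    using compact_imp_bounded[OF assms] by (metis bounded_pos_less)
  let ?f = "flat_exp 1"
  define a where "a x = (\<Prod>i\<in>UNIV. complex_of_real (?f ((R + 1) + (-1) * x $ i)) * of_real (?f ((R + 1) + 1 * x $ i)))" for x :: "real ^ 'n"
  define b where "b x = (\<Sum>i\<in>UNIV. complex_of_real (?f ((-R) + 1 * x $ i)) + of_real (?f ((- R) + (-1) * x $ i)))" for x :: "real ^ 'n"
  \<comment> \<open>Real twins of \<open>a\<close> and \<open>b\<close>: signs are discussed for
    these, smoothness for the complex versions.\<close>
  define a' where "a' x = (\<Prod>i\<in>UNIV. (?f ((R + 1) + (-1) * x $ i)) * (?f ((R + 1) + 1 * x $ i)))" for x :: "real ^ 'n"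
  define b' where "b' x = (\<Sum>i\<in>UNIV. (?f ((-R) + 1 * x $ i)) + (?f ((- R) + (-1) * x $ i)))" for x :: "real ^ 'n"
  have ab: "a x = of_real (a' x)" "b x = of_real (b' x)" for x by (simp_all add: a_def a'_def b_def b'_def)
  have sa: "smooth a" "smooth b"
    unfolding a_def b_def
    by (intro smooth_prod smooth_sum smooth_mult smooth_add smooth_flat_exp_affine)+
  have fpos: "?f t \<ge> 0" "?f t > 0 \<longleftrightarrow> t > 0" "t \<le> 0 \<Longrightarrow> ?f t = 0" for t by (auto simp: flat_exp_def)
  have a0: "a' x \<ge> 0" "b' x \<ge> 0" for x
    unfolding a'_def b'_def by (auto intro!: prod_nonneg sum_nonneg add_nonneg_nonneg mult_nonneg_nonneg fpos)
  have b1: "b' x > 0" if "\<bar>x $ i\<bar> > R" for x i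
    unfolding b'_def using that fpos
    by (intro sum_pos2[of _ i] add_nonneg_nonneg) (auto simp: abs_if add_pos_nonneg add_nonneg_pos split: if_splits)
  have a1: "a' x > 0" if "\<And>i. \<bar>x $ i\<bar> < R + 1" for x
    unfolding a'_def
  proof (intro prod_pos mult_pos_pos)
    fix i show "?f ((R + 1) + (-1) * x $ i) > 0" "?f ((R + 1) + 1 * x $ i) > 0"
      using that[of i] by (auto simp: fpos(2))
  qed
  \<comment> \<open>The open box of radius \<open>R + 1\<close> and the exterior of the closed box
    of radius \<open>R\<close> cover the space, so the denominator never vanishes.\<close>
  have pos: "a' x + b' x > 0" for x
  proof (cases "\<forall>i. \<bar>x $ i\<bar> < R + 1")
    case True thus ?thesis using a1[of x] a0(2)[of x] by (auto intro: add_pos_nonneg)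
  next
    case False
    then obtain i where "\<bar>x $ i\<bar> \<ge> R + 1" by (auto simp: not_less)
    hence "\<bar>x $ i\<bar> > R" by simp
    thus ?thesis using b1 a0 by (auto intro: add_nonneg_pos)
  qed
  define \<psi> where "\<psi> x = a x * inverse (a x + b x)" for x
  have nz: "a x + b x \<noteq> 0" for x using pos[of x] by (metis ab less_irrefl of_real_add of_real_eq_0_iff)
  have "smooth \<psi>" unfolding \<psi>_def
    by (intro smooth_mult smooth_inverse sa smooth_add nz)
  moreover have "\<psi> x = 0" if "x \<notin> cbox (\<chi> i. - (R+1)) (\<chi> i. R + 1)" for x
  proof -
    from that obtain i where "\<bar>x $ i\<bar> > R + 1" by (auto simp: mem_box_cart) (smt (verit))+
    hence "?f ((R + 1) + (-1) * x $ i) = 0 \<or> ?f ((R + 1) + 1 * x $ i) = 0" by (auto intro!: fpos(3))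
    hence "a x = 0" by (auto simp: a_def)
    thus ?thesis by (simp add: \<psi>_def)
  qed
  ultimately have "\<psi> \<in> test_functions"
    unfolding test_functions_def smooth_supported_def by (blast intro: compact_cbox)
  moreover have "\<psi> x = 1" if "x \<in> ball 0 R" for x
  proof -
    have "b' x = 0" unfolding b'_def
    proof (rule sum.neutral, rule ballI)
      fix i
      have "\<bar>x $ i\<bar> < R" using that component_le_norm_cart[of x i] by simp
      thus "?f ((-R) + 1 * x $ i) + ?f ((- R) + (-1) * x $ i) = 0" by (simp add: fpos(3))
    qed
    thus ?thesis using nz[of x] by (simp add: \<psi>_def ab)
  qed
  moreover have "K \<subseteq> ball 0 R" using R by auto
  ultimately show thesis by (intro that[of \<psi> "ball 0 R"]) auto
qed

section \<open>Polynomials\<close>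

definition cvec :: "real ^ 'n \<Rightarrow> complex ^ 'n::finite" where
  "cvec x = (\<chi> i. of_real (x $ i))"

definition cmono :: "'n::finite multiindex \<Rightarrow> complex ^ 'n \<Rightarrow> complex" where
  "cmono \<alpha> z = (\<Prod>i\<in>UNIV. (z $ i) ^ \<alpha> i)"

definition cpol :: "nat \<Rightarrow> ('n::finite multiindex \<Rightarrow> complex) \<Rightarrow> complex ^ 'n \<Rightarrow> complex" where
  "cpol m b z = (\<Sum>\<alpha> | mi_order \<alpha> \<le> m. b \<alpha> * cmono \<alpha> z)"

text \<open>Hoermander's function P~ of a single polynomial. The index \<epsilon> is dropped:
  estimates are proved for one coefficient family \<open>b\<close>, with constants chosen
  beforehand, and are applied to every member of the net at the end.\<close>

definition ptilde :: "nat \<Rightarrow> ('n::finite multiindex \<Rightarrow> complex) \<Rightarrow> real ^ 'n \<Rightarrow> real" where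
  "ptilde m b \<xi> = sqrt (\<Sum>\<alpha> | mi_order \<alpha> \<le> m. (cmod (mpartial \<alpha> (\<lambda>x. cpol m b (cvec x)) \<xi>))\<^sup>2)"

lemma cvec_nth [simp]: "cvec x $ i = of_real (x $ i)"
  by (simp add: cvec_def)

lemma cvec_add: "cvec (x + y) = cvec x + cvec y"
  and cvec_diff: "cvec (x - y) = cvec x - cvec y"
  and cvec_minus: "cvec (- x) = - cvec x"
  by (simp_all add: vec_eq_iff)

lemma symbol_eq_cpol: "symbol m a \<epsilon> \<xi> = cpol m (\<lambda>\<alpha>. a \<alpha> \<epsilon>) (cvec \<xi>)"
  by (simp add: symbol_def cpol_def cmono_def monomial_def of_real_prod)

lemma symbol_tilde_eq_ptilde: "symbol_tilde m a \<epsilon> = ptilde m (\<lambda>\<alpha>. a \<alpha> \<epsilon>)"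
  by (simp add: symbol_tilde_def ptilde_def fun_eq_iff symbol_eq_cpol[abs_def])

lemma smooth_coord: "smooth (\<lambda>x. of_real (x $ i))"
proof (rule smooth_coinduct)
  let ?X = "insert (\<lambda>x. of_real (x $ i)) (range (\<lambda>c x. c)) :: (real ^ 'a \<Rightarrow> complex) set"
  have D: "((\<lambda>x. complex_of_real (x $ i)) has_derivative (\<lambda>h. of_real (h $ i))) (at x)" for x
    by (intro has_derivative_of_real bounded_linear_imp_has_derivative bounded_linear_vec_nth)
  show "(\<lambda>x. of_real (x $ i)) \<in> ?X" by simp
  show "g differentiable (at x)" if "g \<in> ?X" for g x
    using that D unfolding differentiable_def by (auto intro: derivative_eq_intros)
  show "partial_deriv j g \<in> ?X" if "g \<in> ?X" for g j
  proof -
    have "partial_deriv j (\<lambda>x. complex_of_real (x $ i)) = (\<lambda>x. if i = j then 1 else 0)"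
      by (rule ext, subst partial_deriv_eqI[OF D]) (auto simp: axis_def)
    thus ?thesis using that by (auto simp: partial_deriv_const)
  qed
qed

lemma smooth_power: "smooth f \<Longrightarrow> smooth (\<lambda>x. f x ^ k)"
  by (induction k) (auto intro: smooth_mult smooth_const)

lemma smooth_cmono: "smooth (\<lambda>x. cmono \<alpha> (cvec x))"
  unfolding cmono_def by (auto intro!: smooth_prod smooth_power smooth_coord)

lemma smooth_cpol: "smooth (\<lambda>x. cpol m b (cvec x))"
  unfolding cpol_def by (intro smooth_sum smooth_cmult smooth_cmono)

section \<open>Derivatives of monomials and Taylor's formula\<close>

lemma partial_deriv_along_axis:
  assumes "f differentiable (at x)"
    and "((\<lambda>t. f (x + t *\<^sub>R axis i 1)) has_vector_derivative D) (at 0)"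
  shows "partial_deriv i f x = D"
proof -
  have "((\<lambda>t. x + t *\<^sub>R axis i 1) has_vector_derivative axis i 1) (at 0)"
    by (auto intro!: derivative_eq_intros simp: has_vector_derivative_def)
  moreover have "(f has_derivative frechet_derivative f (at (x + 0 *\<^sub>R axis i 1))) (at (x + 0 *\<^sub>R axis i 1))"
    using assms(1) by (simp add: frechet_derivative_works[symmetric])
  ultimately have "((\<lambda>t. f (x + t *\<^sub>R axis i 1)) has_vector_derivative
      frechet_derivative f (at (x + 0 *\<^sub>R axis i 1)) (axis i 1)) (at 0)"
    using vector_derivative_diff_chain_within[of "\<lambda>t. x + t *\<^sub>R axis i 1" "axis i 1" 0 UNIV f]
    by (simp add: o_def has_derivative_at_withinI)
  from vector_derivative_unique_at[OF this assms(2)] show ?thesis by (simp add: partial_deriv_def)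
qed

text \<open>A factorial times a binomial coefficient is a falling factorial, and it vanishes by
  itself once \<beta> exceeds \<gamma> in some coordinate. This form needs no case distinction for
  the truncated exponents.\<close>

lemma mpartial_cmono:
  "mpartial \<beta> (\<lambda>x. cmono \<gamma> (cvec x)) =
    (\<lambda>x. \<Prod>i\<in>UNIV. of_nat (fact (\<beta> i) * (\<gamma> i choose \<beta> i)) * of_real (x $ i) ^ (\<gamma> i - \<beta> i))"
proof -
  define F :: "'a multiindex \<Rightarrow> real ^ 'a \<Rightarrow> complex" where
    "F \<beta> x = (\<Prod>i\<in>UNIV. of_nat (fact (\<beta> i) * (\<gamma> i choose \<beta> i)) * of_real (x $ i) ^ (\<gamma> i - \<beta> i))" for \<beta> x
  have sF: "smooth (F \<beta>)" for \<beta>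
    unfolding F_def by (auto intro!: smooth_prod smooth_cmult smooth_power smooth_coord)
  have step: "partial_deriv j (F \<beta>) = F (\<lambda>i. (if j = i then 1 else 0) + \<beta> i)" for j \<beta>
  proof
    fix x
    define A where "A = (\<Prod>i\<in>UNIV - {j}. of_nat (fact (\<beta> i) * (\<gamma> i choose \<beta> i)) * complex_of_real (x $ i) ^ (\<gamma> i - \<beta> i))"
    have 1: "F \<beta> (x + t *\<^sub>R axis j 1) = of_nat (fact (\<beta> j) * (\<gamma> j choose \<beta> j)) * of_real (x $ j + t) ^ (\<gamma> j - \<beta> j) * A" for t
      unfolding F_def A_def
      by (subst prod.remove[of _ j]) (auto simp: axis_def intro!: arg_cong2[where f = "(*)"] prod.cong)
    have 2: "((\<lambda>t. of_nat (fact (\<beta> j) * (\<gamma> j choose \<beta> j)) * of_real (x $ j + t) ^ (\<gamma> j - \<beta> j) * A)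
       has_vector_derivative of_nat (fact (\<beta> j) * (\<gamma> j choose \<beta> j)) *
          (of_nat (\<gamma> j - \<beta> j) * of_real (x $ j) ^ (\<gamma> j - \<beta> j - 1)) * A) (at 0)"
      unfolding has_vector_derivative_def
      by (auto intro!: derivative_eq_intros simp: fun_eq_iff scaleR_conv_of_real algebra_simps)
    \<comment> \<open>Absorption identity for binomial coefficients; both sides are 0 once \<beta>
      has reached \<gamma> in coordinate \<open>j\<close>.\<close>
    have b: "fact (\<beta> j) * (\<gamma> j choose \<beta> j) * (\<gamma> j - \<beta> j) = fact (Suc (\<beta> j)) * (\<gamma> j choose Suc (\<beta> j))"
    proof (cases "\<beta> j < \<gamma> j")
      case True
      have "(\<gamma> j - \<beta> j) * (\<gamma> j choose \<beta> j) = Suc (\<beta> j) * (\<gamma> j choose Suc (\<beta> j))"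
        unfolding binomial_absorb_comp binomial_absorption ..
      hence "fact (\<beta> j) * ((\<gamma> j - \<beta> j) * (\<gamma> j choose \<beta> j)) = fact (\<beta> j) * (Suc (\<beta> j) * (\<gamma> j choose Suc (\<beta> j)))"
        by (rule arg_cong)
      thus ?thesis by (simp only: fact_Suc of_nat_id mult_ac)
    qed (auto simp: not_less)
    have "partial_deriv j (F \<beta>) x = of_nat (fact (\<beta> j) * (\<gamma> j choose \<beta> j)) *
          (of_nat (\<gamma> j - \<beta> j) * of_real (x $ j) ^ (\<gamma> j - \<beta> j - 1)) * A"
      by (rule partial_deriv_along_axis[OF smooth_differentiable[OF sF]]) (subst 1, rule 2)
    also have "\<dots> = of_nat (fact (\<beta> j) * (\<gamma> j choose \<beta> j) * (\<gamma> j - \<beta> j)) * of_real (x $ j) ^ (\<gamma> j - Suc (\<beta> j)) * A"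
      by simp
    also have "\<dots> = F (\<lambda>i. (if j = i then 1 else 0) + \<beta> i) x"
      unfolding b F_def A_def by (subst (2) prod.remove[of _ j]) (auto intro!: prod.cong)
    finally show "partial_deriv j (F \<beta>) x = F (\<lambda>i. (if j = i then 1 else 0) + \<beta> i) x" .
  qed
  have "foldr partial_deriv is (F (\<lambda>_. 0)) = F (count_list is)" for "is"
  proof (induction "is")
    case (Cons j js)
    have "(\<lambda>i. (if j = i then 1 else 0) + count_list js i) = count_list (j # js)" by (auto simp: fun_eq_iff)
    thus ?case by (simp only: foldr.simps comp_apply Cons step)
  qed (auto simp: fun_eq_iff F_def)
  moreover obtain "is" where "count_list is = \<beta>" using ex_list_of_multiindex[of \<beta>] by blast
  moreover have "F (\<lambda>_. 0) = (\<lambda>x. cmono \<gamma> (cvec x))" by (simp add: F_def cmono_def fun_eq_iff)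
  ultimately have "mpartial \<beta> (\<lambda>x. cmono \<gamma> (cvec x)) = F \<beta>"
    using foldr_partial_deriv[OF smooth_cmono, of "is" \<gamma>] by simp
  thus ?thesis by (simp add: F_def[abs_def])
qed

lemma mpartial_sum:
  "finite A \<Longrightarrow> (\<And>i. i \<in> A \<Longrightarrow> smooth (f i)) \<Longrightarrow> mpartial \<alpha> (\<lambda>x. \<Sum>i\<in>A. f i x) = (\<lambda>x. \<Sum>i\<in>A. mpartial \<alpha> (f i) x)"
  by (induction A rule: finite_induct) (simp_all add: mpartial_0 mpartial_add smooth_sum)

lemma mpartial_cpol:
  "mpartial \<beta> (\<lambda>x. cpol m b (cvec x)) =
    (\<lambda>x. \<Sum>\<gamma> | mi_order \<gamma> \<le> m. b \<gamma> * mpartial \<beta> (\<lambda>x. cmono \<gamma> (cvec x)) x)"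
  unfolding cpol_def
  by (subst mpartial_sum) (auto simp: finite_mi_order_le mpartial_cmult smooth_cmono intro!: smooth_cmult)

definition mfact :: "'n::finite multiindex \<Rightarrow> complex" where
  "mfact \<alpha> = (\<Prod>i\<in>UNIV. fact (\<alpha> i))"

lemma mfact_nz [simp]: "mfact \<alpha> \<noteq> 0"
  by (simp add: mfact_def)

lemma mfact_ge_1: "cmod (mfact \<alpha>) \<ge> 1"
proof -
  have "mfact \<alpha> = of_nat (\<Prod>i\<in>UNIV. fact (\<alpha> i))" by (simp add: mfact_def)
  moreover have "(\<Prod>i\<in>UNIV. fact (\<alpha> i) :: nat) \<ge> 1" by (intro prod_ge_1) (simp add: Suc_leI)
  ultimately show ?thesis by (metis norm_of_nat of_nat_1 of_nat_mono)
qed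

lemma mi_order_mono: "(\<And>i. \<beta> i \<le> \<gamma> i) \<Longrightarrow> mi_order \<beta> \<le> mi_order \<gamma>"
  unfolding mi_order_def by (rule sum_mono)

text \<open>The binomial theorem in each coordinate, multiplied out. Summing over all orders up to
  \<open>m\<close>, where the additional terms have a vanishing binomial coefficient, gives all
  monomials of a polynomial the same index set. The increment \<open>z\<close> is complex although
  the derivatives are taken at a real point.\<close>

lemma taylor_cmono:
  assumes "mi_order \<gamma> \<le> m"
  shows "cmono \<gamma> (cvec \<xi> + z) = (\<Sum>\<beta> | mi_order \<beta> \<le> m.
    mpartial \<beta> (\<lambda>x. cmono \<gamma> (cvec x)) \<xi> * cmono \<beta> z / mfact \<beta>)"
proof -
  let ?t = "\<lambda>\<beta>. \<Prod>i\<in>UNIV. of_nat (\<gamma> i choose \<beta> i) * z $ i ^ \<beta> i * of_real (\<xi> $ i) ^ (\<gamma> i - \<beta> i)"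
  have "cmono \<gamma> (cvec \<xi> + z) = (\<Prod>i\<in>UNIV. (z $ i + of_real (\<xi> $ i)) ^ \<gamma> i)"
    by (simp add: cmono_def add.commute)
  also have "\<dots> = (\<Prod>i\<in>UNIV. \<Sum>k\<in>{..\<gamma> i}. of_nat (\<gamma> i choose k) * z $ i ^ k * of_real (\<xi> $ i) ^ (\<gamma> i - k))"
    by (intro prod.cong refl binomial_ring)
  also have "\<dots> = sum ?t (PiE UNIV (\<lambda>i. {..\<gamma> i}))"
    by (subst prod_sum_PiE) simp_all
  also have "\<dots> = sum ?t {\<beta>. \<forall>i. \<beta> i \<le> \<gamma> i}"
    by (simp add: PiE_UNIV_domain Pi_def)
  also have "\<dots> = sum ?t {\<beta>. mi_order \<beta> \<le> m}"
  proof (rule sum.mono_neutral_left)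
    show "finite {\<beta> :: 'a multiindex. mi_order \<beta> \<le> m}" by (rule finite_mi_order_le)
    show "{\<beta>. \<forall>i. \<beta> i \<le> \<gamma> i} \<subseteq> {\<beta>. mi_order \<beta> \<le> m}"
    proof safe
      fix \<beta> assume "\<forall>i. \<beta> i \<le> \<gamma> i"
      hence "mi_order \<beta> \<le> mi_order \<gamma>" by (intro mi_order_mono) simp
      with assms show "mi_order \<beta> \<le> m" by simp
    qed
    show "\<forall>i\<in>{\<beta>. mi_order \<beta> \<le> m} - {\<beta>. \<forall>i. \<beta> i \<le> \<gamma> i}. ?t i = 0"
    proof
      fix \<beta> assume "\<beta> \<in> {\<beta>. mi_order \<beta> \<le> m} - {\<beta>. \<forall>i. \<beta> i \<le> \<gamma> i}"
      then obtain i where "\<gamma> i choose \<beta> i = 0" by (auto simp: not_le)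
      thus "?t \<beta> = 0" by (intro prod_zero bexI[of _ i]) simp_all
    qed
  qed
  also have "\<dots> = (\<Sum>\<beta> | mi_order \<beta> \<le> m. mpartial \<beta> (\<lambda>x. cmono \<gamma> (cvec x)) \<xi> * cmono \<beta> z / mfact \<beta>)"
  proof (rule sum.cong[OF refl])
    fix \<beta> :: "'a multiindex"
    define A C X Z where "A = mfact \<beta>" "C = (\<Prod>i\<in>UNIV. complex_of_nat (\<gamma> i choose \<beta> i))"
      "X = (\<Prod>i\<in>UNIV. complex_of_real (\<xi> $ i) ^ (\<gamma> i - \<beta> i))" "Z = cmono \<beta> z"
    have "mpartial \<beta> (\<lambda>x. cmono \<gamma> (cvec x)) \<xi> = A * C * X"
      by (simp add: mpartial_cmono A_C_X_Z_def prod.distrib mfact_def)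
    moreover have "?t \<beta> = C * Z * X" by (simp add: A_C_X_Z_def prod.distrib cmono_def)
    moreover have "A \<noteq> 0" by (simp add: A_C_X_Z_def)
    ultimately show "?t \<beta> = mpartial \<beta> (\<lambda>x. cmono \<gamma> (cvec x)) \<xi> * cmono \<beta> z / mfact \<beta>"
      unfolding A_C_X_Z_def(1,4)[symmetric] by simp
  qed
  finally show ?thesis .
qed

lemma taylor_cpol:
  "cpol m b (cvec \<xi> + z) = (\<Sum>\<beta> | mi_order \<beta> \<le> m.
    mpartial \<beta> (\<lambda>x. cpol m b (cvec x)) \<xi> * cmono \<beta> z / mfact \<beta>)"
proof -
  have "cpol m b (cvec \<xi> + z) = (\<Sum>\<gamma> | mi_order \<gamma> \<le> m. \<Sum>\<beta> | mi_order \<beta> \<le> m.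
      b \<gamma> * (mpartial \<beta> (\<lambda>x. cmono \<gamma> (cvec x)) \<xi> * cmono \<beta> z / mfact \<beta>))"
    unfolding cpol_def by (rule sum.cong) (auto simp: taylor_cmono[of _ m] sum_distrib_left)
  also have "\<dots> = (\<Sum>\<beta> | mi_order \<beta> \<le> m. \<Sum>\<gamma> | mi_order \<gamma> \<le> m.
      b \<gamma> * (mpartial \<beta> (\<lambda>x. cmono \<gamma> (cvec x)) \<xi> * cmono \<beta> z / mfact \<beta>))"
    by (rule sum.swap)
  also have "\<dots> = (\<Sum>\<beta> | mi_order \<beta> \<le> m. mpartial \<beta> (\<lambda>x. cpol m b (cvec x)) \<xi> * cmono \<beta> z / mfact \<beta>)"
    by (simp add: mpartial_cpol sum_distrib_right sum_divide_distrib mult.assoc)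
  finally show ?thesis .
qed

lemma mpartial_cpol_eq_0:
  assumes "mi_order \<beta> > m"
  shows "mpartial \<beta> (\<lambda>x. cpol m b (cvec x)) = (\<lambda>x. 0)"
proof -
  have "mpartial \<beta> (\<lambda>x. cmono \<gamma> (cvec x)) x = 0" if "mi_order \<gamma> \<le> m" for \<gamma> and x :: "real ^ 'a"
  proof -
    have "\<exists>i. \<beta> i > \<gamma> i" using assms that mi_order_mono[of \<beta> \<gamma>] by (meson not_le order_trans)
    then obtain i where "\<beta> i > \<gamma> i" by blast
    thus ?thesis unfolding mpartial_cmono by (intro prod_zero) (auto intro!: bexI[of _ i])
  qed
  thus ?thesis by (simp add: mpartial_cpol)
qed

text \<open>Makes Taylor's formula available for the derivatives too, which is what slow variation
  of P~ requires.\<close>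

lemma mpartial_cpol_is_cpol:
  "\<exists>b'. mpartial \<alpha> (\<lambda>x. cpol m b (cvec x)) = (\<lambda>x. cpol m b' (cvec x))"
proof -
  let ?d = "\<lambda>\<beta>. mpartial \<beta> (\<lambda>x. cpol m b (cvec x))"
  have "mpartial \<alpha> (\<lambda>x. cmono \<gamma> (cvec x)) =
    (\<lambda>x. (\<Prod>i\<in>UNIV. of_nat (fact (\<alpha> i) * (\<gamma> i choose \<alpha> i))) * cmono (\<lambda>i. \<gamma> i - \<alpha> i) (cvec x))" for \<gamma>
    unfolding mpartial_cmono by (simp add: cmono_def prod.distrib)
  hence *: "mpartial \<alpha> (\<lambda>x. cpol m b (cvec x)) = (\<lambda>x. \<Sum>\<gamma> | mi_order \<gamma> \<le> m.
      b \<gamma> * (\<Prod>i\<in>UNIV. of_nat (fact (\<alpha> i) * (\<gamma> i choose \<alpha> i))) * cmono (\<lambda>i. \<gamma> i - \<alpha> i) (cvec x))"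
    by (simp add: mpartial_cpol mult_ac)
  define c where "c \<gamma> = b \<gamma> * (\<Prod>i\<in>UNIV. of_nat (fact (\<alpha> i) * (\<gamma> i choose \<alpha> i)))" for \<gamma>
  \<comment> \<open>Truncated subtraction may send several \<gamma> to the same \<delta>, so the
    coefficients are summed over the fibre.\<close>
  define b' where "b' \<delta> = (\<Sum>\<gamma> | mi_order \<gamma> \<le> m. if (\<lambda>i. \<gamma> i - \<alpha> i) = \<delta> then c \<gamma> else 0)" for \<delta>
  have "cpol m b' (cvec x) = (\<Sum>\<gamma> | mi_order \<gamma> \<le> m. c \<gamma> * cmono (\<lambda>i. \<gamma> i - \<alpha> i) (cvec x))" for x
  proof -
    have "cpol m b' (cvec x) = (\<Sum>\<delta> | mi_order \<delta> \<le> m. \<Sum>\<gamma> | mi_order \<gamma> \<le> m. if (\<lambda>i. \<gamma> i - \<alpha> i) = \<delta> then c \<gamma> * cmono \<delta> (cvec x) else 0)"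
      unfolding cpol_def b'_def sum_distrib_right by (intro sum.cong) auto
    also have "\<dots> = (\<Sum>\<gamma> | mi_order \<gamma> \<le> m. \<Sum>\<delta> | mi_order \<delta> \<le> m. if (\<lambda>i. \<gamma> i - \<alpha> i) = \<delta> then c \<gamma> * cmono \<delta> (cvec x) else 0)"
      by (rule sum.swap)
    also have "\<dots> = (\<Sum>\<gamma> | mi_order \<gamma> \<le> m. c \<gamma> * cmono (\<lambda>i. \<gamma> i - \<alpha> i) (cvec x))"
    proof (rule sum.cong)
      fix \<gamma> :: "'a multiindex" assume "\<gamma> \<in> {\<gamma>. mi_order \<gamma> \<le> m}"
      hence "mi_order (\<lambda>i. \<gamma> i - \<alpha> i) \<le> m" using mi_order_mono[of "\<lambda>i. \<gamma> i - \<alpha> i" \<gamma>] by simp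
      thus "(\<Sum>\<delta> | mi_order \<delta> \<le> m. if (\<lambda>i. \<gamma> i - \<alpha> i) = \<delta> then c \<gamma> * cmono \<delta> (cvec x) else 0) =
         c \<gamma> * cmono (\<lambda>i. \<gamma> i - \<alpha> i) (cvec x)"
        by (subst sum.delta') (auto simp: finite_mi_order_le)
    qed auto
    finally show ?thesis .
  qed
  thus ?thesis unfolding * c_def by (intro exI[of _ b'] ext) simp
qed

section \<open>The weight P~ and its slow variation\<close>

lemma cmod_cmono_cvec_le: "cmod (cmono \<beta> (cvec x)) \<le> norm x ^ mi_order \<beta>"
proof -
  have "cmod (cmono \<beta> (cvec x)) = (\<Prod>i\<in>UNIV. \<bar>x $ i\<bar> ^ \<beta> i)"
    by (simp add: cmono_def prod_norm[symmetric] norm_power)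
  also have "\<dots> \<le> (\<Prod>i\<in>UNIV. norm x ^ \<beta> i)"
    by (intro prod_mono conjI power_mono component_le_norm_cart) auto
  finally show ?thesis by (simp add: power_sum mi_order_def)
qed

lemma cmod_mpartial_le_ptilde:
  "cmod (mpartial \<alpha> (\<lambda>x. cpol m b (cvec x)) \<xi>) \<le> ptilde m b \<xi>"
proof (cases "mi_order \<alpha> \<le> m")
  case True
  hence "(cmod (mpartial \<alpha> (\<lambda>x. cpol m b (cvec x)) \<xi>))\<^sup>2 \<le> (\<Sum>\<alpha> | mi_order \<alpha> \<le> m. (cmod (mpartial \<alpha> (\<lambda>x. cpol m b (cvec x)) \<xi>))\<^sup>2)"
    by (intro member_le_sum) (auto simp: finite_mi_order_le)
  thus ?thesis unfolding ptilde_def by (rule real_le_rsqrt)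
next
  case False
  thus ?thesis by (simp add: mpartial_cpol_eq_0 ptilde_def sum_nonneg)
qed

lemma ptilde_nonneg: "ptilde m b \<xi> \<ge> 0"
  by (simp add: ptilde_def sum_nonneg)

lemma ptilde_le_sum: "ptilde m b \<xi> \<le> (\<Sum>\<alpha> | mi_order \<alpha> \<le> m. cmod (mpartial \<alpha> (\<lambda>x. cpol m b (cvec x)) \<xi>))"
  unfolding ptilde_def using L2_set_le_sum[of "{\<alpha>. mi_order \<alpha> \<le> m}" "\<lambda>\<alpha>. cmod (mpartial \<alpha> (\<lambda>x. cpol m b (cvec x)) \<xi>)"]
  by (simp add: L2_set_def)

text \<open>Each derivative at the shifted point is expanded at \<xi>, with one term per multi-index
  of order at most \<open>m\<close>, bounded by (1 + |\<eta>|)^m P~(\<xi>). Adding up the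
  derivatives gives the second copy of the number of multi-indices. Read with the two points
  exchanged, the estimate also bounds P~ from below.\<close>

lemma ptilde_slowly_varying:
  "ptilde m b (\<xi> + \<eta>) \<le> (real (card {\<alpha> :: 'n::finite multiindex. mi_order \<alpha> \<le> m}))\<^sup>2 * (1 + norm \<eta>) ^ m * ptilde m b (\<xi> :: real ^ 'n)"
proof -
  let ?d = "\<lambda>\<beta>. mpartial \<beta> (\<lambda>x. cpol m b (cvec x))"
  let ?N = "real (card {\<alpha> :: 'n::finite multiindex. mi_order \<alpha> \<le> m})"
  have "cmod (?d \<alpha> (\<xi> + \<eta>)) \<le> ?N * ((1 + norm \<eta>) ^ m * ptilde m b \<xi>)" for \<alpha>
  proof -
    obtain b' where b': "?d \<alpha> = (\<lambda>x. cpol m b' (cvec x))" using mpartial_cpol_is_cpol by blast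
    have "?d \<alpha> (\<xi> + \<eta>) = (\<Sum>\<beta> | mi_order \<beta> \<le> m. mpartial \<beta> (?d \<alpha>) \<xi> * cmono \<beta> (cvec \<eta>) / mfact \<beta>)"
      unfolding b' by (simp add: cvec_add taylor_cpol)
    also have "cmod \<dots> \<le> (\<Sum>\<beta>\<in>{\<beta> :: 'n multiindex. mi_order \<beta> \<le> m}. (1 + norm \<eta>) ^ m * ptilde m b \<xi>)"
    proof (rule sum_norm_le)
      fix \<beta> :: "'n multiindex" assume \<beta>: "\<beta> \<in> {\<beta>. mi_order \<beta> \<le> m}"
      have 1: "cmod (mpartial \<beta> (?d \<alpha>) \<xi>) \<le> ptilde m b \<xi>"
        by (simp add: mpartial_mpartial smooth_cpol cmod_mpartial_le_ptilde)
      have "norm \<eta> ^ mi_order \<beta> \<le> (1 + norm \<eta>) ^ mi_order \<beta>" by (intro power_mono) auto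
      also have "\<dots> \<le> (1 + norm \<eta>) ^ m" using \<beta> by (intro power_increasing) auto
      finally have 2: "cmod (cmono \<beta> (cvec \<eta>)) \<le> (1 + norm \<eta>) ^ m"
        using cmod_cmono_cvec_le order_trans by blast
      have "cmod (mpartial \<beta> (?d \<alpha>) \<xi> * cmono \<beta> (cvec \<eta>) / mfact \<beta>) \<le> cmod (mpartial \<beta> (?d \<alpha>) \<xi>) * cmod (cmono \<beta> (cvec \<eta>)) / 1"
        unfolding norm_divide norm_mult using mfact_ge_1 by (intro divide_left_mono) (auto simp: zero_less_mult_iff)
      also have "\<dots> \<le> ptilde m b \<xi> * (1 + norm \<eta>) ^ m"
        using 1 2 by (auto intro!: mult_mono ptilde_nonneg)
      finally show "cmod (mpartial \<beta> (?d \<alpha>) \<xi> * cmono \<beta> (cvec \<eta>) / mfact \<beta>) \<le> (1 + norm \<eta>) ^ m * ptilde m b \<xi>"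
        by (simp add: mult.commute)
    qed
    finally show ?thesis by simp
  qed
  hence "(\<Sum>\<alpha> | mi_order \<alpha> \<le> m. cmod (?d \<alpha> (\<xi> + \<eta>))) \<le> (\<Sum>\<alpha>\<in>{\<alpha> :: 'n multiindex. mi_order \<alpha> \<le> m}. ?N * ((1 + norm \<eta>) ^ m * ptilde m b \<xi>))"
    by (intro sum_mono)
  with ptilde_le_sum[of m b "\<xi> + \<eta>"] show ?thesis by (simp add: power2_eq_square mult_ac)
qed

section \<open>Circles on which a polynomial is bounded below\<close>

text \<open>On a suitable circle a polynomial is bounded below by its Taylor coefficients; compactness of
  the unit sphere in the space of coefficients leaves only finitely many circles to choose from.\<close>

lemma ex_circle_nonvanishing:
  assumes "mi_order \<alpha>0 \<le> m" "b \<alpha>0 \<noteq> 0"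
  obtains w \<delta> where "\<delta> > 0" "\<And>z. cmod z = 1 \<Longrightarrow> cmod (cpol m b (z *s cvec w)) > \<delta>"
proof -
  have "\<exists>x. cpol m b (cvec x) \<noteq> 0"
  proof (rule ccontr)
    assume "\<not> ?thesis"
    hence 0: "mpartial \<alpha>0 (\<lambda>x. cpol m b (cvec x)) 0 = 0" by (simp add: mpartial_0)
    \<comment> \<open>At the origin the derivative of order \<open>\<alpha>0\<close> sees exactly
      one monomial, so identical vanishing of the function would force the coefficient
      \<open>b \<alpha>0\<close> to be zero.\<close>
    have "mpartial \<alpha>0 (\<lambda>x. cmono \<gamma> (cvec x)) 0 = (if \<gamma> = \<alpha>0 then mfact \<alpha>0 else 0)" for \<gamma>
    proof (cases "\<gamma> = \<alpha>0")
      case False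
      then obtain i where "\<gamma> i \<noteq> \<alpha>0 i" by blast
      hence "of_nat (fact (\<alpha>0 i) * (\<gamma> i choose \<alpha>0 i)) * complex_of_real (0 $ i) ^ (\<gamma> i - \<alpha>0 i) = 0" by auto
      thus ?thesis using False unfolding mpartial_cmono by (subst prod_zero) (auto intro!: bexI[of _ i])
    qed (simp add: mpartial_cmono mfact_def)
    hence "mpartial \<alpha>0 (\<lambda>x. cpol m b (cvec x)) 0 =
        (\<Sum>\<gamma> | mi_order \<gamma> \<le> m. if \<gamma> = \<alpha>0 then b \<alpha>0 * mfact \<alpha>0 else 0)"
      unfolding mpartial_cpol by (intro sum.cong) auto
    hence "mpartial \<alpha>0 (\<lambda>x. cpol m b (cvec x)) 0 = b \<alpha>0 * mfact \<alpha>0"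
      using assms(1) by (simp add: finite_mi_order_le)
    with 0 assms(2) show False by simp
  qed
  then obtain x where x: "cpol m b (cvec x) \<noteq> 0" by blast
  \<comment> \<open>The restriction to the complex line through \<open>x\<close>. It has finitely
    many zeros, so some radius \<open>r\<close> in (0,1) avoids all their moduli; absorbing
    \<open>r\<close> into the direction brings the circle back to radius 1.\<close>
  define q where "q = (\<Sum>\<alpha> | mi_order \<alpha> \<le> m. monom (b \<alpha> * cmono \<alpha> (cvec x)) (mi_order \<alpha>))"
  have q: "cpol m b (z *s cvec x) = poly q z" for z
    by (auto simp: q_def cpol_def poly_sum poly_monom cmono_def power_mult_distrib prod.distrib mi_order_def power_sum intro!: sum.cong)
  have "q \<noteq> 0" using x q[of 1] by auto
  hence "finite (cmod ` {z. poly q z = 0})" by (simp add: poly_roots_finite)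
  moreover have "infinite {0<..<1::real}" by (simp add: infinite_Ioo)
  ultimately obtain r where r: "r \<in> {0<..<1}" "r \<notin> cmod ` {z. poly q z = 0}"
    by (metis finite_subset subsetI)
  define f where "f z = cmod (poly q (z * of_real r))" for z
  have "continuous_on (sphere 0 1) f" unfolding f_def by (intro continuous_intros)
  from continuous_attains_inf[OF _ _ this]
  obtain z0 where z0: "z0 \<in> sphere 0 1" "\<And>z. z \<in> sphere 0 1 \<Longrightarrow> f z0 \<le> f z" by auto
  have "poly q (z0 * of_real r) \<noteq> 0"
  proof
    assume "poly q (z0 * of_real r) = 0"
    hence "cmod (z0 * of_real r) \<in> cmod ` {z. poly q z = 0}" by blast
    with r z0(1) show False by (simp add: norm_mult)
  qed
  hence "f z0 > 0" by (simp add: f_def)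
  show thesis
  proof (rule that[of "f z0 / 2" "r *\<^sub>R x"])
    show "f z0 / 2 > 0" using \<open>f z0 > 0\<close> by simp
    fix z :: complex assume "cmod z = 1"
    hence "f z0 \<le> f z" by (intro z0) simp
    moreover have "z *s cvec (r *\<^sub>R x) = (z * of_real r) *s cvec x" by (simp add: vec_eq_iff)
    ultimately show "cmod (cpol m b (z *s cvec (r *\<^sub>R x))) > f z0 / 2"
      using \<open>f z0 > 0\<close> unfolding f_def by (simp only: q)
  qed
qed

text \<open>Along the unit circle the modulus of each monomial at \<open>z *s cvec w\<close> does
  not depend on \<open>z\<close>, so closeness of the coefficients passes to the values uniformly on
  the circle.\<close>

lemma cpol_circle_stable:
  assumes "\<delta> > 0"
  obtains e where "e > 0" "\<And>b' z. (\<And>\<alpha>. mi_order \<alpha> \<le> m \<Longrightarrow> cmod (b' \<alpha> - b \<alpha>) < e) \<Longrightarrow> cmod z = 1 \<Longrightarrow>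
     cmod (cpol m b' (z *s cvec w) - cpol m b (z *s cvec w)) \<le> \<delta>"
proof -
  define D where "D = 1 + (\<Sum>\<alpha> | mi_order \<alpha> \<le> m. cmod (cmono \<alpha> (cvec w)))"
  have "D > 0" unfolding D_def by (intro add_pos_nonneg sum_nonneg) auto
  show thesis
  proof (rule that[of "\<delta> / D"])
    show "\<delta> / D > 0" using assms \<open>D > 0\<close> by simp
    fix b' z assume *: "\<And>\<alpha>. mi_order \<alpha> \<le> m \<Longrightarrow> cmod (b' \<alpha> - b \<alpha>) < \<delta> / D" "cmod z = 1"
    have c: "cmod (cmono \<alpha> (z *s cvec w)) = cmod (cmono \<alpha> (cvec w))" for \<alpha>
      using *(2) by (simp add: cmono_def prod_norm[symmetric] norm_mult norm_power)
    have "cpol m b' (z *s cvec w) - cpol m b (z *s cvec w) = (\<Sum>\<alpha> | mi_order \<alpha> \<le> m. (b' \<alpha> - b \<alpha>) * cmono \<alpha> (z *s cvec w))"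
      by (simp add: cpol_def sum_subtractf[symmetric] algebra_simps)
    also have "cmod \<dots> \<le> (\<Sum>\<alpha> | mi_order \<alpha> \<le> m. \<delta> / D * cmod (cmono \<alpha> (cvec w)))"
      unfolding c[symmetric] using *
      by (intro sum_norm_le) (simp only: norm_mult mem_Collect_eq, intro mult_right_mono, auto intro: less_imp_le)
    also have "\<dots> = \<delta> / D * (D - 1)" by (simp add: D_def sum_distrib_left)
    also have "\<dots> \<le> \<delta>" using \<open>D > 0\<close> assms by (simp add: field_simps)
    finally show "cmod (cpol m b' (z *s cvec w) - cpol m b (z *s cvec w)) \<le> \<delta>" .
  qed
qed

text \<open>The unit sphere for the maximum norm on coefficients is treated in finitely many compact
  pieces, one for each index \<open>\<alpha>0\<close> at which the maximum may be attained.\<close>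

lemma ex_finite_circles_normalized:
  assumes \<alpha>0: "mi_order (\<alpha>0 :: 'n::finite multiindex) \<le> m"
  obtains W :: "(real ^ 'n) set" and \<delta> where "finite W" "\<delta> > 0"
    "\<And>d. cmod (d \<alpha>0) = 1 \<Longrightarrow> (\<And>\<alpha>. mi_order \<alpha> \<le> m \<Longrightarrow> cmod (d \<alpha>) \<le> 1) \<Longrightarrow>
      \<exists>w\<in>W. \<forall>z. cmod z = 1 \<longrightarrow> cmod (cpol m d (z *s cvec w)) \<ge> \<delta>"
proof -
  \<comment> \<open>Indices of order above \<open>m\<close> are pinned to 0. The set
    \<open>S\<close> is then a product of compact sets, hence compact in the space of all
    coefficient families although this has infinitely many coordinates.\<close>
  define B where "B \<alpha> = (if \<alpha> = \<alpha>0 then sphere 0 1 else if mi_order \<alpha> \<le> m then cball 0 1 else {0::complex})" for \<alpha> :: "'n multiindex"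
  define S where "S = {d. \<forall>\<alpha>. d \<alpha> \<in> B \<alpha>}"
  have "compact S"
  proof -
    have "compactin (product_topology (\<lambda>_. euclidean) UNIV) (PiE UNIV B)"
      by (subst compactin_PiE) (auto simp: B_def)
    thus ?thesis by (simp add: S_def euclidean_product_topology PiE_UNIV_domain Pi_def)
  qed
  define ok where "ok w \<delta> b \<longleftrightarrow> \<delta> > 0 \<and> (\<forall>z. cmod z = 1 \<longrightarrow> cmod (cpol m b (z *s cvec w)) \<ge> \<delta>)" for w :: "real ^ 'n" and \<delta> b
  have "\<forall>d\<in>S. \<exists>U. open U \<and> d \<in> U \<and> (\<exists>w \<delta>. \<forall>d'\<in>U. ok w \<delta> d')"
  proof
    fix d assume "d \<in> S"
    hence "d \<alpha>0 \<in> B \<alpha>0" by (simp add: S_def)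
    hence "d \<alpha>0 \<noteq> 0" by (auto simp: B_def)
    from ex_circle_nonvanishing[of \<alpha>0 m d, OF \<alpha>0 this] obtain w \<delta> where
      w: "\<delta> > 0" "\<And>z. cmod z = 1 \<Longrightarrow> cmod (cpol m d (z *s cvec w)) > \<delta>" by blast
    obtain e where e: "e > 0" "\<And>b' z. (\<And>\<alpha>. mi_order \<alpha> \<le> m \<Longrightarrow> cmod (b' \<alpha> - d \<alpha>) < e) \<Longrightarrow> cmod z = 1 \<Longrightarrow>
       cmod (cpol m b' (z *s cvec w) - cpol m d (z *s cvec w)) \<le> \<delta> / 2"
      using cpol_circle_stable[of "\<delta> / 2" m d w] w(1) by auto
    \<comment> \<open>Only the finitely many coordinates of order at most \<open>m\<close> are
      restricted, so this set is open in the product topology. On it the circle found for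
      \<open>d\<close> still works, with half the lower bound.\<close>
    define U where "U = (\<Inter>\<alpha>\<in>{\<alpha>. mi_order \<alpha> \<le> m}. {d'. d' \<alpha> \<in> ball (d \<alpha>) e})"
    have "open U" unfolding U_def
    proof (intro open_INT finite_mi_order_le ballI)
      fix \<alpha> :: "'n multiindex"
      have "continuous_on UNIV (\<lambda>d' :: 'n multiindex \<Rightarrow> complex. d' \<alpha>)" by (rule continuous_on_product_coordinates)
      from open_vimage[OF open_ball this] show "open {d'. d' \<alpha> \<in> ball (d \<alpha>) e}" by (simp add: vimage_def)
    qed
    moreover have "d \<in> U" using e(1) by (simp add: U_def)
    moreover have "ok w (\<delta> / 2) d'" if "d' \<in> U" for d'
      unfolding ok_def
    proof (intro conjI allI impI)
      show "\<delta> / 2 > 0" using w by simp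
      fix z :: complex assume z: "cmod z = 1"
      have "cmod (cpol m d' (z *s cvec w) - cpol m d (z *s cvec w)) \<le> \<delta> / 2"
        using that z by (intro e(2)) (auto simp: U_def dist_norm norm_minus_commute)
      with w(2)[OF z] show "cmod (cpol m d' (z *s cvec w)) \<ge> \<delta> / 2"
        using norm_triangle_ineq2[of "cpol m d (z *s cvec w)" "cpol m d (z *s cvec w) - cpol m d' (z *s cvec w)"]
        by (simp add: norm_minus_commute)
    qed
    ultimately show "\<exists>U. open U \<and> d \<in> U \<and> (\<exists>w \<delta>. \<forall>d'\<in>U. ok w \<delta> d')" by blast
  qed
  then obtain U where U: "\<And>d. d \<in> S \<Longrightarrow> open (U d)" "\<And>d. d \<in> S \<Longrightarrow> d \<in> U d"
    "\<And>d. d \<in> S \<Longrightarrow> \<exists>w \<delta>. \<forall>d'\<in>U d. ok w \<delta> d'" by metis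
  then obtain w \<delta> where w\<delta>: "\<And>d d'. d \<in> S \<Longrightarrow> d' \<in> U d \<Longrightarrow> ok (w d) (\<delta> d) d'" by metis
  obtain F where F: "F \<subseteq> S" "finite F" "S \<subseteq> (\<Union>d\<in>F. U d)"
    using compactE_image[OF \<open>compact S\<close>, of S U] U by (metis UN_I subsetI)
  have pos: "\<delta> d > 0" if "d \<in> S" for d using w\<delta>[OF that U(2)[OF that]] by (simp add: ok_def)
  \<comment> \<open>Inserting \<open>1\<close> makes the minimum one over a nonempty set, whatever
    the finite subcover.\<close>
  define \<delta>0 where "\<delta>0 = Min (insert 1 (\<delta> ` F))"
  show thesis
  proof (rule that[of "w ` F" \<delta>0])
    show "finite (w ` F)" using F by simp
    show "\<delta>0 > 0" unfolding \<delta>0_def using F pos by (subst Min_gr_iff) auto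
    fix d :: "'n multiindex \<Rightarrow> complex"
    assume d: "cmod (d \<alpha>0) = 1" "\<And>\<alpha>. mi_order \<alpha> \<le> m \<Longrightarrow> cmod (d \<alpha>) \<le> 1"
    define d' where "d' \<alpha> = (if mi_order \<alpha> \<le> m then d \<alpha> else 0)" for \<alpha>
    have "d' \<in> S" using d \<alpha>0 by (auto simp: S_def B_def d'_def)
    then obtain d0 where d0: "d0 \<in> F" "d' \<in> U d0" using F by blast
    hence "ok (w d0) (\<delta> d0) d'" using w\<delta> F by blast
    moreover have "cpol m d' = cpol m d" by (auto simp: cpol_def d'_def fun_eq_iff intro!: sum.cong)
    moreover have "\<delta>0 \<le> \<delta> d0" unfolding \<delta>0_def using F d0 by (intro Min_le) auto
    ultimately show "\<exists>w\<in>w ` F. \<forall>z. cmod z = 1 \<longrightarrow> cmod (cpol m d (z *s cvec w)) \<ge> \<delta>0"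
      using d0 unfolding ok_def by (metis image_eqI order_trans)
  qed
qed

text \<open>Taylor expansion at \<xi> removes the translation, and division by the largest Taylor
  coefficient removes the size; a normalized polynomial remains. This is why \<open>W\<close> and
  \<open>c\<close> depend on neither \<open>b\<close> nor \<xi>.\<close>

lemma ex_finite_circles:
  obtains W :: "(real ^ 'n::finite) set" and c where "finite W" "c > 0"
    "\<And>b \<xi>. \<exists>w\<in>W. \<forall>z. cmod z = 1 \<longrightarrow> c * ptilde m b \<xi> \<le> cmod (cpol m b (cvec \<xi> + z *s cvec w))"
proof -
  let ?A = "{\<alpha> :: 'n multiindex. mi_order \<alpha> \<le> m}"
  define G where "G \<alpha>0 W \<delta> \<longleftrightarrow> finite W \<and> \<delta> > 0 \<and> (\<forall>d. cmod (d \<alpha>0) = 1 \<and> (\<forall>\<alpha>. mi_order \<alpha> \<le> m \<longrightarrow> cmod (d \<alpha>) \<le> 1) \<longrightarrow>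
      (\<exists>w\<in>W. \<forall>z. cmod z = 1 \<longrightarrow> cmod (cpol m d (z *s cvec w)) \<ge> \<delta>))"
    for \<alpha>0 and W :: "(real ^ 'n) set" and \<delta>
  have "\<exists>W \<delta>. G \<alpha>0 W \<delta>" if "\<alpha>0 \<in> ?A" for \<alpha>0
  proof -
    have "mi_order \<alpha>0 \<le> m" using that by simp
    from ex_finite_circles_normalized[OF this] obtain W :: "(real ^ 'n) set" and \<delta> where "finite W" "\<delta> > 0"
      "\<And>d. cmod (d \<alpha>0) = 1 \<Longrightarrow> (\<And>\<alpha>. mi_order \<alpha> \<le> m \<Longrightarrow> cmod (d \<alpha>) \<le> 1) \<Longrightarrow>
      \<exists>w\<in>W. \<forall>z. cmod z = 1 \<longrightarrow> cmod (cpol m d (z *s cvec w)) \<ge> \<delta>" by blast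
    hence "G \<alpha>0 W \<delta>" unfolding G_def by blast
    thus ?thesis by blast
  qed
  then obtain W \<delta> where G: "\<And>\<alpha>0. \<alpha>0 \<in> ?A \<Longrightarrow> G \<alpha>0 (W \<alpha>0) (\<delta> \<alpha>0)" by metis
  have W: "\<And>\<alpha>0. \<alpha>0 \<in> ?A \<Longrightarrow> finite (W \<alpha>0)" "\<And>\<alpha>0. \<alpha>0 \<in> ?A \<Longrightarrow> \<delta> \<alpha>0 > 0"
    using G unfolding G_def by blast+
  have W3: "\<exists>w\<in>W \<alpha>0. \<forall>z. cmod z = 1 \<longrightarrow> cmod (cpol m d (z *s cvec w)) \<ge> \<delta> \<alpha>0"
    if "\<alpha>0 \<in> ?A" "cmod (d \<alpha>0) = 1" "\<And>\<alpha>. mi_order \<alpha> \<le> m \<Longrightarrow> cmod (d \<alpha>) \<le> 1" for \<alpha>0 d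
    using G[OF that(1)] that(2,3) unfolding G_def by blast
  have finA: "finite ?A" by (rule finite_mi_order_le)
  have "(\<lambda>_. 0) \<in> ?A" by (simp add: mi_order_def)
  hence neA: "?A \<noteq> {}" by blast
  define \<delta>0 where "\<delta>0 = Min (\<delta> ` ?A)"
  have \<delta>0: "\<delta>0 > 0" "\<And>\<alpha>. \<alpha> \<in> ?A \<Longrightarrow> \<delta>0 \<le> \<delta> \<alpha>"
    using finA neA W(2) by (auto simp: \<delta>0_def)
  \<comment> \<open>P~ is made of derivatives, the normalization of Taylor coefficients; the
    factorials summed in \<open>F\<close> convert one into the other.\<close>
  define F where "F = (\<Sum>\<alpha>\<in>?A. cmod (mfact \<alpha>))"
  have "F > 0" unfolding F_def using finA neA
    by (intro sum_pos) auto
  show thesis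
  \<comment> \<open>The direction 0 serves the case in which all Taylor coefficients vanish and the
    bound reads 0 \<le> 0.\<close>
  proof (rule that[of "insert 0 (\<Union>\<alpha>0\<in>?A. W \<alpha>0)" "\<delta>0 / F"])
    show "finite (insert 0 (\<Union>\<alpha>0\<in>?A. W \<alpha>0))" using finA W(1) by simp
    show "\<delta>0 / F > 0" using \<delta>0 \<open>F > 0\<close> by simp
    fix b and \<xi> :: "real ^ 'n"
    define e where "e \<beta> = mpartial \<beta> (\<lambda>x. cpol m b (cvec x)) \<xi> / mfact \<beta>" for \<beta>
    have P: "cpol m b (cvec \<xi> + z) = cpol m e z" for z
      unfolding taylor_cpol by (simp add: cpol_def e_def)
    define M where "M = Max ((\<lambda>\<alpha>. cmod (e \<alpha>)) ` ?A)"
    have "M \<in> (\<lambda>\<alpha>. cmod (e \<alpha>)) ` ?A" unfolding M_def using finA neA by (intro Max_in) auto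
    then obtain \<alpha>0 where \<alpha>0: "\<alpha>0 \<in> ?A" "cmod (e \<alpha>0) = M" by auto
    have M: "cmod (e \<alpha>) \<le> M" if "\<alpha> \<in> ?A" for \<alpha> unfolding M_def using finA that by (intro Max_ge) auto
    have pt: "ptilde m b \<xi> \<le> F * M"
    proof -
      have "ptilde m b \<xi> \<le> (\<Sum>\<alpha>\<in>?A. cmod (mfact \<alpha>) * cmod (e \<alpha>))"
        using ptilde_le_sum[of m b \<xi>] by (simp add: e_def norm_divide)
      also have "\<dots> \<le> (\<Sum>\<alpha>\<in>?A. cmod (mfact \<alpha>) * M)" by (intro sum_mono mult_left_mono M) auto
      finally show ?thesis by (simp add: F_def sum_distrib_right)
    qed
    show "\<exists>w\<in>insert 0 (\<Union>\<alpha>0\<in>?A. W \<alpha>0). \<forall>z. cmod z = 1 \<longrightarrow>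
       \<delta>0 / F * ptilde m b \<xi> \<le> cmod (cpol m b (cvec \<xi> + z *s cvec w))"
    proof (cases "M = 0")
      case True
      hence "ptilde m b \<xi> = 0" using pt ptilde_nonneg[of m b \<xi>] by simp
      thus ?thesis by (intro bexI[of _ 0]) simp_all
    next
      case False
      hence "M > 0" using \<alpha>0 norm_ge_zero[of "e \<alpha>0"] by linarith
      define d where "d \<alpha> = e \<alpha> / of_real M" for \<alpha>
      have "\<exists>w\<in>W \<alpha>0. \<forall>z. cmod z = 1 \<longrightarrow> cmod (cpol m d (z *s cvec w)) \<ge> \<delta> \<alpha>0"
        using \<open>M > 0\<close> \<alpha>0 M by (intro W3) (auto simp: d_def norm_divide)
      then obtain w where w: "w \<in> W \<alpha>0" "\<And>z. cmod z = 1 \<Longrightarrow> cmod (cpol m d (z *s cvec w)) \<ge> \<delta> \<alpha>0" by blast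
      have ed: "cpol m e z = of_real M * cpol m d z" for z
        using \<open>M > 0\<close> by (simp add: cpol_def d_def sum_distrib_left)
      have "\<delta>0 / F * ptilde m b \<xi> \<le> cmod (cpol m b (cvec \<xi> + z *s cvec w))" if "cmod z = 1" for z
      proof -
        have "\<delta>0 / F * ptilde m b \<xi> \<le> \<delta>0 / F * (F * M)"
          using pt \<delta>0 \<open>F > 0\<close> by (intro mult_left_mono) auto
        also have "\<dots> = M * \<delta>0" using \<open>F > 0\<close> by simp
        also have "\<dots> \<le> M * cmod (cpol m d (z *s cvec w))"
          using \<delta>0(2)[OF \<alpha>0(1)] w(2)[OF that] \<open>M > 0\<close> by (intro mult_left_mono) auto
        finally show ?thesis using \<open>M > 0\<close> by (simp add: P ed norm_mult)
      qed
      thus ?thesis using w(1) \<alpha>0(1) by blast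
    qed
  qed
qed

text \<open>Among finitely many values a choice can be made by priority: a newly inserted value wins
  on its own measurable set, and the earlier choice is kept elsewhere.\<close>

lemma finite_measurable_selection:
  fixes A :: "'b::topological_space \<Rightarrow> 'a::topological_space set"
  assumes "finite W" "\<And>w. w \<in> W \<Longrightarrow> A w \<in> sets borel"
  shows "\<exists>f\<in>borel_measurable borel. \<forall>x. (\<exists>w\<in>W. x \<in> A w) \<longrightarrow> f x \<in> W \<and> x \<in> A (f x)"
  using assms
proof (induction W rule: finite_induct)
  case (insert w W)
  then obtain f where f: "f \<in> borel_measurable borel" "\<And>x. (\<exists>w\<in>W. x \<in> A w) \<longrightarrow> f x \<in> W \<and> x \<in> A (f x)"
    by auto
  have "(\<lambda>x. if x \<in> A w then w else f x) \<in> borel_measurable borel"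
    using insert.prems f(1) by (intro measurable_If_set) auto
  thus ?case by (rule rev_bexI) (use f(2) in auto)
qed (auto intro!: exI[of _ "\<lambda>_. undefined"])

lemma continuous_on_cpol: "continuous_on S f \<Longrightarrow> continuous_on S (\<lambda>x. cpol m b (f x))"
  unfolding cpol_def cmono_def by (intro continuous_intros)

lemma continuous_on_cvec: "continuous_on S (\<lambda>x. cvec x)"
  unfolding cvec_def by (intro continuous_intros)

lemma continuous_on_ptilde: "continuous_on S (ptilde m b)"
  unfolding ptilde_def[abs_def] by (intro continuous_intros smooth_continuous_on smooth_mpartial smooth_cpol)

text \<open>The order of the quantifiers matters: \<open>R\<close> and \<open>c\<close> precede the
  coefficients and therefore serve a whole net at once. The set of points at which a given direction
  is admissible is closed, being an intersection of closed sets over the circle, so the selection is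
  measurable.\<close>

lemma ex_shift:
  obtains R c :: real where "c > 0"
    "\<And>b. \<exists>w :: real ^ 'n::finite \<Rightarrow> real ^ 'n. w \<in> borel_measurable borel \<and> (\<forall>\<xi>. norm (w \<xi>) \<le> R) \<and>
      (\<forall>\<xi> z. cmod z = 1 \<longrightarrow> c * ptilde m b \<xi> \<le> cmod (cpol m b (cvec \<xi> + z *s cvec (w \<xi>))))"
proof -
  obtain W :: "(real ^ 'n) set" and c where W: "finite W" "c > 0"
    "\<And>b \<xi>. \<exists>w\<in>W. \<forall>z. cmod z = 1 \<longrightarrow> c * ptilde m b \<xi> \<le> cmod (cpol m b (cvec \<xi> + z *s cvec w))"
    using ex_finite_circles[of m] by blast
  obtain R where R: "\<And>w. w \<in> W \<Longrightarrow> norm w \<le> R"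
    using finite_imp_bounded[OF W(1)] by (auto simp: bounded_iff)
  have "\<exists>w :: real ^ 'n \<Rightarrow> real ^ 'n. w \<in> borel_measurable borel \<and> (\<forall>\<xi>. norm (w \<xi>) \<le> R) \<and>
      (\<forall>\<xi> z. cmod z = 1 \<longrightarrow> c * ptilde m b \<xi> \<le> cmod (cpol m b (cvec \<xi> + z *s cvec (w \<xi>))))" for b
  proof -
    define A where "A w = {\<xi>. \<forall>z. cmod z = 1 \<longrightarrow> c * ptilde m b \<xi> \<le> cmod (cpol m b (cvec \<xi> + z *s cvec w))}" for w
    have "closed (A w)" for w
    proof -
      have "A w = (\<Inter>z\<in>{z. cmod z = 1}. {\<xi>. c * ptilde m b \<xi> \<le> cmod (cpol m b (cvec \<xi> + z *s cvec w))})"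
        by (auto simp: A_def)
      also have "closed \<dots>"
        by (intro closed_INT ballI closed_Collect_le continuous_intros continuous_on_ptilde
             continuous_on_cpol continuous_on_cvec)
      finally show ?thesis .
    qed
    then obtain f where "f \<in> borel_measurable borel" "\<And>x. (\<exists>w\<in>W. x \<in> A w) \<longrightarrow> f x \<in> W \<and> x \<in> A (f x)"
      using finite_measurable_selection[OF W(1), of A] by auto
    moreover have "\<exists>w\<in>W. x \<in> A w" for x using W(3)[of b x] by (simp add: A_def)
    ultimately show ?thesis using R unfolding A_def by (intro exI[of _ f]) auto
  qed
  with W(2) show thesis using that by blast
qed

section \<open>Integration over Euclidean space\<close>

text \<open>Lebesgue measure is built on \<open>Basis\<close>, whereas coordinates are indexed by a
  type; the choice operator recovers the index from the basis vector.\<close>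

lemma prod_Basis_cart:
  "(\<Prod>b\<in>(Basis :: (real ^ 'n::finite) set). f (SOME i. b = axis i (1::real)) (g b)) = (\<Prod>i\<in>UNIV. f i (g (axis i 1)))"
proof -
  have B: "(Basis :: (real ^ 'n) set) = (\<lambda>i. axis i 1) ` UNIV"
    by (auto simp: Basis_vec_def)
  have inj: "inj (\<lambda>i. axis i (1::real) :: real ^ 'n)"
    by (auto simp: inj_on_def axis_eq_axis)
  have "(SOME j. axis i (1::real) = (axis j 1 :: real ^ 'n)) = i" for i
    by (rule some_equality) (auto simp: axis_eq_axis)
  thus ?thesis unfolding B by (subst prod.reindex[OF inj]) (simp add: o_def)
qed

text \<open>Lebesgue measure is the image of a product measure over the basis, where products of
  one-variable functions integrate factor by factor. This reduces integrability of power decay and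
  all Gaussian computations to dimension one.\<close>

lemma lborel_integral_prod_cart:
  fixes f :: "'n::finite \<Rightarrow> real \<Rightarrow> 'a::{real_normed_field,banach,second_countable_topology}"
  assumes "\<And>i. integrable lborel (f i)"
  shows "integrable lborel (\<lambda>x :: real ^ 'n. \<Prod>i\<in>UNIV. f i (x $ i))" (is ?int)
    and "(LINT x|lborel. (\<Prod>i\<in>UNIV. f i ((x :: real ^ 'n) $ i))) = (\<Prod>i\<in>UNIV. (LINT t|lborel. f i t))" (is ?eq)
proof -
  interpret product_sigma_finite "\<lambda>_ :: real ^ 'n. lborel :: real measure" ..
  define \<iota> where "\<iota> b = (SOME i. b = axis i (1::real))" for b :: "real ^ 'n"
  have [measurable]: "f i \<in> borel_measurable borel" for i
    using borel_measurable_integrable[OF assms[of i]] by simp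
  let ?T = "\<lambda>f :: real ^ 'n \<Rightarrow> real. \<Sum>b\<in>Basis. f b *\<^sub>R b :: real ^ 'n"
  have T[measurable]: "?T \<in> borel_measurable (\<Pi>\<^sub>M b\<in>Basis. lborel)" by measurable
  have F[measurable]: "(\<lambda>x :: real ^ 'n. \<Prod>i\<in>UNIV. f i (x $ i)) \<in> borel_measurable borel"
    by measurable
  have *: "(\<Prod>i\<in>UNIV. f i (?T y $ i)) = (\<Prod>b\<in>Basis. f (\<iota> b) (y b))" for y
  proof -
    have "?T y $ i = y (axis i 1)" for i
    proof -
      have "?T y \<bullet> axis i 1 = y (axis i 1)" by (rule inner_sum_left_Basis) (simp add: axis_in_Basis_iff)
      thus ?thesis by (simp add: inner_axis)
    qed
    thus ?thesis unfolding \<iota>_def by (subst prod_Basis_cart) simp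
  qed
  have "integrable (\<Pi>\<^sub>M b\<in>Basis. lborel) (\<lambda>y. \<Prod>b\<in>Basis. f (\<iota> b) (y b))"
    by (rule product_integrable_prod) (auto intro: assms)
  thus ?int unfolding lborel_eq[where 'a = "real ^ 'n"] by (subst integrable_distr_eq) (simp_all only: * T F measurable_lborel1)
  have "(LINT x|lborel. (\<Prod>i\<in>UNIV. f i ((x :: real ^ 'n) $ i))) = (LINT y|(\<Pi>\<^sub>M b\<in>Basis. lborel). (\<Prod>b\<in>Basis. f (\<iota> b) (y b)))"
    unfolding lborel_eq[where 'a = "real ^ 'n"] by (subst integral_distr) (simp_all only: * T F)
  also have "\<dots> = (\<Prod>b\<in>Basis. (LINT t|lborel. f (\<iota> b) t))"
    by (rule product_integral_prod) (auto intro: assms)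
  also have "\<dots> = (\<Prod>i\<in>UNIV. (LINT t|lborel. f i t))"
    unfolding \<iota>_def using prod_Basis_cart[of "\<lambda>i _. LINT t|lborel. f i t" "\<lambda>_. ()"] by simp
  finally show ?eq .
qed

lemma nn_integral_affine:
  fixes f :: "'a::euclidean_space \<Rightarrow> ennreal"
  assumes [measurable]: "f \<in> borel_measurable borel" and c: "c \<noteq> 0"
  shows "(\<integral>\<^sup>+x. f x \<partial>lborel) = ennreal (\<bar>c\<bar> ^ DIM('a)) * (\<integral>\<^sup>+x. f (t + c *\<^sub>R x) \<partial>lborel)"
  by (subst lborel_affine[OF c, of t])
     (simp add: nn_integral_density nn_integral_distr nn_integral_cmult)

lemma lborel_integrable_affine:
  fixes f :: "'b::euclidean_space \<Rightarrow> 'a :: {banach, second_countable_topology}"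
  assumes f: "integrable lborel f" and c: "c \<noteq> 0"
  shows "integrable lborel (\<lambda>x. f (t + c *\<^sub>R x))"
  using f f[THEN borel_measurable_integrable] c unfolding integrable_iff_bounded
  by (subst (asm) nn_integral_affine[where c=c and t=t]) (auto simp: ennreal_mult_less_top)

lemma lborel_integral_affine:
  fixes f :: "'b::euclidean_space \<Rightarrow> 'a :: {banach, second_countable_topology}"
  assumes f[measurable]: "f \<in> borel_measurable borel" and c: "c \<noteq> 0"
  shows "(LINT x|lborel. f x) = (\<bar>c\<bar> ^ DIM('b)) *\<^sub>R (LINT x|lborel. f (t + c *\<^sub>R x))"
  using c by (subst lborel_affine[OF c, of t]) (simp add: integral_density integral_distr)

section \<open>Kernels with power decay\<close>

definition decay :: "nat \<Rightarrow> 'a::real_normed_vector \<Rightarrow> real" where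
  "decay M x = 1 / (1 + norm x) ^ M"

lemma one_plus_norm_pos [simp]: "1 + norm x > 0" "1 + norm x \<noteq> 0" "1 + norm x \<ge> 0"
  using norm_ge_zero[of x] by linarith+

lemma decay_pos [simp]: "decay M x > 0"
  by (simp add: decay_def)

lemma decay_nonneg [simp]: "decay M x \<ge> 0"
  by (simp add: decay_def)

lemma decay_le_1: "decay M x \<le> 1"
  by (simp add: decay_def)

lemma decay_add_exponent: "decay (M + N) x = decay M x * decay N x"
  by (simp add: decay_def power_add)

lemma decay_antimono: "M \<le> N \<Longrightarrow> decay N x \<le> decay M x"
  using decay_add_exponent[of M "N - M" x] mult_left_le[OF decay_le_1[of "N - M" x], of "decay M x"] by simp

lemma decay_minus [simp]: "decay M (- x) = decay M x"
  and decay_minus_commute: "decay M (x - y) = decay M (y - x)"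
  by (simp_all add: decay_def norm_minus_commute)

lemma one_plus_norm_add_le: "1 + norm (x + y) \<le> (1 + norm x) * (1 + norm y)"
proof -
  have "(1 + norm x) * (1 + norm y) = 1 + norm x + norm y + norm x * norm y" by (simp add: algebra_simps)
  moreover have "norm x * norm y \<ge> 0" by simp
  ultimately show ?thesis using norm_triangle_ineq[of x y] by linarith
qed

text \<open>An inequality of Peetre type. Decay in two successive differences thereby becomes decay
  in their sum, which is how kernels are composed later.\<close>

lemma decay_mult_le: "decay M x * decay M y \<le> decay M (x + y)"
proof -
  have "1 + norm (x + y) \<le> (1 + norm x) * (1 + norm y)"
    by (rule one_plus_norm_add_le)
  hence "(1 + norm (x + y)) ^ M \<le> ((1 + norm x) * (1 + norm y)) ^ M" by (intro power_mono) auto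
  thus ?thesis unfolding decay_def by (simp add: power_mult_distrib[symmetric] frac_le)
qed

text \<open>The bookkeeping rule of all later estimates: each growth factor is paid for with part of
  the exponent.\<close>

lemma decay_mult_power: "(1 + norm x) ^ k * decay (M + k) x = decay M x"
  by (simp add: decay_def power_add)

lemma decay_measurable [measurable]: "decay M \<in> borel_measurable borel"
  unfolding decay_def[abs_def] by measurable

lemma integrable_decay_1_plus_square: "integrable lborel (\<lambda>t::real. inverse (1 + t\<^sup>2))"
proof -
  have "integrable lborel (\<lambda>t::real. indicator (einterval (-\<infinity>) \<infinity>) t *\<^sub>R inverse (1 + t\<^sup>2))"
    using integrable_inverse_1_plus_square by (simp add: set_integrable_def)
  thus ?thesis by simp
qed

text \<open>The exponent 2n provides one factor (1 + |x|)^(-2) per coordinate, each dominated by the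
  integrable function 1 / (1 + t^2) of that coordinate.\<close>

lemma integrable_decay:
  assumes "M \<ge> 2 * CARD('n)"
  shows "integrable lborel (decay M :: real ^ 'n::finite \<Rightarrow> real)"
proof (rule Bochner_Integration.integrable_bound)
  show "integrable lborel (\<lambda>x :: real ^ 'n. \<Prod>i\<in>UNIV. inverse (1 + (x $ i)\<^sup>2))"
    by (rule lborel_integral_prod_cart) (rule integrable_decay_1_plus_square)
  show "AE x in lborel. norm (decay M x) \<le> norm (\<Prod>i\<in>UNIV. inverse (1 + ((x :: real ^ 'n) $ i)\<^sup>2))"
  proof (rule AE_I2)
    fix x :: "real ^ 'n"
    have "decay M x \<le> decay (2 * CARD('n)) x" by (rule decay_antimono[OF assms])
    also have "\<dots> = (\<Prod>i\<in>(UNIV :: 'n set). inverse ((1 + norm x)\<^sup>2))"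
      by (simp add: decay_def power_mult power_inverse divide_inverse)
    also have "\<dots> \<le> (\<Prod>i\<in>UNIV. inverse (1 + (x $ i)\<^sup>2))"
    proof (intro prod_mono conjI le_imp_inverse_le)
      fix i
      have "(x $ i)\<^sup>2 \<le> (norm x)\<^sup>2" using power_mono[OF component_le_norm_cart[of x i], of 2] by simp
      thus "1 + (x $ i)\<^sup>2 \<le> (1 + norm x)\<^sup>2"
        using norm_ge_zero[of x] unfolding power2_sum one_power2 by linarith
    qed (auto simp: add_pos_nonneg)
    finally show "norm (decay M x) \<le> norm (\<Prod>i\<in>UNIV. inverse (1 + (x $ i)\<^sup>2))" by simp
  qed
qed simp

lemma integrable_decay_shift:
  assumes "M \<ge> 2 * CARD('n)"
  shows "integrable lborel (\<lambda>x. decay M (x - y) :: real)" "integrable lborel (\<lambda>x. decay M (y - x :: real ^ 'n::finite) :: real)"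
    and "(LINT x|lborel. decay M (x - y)) = (LINT x|lborel. decay M (x :: real ^ 'n))"
    and "(LINT x|lborel. decay M (y - x)) = (LINT x|lborel. decay M (x :: real ^ 'n))"
proof -
  show 1: "integrable lborel (\<lambda>x. decay M (x - y) :: real)"
    using lborel_integrable_affine[OF integrable_decay[OF assms], of 1 "- y"] by simp
  thus "integrable lborel (\<lambda>x. decay M (y - x) :: real)" by (simp add: decay_minus_commute)
  show 2: "(LINT x|lborel. decay M (x - y)) = (LINT x|lborel. decay M (x :: real ^ 'n))"
    using lborel_integral_affine[of "decay M" 1 "- y"] by simp
  thus "(LINT x|lborel. decay M (y - x)) = (LINT x|lborel. decay M (x :: real ^ 'n))"
    by (simp add: decay_minus_commute)
qed

lemma integrable_compact_support:
  fixes f :: "'b::euclidean_space \<Rightarrow> 'a :: {banach, second_countable_topology}"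
  assumes "continuous_on UNIV f" "compact K" "\<And>x. x \<notin> K \<Longrightarrow> f x = 0"
  shows "integrable lborel f"
proof -
  have "integrable lborel (\<lambda>x. indicator K x *\<^sub>R f x)"
    using assms by (intro borel_integrable_compact) (auto intro: continuous_on_subset)
  moreover have "(\<lambda>x. indicator K x *\<^sub>R f x) = f" using assms(3) by (auto simp: fun_eq_iff indicator_def)
  ultimately show ?thesis by simp
qed

section \<open>Test functions and integration by parts\<close>

lemma smooth_supported_partial_deriv:
  assumes "f \<in> smooth_supported K" "closed K"
  shows "partial_deriv i f \<in> smooth_supported K"
proof -
  have "partial_deriv i f x = 0" if "x \<notin> K" for x
  proof (rule partial_deriv_eqI[THEN trans])
    show "(f has_derivative (\<lambda>h. 0)) (at x)"
    proof (rule has_derivative_transform_within_open[where f = "\<lambda>x. 0" and s = "- K"])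
      show "0 = f y" if "y \<in> - K" for y using that assms(1) by (simp add: smooth_supported_def)
    qed (use that assms in auto)
  qed simp
  thus ?thesis using assms(1) by (simp add: smooth_supported_def smooth_partial_deriv)
qed

lemma smooth_supported_foldr:
  "f \<in> smooth_supported K \<Longrightarrow> closed K \<Longrightarrow> foldr partial_deriv is f \<in> smooth_supported K"
  by (induction "is") (auto intro: smooth_supported_partial_deriv)

lemma smooth_supported_mpartial:
  "f \<in> smooth_supported K \<Longrightarrow> closed K \<Longrightarrow> mpartial \<alpha> f \<in> smooth_supported K"
  unfolding mpartial_def by (rule smooth_supported_foldr)

lemma smooth_supported_smooth: "f \<in> smooth_supported K \<Longrightarrow> smooth f"
  by (simp add: smooth_supported_def)

lemma integrable_smooth_supported:
  "f \<in> smooth_supported K \<Longrightarrow> compact K \<Longrightarrow> integrable lborel f"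
  by (rule integrable_compact_support) (auto simp: smooth_supported_def smooth_continuous_on)

lemma smooth_supported_bounded:
  assumes "f \<in> smooth_supported K" "compact K"
  obtains B where "B \<ge> 0" "\<And>x. cmod (f x) \<le> B"
proof -
  have "compact (f ` K)"
    using assms by (intro compact_continuous_image smooth_continuous_on) (auto simp: smooth_supported_def)
  then obtain B where B: "\<And>y. y \<in> f ` K \<Longrightarrow> cmod y \<le> B" using compact_imp_bounded bounded_iff by metis
  have "cmod (f x) \<le> max B 0" for x
    using B[of "f x"] assms(1) by (cases "x \<in> K") (auto simp: smooth_supported_def)
  thus thesis by (intro that[of "max B 0"]) auto
qed

lemma has_vector_derivative_along_axis:
  fixes f :: "real ^ 'n::finite \<Rightarrow> complex"
  assumes "f differentiable (at (x + t *\<^sub>R axis i 1))"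
  shows "((\<lambda>t. f (x + t *\<^sub>R axis i 1)) has_vector_derivative partial_deriv i f (x + t *\<^sub>R axis i 1)) (at t)"
proof -
  have "((\<lambda>t. x + t *\<^sub>R axis i 1) has_vector_derivative axis i 1) (at t)"
    by (auto intro!: derivative_eq_intros simp: has_vector_derivative_def)
  moreover have "(f has_derivative frechet_derivative f (at (x + t *\<^sub>R axis i 1))) (at (x + t *\<^sub>R axis i 1))"
    using assms(1) by (simp add: frechet_derivative_works[symmetric])
  ultimately show ?thesis
    using vector_derivative_diff_chain_within[of "\<lambda>t. x + t *\<^sub>R axis i 1" "axis i 1" t UNIV f]
    by (simp add: o_def has_derivative_at_withinI partial_deriv_def)
qed

lemma difference_bound_along_axis:
  fixes f :: "real ^ 'n::finite \<Rightarrow> complex"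
  assumes "\<And>x. f differentiable (at x)" "\<And>x. cmod (partial_deriv i f x) \<le> B"
  shows "cmod (f (x + h *\<^sub>R axis i 1) - f x) \<le> B * \<bar>h\<bar>"
proof -
  let ?g = "\<lambda>t. f (x + t *\<^sub>R axis i 1)"
  have "norm (?g h - ?g 0) \<le> B * norm (h - 0)"
  proof (rule differentiable_bound[where S = UNIV and f' = "\<lambda>t s. s *\<^sub>R partial_deriv i f (x + t *\<^sub>R axis i 1)"])
    show "(?g has_derivative (\<lambda>s. s *\<^sub>R partial_deriv i f (x + t *\<^sub>R axis i 1))) (at t within UNIV)" for t
      using has_vector_derivative_along_axis[where x = x and t = t and i = i, OF assms(1)] by (simp add: has_vector_derivative_def)
    show "onorm (\<lambda>s. s *\<^sub>R partial_deriv i f (x + t *\<^sub>R axis i 1)) \<le> B" for t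
      using assms(2) by (intro onorm_le) (subst mult.commute, simp add: mult_left_mono)
  qed auto
  thus ?thesis by simp
qed

text \<open>Difference quotients integrate to zero by translation invariance, and dominated
  convergence passes to the derivative. Applied to products, this is integration by parts.\<close>

lemma integral_partial_deriv_eq_0:
  assumes f: "f \<in> smooth_supported (K :: (real ^ 'n::finite) set)" and K: "compact K"
  shows "(LINT x|lborel. partial_deriv i f x) = 0"
proof -
  let ?e = "axis i 1 :: real ^ 'n"
  define h where "h k = inverse (real (Suc k))" for k
  have h: "h k > 0" "h k \<le> 1" for k by (auto simp: h_def inverse_le_1_iff)
  have hlim: "h \<longlonglongrightarrow> 0" unfolding h_def using LIMSEQ_inverse_real_of_nat by simp
  define F where "F k x = (f (x + h k *\<^sub>R ?e) - f x) / of_real (h k)" for k x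
  have d: "f differentiable (at x)" for x using f by (simp add: smooth_supported_def smooth_differentiable)
  have fK: "f x = 0" if "x \<notin> K" for x using that f by (simp add: smooth_supported_def)
  obtain B where B: "B \<ge> 0" "\<And>x. cmod (partial_deriv i f x) \<le> B"
    using smooth_supported_bounded[OF smooth_supported_partial_deriv[OF f] K] compact_imp_closed[OF K] by blast
  \<comment> \<open>\<open>K\<close> swept backwards along the coordinate axis by steps in [0,1].
    This compact set contains the supports of all difference quotients used, so a constant bound on
    it is an integrable majorant.\<close>
  define K' where "K' = (\<lambda>(x, t). x - t *\<^sub>R ?e) ` (K \<times> {0..1})"
  have "compact K'" unfolding K'_def
    by (intro compact_continuous_image compact_Times K compact_Icc)
       (auto simp: case_prod_beta intro!: continuous_intros)
  have int_f: "integrable lborel f" using integrable_smooth_supported[OF f K] .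
  have m[measurable]: "f \<in> borel_measurable borel" using f by (auto simp: smooth_supported_def smooth_measurable)
  have shift: "integrable lborel (\<lambda>x. f (x + c))" "(LINT x|lborel. f (x + c)) = (LINT x|lborel. f x)" for c
    using lborel_integrable_affine[OF int_f, of 1 c] lborel_integral_affine[OF m, of 1 c] by (simp_all add: add.commute)
  have "(\<lambda>k. LINT x|lborel. F k x) \<longlonglongrightarrow> (LINT x|lborel. partial_deriv i f x)"
  proof (rule integral_dominated_convergence[where w = "\<lambda>x. indicator K' x *\<^sub>R B"])
    show "integrable lborel (\<lambda>x. indicator K' x *\<^sub>R B)"
      by (intro borel_integrable_compact \<open>compact K'\<close> continuous_intros)
    show "partial_deriv i f \<in> borel_measurable lborel"
      using f by (auto simp: smooth_supported_def intro!: smooth_measurable smooth_partial_deriv)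
    show "F k \<in> borel_measurable lborel" for k unfolding F_def[abs_def] by measurable
    show "AE x in lborel. (\<lambda>k. F k x) \<longlonglongrightarrow> partial_deriv i f x"
    proof (rule AE_I2)
      fix x
      have "((\<lambda>t. f (x + t *\<^sub>R ?e)) has_vector_derivative partial_deriv i f (x + 0 *\<^sub>R ?e)) (at 0)"
        by (rule has_vector_derivative_along_axis[OF d])
      hence 1: "((\<lambda>t. norm (f (x + t *\<^sub>R ?e) - f x - t *\<^sub>R partial_deriv i f x) / norm t) \<longlongrightarrow> 0) (at 0)"
        by (simp add: has_vector_derivative_def has_derivative_at)
      have 2: "norm (f (x + t *\<^sub>R ?e) - f x - t *\<^sub>R partial_deriv i f x) / norm t =
          norm ((f (x + t *\<^sub>R ?e) - f x) /\<^sub>R t - partial_deriv i f x)" if "t \<noteq> 0" for t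
      proof -
        have "(f (x + t *\<^sub>R ?e) - f x) /\<^sub>R t - partial_deriv i f x =
            (f (x + t *\<^sub>R ?e) - f x - t *\<^sub>R partial_deriv i f x) /\<^sub>R t"
          using that by (simp add: scaleR_diff_right)
        thus ?thesis by (simp add: divide_inverse mult.commute)
      qed
      have "((\<lambda>t. norm ((f (x + t *\<^sub>R ?e) - f x) /\<^sub>R t - partial_deriv i f x)) \<longlongrightarrow> 0) (at 0)"
        by (rule Lim_transform_eventually[OF 1]) (unfold eventually_at_filter, rule always_eventually, intro allI impI 2)
      hence "((\<lambda>t. (f (x + t *\<^sub>R ?e) - f x) /\<^sub>R t) \<longlongrightarrow> partial_deriv i f x) (at 0)"
        using Lim_null tendsto_norm_zero_iff by blast
      moreover have "filterlim h (at 0) sequentially"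
        using hlim h(1) by (auto simp: filterlim_at less_imp_neq[symmetric] intro!: eventuallyI)
      ultimately have "(\<lambda>k. (f (x + h k *\<^sub>R ?e) - f x) /\<^sub>R h k) \<longlonglongrightarrow> partial_deriv i f x"
        by (rule filterlim_compose)
      thus "(\<lambda>k. F k x) \<longlonglongrightarrow> partial_deriv i f x"
        by (simp add: F_def scaleR_conv_of_real divide_inverse mult.commute)
    qed
    show "AE x in lborel. norm (F k x) \<le> indicator K' x *\<^sub>R B" for k
    proof (rule AE_I2)
      fix x
      show "norm (F k x) \<le> indicator K' x *\<^sub>R B"
      proof (cases "x \<in> K'")
        case True
        have "cmod (f (x + h k *\<^sub>R ?e) - f x) \<le> B * h k"
          using difference_bound_along_axis[of f i B x "h k"] d B h(1)[of k] by simp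
        thus ?thesis using True h(1)[of k] by (simp add: F_def norm_divide divide_le_eq)
      next
        case False
        have "x \<notin> K" using False unfolding K'_def by (force intro!: image_eqI[of _ _ "(x, 0)"])
        moreover have "x + h k *\<^sub>R ?e \<notin> K"
        proof
          assume "x + h k *\<^sub>R ?e \<in> K"
          hence "x \<in> K'" unfolding K'_def using h[of k]
            by (intro image_eqI[of _ _ "(x + h k *\<^sub>R ?e, h k)"]) (auto intro: less_imp_le)
          with False show False ..
        qed
        ultimately show ?thesis using False by (simp add: F_def fK)
      qed
    qed
  qed
  moreover have "(LINT x|lborel. F k x) = 0" for k
    unfolding F_def using shift[of "h k *\<^sub>R ?e"] int_f
    by (simp add: Bochner_Integration.integral_diff)
  ultimately show ?thesis by (simp add: LIMSEQ_const_iff)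
qed

section \<open>Fourier--Laplace transform\<close>

text \<open>Valid for arbitrary \<open>f\<close> because the integral of a non-integrable function
  is 0 by convention; kernel estimates can then be applied without measurability side
  conditions.\<close>

lemma norm_integral_le:
  fixes f :: "'a \<Rightarrow> 'b::{banach,second_countable_topology}"
  assumes g: "integrable M g" and le: "\<And>x. norm (f x) \<le> g x"
  shows "norm (integral\<^sup>L M f) \<le> integral\<^sup>L M g"
proof (cases "integrable M f")
  case True
  have "norm (integral\<^sup>L M f) \<le> (LINT x|M. norm (f x))" by (rule integral_norm_bound)
  also have "\<dots> \<le> integral\<^sup>L M g" using True g le by (intro integral_mono) auto
  finally show ?thesis .
next
  case False
  moreover have "integral\<^sup>L M g \<ge> 0"
    by (rule Bochner_Integration.integral_nonneg) (use le norm_ge_zero order_trans in blast)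
  ultimately show ?thesis by (simp add: not_integrable_integral_eq)
qed

text \<open>Bilinear, without conjugation, so that the exponentials built from it are entire in the
  frequency.\<close>

definition cdot :: "real ^ 'n \<Rightarrow> complex ^ 'n::finite \<Rightarrow> complex" where
  "cdot x z = (\<Sum>i\<in>UNIV. of_real (x $ i) * z $ i)"

definition cexp :: "real ^ 'n \<Rightarrow> complex ^ 'n::finite \<Rightarrow> complex" where
  "cexp x z = exp (\<i> * cdot x z)"

text \<open>The sign of the exponent makes the transposed operator \<open>\<^sup>tP(D)\<close> act as multiplication by \<open>P\<close>.\<close>

definition laplace :: "(real ^ 'n::finite \<Rightarrow> complex) \<Rightarrow> complex ^ 'n \<Rightarrow> complex" where
  "laplace f z = (LINT x|lborel. cexp x z * f x)"

lemma cdot_cvec: "cdot x (cvec \<xi>) = of_real (x \<bullet> \<xi>)"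
  by (simp add: cdot_def inner_vec_def)

lemma cdot_simps:
  "cdot x (z + z') = cdot x z + cdot x z'" "cdot x (z - z') = cdot x z - cdot x z'" "cdot x (- z) = - cdot x z"
  "cdot (x + y) z = cdot x z + cdot y z" "cdot (x - y) z = cdot x z - cdot y z" "cdot (- x) z = - cdot x z"
  "cdot x (c *s z) = c * cdot x z" "cdot (r *\<^sub>R x) z = of_real r * cdot x z" "cdot 0 z = 0" "cdot x 0 = 0"
  by (simp_all add: cdot_def sum.distrib sum_subtractf sum_negf algebra_simps sum_distrib_left)

lemma cexp_add: "cexp x (z + z') = cexp x z * cexp x z'"
  and cexp_add_left: "cexp (x + y) z = cexp x z * cexp y z"
  and cexp_nz [simp]: "cexp x z \<noteq> 0"
  and cexp_minus: "cexp (- x) z = cexp x (- z)"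
  by (simp_all add: cexp_def cdot_simps distrib_left exp_add)

lemma fourier_eq_laplace: "fourier f \<xi> = laplace f (- cvec \<xi>)"
  by (simp add: fourier_def laplace_def cexp_def cdot_simps cdot_cvec)

lemma norm_cexp_cvec [simp]: "cmod (cexp x (cvec \<xi>)) = 1" "cmod (cexp x (- cvec \<xi>)) = 1"
  by (simp_all add: cexp_def cdot_simps cdot_cvec)

lemma abs_Im_cdot_le:
  assumes "\<And>i. \<bar>Im (z $ i)\<bar> \<le> R"
  shows "\<bar>Im (cdot x z)\<bar> \<le> real CARD('n) * R * norm (x :: real ^ 'n::finite)"
proof -
  have "\<bar>Im (cdot x z)\<bar> \<le> (\<Sum>i\<in>UNIV. \<bar>x $ i * Im (z $ i)\<bar>)"
    unfolding cdot_def by simp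
  also have "\<dots> \<le> (\<Sum>i\<in>(UNIV :: 'n set). norm x * R)"
    unfolding abs_mult by (intro sum_mono mult_mono component_le_norm_cart assms) auto
  finally show ?thesis by (simp add: mult_ac)
qed

lemma norm_cexp_le:
  assumes "\<And>i. \<bar>Im (z $ i)\<bar> \<le> R"
  shows "cmod (cexp x z) \<le> exp (real CARD('n) * R * norm (x :: real ^ 'n::finite))"
  using abs_Im_cdot_le[of z R x, OF assms] by (simp add: cexp_def)

lemma norm_cdot_le: "cmod (cdot x z) \<le> real CARD('n) * (norm x * norm (z :: complex ^ 'n::finite))"
proof -
  have "cmod (cdot x z) \<le> (\<Sum>i\<in>(UNIV :: 'n set). norm x * norm z)"
    unfolding cdot_def by (intro sum_norm_le) (auto simp: norm_mult intro!: mult_mono component_le_norm_cart Finite_Cartesian_Product.norm_nth_le)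
  thus ?thesis by simp
qed

lemma cmod_cmono_le: "cmod (cmono \<beta> z) \<le> norm z ^ mi_order \<beta>"
proof -
  have "cmod (cmono \<beta> z) = (\<Prod>i\<in>UNIV. cmod (z $ i) ^ \<beta> i)"
    by (simp add: cmono_def prod_norm[symmetric] norm_power)
  also have "\<dots> \<le> (\<Prod>i\<in>UNIV. norm z ^ \<beta> i)"
    by (intro prod_mono conjI power_mono Finite_Cartesian_Product.norm_nth_le) auto
  finally show ?thesis by (simp add: power_sum mi_order_def)
qed

lemma has_derivative_cexp:
  "((\<lambda>x. cexp x z) has_derivative (\<lambda>h. \<i> * cdot h z * cexp x z)) (at x)"
proof -
  have "((\<lambda>x. cdot x z) has_derivative (\<lambda>h. cdot h z)) (at x)"
    unfolding cdot_def
    by (intro has_derivative_sum has_derivative_mult_left has_derivative_of_real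
        bounded_linear_imp_has_derivative bounded_linear_vec_nth)
  hence "((\<lambda>x. \<i> * cdot x z) has_derivative (\<lambda>h. \<i> * cdot h z)) (at x)"
    by (rule has_derivative_mult_right)
  from has_derivative_compose[OF this DERIV_exp[THEN has_field_derivative_imp_has_derivative]] show ?thesis by (simp add: cexp_def mult_ac)
qed

lemma cdot_axis [simp]: "cdot (axis i 1) z = z $ i"
proof -
  have "cdot (axis i 1) z = (\<Sum>j\<in>UNIV. if j = i then z $ i else 0)"
    unfolding cdot_def by (intro sum.cong) (auto simp: axis_def)
  thus ?thesis by simp
qed

lemma partial_deriv_cexp: "partial_deriv i (\<lambda>x. cexp x z) = (\<lambda>x. \<i> * z $ i * cexp x z)"
  by (rule ext, subst partial_deriv_eqI[OF has_derivative_cexp]) simp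

lemma smooth_cexp: "smooth (\<lambda>x. cexp x z)"
proof (rule smooth_coinduct)
  have d: "(\<lambda>x. cexp x z) differentiable (at x)" for x
    using has_derivative_cexp by (rule differentiableI)
  show "(\<lambda>x. cexp x z) \<in> {\<lambda>x. c * cexp x z | c. True}"
    by (intro CollectI exI[of _ 1]) simp
  show "g differentiable (at x)" if "g \<in> {\<lambda>x. c * cexp x z | c. True}" for g x
    using that d by (auto intro!: differentiable_mult)
  show "partial_deriv i g \<in> {\<lambda>x. c * cexp x z | c. True}" if "g \<in> {\<lambda>x. c * cexp x z | c. True}" for g i
    using that d by (auto simp: partial_deriv_cmult partial_deriv_cexp mult.assoc[symmetric])
qed

lemma measurable_cart_nth [measurable]: "(\<lambda>v :: complex ^ 'n::finite. v $ i) \<in> borel_measurable borel"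
  "(\<lambda>v :: real ^ 'n::finite. v $ i) \<in> borel_measurable borel"
  by (intro borel_measurable_continuous_onI continuous_intros)+

lemma measurable_cdot [measurable]:
  assumes [measurable]: "f \<in> borel_measurable M" "g \<in> borel_measurable M"
  shows "(\<lambda>s. cdot (f s) (g s)) \<in> borel_measurable M"
  unfolding cdot_def by measurable

lemma measurable_cexp [measurable]:
  assumes [measurable]: "f \<in> borel_measurable M" "g \<in> borel_measurable M"
  shows "(\<lambda>s. cexp (f s) (g s)) \<in> borel_measurable M"
  unfolding cexp_def by measurable

lemma measurable_cvec [measurable]: "cvec \<in> borel_measurable borel"
  by (intro borel_measurable_continuous_onI continuous_on_cvec)

lemma measurable_laplace [measurable]:
  assumes [measurable]: "f \<in> borel_measurable borel"
  shows "laplace f \<in> borel_measurable borel"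
proof -
  have "(\<lambda>z. LINT x|lborel. cexp x z * f x) \<in> borel_measurable borel"
    by (rule lborel.borel_measurable_lebesgue_integral) measurable
  thus ?thesis by (simp add: laplace_def[abs_def])
qed

lemma smooth_supported_mult:
  assumes "smooth f" "g \<in> smooth_supported K"
  shows "(\<lambda>x. f x * g x) \<in> smooth_supported K"
  using assms by (auto simp: smooth_supported_def intro: smooth_mult)

lemma integrable_laplace:
  "f \<in> smooth_supported K \<Longrightarrow> compact K \<Longrightarrow> integrable lborel (\<lambda>x. cexp x z * f x)"
  by (rule integrable_smooth_supported[OF smooth_supported_mult]) (auto intro: smooth_cexp)

text \<open>Integration by parts: the derivative of \<open>cexp x z * f x\<close> has integral
  zero.\<close>

lemma laplace_partial_deriv:
  assumes f: "f \<in> smooth_supported K" and K: "compact K"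
  shows "laplace (partial_deriv i f) z = - \<i> * z $ i * laplace f z"
proof -
  have sf: "smooth f" using f by (rule smooth_supported_smooth)
  have f': "partial_deriv i f \<in> smooth_supported K"
    using f K by (intro smooth_supported_partial_deriv compact_imp_closed)
  have "0 = (LINT x|lborel. partial_deriv i (\<lambda>x. cexp x z * f x) x)"
    by (rule integral_partial_deriv_eq_0[OF _ K, symmetric]) (intro smooth_supported_mult smooth_cexp f)
  also have "partial_deriv i (\<lambda>x. cexp x z * f x) = (\<lambda>x. \<i> * z $ i * (cexp x z * f x) + cexp x z * partial_deriv i f x)"
    by (subst partial_deriv_mult) (auto intro: smooth_differentiable smooth_cexp sf simp: partial_deriv_cexp mult_ac)
  also have "(LINT x|lborel. \<i> * z $ i * (cexp x z * f x) + cexp x z * partial_deriv i f x) =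
      \<i> * z $ i * laplace f z + laplace (partial_deriv i f) z"
    unfolding laplace_def using integrable_laplace[OF f K] integrable_laplace[OF f' K]
    by (subst Bochner_Integration.integral_add) auto
  finally show ?thesis by (simp add: eq_neg_iff_add_eq_0 add.commute)
qed

lemma mi_order_count_list: "mi_order (count_list is) = length is"
  unfolding mi_order_def using sum_count_set[of "is" UNIV] by simp

lemma cmono_count_list_Cons: "cmono (count_list (j # js)) z = z $ j * cmono (count_list js) z"
proof -
  have "cmono (count_list (j # js)) z = (\<Prod>i\<in>UNIV. (if i = j then z $ j else 1) * z $ i ^ count_list js i)"
    unfolding cmono_def by (intro prod.cong) auto
  also have "\<dots> = z $ j * cmono (count_list js) z" by (simp add: prod.distrib cmono_def)
  finally show ?thesis .
qed

lemma laplace_mpartial: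
  assumes f: "f \<in> smooth_supported K" and K: "compact K"
  shows "laplace (mpartial \<alpha> f) z = (- \<i>) ^ mi_order \<alpha> * cmono \<alpha> z * laplace f z"
proof -
  obtain "is" where "is": "count_list is = \<alpha>" using ex_list_of_multiindex[of \<alpha>] by blast
  have "laplace (foldr partial_deriv is f) z = (- \<i>) ^ length is * cmono (count_list is) z * laplace f z"
  proof (induction "is")
    case Nil show ?case by (simp add: cmono_def)
  next
    case (Cons j js)
    have "laplace (foldr partial_deriv (j # js) f) z = - \<i> * z $ j * laplace (foldr partial_deriv js f) z"
      using smooth_supported_foldr[OF f compact_imp_closed[OF K]] by (simp add: laplace_partial_deriv[OF _ K])
    thus ?case by (simp only: Cons cmono_count_list_Cons) simp
  qed
  thus ?thesis
    using foldr_partial_deriv[OF smooth_supported_smooth[OF f], of "is"] "is" mi_order_count_list[of "is"] by simp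
qed

section \<open>Estimates of Paley-Wiener type\<close>

lemma norm_laplace_le:
  assumes K: "compact (K :: (real ^ 'n::finite) set)"
  obtains C where "C \<ge> 0" "\<And>f B (z :: complex ^ 'n). f \<in> smooth_supported K \<Longrightarrow> (\<And>x. cmod (f x) \<le> B) \<Longrightarrow> (\<And>i. \<bar>Im (z $ i)\<bar> \<le> R) \<Longrightarrow>
     cmod (laplace f z) \<le> C * B"
proof -
  obtain r where r: "\<And>x. x \<in> K \<Longrightarrow> norm x \<le> r" using compact_imp_bounded[OF K] bounded_iff by metis
  define E where "E = exp (real CARD('n) * \<bar>R\<bar> * r)"
  show thesis
  proof (rule that[of "E * measure lborel K"])
    show "E * measure lborel K \<ge> 0" by (simp add: E_def)
    fix f :: "real ^ 'n \<Rightarrow> complex" and B and z :: "complex ^ 'n"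
    assume f: "f \<in> smooth_supported K" and B: "\<And>x. cmod (f x) \<le> B" and R: "\<And>i. \<bar>Im (z $ i)\<bar> \<le> R"
    have B0: "B \<ge> 0" using B[of 0] norm_ge_zero order_trans by blast
    have R0: "R \<ge> 0" using R[of undefined] abs_ge_zero order_trans by blast
    have "cmod (laplace f z) \<le> (LINT x|lborel. indicator K x *\<^sub>R (E * B))"
      unfolding laplace_def
    proof (rule norm_integral_le)
      show "integrable lborel (\<lambda>x. indicator K x *\<^sub>R (E * B))"
        by (intro borel_integrable_compact K continuous_intros)
      fix x
      show "norm (cexp x z * f x) \<le> indicator K x *\<^sub>R (E * B)"
      proof (cases "x \<in> K")
        case True
        have "cmod (cexp x z) \<le> exp (real CARD('n) * R * norm x)" by (rule norm_cexp_le[OF R])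
        also have "\<dots> \<le> E" unfolding E_def exp_le_cancel_iff using r[OF True]
          using R0 by (intro mult_mono) auto
        finally show ?thesis using True B[of x] B0 by (auto simp: norm_mult intro!: mult_mono order_trans[OF norm_ge_zero])
      qed (use f in \<open>simp add: smooth_supported_def\<close>)
    qed
    also have "\<dots> = E * measure lborel K * B"
      using compact_imp_closed[OF K] emeasure_compact_finite[OF K] by (simp add: mult_ac)
    finally show "cmod (laplace f z) \<le> E * measure lborel K * B" .
  qed
qed

text \<open>The factor (1 + |\<xi>|)^M is controlled by 1 + |z_j|^M for the largest coordinate z_j,
  and multiplication by a power of z_j amounts to differentiating \<open>f\<close>. One constant
  serves all \<open>f\<close> supported in \<open>K\<close>, which later gives continuity in
  seminorms and not just finiteness.\<close>

lemma laplace_decay: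
  assumes K: "compact (K :: (real ^ 'n::finite) set)" and R: "R \<ge> 0"
  obtains C where "C \<ge> 0" "\<And>f B (z :: complex ^ 'n) \<xi>. f \<in> smooth_supported K \<Longrightarrow>
     (\<And>\<alpha> x. mi_order \<alpha> \<le> M \<Longrightarrow> cmod (mpartial \<alpha> f x) \<le> B) \<Longrightarrow> norm (z - cvec \<xi>) \<le> R \<Longrightarrow>
     cmod (laplace f z) \<le> C * B * decay M \<xi>"
proof -
  obtain C0 where C0: "C0 \<ge> 0" "\<And>f B (z :: complex ^ 'n). f \<in> smooth_supported K \<Longrightarrow> (\<And>x. cmod (f x) \<le> B) \<Longrightarrow> (\<And>i. \<bar>Im (z $ i)\<bar> \<le> R) \<Longrightarrow>
     cmod (laplace f z) \<le> C0 * B" using norm_laplace_le[OF K] by blast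
  let ?n = "real CARD('n)"
  define A where "A = 1 + ?n * R + ?n"
  have A: "A \<ge> 1" using R by (simp add: A_def)
  show thesis
  proof (rule that[of "A ^ M * (2 * C0)"])
    show "A ^ M * (2 * C0) \<ge> 0" using A C0 by simp
    fix f :: "real ^ 'n \<Rightarrow> complex" and B and z :: "complex ^ 'n" and \<xi>
    assume f: "f \<in> smooth_supported K" and B: "\<And>\<alpha> x. mi_order \<alpha> \<le> M \<Longrightarrow> cmod (mpartial \<alpha> f x) \<le> B"
      and z: "norm (z - cvec \<xi>) \<le> R"
    have zi: "cmod (z $ i - of_real (\<xi> $ i)) \<le> R" for i
      using Finite_Cartesian_Product.norm_nth_le[of "z - cvec \<xi>" i] z by simp
    have Im: "\<bar>Im (z $ i)\<bar> \<le> R" for i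
      using abs_Im_le_cmod[of "z $ i - of_real (\<xi> $ i)"] zi[of i] by simp
    have L: "cmod (cmono \<alpha> z) * cmod (laplace f z) \<le> C0 * B" if "mi_order \<alpha> \<le> M" for \<alpha>
    proof -
      have "cmod (laplace (mpartial \<alpha> f) z) \<le> C0 * B"
        using B that f K by (intro C0 Im smooth_supported_mpartial compact_imp_closed) auto
      thus ?thesis by (simp add: laplace_mpartial[OF f K] norm_mult norm_power)
    qed
    have "finite (range (\<lambda>i. cmod (z $ i)))" "range (\<lambda>i. cmod (z $ i)) \<noteq> {}" by auto
    \<comment> \<open>With the largest coordinate selected, only two multi-indices are needed: 0 and
      the pure power \<open>M\<close> in direction \<open>j\<close>.\<close>
    from Max_in[OF this] obtain j where j: "cmod (z $ j) = Max (range (\<lambda>i. cmod (z $ i)))" by (metis imageE)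
    have j: "cmod (z $ i) \<le> cmod (z $ j)" for i unfolding j by (rule Max_ge) auto
    have "norm \<xi> \<le> (\<Sum>i\<in>UNIV. \<bar>\<xi> $ i\<bar>)" by (rule norm_le_l1_cart)
    also have "\<dots> \<le> (\<Sum>i\<in>(UNIV :: 'n set). cmod (z $ j) + R)"
    proof (rule sum_mono)
      fix i
      have "\<bar>\<xi> $ i\<bar> \<le> cmod (z $ i) + R"
        using zi[of i] norm_triangle_ineq3[of "of_real (\<xi> $ i)" "z $ i"] by (simp add: norm_minus_commute)
      thus "\<bar>\<xi> $ i\<bar> \<le> cmod (z $ j) + R" using j[of i] by simp
    qed
    finally have "1 + norm \<xi> \<le> 1 + ?n * R + ?n * cmod (z $ j)" by (simp add: algebra_simps)
    also have "\<dots> \<le> A * max 1 (cmod (z $ j))"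
    proof -
      have "1 + ?n * R \<le> (1 + ?n * R) * max 1 (cmod (z $ j))"
        using R mult_left_mono[of 1 "max 1 (cmod (z $ j))" "1 + ?n * R"] by simp
      moreover have "?n * cmod (z $ j) \<le> ?n * max 1 (cmod (z $ j))" by (intro mult_left_mono) auto
      ultimately show ?thesis unfolding A_def by (simp only: distrib_right)
    qed
    finally have "(1 + norm \<xi>) ^ M \<le> (A * max 1 (cmod (z $ j))) ^ M" by (intro power_mono) auto
    also have "\<dots> \<le> A ^ M * (1 + cmod (z $ j) ^ M)"
      unfolding power_mult_distrib using A by (intro mult_left_mono) (auto simp: max_def)
    finally have P: "(1 + norm \<xi>) ^ M \<le> A ^ M * (1 + cmod (z $ j) ^ M)" .
    have 1: "cmod (laplace f z) \<le> C0 * B" using L[of "\<lambda>_. 0"] by (simp add: cmono_def mi_order_def)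
    have 2: "cmod (z $ j) ^ M * cmod (laplace f z) \<le> C0 * B"
    proof -
      have "cmono (\<lambda>i. if i = j then M else 0) z = z $ j ^ M"
        unfolding cmono_def by (subst prod.remove[of _ j]) auto
      moreover have "mi_order (\<lambda>i. if i = j then M else 0) = M" by (simp add: mi_order_def)
      ultimately show ?thesis using L[of "\<lambda>i. if i = j then M else 0"] by (simp add: norm_power)
    qed
    have "(1 + norm \<xi>) ^ M * cmod (laplace f z) \<le> A ^ M * (1 + cmod (z $ j) ^ M) * cmod (laplace f z)"
      by (intro mult_right_mono P) auto
    also have "\<dots> = A ^ M * (cmod (laplace f z) + cmod (z $ j) ^ M * cmod (laplace f z))"
      by (simp add: algebra_simps)
    also have "\<dots> \<le> A ^ M * (C0 * B + C0 * B)" using A by (intro mult_left_mono add_mono 1 2) auto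
    finally show "cmod (laplace f z) \<le> A ^ M * (2 * C0) * B * decay M \<xi>"
      by (simp add: decay_def field_simps)
  qed
qed

section \<open>Superpositions of exponentials\<close>

lemma norm_exp_minus_1_minus_le: "cmod (exp w - 1 - w) \<le> exp \<bar>Re w\<bar> * (cmod w)\<^sup>2"
  using Taylor_exp[of w 1] by (simp add: power2_eq_square diff_diff_eq)

text \<open>The parameter space is left open because two instances occur: the contour, for the
  solution operator, and the position variable of a test function, for Fourier transforms.\<close>

definition expint :: "'s measure \<Rightarrow> ('s \<Rightarrow> complex) \<Rightarrow> ('s \<Rightarrow> complex ^ 'n::finite) \<Rightarrow> real ^ 'n \<Rightarrow> complex" where
  "expint M a z y = (LINT s|M. a s * cexp y (z s))"

text \<open>Bounded imaginary parts keep the exponentials bounded for \<open>y\<close> in a compact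
  set; moments of every order permit differentiation under the integral any number of times. The
  class is stable under the polynomial factors that differentiation produces.\<close>

definition expint_adm :: "'s measure \<Rightarrow> ('s \<Rightarrow> complex) \<Rightarrow> ('s \<Rightarrow> complex ^ 'n::finite) \<Rightarrow> real \<Rightarrow> bool" where
  "expint_adm M a z R \<longleftrightarrow> a \<in> borel_measurable M \<and> z \<in> borel_measurable M \<and>
     (\<forall>s i. \<bar>Im (z s $ i)\<bar> \<le> R) \<and> (\<forall>N::nat. integrable M (\<lambda>s. cmod (a s) * (1 + norm (z s)) ^ N))"

lemma expint_adm_mult:
  assumes "expint_adm M a z R" "b \<in> borel_measurable M" "\<And>s. cmod (b s) \<le> (1 + norm (z s)) ^ k"
  shows "expint_adm M (\<lambda>s. a s * b s) z R"
proof -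
  have [measurable]: "a \<in> borel_measurable M" "z \<in> borel_measurable M" "b \<in> borel_measurable M"
    using assms by (auto simp: expint_adm_def)
  have "integrable M (\<lambda>s. cmod (a s * b s) * (1 + norm (z s)) ^ N)" for N
  proof (rule Bochner_Integration.integrable_bound)
    show "integrable M (\<lambda>s. cmod (a s) * (1 + norm (z s)) ^ (k + N))"
      using assms(1) unfolding expint_adm_def by blast
    show "AE s in M. norm (cmod (a s * b s) * (1 + norm (z s)) ^ N) \<le> norm (cmod (a s) * (1 + norm (z s)) ^ (k + N))"
      using assms(3) by (intro AE_I2) (auto simp: norm_mult power_add abs_mult mult.assoc intro!: mult_left_mono mult_right_mono)
  qed measurable
  thus ?thesis using assms(1) by (auto simp: expint_adm_def)
qed

lemma expint_integrable:
  assumes "expint_adm M a z R"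
  shows "integrable M (\<lambda>s. a s * cexp y (z s))"
proof (rule Bochner_Integration.integrable_bound)
  let ?E = "exp (real CARD('b) * R * norm y)"
  have [measurable]: "a \<in> borel_measurable M" "z \<in> borel_measurable M"
    using assms by (auto simp: expint_adm_def)
  have "integrable M (\<lambda>s. cmod (a s) * (1 + norm (z s)) ^ 0)"
    using assms unfolding expint_adm_def by blast
  thus "integrable M (\<lambda>s. ?E * cmod (a s))" by simp
  show "(\<lambda>s. a s * cexp y (z s)) \<in> borel_measurable M" by measurable
  show "AE s in M. norm (a s * cexp y (z s)) \<le> norm (?E * cmod (a s))"
    using assms norm_cexp_le[of "z s" R y for s]
    by (intro AE_I2) (auto simp: norm_mult expint_adm_def abs_mult mult.commute intro!: mult_left_mono)
qed

lemma norm_expint_le: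
  assumes "expint_adm M a z R"
  shows "cmod (expint M a z y) \<le> exp (real CARD('n) * R * norm (y :: real ^ 'n::finite)) * (LINT s|M. cmod (a s))"
proof -
  let ?E = "exp (real CARD('n) * R * norm y)"
  have "integrable M (\<lambda>s. cmod (a s) * (1 + norm (z s)) ^ 0)"
    using assms unfolding expint_adm_def by blast
  hence "integrable M (\<lambda>s. ?E * cmod (a s))" by simp
  hence "cmod (expint M a z y) \<le> (LINT s|M. ?E * cmod (a s))"
    unfolding expint_def
    using assms norm_cexp_le[of "z s" R y for s]
    by (intro norm_integral_le)
       (auto simp: norm_mult expint_adm_def mult.commute intro!: mult_left_mono)
  thus ?thesis by simp
qed

lemma expint_adm_coord:
  assumes "expint_adm M a z R"
  shows "expint_adm M (\<lambda>s. a s * (\<i> * z s $ i)) z R"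
proof (rule expint_adm_mult[OF assms, of _ 1])
  have [measurable]: "z \<in> borel_measurable M" using assms by (simp add: expint_adm_def)
  show "(\<lambda>s. \<i> * z s $ i) \<in> borel_measurable M" by measurable
  show "cmod (\<i> * z s $ i) \<le> (1 + norm (z s)) ^ 1" for s
    using Finite_Cartesian_Product.norm_nth_le[of "z s" i] by (simp add: norm_mult)
qed

text \<open>The second-order remainder of the exponential is integrated directly. The error is of
  order |h|^2 with the second moment \<open>I\<close> as constant, so differentiability needs no
  limit theorem.\<close>

lemma expint_has_derivative:
  assumes adm: "expint_adm M a (z :: 's \<Rightarrow> complex ^ 'n::finite) R"
  shows "(expint M a z has_derivative (\<lambda>h. \<Sum>i\<in>UNIV. of_real (h $ i) * expint M (\<lambda>s. a s * (\<i> * z s $ i)) z y)) (at y)"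
proof -
  let ?n = "real CARD('n)"
  have R: "\<bar>Im (z s $ i)\<bar> \<le> R" for s i using adm by (auto simp: expint_adm_def)
  have R0: "R \<ge> 0" using R[of undefined undefined] abs_ge_zero order_trans by blast
  have [measurable]: "a \<in> borel_measurable M" "z \<in> borel_measurable M" using adm by (auto simp: expint_adm_def)
  define I where "I = (LINT s|M. cmod (a s) * (1 + norm (z s)) ^ 2)"
  have intI: "integrable M (\<lambda>s. cmod (a s) * (1 + norm (z s)) ^ 2)" using adm unfolding expint_adm_def by blast
  \<comment> \<open>First factor: size of the exponentials at \<open>y\<close>. Second factor: the
    remainder of exp for |h| \<le> 1, with the squared dimension coming from the bound for
    \<open>cdot\<close>.\<close>
  define C where "C = exp (?n * R * norm y) * (exp (?n * R) * ?n\<^sup>2)"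
  have C: "C \<ge> 0" by (simp add: C_def)
  let ?D = "\<lambda>h. \<Sum>i\<in>UNIV. of_real (h $ i) * expint M (\<lambda>s. a s * (\<i> * z s $ i)) z y"
  have D: "?D h = (LINT s|M. a s * (\<i> * cdot h (z s)) * cexp y (z s))" for h
  proof -
    have "?D h = (\<Sum>i\<in>UNIV. LINT s|M. of_real (h $ i) * (a s * (\<i> * z s $ i) * cexp y (z s)))"
      by (simp add: expint_def)
    also have "\<dots> = (LINT s|M. (\<Sum>i\<in>UNIV. of_real (h $ i) * (a s * (\<i> * z s $ i) * cexp y (z s))))"
      using expint_integrable[OF expint_adm_coord[OF adm]]
      by (intro Bochner_Integration.integral_sum[symmetric]) simp
    also have "\<dots> = (LINT s|M. a s * (\<i> * cdot h (z s)) * cexp y (z s))"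
      by (intro Bochner_Integration.integral_cong refl) (simp add: cdot_def sum_distrib_left sum_distrib_right mult_ac)
    finally show ?thesis .
  qed
  have intD: "integrable M (\<lambda>s. a s * (\<i> * cdot h (z s)) * cexp y (z s))" for h
  proof -
    have "integrable M (\<lambda>s. (\<Sum>i\<in>UNIV. of_real (h $ i) * (a s * (\<i> * z s $ i) * cexp y (z s))))"
      using expint_integrable[OF expint_adm_coord[OF adm]]
      by (intro Bochner_Integration.integrable_sum) simp
    thus ?thesis by (simp add: cdot_def sum_distrib_left sum_distrib_right mult_ac)
  qed
  have est: "cmod (expint M a z (y + h) - expint M a z y - ?D h) \<le> C * I * (norm h)\<^sup>2" if h: "norm h \<le> 1" for h
  proof -
    have "expint M a z (y + h) - expint M a z y - ?D h =
      (LINT s|M. a s * cexp (y + h) (z s) - a s * cexp y (z s) - a s * (\<i> * cdot h (z s)) * cexp y (z s))"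
      unfolding D unfolding expint_def using expint_integrable[OF adm] intD by simp
    also have "cmod \<dots> \<le> (LINT s|M. C * (norm h)\<^sup>2 * (cmod (a s) * (1 + norm (z s)) ^ 2))"
    proof (rule norm_integral_le)
      fix s
      let ?w = "\<i> * cdot h (z s)"
      have "a s * cexp (y + h) (z s) - a s * cexp y (z s) - a s * (\<i> * cdot h (z s)) * cexp y (z s)
         = a s * cexp y (z s) * (exp ?w - 1 - ?w)"
        unfolding cexp_add_left by (simp add: cexp_def algebra_simps)
      also have "cmod \<dots> \<le> cmod (a s) * exp (?n * R * norm y) * (exp (?n * R) * (?n\<^sup>2 * (norm h)\<^sup>2 * (1 + norm (z s)) ^ 2))"
        unfolding norm_mult
      proof (intro mult_mono)
        show "cmod (cexp y (z s)) \<le> exp (?n * R * norm y)" by (rule norm_cexp_le[OF R])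
        have 1: "\<bar>Re ?w\<bar> \<le> ?n * R"
        proof -
          have "\<bar>Im (cdot h (z s))\<bar> \<le> ?n * R * norm h" by (rule abs_Im_cdot_le[OF R])
          also have "\<dots> \<le> ?n * R * 1" using h R0 by (intro mult_left_mono) auto
          finally show ?thesis by simp
        qed
        have 2: "cmod ?w \<le> ?n * (norm h * (1 + norm (z s)))"
        proof -
          have "cmod ?w \<le> ?n * (norm h * norm (z s))" using norm_cdot_le[of h "z s"] by (simp add: norm_mult)
          also have "\<dots> \<le> ?n * (norm h * (1 + norm (z s)))" by (intro mult_left_mono) auto
          finally show ?thesis .
        qed
        have "cmod (exp ?w - 1 - ?w) \<le> exp \<bar>Re ?w\<bar> * (cmod ?w)\<^sup>2" by (rule norm_exp_minus_1_minus_le)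
        also have "\<dots> \<le> exp (?n * R) * (?n * (norm h * (1 + norm (z s))))\<^sup>2"
          using 1 2 by (intro mult_mono power_mono) auto
        also have "\<dots> = exp (?n * R) * (?n\<^sup>2 * (norm h)\<^sup>2 * (1 + norm (z s)) ^ 2)"
          by (simp add: power_mult_distrib)
        finally show "cmod (exp ?w - 1 - ?w) \<le> exp (?n * R) * (?n\<^sup>2 * (norm h)\<^sup>2 * (1 + norm (z s)) ^ 2)" .
      qed auto
      also have "\<dots> = C * (norm h)\<^sup>2 * (cmod (a s) * (1 + norm (z s)) ^ 2)" by (simp add: C_def mult_ac)
      finally show "norm (a s * cexp (y + h) (z s) - a s * cexp y (z s) - a s * (\<i> * cdot h (z s)) * cexp y (z s))
        \<le> C * (norm h)\<^sup>2 * (cmod (a s) * (1 + norm (z s)) ^ 2)" .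
    qed (use expint_integrable[OF adm] intD intI in auto)
    also have "\<dots> = C * I * (norm h)\<^sup>2" by (simp add: I_def)
    finally show ?thesis .
  qed
  show ?thesis
  proof (rule has_derivativeI_sandwich[of 1])
    show "bounded_linear ?D"
    proof (rule bounded_linear_sum)
      fix i
      have "bounded_linear (\<lambda>h. expint M (\<lambda>s. a s * (\<i> * z s $ i)) z y * of_real (h $ i))"
        by (intro bounded_linear_compose[OF bounded_linear_mult_right] bounded_linear_compose[OF bounded_linear_of_real] bounded_linear_vec_nth)
      thus "bounded_linear (\<lambda>h. of_real (h $ i) * expint M (\<lambda>s. a s * (\<i> * z s $ i)) z y)"
        by (simp add: mult.commute)
    qed
    fix x assume x: "x \<in> UNIV" "x \<noteq> y" "dist x y < 1"
    show "norm (expint M a z x - expint M a z y - ?D (x - y)) / norm (x - y) \<le> C * I * norm (x - y)"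
      using est[of "x - y"] x by (simp add: dist_norm divide_le_eq power2_eq_square mult_ac)
  next
    have "((\<lambda>x. C * I * norm (x - y)) \<longlongrightarrow> C * I * norm (y - y)) (at y)" by (intro tendsto_intros)
    thus "((\<lambda>x. C * I * norm (x - y)) \<longlongrightarrow> 0) (at y)" by simp
  qed simp
qed

lemma partial_deriv_expint:
  assumes "expint_adm M a z R"
  shows "partial_deriv i (expint M a z) = expint M (\<lambda>s. a s * (\<i> * z s $ i)) z"
proof
  fix y
  have "partial_deriv i (expint M a z) y = (\<Sum>j\<in>UNIV. of_real (axis i 1 $ j) * expint M (\<lambda>s. a s * (\<i> * z s $ j)) z y)"
    by (rule partial_deriv_eqI[OF expint_has_derivative[OF assms]])
  also have "\<dots> = (\<Sum>j\<in>UNIV. if j = i then expint M (\<lambda>s. a s * (\<i> * z s $ i)) z y else 0)"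
    by (intro sum.cong) (auto simp: axis_def)
  finally show "partial_deriv i (expint M a z) y = expint M (\<lambda>s. a s * (\<i> * z s $ i)) z y" by simp
qed

lemma smooth_expint:
  assumes "expint_adm M a z R"
  shows "smooth (expint M a z)"
proof (rule smooth_coinduct)
  let ?X = "{expint M b z | b. expint_adm M b z R}"
  show "expint M a z \<in> ?X" using assms by blast
  show "g differentiable (at x)" if "g \<in> ?X" for g x
    using that expint_has_derivative unfolding differentiable_def by blast
  show "partial_deriv i g \<in> ?X" if "g \<in> ?X" for g i
    using that partial_deriv_expint expint_adm_coord by blast
qed

lemma mpartial_expint:
  assumes "expint_adm M a z R"
  shows "mpartial \<alpha> (expint M a z) = expint M (\<lambda>s. a s * (\<i> ^ mi_order \<alpha> * cmono \<alpha> (z s))) z"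
    and "expint_adm M (\<lambda>s. a s * (\<i> ^ mi_order \<alpha> * cmono \<alpha> (z s))) z R"
proof -
  have zm[measurable]: "z \<in> borel_measurable M" using assms by (simp add: expint_adm_def)
  show adm: "expint_adm M (\<lambda>s. a s * (\<i> ^ mi_order \<alpha> * cmono \<alpha> (z s))) z R" for \<alpha>
  proof (rule expint_adm_mult[OF assms, of _ "mi_order \<alpha>"])
    show "(\<lambda>s. \<i> ^ mi_order \<alpha> * cmono \<alpha> (z s)) \<in> borel_measurable M" unfolding cmono_def by measurable
    show "cmod (\<i> ^ mi_order \<alpha> * cmono \<alpha> (z s)) \<le> (1 + norm (z s)) ^ mi_order \<alpha>" for s
      using order_trans[OF cmod_cmono_le[of \<alpha> "z s"] power_mono[of "norm (z s)" "1 + norm (z s)" "mi_order \<alpha>"]]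
      by (simp add: norm_mult norm_power)
  qed
  obtain "is" where "is": "count_list is = \<alpha>" using ex_list_of_multiindex[of \<alpha>] by blast
  have "foldr partial_deriv is (expint M a z) = expint M (\<lambda>s. a s * (\<i> ^ mi_order (count_list is) * cmono (count_list is) (z s))) z"
  proof (induction "is")
    case Nil show ?case by (simp add: cmono_def mi_order_def)
  next
    case (Cons j js)
    have "foldr partial_deriv (j # js) (expint M a z) =
      expint M (\<lambda>s. a s * (\<i> ^ mi_order (count_list js) * cmono (count_list js) (z s)) * (\<i> * z s $ j)) z"
      by (simp only: foldr.simps comp_apply Cons partial_deriv_expint[OF adm])
    thus ?case by (simp only: cmono_count_list_Cons mi_order_count_list length_Cons power_Suc mult_ac)
  qed
  thus "mpartial \<alpha> (expint M a z) = expint M (\<lambda>s. a s * (\<i> ^ mi_order \<alpha> * cmono \<alpha> (z s))) z"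
    using foldr_partial_deriv[OF smooth_expint[OF assms], of "is"] "is" by simp
qed

lemma norm_mpartial_expint_le:
  assumes "expint_adm M a z R"
  shows "cmod (mpartial \<alpha> (expint M a z) y) \<le> exp (real CARD('n) * R * norm (y :: real ^ 'n::finite)) *
     (LINT s|M. cmod (a s) * (1 + norm (z s)) ^ mi_order \<alpha>)"
proof -
  have "(LINT s|M. cmod (a s * (\<i> ^ mi_order \<alpha> * cmono \<alpha> (z s)))) \<le> (LINT s|M. cmod (a s) * (1 + norm (z s)) ^ mi_order \<alpha>)"
  proof (rule integral_mono)
    have "integrable M (\<lambda>s. cmod (a s * (\<i> ^ mi_order \<alpha> * cmono \<alpha> (z s))) * (1 + norm (z s)) ^ 0)"
      using mpartial_expint(2)[OF assms, of \<alpha>] unfolding expint_adm_def by blast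
    thus "integrable M (\<lambda>s. cmod (a s * (\<i> ^ mi_order \<alpha> * cmono \<alpha> (z s))))" by simp
    show "integrable M (\<lambda>s. cmod (a s) * (1 + norm (z s)) ^ mi_order \<alpha>)" using assms unfolding expint_adm_def by blast
    show "cmod (a s * (\<i> ^ mi_order \<alpha> * cmono \<alpha> (z s))) \<le> cmod (a s) * (1 + norm (z s)) ^ mi_order \<alpha>" for s
      using order_trans[OF cmod_cmono_le[of \<alpha> "z s"] power_mono[of "norm (z s)" "1 + norm (z s)" "mi_order \<alpha>"]]
      by (simp add: norm_mult norm_power mult_left_mono)
  qed
  thus ?thesis unfolding mpartial_expint(1)[OF assms]
    using norm_expint_le[OF mpartial_expint(2)[OF assms], of \<alpha> y] by (meson exp_ge_zero mult_left_mono order_trans)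
qed

section \<open>Mean value property and Fourier inversion\<close>

text \<open>Cauchy's integral formula at the centre for the entire function exp(c z). The functions
  averaged over circles below are superpositions of such exponentials, so this scalar mean value is
  all that is used.\<close>

lemma integral_exp_circle:
  "integrable lborel (\<lambda>t. indicator {0..1} t *\<^sub>R exp (c * cis (2 * pi * t)))"
  "(LINT t|lborel. indicator {0..1} t *\<^sub>R exp (c * cis (2 * pi * t))) = 1"
proof -
  let ?f = "\<lambda>t. exp (c * cis (2 * pi * t))"
  have cont: "continuous_on {0..1} ?f" by (intro continuous_intros)
  show int: "integrable lborel (\<lambda>t. indicator {0..1} t *\<^sub>R ?f t)"
    by (rule borel_integrable_compact[OF _ cont]) auto
  have "((\<lambda>z. exp (c * z) / (z - 0)) has_contour_integral (2 * of_real pi * \<i> * exp (c * 0))) (circlepath 0 1)"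
    by (rule Cauchy_integral_circlepath_simple) (auto intro!: holomorphic_intros)
  hence "((\<lambda>t. exp (c * circlepath 0 1 t) / circlepath 0 1 t * vector_derivative (circlepath 0 1) (at t)) has_integral (2 * of_real pi * \<i>)) {0..1}"
    by (simp add: has_contour_integral)
  hence "((\<lambda>t. 2 * of_real pi * \<i> * ?f t) has_integral (2 * of_real pi * \<i>)) {0..1}"
  proof (rule has_integral_eq[rotated])
    fix t :: real
    have 1: "circlepath 0 1 t = cis (2 * pi * t)" by (simp add: circlepath cis_conv_exp mult_ac)
    have 2: "vector_derivative (circlepath 0 1) (at t) = 2 * of_real pi * \<i> * cis (2 * pi * t)"
      by (simp add: vector_derivative_circlepath cis_conv_exp mult_ac)
    show "exp (c * circlepath 0 1 t) / circlepath 0 1 t * vector_derivative (circlepath 0 1) (at t) = 2 * of_real pi * \<i> * ?f t"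
      unfolding 1 2 by simp
  qed
  hence "((\<lambda>t. inverse (2 * of_real pi * \<i>) * (2 * of_real pi * \<i> * ?f t)) has_integral inverse (2 * of_real pi * \<i>) * (2 * of_real pi * \<i>)) {0..1}"
    by (rule has_integral_mult_right)
  moreover have nz: "2 * of_real pi * \<i> \<noteq> 0" by simp
  moreover have "inverse (2 * of_real pi * \<i>) * (2 * of_real pi * \<i> * u) = u" for u
    using left_inverse[OF nz] by (simp only: mult.assoc[symmetric] mult_1)
  moreover have "inverse (2 * of_real pi * \<i>) * (2 * of_real pi * \<i>) = 1" using left_inverse[OF nz] .
  ultimately have "(?f has_integral 1) {0..1}" by (simp only:)
  hence 1: "integral {0..1} ?f = 1" by (rule integral_unique)
  have "set_integrable lborel {0..1} ?f" using int by (simp add: set_integrable_def)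
  from set_borel_integral_eq_integral(2)[OF this] 1
  show "(LINT t|lborel. indicator {0..1} t *\<^sub>R ?f t) = 1" by (simp add: set_lebesgue_integral_def)
qed

section \<open>Gaussians and Fourier inversion\<close>

lemma integral_gauss_1d:
  "integrable lborel (\<lambda>t. complex_of_real (std_normal_density t) * exp (\<i> * of_real (x * t)))"
  "(LINT t|lborel. complex_of_real (std_normal_density t) * exp (\<i> * of_real (x * t))) = of_real (exp (- x\<^sup>2 / 2))"
proof -
  have "integrable lborel (\<lambda>t. std_normal_density t)" using integrable_std_normal_moment[of 0] by simp
  thus 1: "integrable lborel (\<lambda>t. complex_of_real (std_normal_density t) * exp (\<i> * of_real (x * t)))"
    by (rule Bochner_Integration.integrable_bound) (auto simp: norm_mult)
  have "char std_normal_distribution x = (LINT t|lborel. std_normal_density t *\<^sub>R iexp (x * t))"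
    unfolding char_def by (subst integral_density) (auto simp: normal_density_nonneg)
  thus "(LINT t|lborel. complex_of_real (std_normal_density t) * exp (\<i> * of_real (x * t))) = of_real (exp (- x\<^sup>2 / 2))"
    unfolding char_std_normal_distribution by (simp add: scaleR_conv_of_real)
qed

text \<open>The common justification for exchanging integrals: domination by a product of two
  integrable functions of one variable each.\<close>

lemma (in pair_sigma_finite) integrable_pair_bound:
  fixes w :: "'a \<times> 'b \<Rightarrow> 'c::{banach,second_countable_topology}"
  assumes w[measurable]: "w \<in> borel_measurable (M1 \<Otimes>\<^sub>M M2)"
    and u: "integrable M1 (u :: 'a \<Rightarrow> real)" and v: "integrable M2 (v :: 'b \<Rightarrow> real)"
    and le: "\<And>x y. norm (w (x, y)) \<le> u x * v y"
  shows "integrable (M1 \<Otimes>\<^sub>M M2) w"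
proof (rule Fubini_integrable)
  have [measurable]: "u \<in> borel_measurable M1" "v \<in> borel_measurable M2" using u v by auto
  have iw: "integrable M2 (\<lambda>y. w (x, y))" if "x \<in> space M1" for x
  proof (rule Bochner_Integration.integrable_bound)
    show "integrable M2 (\<lambda>y. u x * v y)" using v by simp
    show "(\<lambda>y. w (x, y)) \<in> borel_measurable M2" using that by measurable
    show "AE y in M2. norm (w (x, y)) \<le> norm (u x * v y)"
      by (rule AE_I2) (use le in \<open>force intro: order_trans[OF _ abs_ge_self]\<close>)
  qed
  thus "AE x in M1. integrable M2 (\<lambda>y. w (x, y))" by (rule AE_I2)
  show "integrable M1 (\<lambda>x. LINT y|M2. norm (w (x, y)))"
  proof (rule Bochner_Integration.integrable_bound)
    show "integrable M1 (\<lambda>x. u x * (LINT y|M2. v y))" using u by simp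
    show "(\<lambda>x. LINT y|M2. norm (w (x, y))) \<in> borel_measurable M1" by measurable
    show "AE x in M1. norm (LINT y|M2. norm (w (x, y))) \<le> norm (u x * (LINT y|M2. v y))"
    proof (rule AE_I2)
      fix x
      have "(LINT y|M2. norm (w (x, y))) \<le> (LINT y|M2. u x * v y)"
        using norm_integral_le[of M2 "\<lambda>y. u x * v y" "\<lambda>y. norm (w (x, y))"] v le by simp
      moreover have "(LINT y|M2. norm (w (x, y))) \<ge> 0" by simp
      ultimately show "norm (LINT y|M2. norm (w (x, y))) \<le> norm (u x * (LINT y|M2. v y))" by simp
    qed
  qed
qed measurable

text \<open>Normalized by its value 1 at the origin, since it serves as a multiplier tending to 1;
  its integral is a power of sqrt(2 pi).\<close>

definition ngauss :: "real ^ 'n::finite \<Rightarrow> real" where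
  "ngauss x = (\<Prod>i\<in>UNIV. exp (- (x $ i)\<^sup>2 / 2))"

lemma std_normal_density_alt: "std_normal_density t = exp (- t\<^sup>2 / 2) / sqrt (2 * pi)"
  by (simp add: normal_density_def)

lemma ngauss_facts:
  "integrable lborel (ngauss :: real ^ 'n::finite \<Rightarrow> real)"
  "(LINT x|lborel. ngauss (x :: real ^ 'n)) = sqrt (2 * pi) ^ CARD('n)"
  "ngauss x > 0" "ngauss x \<le> 1" "ngauss 0 = 1"
proof -
  have e: "exp (- t\<^sup>2 / 2) = sqrt (2 * pi) * std_normal_density t" for t :: real
    by (simp add: std_normal_density_alt)
  have i: "integrable lborel (\<lambda>t::real. exp (- t\<^sup>2 / 2))"
    unfolding e using integrable_std_normal_moment[of 0] by simp
  show "integrable lborel (ngauss :: real ^ 'n::finite \<Rightarrow> real)"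
    unfolding ngauss_def[abs_def] by (rule lborel_integral_prod_cart(1)[OF i])
  have "(LINT t|lborel. exp (- t\<^sup>2 / 2)) = sqrt (2 * pi)"
    unfolding e using integral_std_normal_moment_even[of 0] by simp
  thus "(LINT x|lborel. ngauss (x :: real ^ 'n)) = sqrt (2 * pi) ^ CARD('n)"
    unfolding ngauss_def by (subst lborel_integral_prod_cart(2)[OF i]) simp
  show "ngauss x > 0" "ngauss x \<le> 1" "ngauss 0 = 1"
    by (auto simp: ngauss_def intro!: prod_pos prod_le_1)
qed

lemma continuous_on_ngauss: "continuous_on S ngauss"
  unfolding ngauss_def[abs_def] by (intro continuous_intros) auto

lemma ngauss_measurable [measurable]: "ngauss \<in> borel_measurable borel"
  by (intro borel_measurable_continuous_onI continuous_on_ngauss)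

lemma fourier_ngauss:
  "(LINT \<xi>|lborel. of_real (ngauss \<xi>) * cexp x (cvec \<xi>)) = of_real (sqrt (2 * pi) ^ CARD('n) * ngauss (x :: real ^ 'n::finite))"
proof -
  let ?g = "\<lambda>x t. complex_of_real (std_normal_density t) * exp (\<i> * of_real (x * t))"
  have "of_real (ngauss \<xi>) * cexp x (cvec \<xi>) = of_real (sqrt (2 * pi) ^ CARD('n)) * (\<Prod>i\<in>UNIV. ?g (x $ i) (\<xi> $ i))" for \<xi>
  proof -
    have 1: "ngauss \<xi> = sqrt (2 * pi) ^ CARD('n) * (\<Prod>i\<in>UNIV. std_normal_density (\<xi> $ i))"
    proof -
      have "ngauss \<xi> = (\<Prod>i\<in>UNIV. sqrt (2 * pi) * std_normal_density (\<xi> $ i))"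
        unfolding ngauss_def std_normal_density_alt by simp
      thus ?thesis by (simp add: prod.distrib)
    qed
    have 2: "cexp x (cvec \<xi>) = (\<Prod>i\<in>UNIV. exp (\<i> * of_real (x $ i * \<xi> $ i)))"
      by (simp add: cexp_def cdot_def sum_distrib_left exp_sum)
    show ?thesis unfolding 1 2 by (simp add: prod.distrib)
  qed
  hence "(LINT \<xi>|lborel. of_real (ngauss \<xi>) * cexp x (cvec \<xi>)) =
     of_real (sqrt (2 * pi) ^ CARD('n)) * (LINT \<xi>|lborel. (\<Prod>i\<in>UNIV. ?g (x $ i) (\<xi> $ i)))" by simp
  also have "(LINT \<xi>|lborel. (\<Prod>i\<in>UNIV. ?g (x $ i) (\<xi> $ i))) = (\<Prod>i\<in>UNIV. of_real (exp (- (x $ i)\<^sup>2 / 2)))"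
    by (subst lborel_integral_prod_cart(2)[OF integral_gauss_1d(1)]) (simp only: integral_gauss_1d(2))
  finally show ?thesis by (simp add: ngauss_def)
qed

text \<open>For a fixed function the bounds on its derivatives are absorbed into the constant. This
  is the version for cutoffs, which do not vary with \<epsilon>.\<close>

lemma laplace_cvec_decay:
  assumes "f \<in> smooth_supported (K :: (real ^ 'n::finite) set)" "compact K"
  obtains C where "C \<ge> 0" "\<And>z \<xi>. norm (z - cvec \<xi>) \<le> R \<Longrightarrow> cmod (laplace f z) \<le> C * decay M \<xi>"
proof -
  have "\<exists>B. \<forall>x. cmod (mpartial \<alpha> f x) \<le> B" for \<alpha>
    using smooth_supported_bounded[OF smooth_supported_mpartial[OF assms(1) compact_imp_closed[OF assms(2)]] assms(2), of \<alpha>]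
    by metis
  then obtain B where B: "\<And>\<alpha> x. cmod (mpartial \<alpha> f x) \<le> B \<alpha>" by metis
  have B0: "B \<alpha> \<ge> 0" for \<alpha> using B[of \<alpha> 0] norm_ge_zero order_trans by blast
  define B' where "B' = (\<Sum>\<alpha> | mi_order \<alpha> \<le> M. B \<alpha>)"
  have B': "cmod (mpartial \<alpha> f x) \<le> B'" if "mi_order \<alpha> \<le> M" for \<alpha> x
  proof -
    have "B \<alpha> \<le> B'" unfolding B'_def using that B0 by (intro member_le_sum) (auto simp: finite_mi_order_le)
    thus ?thesis using B order_trans by blast
  qed
  have "B' \<ge> 0" unfolding B'_def using B0 by (simp add: sum_nonneg)
  \<comment> \<open>\<open>max 0 R\<close> meets the sign condition of \<open>laplace_decay\<close>;
    for negative \<open>R\<close> the claim is vacuous.\<close>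
  obtain C where C: "C \<ge> 0" "\<And>f B (z :: complex ^ 'n) \<xi>. f \<in> smooth_supported K \<Longrightarrow>
     (\<And>\<alpha> x. mi_order \<alpha> \<le> M \<Longrightarrow> cmod (mpartial \<alpha> f x) \<le> B) \<Longrightarrow> norm (z - cvec \<xi>) \<le> max 0 R \<Longrightarrow>
     cmod (laplace f z) \<le> C * B * decay M \<xi>" using laplace_decay[OF assms(2), of "max 0 R" M] by auto
  show thesis
    by (rule that[of "C * B'"]) (use C B' \<open>B' \<ge> 0\<close> assms(1) in auto)
qed

lemma integrable_laplace_cvec:
  assumes "f \<in> smooth_supported (K :: (real ^ 'n::finite) set)" "compact K"
  shows "integrable lborel (\<lambda>\<xi>. laplace f (cvec \<xi>) * (of_real (1 + norm \<xi>)) ^ N)"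
proof -
  obtain C where C: "C \<ge> 0" "\<And>z \<xi>. norm (z - cvec \<xi>) \<le> 0 \<Longrightarrow> cmod (laplace f z) \<le> C * decay (2 * CARD('n) + N) \<xi>"
    using laplace_cvec_decay[OF assms] by blast
  have [measurable]: "f \<in> borel_measurable borel" using assms by (auto simp: smooth_supported_def smooth_measurable)
  show ?thesis
  proof (rule Bochner_Integration.integrable_bound)
    show "integrable lborel (\<lambda>\<xi> :: real ^ 'n. C * decay (2 * CARD('n)) \<xi>)" by (intro integrable_mult_right integrable_decay) simp
    show "AE \<xi> in lborel. norm (laplace f (cvec \<xi>) * (of_real (1 + norm \<xi>)) ^ N) \<le> norm (C * decay (2 * CARD('n)) \<xi>)"
    proof (rule AE_I2)
      fix \<xi> :: "real ^ 'n"
      have "norm (laplace f (cvec \<xi>) * (of_real (1 + norm \<xi>)) ^ N) = cmod (laplace f (cvec \<xi>)) * (1 + norm \<xi>) ^ N"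
        by (simp only: norm_mult norm_power norm_of_real abs_of_pos one_plus_norm_pos)
      also have "\<dots> \<le> C * decay (2 * CARD('n) + N) \<xi> * (1 + norm \<xi>) ^ N" by (intro mult_right_mono C) auto
      also have "\<dots> = C * decay (2 * CARD('n)) \<xi>" using decay_mult_power[of \<xi> N "2 * CARD('n)"] by (simp add: mult_ac)
      also have "\<dots> \<le> norm (C * decay (2 * CARD('n)) \<xi>)" by simp
      finally show "norm (laplace f (cvec \<xi>) * (of_real (1 + norm \<xi>)) ^ N) \<le> norm (C * decay (2 * CARD('n)) \<xi>)" .
    qed
  qed measurable
qed

text \<open>A Gaussian multiplier of width 1/d makes the exchange of integrals legitimate. The
  regularized left side is then a Gaussian mean of \<open>f\<close> around \<open>y\<close> at scale
  d, and both sides converge as d tends to 0.\<close>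

lemma fourier_inversion:
  assumes f: "f \<in> smooth_supported (K :: (real ^ 'n::finite) set)" and K: "compact K"
  shows "(LINT \<xi>|lborel. laplace f (cvec \<xi>) * cexp y (- cvec \<xi>)) = of_real ((2 * pi) ^ CARD('n)) * f y"
proof -
  let ?c = "complex_of_real (sqrt (2 * pi) ^ CARD('n))"
  have fm[measurable]: "f \<in> borel_measurable borel" using f by (auto simp: smooth_supported_def smooth_measurable)
  have intf: "integrable lborel f" by (rule integrable_smooth_supported[OF f K])
  have intL: "integrable lborel (\<lambda>\<xi>. laplace f (cvec \<xi>))" using integrable_laplace_cvec[OF f K, of 0] by simp
  obtain B where B: "B \<ge> 0" "\<And>x. cmod (f x) \<le> B" using smooth_supported_bounded[OF f K] by blast
  have key: "(LINT \<xi>|lborel. of_real (ngauss (d *\<^sub>R \<xi>)) * (laplace f (cvec \<xi>) * cexp y (- cvec \<xi>))) =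
     (LINT x|lborel. ?c * (f (y + d *\<^sub>R x) * of_real (ngauss x)))" if d: "d > 0" for d
  proof -
    have intg: "integrable lborel (\<lambda>\<xi> :: real ^ 'n. ngauss (d *\<^sub>R \<xi>))"
      using lborel_integrable_affine[OF ngauss_facts(1), of d 0] d by simp
    have gauss: "(LINT \<xi>|lborel. of_real (ngauss (d *\<^sub>R \<xi>)) * cexp x (cvec \<xi>)) =
        ?c * of_real (inverse d ^ CARD('n) * ngauss (x /\<^sub>R d))" for x :: "real ^ 'n"
    proof -
      have "(LINT \<xi>|lborel. of_real (ngauss (d *\<^sub>R \<xi>)) * cexp x (cvec \<xi>)) =
         (\<bar>inverse d\<bar> ^ DIM(real ^ 'n)) *\<^sub>R (LINT \<xi>|lborel. of_real (ngauss (d *\<^sub>R (0 + inverse d *\<^sub>R \<xi>))) * cexp x (cvec (0 + inverse d *\<^sub>R \<xi>)))"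
        by (rule lborel_integral_affine) (use d in auto)
      also have "(\<lambda>\<xi>. of_real (ngauss (d *\<^sub>R (0 + inverse d *\<^sub>R \<xi>))) * cexp x (cvec (0 + inverse d *\<^sub>R \<xi>))) =
         (\<lambda>\<xi>. of_real (ngauss \<xi>) * cexp (x /\<^sub>R d) (cvec \<xi>))"
        using d by (auto simp: fun_eq_iff cexp_def cdot_cvec)
      finally show ?thesis using d by (simp add: fourier_ngauss scaleR_conv_of_real mult_ac)
    qed
    have "(LINT \<xi>|lborel. of_real (ngauss (d *\<^sub>R \<xi>)) * (laplace f (cvec \<xi>) * cexp y (- cvec \<xi>))) =
      (LINT \<xi>|lborel. (LINT x|lborel. f x * (of_real (ngauss (d *\<^sub>R \<xi>)) * cexp (x - y) (cvec \<xi>))))"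
    proof (intro Bochner_Integration.integral_cong refl)
      fix \<xi> :: "real ^ 'n"
      have "of_real (ngauss (d *\<^sub>R \<xi>)) * (laplace f (cvec \<xi>) * cexp y (- cvec \<xi>)) =
        (LINT x|lborel. (of_real (ngauss (d *\<^sub>R \<xi>)) * cexp y (- cvec \<xi>)) * (cexp x (cvec \<xi>) * f x))"
        unfolding laplace_def integral_mult_right_zero by (simp only: mult_ac)
      also have "(\<lambda>x. (of_real (ngauss (d *\<^sub>R \<xi>)) * cexp y (- cvec \<xi>)) * (cexp x (cvec \<xi>) * f x)) =
         (\<lambda>x. f x * (of_real (ngauss (d *\<^sub>R \<xi>)) * cexp (x - y) (cvec \<xi>)))"
        using cexp_add_left[of x "- y" "cvec \<xi>" for x] by (auto simp: fun_eq_iff cexp_minus mult_ac)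
      finally show "of_real (ngauss (d *\<^sub>R \<xi>)) * (laplace f (cvec \<xi>) * cexp y (- cvec \<xi>)) =
        (LINT x|lborel. f x * (of_real (ngauss (d *\<^sub>R \<xi>)) * cexp (x - y) (cvec \<xi>)))" .
    qed
    also have "\<dots> = (LINT x|lborel. (LINT \<xi>|lborel. f x * (of_real (ngauss (d *\<^sub>R \<xi>)) * cexp (x - y) (cvec \<xi>))))"
    proof (rule lborel_pair.Fubini_integral)
      show "integrable (lborel \<Otimes>\<^sub>M lborel) (\<lambda>(x, \<xi>). f x * (of_real (ngauss (d *\<^sub>R \<xi>)) * cexp (x - y) (cvec \<xi>)))"
      proof (rule lborel_pair.integrable_pair_bound)
        show "integrable lborel (\<lambda>x. cmod (f x))" using intf by simp
        show "integrable lborel (\<lambda>\<xi> :: real ^ 'n. ngauss (d *\<^sub>R \<xi>))" by (rule intg)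
        show "norm (case (x, \<xi>) of (x, \<xi>) \<Rightarrow> f x * (of_real (ngauss (d *\<^sub>R \<xi>)) * cexp (x - y) (cvec \<xi>))) \<le> cmod (f x) * ngauss (d *\<^sub>R \<xi>)" for x \<xi>
          using ngauss_facts(3)[of "d *\<^sub>R \<xi>"] by (simp add: norm_mult)
      qed measurable
    qed
    also have "\<dots> = (LINT x|lborel. f x * (?c * of_real (inverse d ^ CARD('n) * ngauss ((x - y) /\<^sub>R d))))"
      by (simp add: gauss)
    also have "\<dots> = (\<bar>d\<bar> ^ DIM(real ^ 'n)) *\<^sub>R (LINT x|lborel. f (y + d *\<^sub>R x) * (?c * of_real (inverse d ^ CARD('n) * ngauss ((y + d *\<^sub>R x - y) /\<^sub>R d))))"
      by (rule lborel_integral_affine) (use d in auto)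
    also have "\<dots> = (LINT x|lborel. (\<bar>d\<bar> ^ DIM(real ^ 'n)) *\<^sub>R (f (y + d *\<^sub>R x) * (?c * of_real (inverse d ^ CARD('n) * ngauss ((y + d *\<^sub>R x - y) /\<^sub>R d)))))"
      by (rule Bochner_Integration.integral_scaleR_right[symmetric])
    also have "\<dots> = (LINT x|lborel. ?c * (f (y + d *\<^sub>R x) * of_real (ngauss x)))"
    proof (intro Bochner_Integration.integral_cong refl)
      fix x :: "real ^ 'n"
      have 1: "(y + d *\<^sub>R x - y) /\<^sub>R d = x" using d by (simp add: vec_eq_iff)
      have "d ^ CARD('n) * inverse d ^ CARD('n) = 1" using d by (simp add: power_mult_distrib[symmetric])
      hence 2: "complex_of_real (d ^ CARD('n)) * of_real (inverse d ^ CARD('n)) = 1" by (metis of_real_1 of_real_mult)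
      have "(\<bar>d\<bar> ^ DIM(real ^ 'n)) *\<^sub>R (f (y + d *\<^sub>R x) * (?c * of_real (inverse d ^ CARD('n) * ngauss x))) =
        (complex_of_real (d ^ CARD('n)) * of_real (inverse d ^ CARD('n))) * (?c * (f (y + d *\<^sub>R x) * of_real (ngauss x)))"
        using d by (simp add: scaleR_conv_of_real)
      thus "(\<bar>d\<bar> ^ DIM(real ^ 'n)) *\<^sub>R (f (y + d *\<^sub>R x) * (?c * of_real (inverse d ^ CARD('n) * ngauss ((y + d *\<^sub>R x - y) /\<^sub>R d)))) =
        ?c * (f (y + d *\<^sub>R x) * of_real (ngauss x))" unfolding 1 2 by simp
    qed
    finally show ?thesis .
  qed
  define d where "d k = inverse (real (Suc k))" for k
  have d: "d k > 0" for k by (simp add: d_def)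
  have dlim: "d \<longlonglongrightarrow> 0" unfolding d_def using LIMSEQ_inverse_real_of_nat by simp
  have "(\<lambda>k. LINT \<xi>|lborel. of_real (ngauss (d k *\<^sub>R \<xi>)) * (laplace f (cvec \<xi>) * cexp y (- cvec \<xi>))) \<longlonglongrightarrow>
     (LINT \<xi>|lborel. laplace f (cvec \<xi>) * cexp y (- cvec \<xi>))"
  proof (rule integral_dominated_convergence[where w = "\<lambda>\<xi>. cmod (laplace f (cvec \<xi>))"])
    show "integrable lborel (\<lambda>\<xi>. cmod (laplace f (cvec \<xi>)))" using intL by simp
    show "AE \<xi> in lborel. (\<lambda>k. of_real (ngauss (d k *\<^sub>R \<xi>)) * (laplace f (cvec \<xi>) * cexp y (- cvec \<xi>))) \<longlonglongrightarrow> laplace f (cvec \<xi>) * cexp y (- cvec \<xi>)"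
    proof (rule AE_I2)
      fix \<xi> :: "real ^ 'n"
      have "(\<lambda>k. ngauss (d k *\<^sub>R \<xi>)) \<longlonglongrightarrow> ngauss (0 *\<^sub>R \<xi>)"
        using continuous_on_ngauss[of "UNIV :: (real ^ 'n) set"] tendsto_scaleR[OF dlim tendsto_const[of \<xi>]]
        by (intro isCont_tendsto_compose[where g = ngauss]) (simp_all add: continuous_on_eq_continuous_at)
      hence "(\<lambda>k. of_real (ngauss (d k *\<^sub>R \<xi>)) * (laplace f (cvec \<xi>) * cexp y (- cvec \<xi>))) \<longlonglongrightarrow> of_real (ngauss (0 *\<^sub>R \<xi>)) * (laplace f (cvec \<xi>) * cexp y (- cvec \<xi>))"
        by (intro tendsto_intros)
      thus "(\<lambda>k. of_real (ngauss (d k *\<^sub>R \<xi>)) * (laplace f (cvec \<xi>) * cexp y (- cvec \<xi>))) \<longlonglongrightarrow> laplace f (cvec \<xi>) * cexp y (- cvec \<xi>)"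
        by (simp add: ngauss_facts)
    qed
    show "AE \<xi> in lborel. norm (of_real (ngauss (d k *\<^sub>R \<xi>)) * (laplace f (cvec \<xi>) * cexp y (- cvec \<xi>))) \<le> cmod (laplace f (cvec \<xi>))" for k
    proof (rule AE_I2)
      fix \<xi> :: "real ^ 'n"
      have "ngauss (d k *\<^sub>R \<xi>) * cmod (laplace f (cvec \<xi>)) \<le> cmod (laplace f (cvec \<xi>))"
        using ngauss_facts(3,4)[of "d k *\<^sub>R \<xi>"] by (intro mult_left_le_one_le) auto
      thus "norm (of_real (ngauss (d k *\<^sub>R \<xi>)) * (laplace f (cvec \<xi>) * cexp y (- cvec \<xi>))) \<le> cmod (laplace f (cvec \<xi>))"
        using ngauss_facts(3)[of "d k *\<^sub>R \<xi>"] by (simp add: norm_mult)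
    qed
  qed measurable
  moreover have "(\<lambda>k. LINT x|lborel. ?c * (f (y + d k *\<^sub>R x) * of_real (ngauss x))) \<longlonglongrightarrow> (LINT x|lborel. ?c * (f y * of_real (ngauss (x :: real ^ 'n))))"
  proof (rule integral_dominated_convergence[where w = "\<lambda>x. cmod ?c * (B * ngauss x)"])
    show "integrable lborel (\<lambda>x :: real ^ 'n. cmod ?c * (B * ngauss x))" by (intro integrable_mult_right ngauss_facts(1))
    show "AE x in lborel. (\<lambda>k. ?c * (f (y + d k *\<^sub>R x) * of_real (ngauss x))) \<longlonglongrightarrow> ?c * (f y * of_real (ngauss (x :: real ^ 'n)))"
    proof (rule AE_I2)
      fix x :: "real ^ 'n"
      have "(\<lambda>k. f (y + d k *\<^sub>R x)) \<longlonglongrightarrow> f (y + 0 *\<^sub>R x)"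
        using smooth_continuous_on[OF smooth_supported_smooth[OF f], of UNIV]
          tendsto_add[OF tendsto_const[of y] tendsto_scaleR[OF dlim tendsto_const[of x]]]
        by (intro isCont_tendsto_compose[where g = f]) (simp_all add: continuous_on_eq_continuous_at)
      thus "(\<lambda>k. ?c * (f (y + d k *\<^sub>R x) * of_real (ngauss x))) \<longlonglongrightarrow> ?c * (f y * of_real (ngauss x))"
        by (intro tendsto_intros) simp
    qed
    show "AE x in lborel. norm (?c * (f (y + d k *\<^sub>R x) * of_real (ngauss x))) \<le> cmod ?c * (B * ngauss x)" for k
    proof (rule AE_I2)
      fix x :: "real ^ 'n"
      have "cmod (f (y + d k *\<^sub>R x)) * ngauss x \<le> B * ngauss x"
        using B(2) ngauss_facts(3)[of x] by (intro mult_right_mono) auto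
      thus "norm (?c * (f (y + d k *\<^sub>R x) * of_real (ngauss x))) \<le> cmod ?c * (B * ngauss x)"
        using ngauss_facts(3)[of x] by (simp only: norm_mult norm_of_real abs_of_pos mult_left_mono norm_ge_zero)
    qed
  qed measurable
  ultimately have "(LINT \<xi>|lborel. laplace f (cvec \<xi>) * cexp y (- cvec \<xi>)) = (LINT x|lborel. ?c * (f y * of_real (ngauss (x :: real ^ 'n))))"
    unfolding key[OF d] by (rule LIMSEQ_unique)
  also have "\<dots> = ?c * f y * of_real (LINT x|lborel. ngauss (x :: real ^ 'n))" by simp
  \<comment> \<open>One factor sqrt(2 pi)^n comes from transforming the Gaussian, the other from its
    integral.\<close>
  also have "\<dots> = of_real (sqrt (2 * pi) ^ CARD('n) * sqrt (2 * pi) ^ CARD('n)) * f y"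
    by (simp only: ngauss_facts of_real_mult mult_ac)
  also have "sqrt (2 * pi) ^ CARD('n) * sqrt (2 * pi) ^ CARD('n) = (2 * pi) ^ CARD('n)"
    by (simp only: power_mult_distrib[symmetric] real_sqrt_mult_self abs_of_nonneg) simp
  finally show ?thesis .
qed

section \<open>Solution operators\<close>

text \<open>The contour of integration: \<open>\<xi> \<in> \<real>\<^sup>n\<close> is moved to the circle of radius 1 around \<open>\<xi>\<close> in the complex
  line with direction \<open>w \<xi>\<close>, parametrized by the second component of \<open>s\<close>.\<close>

definition contour :: "(real ^ 'n \<Rightarrow> real ^ 'n) \<Rightarrow> ((real ^ 'n) \<times> real) \<Rightarrow> complex ^ 'n::finite" where
  "contour w s = cvec (fst s) + cis (2 * pi * snd s) *s cvec (w (fst s))"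

text \<open>The indicator confines the circle parameter to one turn, so that all integrals extend
  over the full product space. The power of 2 pi is that of the inversion formula.\<close>

definition solker :: "nat \<Rightarrow> ('n::finite multiindex \<Rightarrow> complex) \<Rightarrow> (real ^ 'n \<Rightarrow> real ^ 'n) \<Rightarrow> ((real ^ 'n) \<times> real) \<Rightarrow> complex" where
  "solker m b w s = of_real (indicator {0..1} (snd s)) / (of_real ((2 * pi) ^ CARD('n)) * cpol m b (contour w s))"

text \<open>Written as a superposition of exponentials with frequencies on the negative contour, so
  that smoothness, derivatives and bounds are inherited from \<open>expint\<close>.\<close>

definition sol :: "nat \<Rightarrow> ('n::finite multiindex \<Rightarrow> complex) \<Rightarrow> (real ^ 'n \<Rightarrow> real ^ 'n) \<Rightarrow> (real ^ 'n \<Rightarrow> complex) \<Rightarrow> real ^ 'n \<Rightarrow> complex" where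
  "sol m b w f = expint lborel (\<lambda>s. solker m b w s * laplace f (contour w s)) (\<lambda>s. - contour w s)"

definition transposed :: "nat \<Rightarrow> ('n::finite multiindex \<Rightarrow> complex) \<Rightarrow> (real ^ 'n \<Rightarrow> complex) \<Rightarrow> real ^ 'n \<Rightarrow> complex" where
  "transposed m b f x = (\<Sum>\<alpha> | mi_order \<alpha> \<le> m. ((- 1) ^ mi_order \<alpha> * b \<alpha>) * ((- \<i>) ^ mi_order \<alpha> * mpartial \<alpha> f x))"

text \<open>Separates \<open>m\<close>, \<open>R\<close>, \<open>c\<close>, on which constants may
  depend, from \<open>b\<close> and \<open>w\<close>, over which all bounds are uniform. Positivity
  of P~ everywhere prevents zeros of the polynomial on the contour.\<close>

definition good_shift :: "nat \<Rightarrow> real \<Rightarrow> real \<Rightarrow> ('n::finite multiindex \<Rightarrow> complex) \<Rightarrow> (real ^ 'n \<Rightarrow> real ^ 'n) \<Rightarrow> bool" where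
  "good_shift m R c b w \<longleftrightarrow> w \<in> borel_measurable borel \<and> (\<forall>\<xi>. norm (w \<xi>) \<le> R) \<and> c > 0 \<and>
     (\<forall>\<xi> z. cmod z = 1 \<longrightarrow> c * ptilde m b \<xi> \<le> cmod (cpol m b (cvec \<xi> + z *s cvec (w \<xi>)))) \<and>
     (\<forall>\<xi>. ptilde m b \<xi> > 0)"

abbreviation lebs :: "((real ^ 'n::finite) \<times> real) measure" where
  "lebs \<equiv> lborel \<Otimes>\<^sub>M lborel"

abbreviation mcount :: "'n::finite itself \<Rightarrow> nat \<Rightarrow> real" where
  "mcount _ m \<equiv> real (card {\<alpha> :: 'n multiindex. mi_order \<alpha> \<le> m})"

section \<open>Estimates along the contour\<close>

lemma norm_cvec [simp]: "norm (cvec x) = norm x"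
  by (simp add: norm_vec_def)

lemma norm_vector_scalar_mult: "norm (c *s (v :: complex ^ 'n::finite)) = cmod c * norm v"
  by (simp add: norm_vec_def norm_mult L2_set_right_distrib)

lemma norm_contour_diff_le: "good_shift m R c b w \<Longrightarrow> norm (contour w s - cvec (fst s)) \<le> R"
  by (simp add: contour_def good_shift_def norm_vector_scalar_mult)

lemma good_shift_R_nonneg: "good_shift m R c b w \<Longrightarrow> R \<ge> 0"
  unfolding good_shift_def using norm_ge_zero order_trans by blast

lemma Im_contour_le: "good_shift m R c b w \<Longrightarrow> \<bar>Im (contour w s $ i)\<bar> \<le> R"
  using norm_contour_diff_le[of m R c b w s] Finite_Cartesian_Product.norm_nth_le[of "contour w s - cvec (fst s)" i]
    abs_Im_le_cmod[of "(contour w s - cvec (fst s)) $ i"] by simp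

lemma one_plus_norm_contour_le:
  assumes "good_shift m R c b w"
  shows "1 + norm (contour w s) \<le> (1 + R) * (1 + norm (fst s))"
proof -
  have "norm (contour w s) \<le> norm (contour w s - cvec (fst s)) + norm (fst s)"
    using norm_triangle_ineq[of "contour w s - cvec (fst s)" "cvec (fst s)"] by simp
  also have "\<dots> \<le> R + norm (fst s)" using norm_contour_diff_le[OF assms] by simp
  finally have "1 + norm (contour w s) \<le> 1 + R + norm (fst s)" by simp
  moreover have "R * norm (fst s) \<ge> 0" using good_shift_R_nonneg[OF assms] by simp
  ultimately show ?thesis by (simp add: algebra_simps)
qed

lemma measurable_contour [measurable (raw)]:
  assumes "good_shift m R c b w"
  shows "contour w \<in> borel_measurable (lborel \<Otimes>\<^sub>M lborel)"
proof -
  have [measurable]: "w \<in> borel_measurable borel" using assms by (simp add: good_shift_def)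
  have "contour w = (\<lambda>s. \<chi> i. of_real (fst s $ i) + cis (2 * pi * snd s) * of_real (w (fst s) $ i))"
    by (simp add: contour_def fun_eq_iff vec_eq_iff)
  also have "\<dots> \<in> borel_measurable (lborel \<Otimes>\<^sub>M lborel)"
  proof (subst borel_measurable_euclidean_space, intro ballI)
    fix u :: "complex ^ 'a" assume "u \<in> Basis"
    then obtain i v where u: "u = axis i v" by (auto simp: Basis_vec_def)
    have [measurable]: "cis \<in> borel_measurable borel"
      by (intro borel_measurable_continuous_onI continuous_intros)
    have "(\<lambda>x. (of_real (fst x $ i) + cis (2 * pi * snd x) * of_real (w (fst x) $ i)) \<bullet> v) \<in> borel_measurable (lborel \<Otimes>\<^sub>M lborel)"
      by measurable
    thus "(\<lambda>x. (\<chi> i. of_real (fst x $ i) + cis (2 * pi * snd x) * of_real (w (fst x) $ i)) \<bullet> u) \<in> borel_measurable (lborel \<Otimes>\<^sub>M lborel)"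
      unfolding u by (simp add: inner_axis)
  qed
  finally show ?thesis .
qed

lemma measurable_cpol [measurable]: "cpol m b \<in> borel_measurable borel"
  by (intro borel_measurable_continuous_onI continuous_on_cpol continuous_intros)

lemma measurable_solker [measurable (raw)]:
  assumes "good_shift m R c b w"
  shows "solker m b w \<in> borel_measurable (lborel \<Otimes>\<^sub>M lborel)"
proof -
  have [measurable]: "contour w \<in> borel_measurable (lborel \<Otimes>\<^sub>M lborel)" by (rule measurable_contour[OF assms])
  show ?thesis unfolding solker_def[abs_def] by measurable
qed

lemma cpol_contour_ge:
  assumes "good_shift m R c b w"
  shows "c * ptilde m b (fst s) \<le> cmod (cpol m b (contour w s))" "cpol m b (contour w s) \<noteq> 0"
proof -
  show *: "c * ptilde m b (fst s) \<le> cmod (cpol m b (contour w s))"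
    using assms unfolding good_shift_def contour_def by (metis norm_cis)
  have "c * ptilde m b (fst s) > 0" using assms by (simp add: good_shift_def)
  with * show "cpol m b (contour w s) \<noteq> 0" by auto
qed

text \<open>Slow variation moves the weight from the integration point to a free point \<eta>, at
  the price of a power of the distance. The origin gives the seminorm bounds, the output frequency
  gives the kernel bound of the regularity part.\<close>

lemma norm_solker_le:
  assumes g: "good_shift m R c b (w :: real ^ 'n::finite \<Rightarrow> _)"
  shows "cmod (solker m b w s) \<le> indicator {0..1} (snd s) * ((mcount TYPE('n) m)\<^sup>2 / c * (1 + norm (fst s - \<eta>)) ^ m / ptilde m b \<eta>)"
proof -
  have c: "c > 0" "ptilde m b (fst s) > 0" "ptilde m b \<eta> > 0" using g by (auto simp: good_shift_def)
  have "ptilde m b \<eta> \<le> (mcount TYPE('n) m)\<^sup>2 * (1 + norm (\<eta> - fst s)) ^ m * ptilde m b (fst s)"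
    using ptilde_slowly_varying[of m b "fst s" "\<eta> - fst s"] by simp
  hence "c * ptilde m b \<eta> \<le> c * ((mcount TYPE('n) m)\<^sup>2 * (1 + norm (\<eta> - fst s)) ^ m * ptilde m b (fst s))"
    using c by (intro mult_left_mono) auto
  also have "\<dots> = (mcount TYPE('n) m)\<^sup>2 * (1 + norm (fst s - \<eta>)) ^ m * (c * ptilde m b (fst s))"
    by (simp add: mult_ac norm_minus_commute)
  also have "\<dots> \<le> (mcount TYPE('n) m)\<^sup>2 * (1 + norm (fst s - \<eta>)) ^ m * cmod (cpol m b (contour w s))"
    using cpol_contour_ge(1)[OF g, of s] by (intro mult_left_mono) auto
  finally have *: "1 / cmod (cpol m b (contour w s)) \<le> (mcount TYPE('n) m)\<^sup>2 / c * (1 + norm (fst s - \<eta>)) ^ m / ptilde m b \<eta>"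
    using c cpol_contour_ge(2)[OF g, of s] by (simp add: field_simps)
  \<comment> \<open>The factor (2 pi)^(-n) is at most 1 and is dropped.\<close>
  have p: "(2 * pi) ^ CARD('n) \<ge> 1"
  proof (rule one_le_power)
    show "2 * pi \<ge> 1" using pi_gt3 by linarith
  qed
  have "cmod (solker m b w s) = indicator {0..1} (snd s) * (1 / cmod (cpol m b (contour w s)) / (2 * pi) ^ CARD('n))"
    by (simp add: solker_def norm_divide norm_mult norm_power indicator_def)
  also have "\<dots> \<le> indicator {0..1} (snd s) * (1 / cmod (cpol m b (contour w s)) / 1)"
    using p by (intro mult_left_mono divide_left_mono) auto
  also have "\<dots> \<le> indicator {0..1} (snd s) * ((mcount TYPE('n) m)\<^sup>2 / c * (1 + norm (fst s - \<eta>)) ^ m / ptilde m b \<eta>)"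
    using * by (intro mult_left_mono) auto
  finally show ?thesis .
qed

lemma integrable_indicator_01: "integrable lborel (indicator {0..1::real} :: real \<Rightarrow> real)"
  by (rule integrable_real_indicator) auto

text \<open>The circle parameter runs through an interval of length 1, so integrating it out costs
  no constant.\<close>

lemma lebs_integral_fst:
  fixes u :: "real ^ 'n::finite \<Rightarrow> real"
  assumes u: "integrable lborel u"
  shows "integrable lebs (\<lambda>s. indicator {0..1} (snd s) * u (fst s))" (is ?I)
    and "(LINT s|lebs. indicator {0..1} (snd s) * u (fst s)) = (LINT \<xi>|lborel. u \<xi>)" (is ?E)
proof -
  have [measurable]: "u \<in> borel_measurable borel" using u by auto
  show *: ?I
    by (rule lborel_pair.integrable_pair_bound[where u = "\<lambda>x. \<bar>u x\<bar>" and v = "indicator {0..1}"])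
       (use u integrable_indicator_01 in \<open>auto simp: mult.commute abs_mult\<close>)
  have "(LINT s|lebs. indicator {0..1} (snd s) * u (fst s)) = (LINT \<xi>|lborel. (LINT t|lborel. indicator {0..1::real} t * u \<xi>))"
    using lborel_pair.integral_fst'[OF *] by simp
  thus ?E by simp
qed

text \<open>The decay of the transform of \<open>f\<close> pays for all growth on the contour.
  \<open>C\<close> and \<open>M\<close> precede \<open>b\<close>, \<open>w\<close> and
  \<open>f\<close>; the polynomial contributes the factor 1 / P~(0) and nothing else.\<close>

lemma ex_expint_adm_solker:
  fixes K :: "(real ^ 'n::finite) set"
  assumes K: "compact K" and R: "R \<ge> 0"
  obtains C M where "C \<ge> 0" "\<And>b w f B. good_shift m R c b w \<Longrightarrow> f \<in> smooth_supported K \<Longrightarrow>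
     (\<And>\<alpha> x. mi_order \<alpha> \<le> M \<Longrightarrow> cmod (mpartial \<alpha> f x) \<le> B) \<Longrightarrow>
     integrable lebs (\<lambda>s. cmod (solker m b w s * laplace f (contour w s)) * (1 + norm (- contour w s)) ^ N) \<and>
     (LINT s|lebs. cmod (solker m b w s * laplace f (contour w s)) * (1 + norm (- contour w s)) ^ N) \<le> C * B / ptilde m b 0"
proof -
  define L where "L = 2 * CARD('n)"
  \<comment> \<open>Of these derivatives of \<open>f\<close>, 2n provide integrability,
    \<open>m\<close> compensate slow variation and \<open>N\<close> the moment.\<close>
  define M where "M = L + (m + N)"
  obtain C where C: "C \<ge> 0" "\<And>f B (z :: complex ^ 'n) \<xi>. f \<in> smooth_supported K \<Longrightarrow>
     (\<And>\<alpha> x. mi_order \<alpha> \<le> M \<Longrightarrow> cmod (mpartial \<alpha> f x) \<le> B) \<Longrightarrow> norm (z - cvec \<xi>) \<le> R \<Longrightarrow>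
     cmod (laplace f z) \<le> C * B * decay M \<xi>" using laplace_decay[OF K R] by blast
  \<comment> \<open>The absolute value makes the constant nonnegative at once; positivity of
    \<open>c\<close> is known only under \<open>good_shift\<close>.\<close>
  define A where "A = (mcount TYPE('n) m)\<^sup>2 / \<bar>c\<bar> * C * (1 + R) ^ N"
  define I where "I = (LINT x|lborel. decay L (x :: real ^ 'n))"
  have I0: "I \<ge> 0" unfolding I_def by simp
  show thesis
  proof (rule that[of "A * I" M])
    show "A * I \<ge> 0" using C R I0 by (simp add: A_def)
    fix b and w :: "real ^ 'n \<Rightarrow> real ^ 'n" and f B
    assume g: "good_shift m R c b w" and f: "f \<in> smooth_supported K"
      and B: "\<And>\<alpha> x. mi_order \<alpha> \<le> M \<Longrightarrow> cmod (mpartial \<alpha> f x) \<le> B"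
    have [measurable]: "contour w \<in> borel_measurable lebs" "solker m b w \<in> borel_measurable lebs"
      "f \<in> borel_measurable borel"
      using measurable_contour[OF g] measurable_solker[OF g] f by (auto simp: smooth_supported_def smooth_measurable)
    have c: "c > 0" using g by (simp add: good_shift_def)
    have p0: "ptilde m b 0 > 0" using g by (simp add: good_shift_def)
    have "cmod (mpartial (\<lambda>_. 0) f 0) \<le> B" by (rule B) (simp add: mi_order_def)
    hence B0: "B \<ge> 0" using norm_ge_zero order_trans by blast
    let ?F = "\<lambda>s. cmod (solker m b w s * laplace f (contour w s)) * (1 + norm (- contour w s)) ^ N"
    let ?G = "\<lambda>s :: (real ^ 'n) \<times> real. A * B / ptilde m b 0 * (indicator {0..1} (snd s) * decay L (fst s))"
    have le: "?F s \<le> ?G s" for s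
    proof -
      have "?F s \<le> (indicator {0..1} (snd s) * ((mcount TYPE('n) m)\<^sup>2 / c * (1 + norm (fst s)) ^ m / ptilde m b 0)) *
          (C * B * decay M (fst s)) * ((1 + R) * (1 + norm (fst s))) ^ N"
        unfolding norm_mult norm_minus_cancel
      proof (intro mult_mono power_mono one_plus_norm_contour_le[OF g])
        show "cmod (solker m b w s) \<le> indicator {0..1} (snd s) * ((mcount TYPE('n) m)\<^sup>2 / c * (1 + norm (fst s)) ^ m / ptilde m b 0)"
          using norm_solker_le[OF g, of s 0] by simp
        show "cmod (laplace f (contour w s)) \<le> C * B * decay M (fst s)"
          using norm_contour_diff_le[OF g] f B by (intro C(2)) auto
      qed (use c p0 C B0 R in auto)
      also have "\<dots> = A * B / ptilde m b 0 * (indicator {0..1} (snd s) * ((1 + norm (fst s)) ^ (m + N) * decay M (fst s)))"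
        using c unfolding A_def power_mult_distrib power_add by (simp add: mult_ac)
      also have "(1 + norm (fst s)) ^ (m + N) * decay M (fst s) = decay L (fst s)"
        unfolding M_def by (rule decay_mult_power)
      finally show ?thesis .
    qed
    have intG: "integrable lebs ?G"
      by (intro integrable_mult_right lebs_integral_fst integrable_decay) (simp add: L_def)
    have intF: "integrable lebs ?F"
    proof (rule Bochner_Integration.integrable_bound[OF intG])
      show "AE s in lebs. norm (?F s) \<le> norm (?G s)"
      proof (rule AE_I2)
        fix s
        have "norm (?F s) = ?F s" by simp
        also have "\<dots> \<le> ?G s" by (rule le)
        also have "\<dots> \<le> norm (?G s)" unfolding real_norm_def by (rule abs_ge_self)
        finally show "norm (?F s) \<le> norm (?G s)" .
      qed
    qed measurable
    have "integral\<^sup>L lebs ?F \<le> integral\<^sup>L lebs ?G" by (intro integral_mono intF intG le)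
    also have "\<dots> = A * I * B / ptilde m b 0"
      using lebs_integral_fst(2)[of "decay L :: real ^ 'n \<Rightarrow> real"] integrable_decay[of L, where 'n = 'n]
      by (simp add: I_def L_def)
    finally show "integrable lebs ?F \<and> integral\<^sup>L lebs ?F \<le> A * I * B / ptilde m b 0" using intF by simp
  qed
qed

lemma smooth_supported_mpartial_bounded:
  assumes "f \<in> smooth_supported K" "compact K"
  obtains B where "\<And>\<alpha> x. mi_order \<alpha> \<le> M \<Longrightarrow> cmod (mpartial \<alpha> f x) \<le> B"
proof -
  have "\<exists>B. \<forall>x. cmod (mpartial \<alpha> f x) \<le> B" for \<alpha>
    using smooth_supported_bounded[OF smooth_supported_mpartial[OF assms(1) compact_imp_closed[OF assms(2)]] assms(2), of \<alpha>]
    by metis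
  then obtain B where B: "\<And>\<alpha> x. cmod (mpartial \<alpha> f x) \<le> B \<alpha>" by metis
  have B0: "B \<alpha> \<ge> 0" for \<alpha> using B[of \<alpha> 0] norm_ge_zero order_trans by blast
  show thesis
  proof (rule that[of "\<Sum>\<alpha> | mi_order \<alpha> \<le> M. B \<alpha>"])
    fix \<alpha> :: "'a multiindex" and x assume "mi_order \<alpha> \<le> M"
    hence "B \<alpha> \<le> (\<Sum>\<alpha> | mi_order \<alpha> \<le> M. B \<alpha>)" using B0 by (intro member_le_sum) (auto simp: finite_mi_order_le)
    thus "cmod (mpartial \<alpha> f x) \<le> (\<Sum>\<alpha> | mi_order \<alpha> \<le> M. B \<alpha>)" using B order_trans by blast
  qed
qed

lemma expint_adm_sol:
  assumes g: "good_shift m R c b w" and f: "f \<in> smooth_supported K" and K: "compact K"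
  shows "expint_adm lebs (\<lambda>s. solker m b w s * laplace f (contour w s)) (\<lambda>s. - contour w s) R"
proof -
  have [measurable]: "contour w \<in> borel_measurable lebs" "solker m b w \<in> borel_measurable lebs"
      "f \<in> borel_measurable borel"
      using measurable_contour[OF g] measurable_solker[OF g] f by (auto simp: smooth_supported_def smooth_measurable)
  have "integrable lebs (\<lambda>s. cmod (solker m b w s * laplace f (contour w s)) * (1 + norm (- contour w s)) ^ N)" for N
  proof -
    obtain C M where C: "\<And>b w f B. good_shift m R c b w \<Longrightarrow> f \<in> smooth_supported K \<Longrightarrow>
     (\<And>\<alpha> x. mi_order \<alpha> \<le> M \<Longrightarrow> cmod (mpartial \<alpha> f x) \<le> B) \<Longrightarrow>
     integrable lebs (\<lambda>s. cmod (solker m b w s * laplace f (contour w s)) * (1 + norm (- contour w s)) ^ N)"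
      by (rule ex_expint_adm_solker[OF K good_shift_R_nonneg[OF g], of m c N]) blast
    obtain B where "\<And>\<alpha> x. mi_order \<alpha> \<le> M \<Longrightarrow> cmod (mpartial \<alpha> f x) \<le> B"
      using smooth_supported_mpartial_bounded[OF f K, of M] by blast
    from C[OF g f this] show ?thesis .
  qed
  thus ?thesis unfolding expint_adm_def using Im_contour_le[OF g] by auto
qed

lemma sol_eq: "sol m b w f = expint lebs (\<lambda>s. solker m b w s * laplace f (contour w s)) (\<lambda>s. - contour w s)"
  by (simp add: sol_def lborel_prod)

lemma smooth_sol:
  assumes "good_shift m R c b w" "f \<in> smooth_supported K" "compact K"
  shows "smooth (sol m b w f)"
  unfolding sol_eq by (rule smooth_expint[OF expint_adm_sol[OF assms]])

text \<open>Local in \<open>y\<close>, because the frequencies have imaginary parts up to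
  \<open>R\<close> and the exponentials may grow; \<open>E\<close> is the price on the ball of
  radius \<open>r\<close>.\<close>

lemma sol_bound:
  fixes K :: "(real ^ 'n::finite) set"
  assumes K: "compact K" and R: "R \<ge> 0"
  obtains C M where "C \<ge> 0" "\<And>b w f B (\<alpha> :: 'n multiindex) (y :: real ^ 'n). good_shift m R c b w \<Longrightarrow> f \<in> smooth_supported K \<Longrightarrow>
     (\<And>\<alpha> x. mi_order \<alpha> \<le> M \<Longrightarrow> cmod (mpartial \<alpha> f x) \<le> B) \<Longrightarrow> mi_order \<alpha> \<le> j \<Longrightarrow> norm y \<le> r \<Longrightarrow>
     cmod (mpartial \<alpha> (sol m b w f) y) \<le> C * B / ptilde m b 0"
proof -
  obtain C M where C: "C \<ge> 0" "\<And>b w f B. good_shift m R c b w \<Longrightarrow> f \<in> smooth_supported K \<Longrightarrow>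
     (\<And>\<alpha> x. mi_order \<alpha> \<le> M \<Longrightarrow> cmod (mpartial \<alpha> f x) \<le> B) \<Longrightarrow>
     integrable lebs (\<lambda>s. cmod (solker m b w s * laplace f (contour w s)) * (1 + norm (- contour w s)) ^ j) \<and>
     (LINT s|lebs. cmod (solker m b w s * laplace f (contour w s)) * (1 + norm (- contour w s)) ^ j) \<le> C * B / ptilde m b 0"
    by (rule ex_expint_adm_solker[OF K R, of m c j]) blast
  define E where "E = exp (real CARD('n) * R * r)"
  show thesis
  proof (rule that[of "E * C" M])
    show "E * C \<ge> 0" using C by (simp add: E_def)
    fix b and w :: "real ^ 'n \<Rightarrow> real ^ 'n" and f B and \<alpha> :: "'n multiindex" and y :: "real ^ 'n"
    assume g: "good_shift m R c b w" and f: "f \<in> smooth_supported K"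
      and B: "\<And>\<alpha> x. mi_order \<alpha> \<le> M \<Longrightarrow> cmod (mpartial \<alpha> f x) \<le> B" and \<alpha>: "mi_order \<alpha> \<le> j" and y: "norm y \<le> r"
    let ?F = "\<lambda>k s. cmod (solker m b w s * laplace f (contour w s)) * (1 + norm (- contour w s)) ^ k"
    note adm = expint_adm_sol[OF g f K]
    have "cmod (mpartial \<alpha> (sol m b w f) y) \<le> exp (real CARD('n) * R * norm y) * integral\<^sup>L lebs (?F (mi_order \<alpha>))"
      unfolding sol_eq by (rule norm_mpartial_expint_le[OF adm])
    also have "\<dots> \<le> E * integral\<^sup>L lebs (?F j)"
    proof (intro mult_mono)
      show "exp (real CARD('n) * R * norm y) \<le> E" using y R by (auto simp: E_def intro!: mult_left_mono)
      show "integral\<^sup>L lebs (?F (mi_order \<alpha>)) \<le> integral\<^sup>L lebs (?F j)"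
        using adm \<alpha> unfolding expint_adm_def by (intro integral_mono mult_left_mono power_increasing) auto
    qed (auto simp: E_def)
    also have "\<dots> \<le> E * (C * B / ptilde m b 0)"
      using C(2)[OF g f B] by (intro mult_left_mono) (auto simp: E_def)
    finally show "cmod (mpartial \<alpha> (sol m b w f) y) \<le> E * C * B / ptilde m b 0" by simp
  qed
qed

section \<open>The left inverse of the transposed operator\<close>

lemma laplace_sum:
  assumes "\<And>i. i \<in> A \<Longrightarrow> f i \<in> smooth_supported K" "compact K"
  shows "laplace (\<lambda>x. \<Sum>i\<in>A. c i * f i x) z = (\<Sum>i\<in>A. c i * laplace (f i) z)"
proof -
  have "laplace (\<lambda>x. \<Sum>i\<in>A. c i * f i x) z = (LINT x|lborel. (\<Sum>i\<in>A. c i * (cexp x z * f i x)))"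
    by (simp add: laplace_def sum_distrib_left mult_ac)
  also have "\<dots> = (\<Sum>i\<in>A. LINT x|lborel. c i * (cexp x z * f i x))"
    using integrable_laplace[OF assms] by (intro Bochner_Integration.integral_sum) simp
  finally show ?thesis by (simp add: laplace_def)
qed

lemma laplace_add:
  "f \<in> smooth_supported K \<Longrightarrow> g \<in> smooth_supported K \<Longrightarrow> compact K \<Longrightarrow>
    laplace (\<lambda>x. f x + g x) z = laplace f z + laplace g z"
  using integrable_laplace[of f K z] integrable_laplace[of g K z] by (simp add: laplace_def distrib_left)

lemma laplace_cmult: "laplace (\<lambda>x. c * f x) z = c * laplace f z"
  by (simp add: laplace_def mult.left_commute)

lemma sol_add:
  assumes "good_shift m R c b w" "f \<in> smooth_supported K" "g \<in> smooth_supported K" "compact K"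
  shows "sol m b w (\<lambda>x. f x + g x) = (\<lambda>y. sol m b w f y + sol m b w g y)"
  using expint_integrable[OF expint_adm_sol[OF assms(1,2,4)]] expint_integrable[OF expint_adm_sol[OF assms(1,3,4)]]
  by (auto simp: sol_eq expint_def laplace_add[OF assms(2-4)] algebra_simps)

lemma sol_cmult: "sol m b w (\<lambda>x. a * f x) = (\<lambda>y. a * sol m b w f y)"
  by (auto simp: sol_eq expint_def laplace_cmult fun_eq_iff mult_ac integral_mult_right_zero[symmetric] simp del: integral_mult_right_zero)

lemma transposed_smooth_supported:
  assumes "f \<in> smooth_supported K" "closed K"
  shows "transposed m b f \<in> smooth_supported K"
  using smooth_supported_mpartial[OF assms] unfolding transposed_def[abs_def] smooth_supported_def
  by (auto intro!: smooth_sum smooth_cmult)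

lemma laplace_transposed:
  assumes "f \<in> smooth_supported K" "compact K"
  shows "laplace (transposed m b f) z = cpol m b z * laplace f z"
proof -
  have "laplace (transposed m b f) z = (\<Sum>\<alpha> | mi_order \<alpha> \<le> m.
    ((- 1) ^ mi_order \<alpha> * b \<alpha> * (- \<i>) ^ mi_order \<alpha>) * laplace (mpartial \<alpha> f) z)"
    unfolding transposed_def[abs_def] mult.assoc[symmetric]
    by (rule laplace_sum[OF smooth_supported_mpartial[OF assms(1) compact_imp_closed] assms(2)]) (rule assms)
  also have "\<dots> = (\<Sum>\<alpha> | mi_order \<alpha> \<le> m. b \<alpha> * cmono \<alpha> z * laplace f z)"
  proof (rule sum.cong[OF refl])
    fix \<alpha> :: "'a multiindex"
    \<comment> \<open>One power of -i belongs to D, the other comes from integration by parts;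
      together they cancel the sign (-1)^k of the transpose.\<close>
    have "(- 1) ^ k * ((- \<i>) ^ k * (- \<i>) ^ k) = 1" for k
      by (simp add: power_mult_distrib[symmetric])
    hence "(- 1) ^ k * b \<alpha> * (- \<i>) ^ k * ((- \<i>) ^ k * u) = b \<alpha> * u" for k u
      by (metis (no_types, lifting) mult.assoc mult.commute mult_1)
    thus "((- 1) ^ mi_order \<alpha> * b \<alpha> * (- \<i>) ^ mi_order \<alpha>) * laplace (mpartial \<alpha> f) z = b \<alpha> * cmono \<alpha> z * laplace f z"
      unfolding laplace_mpartial[OF assms] by (simp only: mult.assoc)
  qed
  finally show ?thesis by (simp add: cpol_def sum_distrib_right)
qed

text \<open>After the exchange of integrals only the scalar exponential \<open>E\<close> depends on
  the circle parameter, and its mean is 1. Holomorphy in several variables is thereby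
  bypassed.\<close>

lemma circle_mean_laplace:
  assumes f: "f \<in> smooth_supported (K :: (real ^ 'n::finite) set)" and K: "compact K"
  shows "(LINT t|lborel. indicator {0..1} t *\<^sub>R (laplace f (cvec \<xi> + cis (2 * pi * t) *s u) * cexp y (- (cvec \<xi> + cis (2 * pi * t) *s u))))
    = laplace f (cvec \<xi>) * cexp y (- cvec \<xi>)"
proof -
  have fm[measurable]: "f \<in> borel_measurable borel" using f by (auto simp: smooth_supported_def smooth_measurable)
  have cism[measurable]: "cis \<in> borel_measurable borel" by (intro borel_measurable_continuous_onI continuous_intros)
  let ?z = "\<lambda>t. cvec \<xi> + cis (2 * pi * t) *s u"
  define E where "E x t = exp (\<i> * cdot (x - y) u * cis (2 * pi * t))" for x t
  have e: "cexp x (?z t) * cexp y (- ?z t) = cexp (x - y) (cvec \<xi>) * E x t" for x t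
    unfolding E_def by (simp add: cexp_def exp_add[symmetric] cdot_simps algebra_simps)
  have "(LINT t|lborel. indicator {0..1} t *\<^sub>R (laplace f (?z t) * cexp y (- ?z t))) =
     (LINT t|lborel. LINT x|lborel. indicator {0..1} t *\<^sub>R (f x * cexp (x - y) (cvec \<xi>) * E x t))"
  proof (intro Bochner_Integration.integral_cong refl)
    fix t
    have "indicator {0..1} t *\<^sub>R (laplace f (?z t) * cexp y (- ?z t)) =
       (LINT x|lborel. indicator {0..1} t *\<^sub>R ((cexp x (?z t) * cexp y (- ?z t)) * f x))"
      unfolding laplace_def by (simp add: mult_ac integral_mult_right_zero[symmetric] del: integral_mult_right_zero)
    thus "indicator {0..1} t *\<^sub>R (laplace f (?z t) * cexp y (- ?z t)) = (LINT x|lborel. indicator {0..1} t *\<^sub>R (f x * cexp (x - y) (cvec \<xi>) * E x t))"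
      unfolding e by (simp add: mult_ac)
  qed
  also have "\<dots> = (LINT x|lborel. LINT t|lborel. indicator {0..1} t *\<^sub>R (f x * cexp (x - y) (cvec \<xi>) * E x t))"
  proof (rule lborel_pair.Fubini_integral[symmetric])
    \<comment> \<open>The second factor bounds \<open>E x t\<close> for all points of the circle at
      once.\<close>
    let ?v = "\<lambda>x. cmod (f x) * exp (cmod (cdot (x - y) u))"
    have "integrable lborel ?v"
    proof (rule integrable_compact_support[OF _ K])
      have "continuous_on UNIV (\<lambda>x. cdot (x - y) u)" unfolding cdot_def by (intro continuous_intros)
      thus "continuous_on UNIV ?v" using smooth_continuous_on[OF smooth_supported_smooth[OF f]]
        by (intro continuous_intros) auto
    qed (use f in \<open>simp add: smooth_supported_def\<close>)
    moreover have "norm (indicator {0..1} t *\<^sub>R (f x * cexp (x - y) (cvec \<xi>) * E x t)) \<le> indicator {0..1} t * ?v x" for x t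
    proof -
      have "cmod (E x t) \<le> exp (cmod (cdot (x - y) u))"
        unfolding E_def using norm_exp[of "\<i> * cdot (x - y) u * cis (2 * pi * t)"] by (simp add: norm_mult)
      thus ?thesis by (simp add: norm_mult indicator_def mult_left_mono)
    qed
    ultimately have "integrable (lborel \<Otimes>\<^sub>M lborel) (\<lambda>p. indicator {0..1} (fst p) *\<^sub>R (f (snd p) * cexp (snd p - y) (cvec \<xi>) * E (snd p) (fst p)))"
      by (intro lborel_pair.integrable_pair_bound[where u = "indicator {0..1}" and v = ?v])
         (auto simp: integrable_indicator_01 E_def)
    moreover have "(\<lambda>(t, x). indicator {0..1} t *\<^sub>R (f x * cexp (x - y) (cvec \<xi>) * E x t)) =
      (\<lambda>p. indicator {0..1} (fst p) *\<^sub>R (f (snd p) * cexp (snd p - y) (cvec \<xi>) * E (snd p) (fst p)))"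
      by (simp add: fun_eq_iff)
    ultimately show "integrable (lborel \<Otimes>\<^sub>M lborel) (\<lambda>(t, x). indicator {0..1} t *\<^sub>R (f x * cexp (x - y) (cvec \<xi>) * E x t))"
      by (simp only:)
  qed
  also have "\<dots> = (LINT x|lborel. f x * cexp (x - y) (cvec \<xi>) * 1)"
  proof (intro Bochner_Integration.integral_cong refl)
    fix x
    have "(LINT t|lborel. indicator {0..1} t *\<^sub>R (f x * cexp (x - y) (cvec \<xi>) * E x t)) =
       (LINT t|lborel. (f x * cexp (x - y) (cvec \<xi>)) * (indicator {0..1} t *\<^sub>R E x t))" by simp
    also have "\<dots> = f x * cexp (x - y) (cvec \<xi>) * 1"
      unfolding E_def integral_mult_right_zero integral_exp_circle(2) ..
    finally show "(LINT t|lborel. indicator {0..1} t *\<^sub>R (f x * cexp (x - y) (cvec \<xi>) * E x t)) = f x * cexp (x - y) (cvec \<xi>) * 1" .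
  qed
  also have "\<dots> = (LINT x|lborel. cexp y (- cvec \<xi>) * (cexp x (cvec \<xi>) * f x))"
    using cexp_add_left[of x "- y" "cvec \<xi>" for x] by (simp add: cexp_minus mult_ac)
  finally show ?thesis by (simp add: laplace_def mult.commute)
qed

text \<open>A left inverse is what the equation asks for: a functional composed with
  \<open>sol\<close> and evaluated at the transposed operator of \<open>f\<close> returns its value
  at \<open>f\<close>.\<close>

lemma sol_transposed:
  assumes g: "good_shift m R c b w" and f: "f \<in> smooth_supported (K :: (real ^ 'n::finite) set)" and K: "compact K"
  shows "sol m b w (transposed m b f) = f"
proof
  fix y
  let ?c = "of_real ((2 * pi) ^ CARD('n)) :: complex"
  have c: "?c \<noteq> 0" by simp
  let ?h = "\<lambda>\<xi> t. indicator {0..1} t *\<^sub>R (laplace f (cvec \<xi> + cis (2 * pi * t) *s cvec (w \<xi>)) * cexp y (- (cvec \<xi> + cis (2 * pi * t) *s cvec (w \<xi>))))"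
  have tf: "transposed m b f \<in> smooth_supported K" by (rule transposed_smooth_supported[OF f compact_imp_closed[OF K]])
  \<comment> \<open>The polynomial cancels pointwise on the contour, where it has no zeros. What
    remains extends to an entire function of the frequency, to which the circle mean
    applies.\<close>
  have eq: "solker m b w s * laplace (transposed m b f) (contour w s) * cexp y (- contour w s) = inverse ?c * ?h (fst s) (snd s)" for s
  proof -
    have "?h (fst s) (snd s) = indicator {0..1} (snd s) *\<^sub>R (laplace f (contour w s) * cexp y (- contour w s))"
      by (simp only: contour_def)
    thus ?thesis using cpol_contour_ge(2)[OF g, of s]
      unfolding laplace_transposed[OF f K] solker_def
      by (simp only: divide_inverse scaleR_conv_of_real inverse_mult_distrib) (simp add: field_simps)
  qed
  have int: "integrable lebs (\<lambda>s. inverse ?c * ?h (fst s) (snd s))"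
    using expint_integrable[OF expint_adm_sol[OF g tf K], of y] unfolding eq .
  have "sol m b w (transposed m b f) y = (LINT s|lebs. inverse ?c * ?h (fst s) (snd s))"
    unfolding sol_eq expint_def eq ..
  also have "\<dots> = (LINT \<xi>|lborel. LINT t|lborel. inverse ?c * ?h \<xi> t)"
    using lborel_pair.integral_fst'[OF int] by simp
  also have "\<dots> = (LINT \<xi>|lborel. inverse ?c * (laplace f (cvec \<xi>) * cexp y (- cvec \<xi>)))"
    unfolding integral_mult_right_zero circle_mean_laplace[OF f K] ..
  also have "\<dots> = inverse ?c * (?c * f y)"
    by (simp only: integral_mult_right_zero fourier_inversion[OF f K])
  also have "\<dots> = f y" using left_inverse[OF c] by (simp only: mult.assoc[symmetric] mult_1)
  finally show "sol m b w (transposed m b f) y = f y" .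
qed

section \<open>Products and Schwartz seminorms\<close>

text \<open>A qualitative Leibniz estimate with constant independent of \<open>g\<close> and
  \<open>x\<close>, by induction on the number of derivatives and without multinomial coefficients.
  Lists replace multi-indices because the induction removes one derivative at a time.\<close>

lemma leibniz_bound_list:
  assumes "smooth f" "compact K"
  shows "\<exists>C\<ge>0. \<forall>g x B. smooth g \<longrightarrow> x \<in> K \<longrightarrow> (\<forall>js. length js \<le> k \<longrightarrow> cmod (foldr partial_deriv js g x) \<le> B) \<longrightarrow>
    (\<forall>is. length is \<le> k \<longrightarrow> cmod (foldr partial_deriv is (\<lambda>x. f x * g x) x) \<le> C * B)"
  using assms(1)
proof (induction k arbitrary: f)
  case 0
  have "compact (f ` K)" using assms(2) 0 by (intro compact_continuous_image smooth_continuous_on)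
  then obtain D where D: "\<And>y. y \<in> f ` K \<Longrightarrow> cmod y \<le> D" using compact_imp_bounded bounded_iff by metis
  show ?case
  proof (intro exI[of _ "max D 0"] conjI allI impI)
    fix g :: "real ^ 'a \<Rightarrow> complex" and x B and "is" :: "'a list"
    assume *: "x \<in> K" "\<forall>js. length js \<le> 0 \<longrightarrow> cmod (foldr partial_deriv js g x) \<le> B" "length is \<le> 0"
    hence "cmod (g x) \<le> B" by (metis foldr.simps(1) id_apply le_refl list.size(3))
    moreover have "cmod (f x) \<le> max D 0" using D[of "f x"] *(1) by auto
    ultimately show "cmod (foldr partial_deriv is (\<lambda>x. f x * g x) x) \<le> max D 0 * B"
      using *(3) by (auto simp: norm_mult intro!: mult_mono)
  qed auto
next
  case (Suc k)
  let ?P = "\<lambda>f C. C \<ge> 0 \<and> (\<forall>g x B. smooth g \<longrightarrow> x \<in> K \<longrightarrow> (\<forall>js. length js \<le> k \<longrightarrow> cmod (foldr partial_deriv js g x) \<le> B) \<longrightarrow>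
    (\<forall>is. length is \<le> k \<longrightarrow> cmod (foldr partial_deriv is (\<lambda>x. f x * g x) x) \<le> C * B))"
  obtain C0 where C0: "?P f C0" using Suc.IH[OF Suc.prems] by blast
  have "\<forall>i. \<exists>C. ?P (partial_deriv i f) C" using Suc.IH[OF smooth_partial_deriv[OF Suc.prems]] by blast
  from choice[OF this] obtain C1 where C1: "\<And>i. ?P (partial_deriv i f) (C1 i)" by blast
  define C where "C = 2 * C0 + (\<Sum>i\<in>UNIV. C1 i)"
  have C1s: "C1 i \<le> (\<Sum>i\<in>UNIV. C1 i)" for i using C1 by (intro member_le_sum) auto
  have Cge: "C \<ge> 0" "C0 \<le> C" "C1 i + C0 \<le> C" for i
    using C0 C1 C1s[of i] by (auto simp: C_def intro!: add_nonneg_nonneg sum_nonneg)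
  show ?case
  proof (intro exI[of _ C] conjI allI impI Cge)
    fix g :: "real ^ 'a \<Rightarrow> complex" and x B and "is" :: "'a list"
    assume g: "smooth g" and x: "x \<in> K" and B: "\<forall>js. length js \<le> Suc k \<longrightarrow> cmod (foldr partial_deriv js g x) \<le> B"
      and l: "length is \<le> Suc k"
    have B0: "B \<ge> 0" using B[rule_format, of "[]"] norm_ge_zero order_trans by (metis le0 list.size(3))
    have Bk: "\<forall>js. length js \<le> k \<longrightarrow> cmod (foldr partial_deriv js g x) \<le> B" using B by simp
    show "cmod (foldr partial_deriv is (\<lambda>x. f x * g x) x) \<le> C * B"
    \<comment> \<open>The last list entry is the innermost derivative, the one acting on the product
      itself. After one product rule the induction hypothesis covers both summands, with
      \<open>f\<close> or its derivative as the fixed factor.\<close>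
    proof (cases "is" rule: rev_cases)
      case Nil
      have "cmod (foldr partial_deriv [] (\<lambda>x. f x * g x) x) \<le> C0 * B" using C0 g x Bk by (metis le0 list.size(3))
      hence "cmod (foldr partial_deriv is (\<lambda>x. f x * g x) x) \<le> C0 * B" unfolding Nil .
      also have "\<dots> \<le> C * B" using Cge B0 by (intro mult_right_mono)
      finally show ?thesis .
    next
      case (snoc js i)
      have Bi: "cmod (foldr partial_deriv ks (partial_deriv i g) x) \<le> B" if "length ks \<le> k" for ks
        using B[rule_format, of "ks @ [i]"] that by simp
      have "foldr partial_deriv is (\<lambda>x. f x * g x) = foldr partial_deriv js (\<lambda>x. partial_deriv i f x * g x + f x * partial_deriv i g x)"
        using Suc.prems g by (simp add: snoc partial_deriv_mult smooth_differentiable)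
      also have "\<dots> = (\<lambda>x. foldr partial_deriv js (\<lambda>x. partial_deriv i f x * g x) x + foldr partial_deriv js (\<lambda>x. f x * partial_deriv i g x) x)"
        by (rule foldr_partial_deriv_add) (intro smooth_mult smooth_partial_deriv Suc.prems g)+
      finally have "cmod (foldr partial_deriv is (\<lambda>x. f x * g x) x) \<le>
         cmod (foldr partial_deriv js (\<lambda>x. partial_deriv i f x * g x) x) + cmod (foldr partial_deriv js (\<lambda>x. f x * partial_deriv i g x) x)"
        by (simp add: norm_triangle_ineq)
      also have "\<dots> \<le> C1 i * B + C0 * B"
      proof (rule add_mono)
        show "cmod (foldr partial_deriv js (\<lambda>x. partial_deriv i f x * g x) x) \<le> C1 i * B"
          using C1[of i] g x Bk l snoc by simp
        show "cmod (foldr partial_deriv js (\<lambda>x. f x * partial_deriv i g x) x) \<le> C0 * B"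
          using C0 smooth_partial_deriv[OF g] x Bi l snoc by simp
      qed
      also have "\<dots> = (C1 i + C0) * B" by (simp add: distrib_right)
      also have "\<dots> \<le> C * B" using Cge B0 by (intro mult_right_mono) auto
      finally show ?thesis .
    qed
  qed
qed

lemma leibniz_bound:
  assumes "smooth (f :: real ^ 'n::finite \<Rightarrow> complex)" "compact K"
  obtains C where "C \<ge> 0" "\<And>g x B \<alpha>. smooth g \<Longrightarrow> x \<in> K \<Longrightarrow> (\<And>\<beta>. mi_order \<beta> \<le> k \<Longrightarrow> cmod (mpartial \<beta> g x) \<le> B) \<Longrightarrow>
    mi_order \<alpha> \<le> k \<Longrightarrow> cmod (mpartial \<alpha> (\<lambda>x. f x * g x) x) \<le> C * B"
proof -
  obtain C where C: "C \<ge> 0" "\<forall>g x B. smooth g \<longrightarrow> x \<in> K \<longrightarrow> (\<forall>js. length js \<le> k \<longrightarrow> cmod (foldr partial_deriv js g x) \<le> B) \<longrightarrow>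
    (\<forall>is. length is \<le> k \<longrightarrow> cmod (foldr partial_deriv is (\<lambda>x. f x * g x) x) \<le> C * B)"
    using leibniz_bound_list[OF assms] by blast
  show thesis
  proof (rule that[OF C(1)])
    fix g x B and \<alpha> :: "'n multiindex"
    assume g: "smooth g" "x \<in> K" and B: "\<And>\<beta>. mi_order \<beta> \<le> k \<Longrightarrow> cmod (mpartial \<beta> g x) \<le> B" and \<alpha>: "mi_order \<alpha> \<le> k"
    have 1: "\<forall>js. length js \<le> k \<longrightarrow> cmod (foldr partial_deriv js g x) \<le> B"
      using B g by (simp add: foldr_partial_deriv mi_order_count_list)
    obtain "is" where "is": "count_list is = \<alpha>" using ex_list_of_multiindex[of \<alpha>] by blast
    hence "length is \<le> k" using \<alpha> mi_order_count_list[of "is"] by simp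
    with C(2) g 1 have "cmod (foldr partial_deriv is (\<lambda>x. f x * g x) x) \<le> C * B" by blast
    thus "cmod (mpartial \<alpha> (\<lambda>x. f x * g x) x) \<le> C * B"
      using foldr_partial_deriv[OF smooth_mult[OF assms(1) g(1)], of "is"] "is" by simp
  qed
qed

lemma abs_monomial_le: "\<bar>monomial \<beta> x\<bar> \<le> (1 + norm x) ^ mi_order \<beta>"
proof -
  have "\<bar>monomial \<beta> x\<bar> = cmod (cmono \<beta> (cvec x))"
    by (simp add: monomial_def cmono_def prod_norm[symmetric] norm_power abs_prod power_abs)
  also have "\<dots> \<le> norm x ^ mi_order \<beta>" by (rule cmod_cmono_cvec_le)
  also have "\<dots> \<le> (1 + norm x) ^ mi_order \<beta>" by (intro power_mono) auto
  finally show ?thesis .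
qed

lemma schwartz_norm_leI:
  assumes "\<And>\<alpha> x. mi_order \<alpha> \<le> j \<Longrightarrow> (1 + norm x) ^ j * cmod (mpartial \<alpha> f x) \<le> B"
  shows "schwartz_norm j f \<le> ennreal B"
  unfolding schwartz_norm_def sup_on_def
proof (intro SUP_least)
  fix \<alpha> \<beta> :: "'a multiindex" and x :: "real ^ 'a"
  assume *: "\<alpha> \<in> {\<alpha>. mi_order \<alpha> \<le> j}" "\<beta> \<in> {\<beta>. mi_order \<beta> \<le> j}"
  have "\<bar>monomial \<beta> x\<bar> \<le> (1 + norm x) ^ mi_order \<beta>" by (rule abs_monomial_le)
  also have "\<dots> \<le> (1 + norm x) ^ j" using * by (intro power_increasing) auto
  finally have "cmod (of_real (monomial \<beta> x) * mpartial \<alpha> f x) \<le> (1 + norm x) ^ j * cmod (mpartial \<alpha> f x)"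
    by (simp add: norm_mult mult_right_mono)
  also have "\<dots> \<le> B" using assms * by simp
  finally show "ennreal (cmod (of_real (monomial \<beta> x) * mpartial \<alpha> f x)) \<le> ennreal B" by (rule ennreal_leI)
qed

lemma schwartz_norm_bound:
  assumes "f \<in> schwartz_functions" "mi_order \<alpha> \<le> j"
  shows "cmod (mpartial \<alpha> f x) \<le> enn2real (schwartz_norm j f)"
proof -
  have "ennreal (cmod (of_real (monomial (\<lambda>_. 0) x) * mpartial \<alpha> f x)) \<le> schwartz_norm j f"
    unfolding schwartz_norm_def sup_on_def
    using assms(2) by (intro SUP_upper2[of \<alpha>] SUP_upper2[of "\<lambda>_. 0"] SUP_upper2[of x]) (auto simp: mi_order_def)
  moreover have "schwartz_norm j f < \<infinity>" using assms(1) by (simp add: schwartz_functions_def)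
  moreover have "monomial (\<lambda>_. 0) x = 1" by (simp add: monomial_def)
  ultimately have "enn2real (ennreal (cmod (mpartial \<alpha> f x))) \<le> enn2real (schwartz_norm j f)"
    by (intro enn2real_mono) simp_all
  thus ?thesis by simp
qed

lemma compactD_norm:
  assumes "compact (K :: 'a::real_normed_vector set)"
  obtains r where "r \<ge> 0" "\<And>x. x \<in> K \<Longrightarrow> norm x \<le> r"
proof -
  obtain r where "\<And>x. x \<in> K \<Longrightarrow> norm x \<le> r" using compact_imp_bounded[OF assms] bounded_iff by metis
  thus thesis using that[of "max 0 r"] by force
qed

text \<open>On a compact set the polynomial weights of the Schwartz seminorms are bounded, so
  uniform bounds of derivatives suffice.\<close>

lemma schwartz_norm_smooth_supported:
  fixes K :: "(real ^ 'n::finite) set"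
  assumes "compact K"
  obtains C where "C \<ge> 0" "\<And>f B. f \<in> smooth_supported K \<Longrightarrow> (\<And>\<alpha> x. mi_order \<alpha> \<le> j \<Longrightarrow> cmod (mpartial \<alpha> f x) \<le> B) \<Longrightarrow>
    schwartz_norm j f \<le> ennreal (C * B)"
proof -
  obtain r where r: "r \<ge> 0" "\<And>x. x \<in> K \<Longrightarrow> norm x \<le> r" using compactD_norm[OF assms] by blast
  show thesis
  proof (rule that[of "(1 + r) ^ j"])
    show "(1 + r) ^ j \<ge> 0" using r by simp
    fix f :: "real ^ 'n \<Rightarrow> complex" and B
    assume f: "f \<in> smooth_supported K" and B: "\<And>\<alpha> x. mi_order \<alpha> \<le> j \<Longrightarrow> cmod (mpartial \<alpha> f x) \<le> B"
    have "cmod (mpartial (\<lambda>_. 0) f 0) \<le> B" by (rule B) (simp add: mi_order_def)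
    hence B0: "B \<ge> 0" using norm_ge_zero order_trans by blast
    show "schwartz_norm j f \<le> ennreal ((1 + r) ^ j * B)"
    proof (rule schwartz_norm_leI)
      fix \<alpha> :: "'n multiindex" and x assume \<alpha>: "mi_order \<alpha> \<le> j"
      show "(1 + norm x) ^ j * cmod (mpartial \<alpha> f x) \<le> (1 + r) ^ j * B"
      proof (cases "x \<in> K")
        case True
        thus ?thesis using r B[OF \<alpha>] by (intro mult_mono power_mono) auto
      next
        case False
        thus ?thesis using smooth_supported_mpartial[OF f compact_imp_closed[OF assms], of \<alpha>] r B0
          by (simp add: smooth_supported_def)
      qed
    qed
  qed
qed

lemma smooth_supported_imp_schwartz:
  assumes "f \<in> smooth_supported K" "compact K"
  shows "f \<in> schwartz_functions"
  unfolding schwartz_functions_def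
proof (intro CollectI conjI allI)
  show "smooth f" using assms(1) by (rule smooth_supported_smooth)
  fix j
  obtain C where C: "\<And>f B. f \<in> smooth_supported K \<Longrightarrow> (\<And>\<alpha> x. mi_order \<alpha> \<le> j \<Longrightarrow> cmod (mpartial \<alpha> f x) \<le> B) \<Longrightarrow>
    schwartz_norm j f \<le> ennreal (C * B)" using schwartz_norm_smooth_supported[OF assms(2), of j] by metis
  obtain B where "\<And>\<alpha> x. mi_order \<alpha> \<le> j \<Longrightarrow> cmod (mpartial \<alpha> f x) \<le> B"
    using smooth_supported_mpartial_bounded[OF assms] by blast
  from C[OF assms(1) this] show "schwartz_norm j f < \<infinity>"
    using ennreal_less_top order_le_less_trans infinity_ennreal_def by metis
qed

section \<open>Extending the Fourier representation to test functions\<close>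

lemma smooth_scale:
  assumes "smooth f"
  shows "smooth (\<lambda>x. f (c *\<^sub>R x))"
proof (rule smooth_coinduct)
  let ?X = "{\<lambda>x. a * g (c *\<^sub>R x) | a g. smooth g}"
  show "(\<lambda>x. f (c *\<^sub>R x)) \<in> ?X" using assms by (intro CollectI exI[of _ 1] exI[of _ f]) simp
  have D: "((\<lambda>x. g (c *\<^sub>R x)) has_derivative (\<lambda>h. frechet_derivative g (at (c *\<^sub>R x)) (c *\<^sub>R h))) (at x)"
    if "smooth g" for g x
  proof -
    have "(g has_derivative frechet_derivative g (at (c *\<^sub>R x))) (at (c *\<^sub>R x))"
      using smooth_differentiable[OF that] by (simp add: frechet_derivative_works[symmetric])
    moreover have "((\<lambda>x. c *\<^sub>R x) has_derivative (\<lambda>h. c *\<^sub>R h)) (at x)"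
      by (intro derivative_eq_intros) auto
    ultimately show ?thesis using has_derivative_compose by blast
  qed
  show d: "h differentiable (at x)" if "h \<in> ?X" for h x
    using that D by (auto intro!: differentiable_mult intro: differentiableI)
  show "partial_deriv i h \<in> ?X" if hX: "h \<in> ?X" for h i
  proof -
    from hX obtain a g where h: "h = (\<lambda>x. a * g (c *\<^sub>R x))" and g: "smooth g" by blast
    have "partial_deriv i (\<lambda>x. g (c *\<^sub>R x)) = (\<lambda>x. of_real c * partial_deriv i g (c *\<^sub>R x))"
    proof
      fix x
      have "bounded_linear (frechet_derivative g (at (c *\<^sub>R x)))"
        using smooth_differentiable[OF g, of "c *\<^sub>R x"] frechet_derivative_works has_derivative_bounded_linear by blast
      hence lin: "linear (frechet_derivative g (at (c *\<^sub>R x)))" by (rule bounded_linear.linear)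
      show "partial_deriv i (\<lambda>x. g (c *\<^sub>R x)) x = of_real c * partial_deriv i g (c *\<^sub>R x)"
        unfolding partial_deriv_eqI[OF D[OF g]] partial_deriv_def[of i g]
        by (simp only: linear_scale[OF lin] scaleR_conv_of_real[where 'a = complex])
    qed
    hence "partial_deriv i h = (\<lambda>x. (a * of_real c) * partial_deriv i g (c *\<^sub>R x))"
      unfolding h using D[OF g] by (subst partial_deriv_cmult) (auto intro: differentiableI)
    thus ?thesis using smooth_partial_deriv[OF g] by blast
  qed
qed

lemma cexp_cvec_commute: "cexp x (cvec y) = cexp y (cvec x)" "cexp x (- cvec y) = cexp y (- cvec x)"
  by (simp_all add: cexp_def cdot_simps cdot_cvec inner_commute)

lemma expint_adm_smooth_supported:
  assumes f: "f \<in> smooth_supported K" and K: "compact K"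
  shows "expint_adm lborel f cvec 0" "expint_adm lborel f (\<lambda>x. - cvec x) 0"
proof -
  have "integrable lborel (\<lambda>s. cmod (f s) * (1 + norm s) ^ N)" for N
    by (rule integrable_compact_support[OF _ K])
       (use f smooth_continuous_on[of f UNIV] in \<open>auto simp: smooth_supported_def intro!: continuous_intros\<close>)
  thus "expint_adm lborel f cvec 0" "expint_adm lborel f (\<lambda>x. - cvec x) 0"
    using f by (auto simp: expint_adm_def smooth_supported_def smooth_measurable)
qed

text \<open>The variables exchange roles: the transform is read as a superposition, over the
  position variable, of exponentials in the frequency. Smoothness and derivatives in the frequency
  follow at once.\<close>

lemma fourier_eq_expint: "fourier f = expint lborel f (\<lambda>x. - cvec x)"
proof
  fix \<xi>
  have "cexp x (- cvec \<xi>) * f x = f x * cexp \<xi> (- cvec x)" for x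
    by (simp add: cexp_cvec_commute(2)[of x \<xi>])
  thus "fourier f \<xi> = expint lborel f (\<lambda>x. - cvec x) \<xi>"
    unfolding fourier_eq_laplace expint_def laplace_def by (simp only:)
qed

lemma laplace_cvec_eq_expint: "(\<lambda>\<xi>. laplace f (cvec \<xi>)) = expint lborel f cvec"
proof
  fix \<xi>
  have "cexp x (cvec \<xi>) * f x = f x * cexp \<xi> (cvec x)" for x
    by (simp add: cexp_cvec_commute(1)[of x \<xi>])
  thus "laplace f (cvec \<xi>) = expint lborel f cvec \<xi>" unfolding expint_def laplace_def by (simp only:)
qed

lemma smooth_fourier: "f \<in> smooth_supported K \<Longrightarrow> compact K \<Longrightarrow> smooth (fourier f)"
  unfolding fourier_eq_expint by (rule smooth_expint[OF expint_adm_smooth_supported(2)])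

lemma smooth_laplace_cvec: "f \<in> smooth_supported K \<Longrightarrow> compact K \<Longrightarrow> smooth (\<lambda>\<xi>. laplace f (cvec \<xi>))"
  unfolding laplace_cvec_eq_expint by (rule smooth_expint[OF expint_adm_smooth_supported(1)])

lemma smooth_supported_lipschitz:
  assumes f: "f \<in> smooth_supported (K :: (real ^ 'n::finite) set)" and K: "compact K"
  obtains L where "L \<ge> 0" "\<And>x y. cmod (f x - f y) \<le> L * norm (x - y)"
proof -
  have "\<exists>B\<ge>0. \<forall>x. cmod (partial_deriv i f x) \<le> B" for i
    using smooth_supported_bounded[OF smooth_supported_partial_deriv[OF f compact_imp_closed[OF K]] K, of i] by metis
  then obtain B where B: "\<And>i. B i \<ge> 0" "\<And>i x. cmod (partial_deriv i f x) \<le> B i" by metis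
  have D: "(f has_derivative frechet_derivative f (at x)) (at x)" for x
    using smooth_differentiable[OF smooth_supported_smooth[OF f]] by (simp add: frechet_derivative_works[symmetric])
  have "cmod (frechet_derivative f (at x) h) \<le> (\<Sum>i\<in>UNIV. B i) * norm h" for x h
  proof -
    have lin: "linear (frechet_derivative f (at x))" using D has_derivative_bounded_linear bounded_linear.linear by blast
    have "h = (\<Sum>i\<in>UNIV. h $ i *\<^sub>R axis i 1)"
      by (simp add: vec_eq_iff axis_def if_distrib[of "(*) _"] cong: if_cong)
    hence "frechet_derivative f (at x) h = frechet_derivative f (at x) (\<Sum>i\<in>UNIV. h $ i *\<^sub>R axis i 1)"
      by (rule arg_cong)
    also have "\<dots> = (\<Sum>i\<in>UNIV. h $ i *\<^sub>R partial_deriv i f x)"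
      by (simp only: linear_sum[OF lin] linear_scale[OF lin] partial_deriv_def)
    finally have "frechet_derivative f (at x) h = (\<Sum>i\<in>UNIV. h $ i *\<^sub>R partial_deriv i f x)" .
    also have "cmod \<dots> \<le> (\<Sum>i\<in>UNIV. B i * norm h)"
      by (intro sum_norm_le) (simp, subst mult.commute, intro mult_mono B component_le_norm_cart, auto)
    finally show ?thesis by (simp add: sum_distrib_right)
  qed
  hence "onorm (frechet_derivative f (at x)) \<le> (\<Sum>i\<in>UNIV. B i)" for x
    by (intro onorm_le)
  hence "norm (f x - f y) \<le> (\<Sum>i\<in>UNIV. B i) * norm (x - y)" for x y
    by (intro differentiable_bound[where S = UNIV]) (use D in auto)
  thus thesis using B by (intro that[of "\<Sum>i\<in>UNIV. B i"]) (auto intro: sum_nonneg)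
qed

section \<open>Regularization on the Fourier side\<close>

text \<open>The regularization \<open>\<F>(\<rho>(d\<cdot>) (2\<pi>)\<^sup>-\<^sup>n \<F>\<^sup>-\<^sup>1f)\<close> is a convolution of \<open>f\<close> with an approximate identity.\<close>

definition fcut :: "(real ^ 'n::finite \<Rightarrow> complex) \<Rightarrow> real \<Rightarrow> (real ^ 'n \<Rightarrow> complex) \<Rightarrow> real ^ 'n \<Rightarrow> complex" where
  "fcut \<rho> d f \<xi> = \<rho> (d *\<^sub>R \<xi>) * (inverse (of_real ((2 * pi) ^ CARD('n))) * laplace f (cvec \<xi>))"

lemma fcut_smooth_supported:
  assumes f: "f \<in> smooth_supported (K :: (real ^ 'n::finite) set)" "compact K" and \<rho>: "\<rho> \<in> smooth_supported K'" and d: "d > 0"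
  shows "fcut \<rho> d f \<in> smooth_supported ((\<lambda>x. x /\<^sub>R d) ` K')"
proof -
  have "smooth (fcut \<rho> d f)" unfolding fcut_def[abs_def]
    by (rule smooth_mult[OF smooth_scale[OF smooth_supported_smooth[OF \<rho>]] smooth_cmult[OF smooth_laplace_cvec[OF f]]])
  moreover have "fcut \<rho> d f x = 0" if "x \<notin> (\<lambda>x. x /\<^sub>R d) ` K'" for x
  proof -
    have "d *\<^sub>R x \<notin> K'" using that d by (force intro!: image_eqI[of _ _ "d *\<^sub>R x"])
    thus ?thesis using \<rho> by (simp add: fcut_def smooth_supported_def)
  qed
  ultimately show ?thesis by (simp add: smooth_supported_def)
qed

lemma compact_scaled: "compact K \<Longrightarrow> compact ((\<lambda>x :: 'a::real_normed_vector. x /\<^sub>R d) ` K)"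
  by (intro compact_continuous_image continuous_intros)

text \<open>An exchange of integrals turns the multiplier \<rho>(d \<xi>) into an average of
  \<open>f\<close> over translates at scale \<open>d\<close>, weighted by the transform of
  \<rho>.\<close>

lemma fourier_fcut:
  assumes f: "f \<in> smooth_supported (K :: (real ^ 'n::finite) set)" and K: "compact K"
    and \<rho>: "\<rho> \<in> smooth_supported (K' :: (real ^ 'n) set)" and K': "compact K'" and d: "d > 0"
  shows "fourier (fcut \<rho> d f) x = inverse (of_real ((2 * pi) ^ CARD('n))) * (LINT y|lborel. f (x + d *\<^sub>R y) * laplace \<rho> (cvec y))"
proof -
  let ?c = "inverse (of_real ((2 * pi) ^ CARD('n))) :: complex"
  have fm[measurable]: "f \<in> borel_measurable borel" "\<rho> \<in> borel_measurable borel"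
    using f \<rho> by (auto simp: smooth_supported_def smooth_measurable)
  have intf: "integrable lborel f" by (rule integrable_smooth_supported[OF f K])
  have int\<rho>: "integrable lborel (\<lambda>\<xi>. \<rho> (d *\<^sub>R \<xi>))"
    using lborel_integrable_affine[OF integrable_smooth_supported[OF \<rho> K'], of d 0] d by simp
  have "fourier (fcut \<rho> d f) x = (LINT \<xi>|lborel. LINT z|lborel. ?c * (f z * (\<rho> (d *\<^sub>R \<xi>) * cexp (z - x) (cvec \<xi>))))"
    unfolding fourier_eq_laplace laplace_def[of "fcut \<rho> d f"]
  proof (intro Bochner_Integration.integral_cong refl)
    fix \<xi>
    have e: "cexp \<xi> (- cvec x) * cexp z (cvec \<xi>) = cexp (z - x) (cvec \<xi>)" for z
      using cexp_add_left[of z "- x" "cvec \<xi>"] by (simp add: cexp_minus cexp_cvec_commute(2)[of \<xi> x] mult.commute)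
    have "cexp \<xi> (- cvec x) * fcut \<rho> d f \<xi> = (LINT z|lborel. (?c * \<rho> (d *\<^sub>R \<xi>) * cexp \<xi> (- cvec x)) * (cexp z (cvec \<xi>) * f z))"
      unfolding integral_mult_right_zero by (simp only: fcut_def laplace_def mult_ac)
    also have "\<dots> = (LINT z|lborel. ?c * (f z * (\<rho> (d *\<^sub>R \<xi>) * cexp (z - x) (cvec \<xi>))))"
      unfolding e[symmetric] by (simp only: mult_ac)
    finally show "cexp \<xi> (- cvec x) * fcut \<rho> d f \<xi> = (LINT z|lborel. ?c * (f z * (\<rho> (d *\<^sub>R \<xi>) * cexp (z - x) (cvec \<xi>))))" .
  qed
  also have "\<dots> = (LINT z|lborel. LINT \<xi>|lborel. ?c * (f z * (\<rho> (d *\<^sub>R \<xi>) * cexp (z - x) (cvec \<xi>))))"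
  proof (rule lborel_pair.Fubini_integral)
    show "integrable (lborel \<Otimes>\<^sub>M lborel) (\<lambda>(z, \<xi>). ?c * (f z * (\<rho> (d *\<^sub>R \<xi>) * cexp (z - x) (cvec \<xi>))))"
    proof (rule lborel_pair.integrable_pair_bound)
      show "integrable lborel (\<lambda>z. cmod ?c * cmod (f z))" using intf by (intro integrable_mult_right integrable_norm)
      show "integrable lborel (\<lambda>\<xi>. cmod (\<rho> (d *\<^sub>R \<xi>)))" using int\<rho> by (rule integrable_norm)
      show "norm (case (z, \<xi>) of (z, \<xi>) \<Rightarrow> ?c * (f z * (\<rho> (d *\<^sub>R \<xi>) * cexp (z - x) (cvec \<xi>)))) \<le> cmod ?c * cmod (f z) * cmod (\<rho> (d *\<^sub>R \<xi>))" for z \<xi>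
        by (simp add: norm_mult del: of_real_power of_real_mult)
    qed measurable
  qed
  also have "\<dots> = (LINT z|lborel. ?c * (f z * (inverse d ^ CARD('n) *\<^sub>R laplace \<rho> (cvec ((z - x) /\<^sub>R d)))))"
  proof (intro Bochner_Integration.integral_cong refl)
    fix z
    have "(LINT \<xi>|lborel. \<rho> (d *\<^sub>R \<xi>) * cexp (z - x) (cvec \<xi>)) =
       (\<bar>inverse d\<bar> ^ DIM(real ^ 'n)) *\<^sub>R (LINT \<xi>|lborel. \<rho> (d *\<^sub>R (0 + inverse d *\<^sub>R \<xi>)) * cexp (z - x) (cvec (0 + inverse d *\<^sub>R \<xi>)))"
      by (rule lborel_integral_affine) (use d in auto)
    also have "(\<lambda>\<xi>. \<rho> (d *\<^sub>R (0 + inverse d *\<^sub>R \<xi>)) * cexp (z - x) (cvec (0 + inverse d *\<^sub>R \<xi>))) =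
       (\<lambda>\<xi>. cexp \<xi> (cvec ((z - x) /\<^sub>R d)) * \<rho> \<xi>)"
      using d by (auto simp: fun_eq_iff cexp_def cdot_cvec inner_commute)
    finally show "(LINT \<xi>|lborel. ?c * (f z * (\<rho> (d *\<^sub>R \<xi>) * cexp (z - x) (cvec \<xi>)))) =
      ?c * (f z * (inverse d ^ CARD('n) *\<^sub>R laplace \<rho> (cvec ((z - x) /\<^sub>R d))))"
      unfolding integral_mult_right_zero using d by (simp add: laplace_def)
  qed
  \<comment> \<open>The substitution z = x + d y absorbs the factor d^(-n).\<close>
  also have "\<dots> = (\<bar>d\<bar> ^ DIM(real ^ 'n)) *\<^sub>R (LINT y|lborel. ?c * (f (x + d *\<^sub>R y) * (inverse d ^ CARD('n) *\<^sub>R laplace \<rho> (cvec ((x + d *\<^sub>R y - x) /\<^sub>R d)))))"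
    by (rule lborel_integral_affine) (use d in auto)
  also have "\<dots> = (LINT y|lborel. ?c * (f (x + d *\<^sub>R y) * laplace \<rho> (cvec y)))"
    unfolding Bochner_Integration.integral_scaleR_right[symmetric]
  proof (intro Bochner_Integration.integral_cong refl)
    fix y :: "real ^ 'n"
    have 1: "(x + d *\<^sub>R y - x) /\<^sub>R d = y" using d by (simp add: vec_eq_iff)
    have 2: "d ^ CARD('n) * inverse d ^ CARD('n) = 1" using d by (simp add: power_mult_distrib[symmetric])
    have "\<bar>d\<bar> ^ DIM(real ^ 'n) *\<^sub>R (?c * (f (x + d *\<^sub>R y) * (inverse d ^ CARD('n) *\<^sub>R laplace \<rho> (cvec y)))) =
       (d ^ CARD('n) * inverse d ^ CARD('n)) *\<^sub>R (?c * (f (x + d *\<^sub>R y) * laplace \<rho> (cvec y)))"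
      using d by (simp del: of_real_power of_real_mult)
    thus "\<bar>d\<bar> ^ DIM(real ^ 'n) *\<^sub>R (?c * (f (x + d *\<^sub>R y) * (inverse d ^ CARD('n) *\<^sub>R laplace \<rho> (cvec ((x + d *\<^sub>R y - x) /\<^sub>R d))))) =
       ?c * (f (x + d *\<^sub>R y) * laplace \<rho> (cvec y))" unfolding 1 2 by simp
  qed
  finally show ?thesis by (simp only: integral_mult_right_zero)
qed

text \<open>The Lipschitz bound yields a gain d |y|, and the weight in \<open>x\<close> is shifted
  onto \<open>y\<close>; the rapid decay of the transform of \<rho> pays for both. The explicit rate
  in \<open>d\<close> makes it easy to collect finitely many derivatives.\<close>

lemma fourier_fcut_converges:
  assumes f: "f \<in> smooth_supported (K :: (real ^ 'n::finite) set)" and K: "compact K"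
    and \<rho>: "\<rho> \<in> smooth_supported (K' :: (real ^ 'n) set)" and K': "compact K'" and \<rho>0: "\<rho> 0 = 1"
  obtains D where "D \<ge> 0" "\<And>d x. 0 < d \<Longrightarrow> d \<le> 1 \<Longrightarrow> (1 + norm x) ^ j * cmod (fourier (fcut \<rho> d f) x - f x) \<le> D * d"
proof -
  let ?c = "inverse (of_real ((2 * pi) ^ CARD('n))) :: complex"
  have c: "?c * of_real ((2 * pi) ^ CARD('n)) = 1" by (rule left_inverse) simp
  have [measurable]: "f \<in> borel_measurable borel" "\<rho> \<in> borel_measurable borel"
    using f \<rho> by (auto simp: smooth_supported_def smooth_measurable)
  obtain L where L: "L \<ge> 0" "\<And>x y. cmod (f x - f y) \<le> L * norm (x - y)" using smooth_supported_lipschitz[OF f K] by blast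
  obtain r where r: "r \<ge> 0" "\<And>x. x \<in> K \<Longrightarrow> norm x \<le> r" using compactD_norm[OF K] by blast
  \<comment> \<open>The exponent provides 2n for integrability, \<open>j\<close> for the weight and
    1 for the Lipschitz factor.\<close>
  obtain C where C: "C \<ge> 0" "\<And>z \<xi>. norm (z - cvec \<xi>) \<le> 0 \<Longrightarrow> cmod (laplace \<rho> z) \<le> C * decay (2 * CARD('n) + (j + 1)) \<xi>"
    using laplace_cvec_decay[OF \<rho> K'] by blast
  have int\<rho>: "integrable lborel (\<lambda>y. laplace \<rho> (cvec y))" using integrable_laplace_cvec[OF \<rho> K', of 0] by simp
  \<comment> \<open>Fourier inversion at the origin together with \<open>\<rho> 0 = 1\<close>: the
    averaging kernel has total mass 1.\<close>
  have one: "?c * (LINT y|lborel. laplace \<rho> (cvec y)) = 1"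
    using fourier_inversion[OF \<rho> K', of 0] c by (simp add: cexp_def cdot_simps \<rho>0)
  obtain Bf where Bf: "\<And>x. cmod (f x) \<le> Bf" using smooth_supported_bounded[OF f K] by metis
  define A where "A = (1 + r) ^ j * L * C"
  have A: "A \<ge> 0" using r L C by (simp add: A_def)
  let ?I = "LINT y|lborel. decay (2 * CARD('n)) (y :: real ^ 'n)"
  show thesis
  proof (rule that[of "cmod ?c * (A * ?I)"])
    show "cmod ?c * (A * ?I) \<ge> 0" using A by simp
    fix d :: real and x :: "real ^ 'n" assume d: "0 < d" "d \<le> 1"
    have intF: "integrable lborel (\<lambda>y. f (x + d *\<^sub>R y) * laplace \<rho> (cvec y))"
    proof (rule Bochner_Integration.integrable_bound)
      show "integrable lborel (\<lambda>y. Bf * cmod (laplace \<rho> (cvec y)))" using int\<rho> by (intro integrable_mult_right integrable_norm)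
      show "AE y in lborel. norm (f (x + d *\<^sub>R y) * laplace \<rho> (cvec y)) \<le> norm (Bf * cmod (laplace \<rho> (cvec y)))"
      proof (rule AE_I2)
        fix y
        have "cmod (f (x + d *\<^sub>R y)) \<le> \<bar>Bf\<bar>" using Bf[of "x + d *\<^sub>R y"] by simp
        thus "norm (f (x + d *\<^sub>R y) * laplace \<rho> (cvec y)) \<le> norm (Bf * cmod (laplace \<rho> (cvec y)))"
          by (simp add: norm_mult abs_mult mult_right_mono)
      qed
    qed measurable
    have "f x = ?c * (LINT y|lborel. laplace \<rho> (cvec y)) * f x" by (simp only: one mult_1)
    also have "\<dots> = ?c * (LINT y|lborel. f x * laplace \<rho> (cvec y))" by (simp only: integral_mult_right_zero mult_ac)
    finally have "fourier (fcut \<rho> d f) x - f x = ?c * ((LINT y|lborel. f (x + d *\<^sub>R y) * laplace \<rho> (cvec y)) - (LINT y|lborel. f x * laplace \<rho> (cvec y)))"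
      unfolding fourier_fcut[OF f K \<rho> K' d(1)] by (simp only: right_diff_distrib)
    also have "\<dots> = ?c * (LINT y|lborel. (f (x + d *\<^sub>R y) - f x) * laplace \<rho> (cvec y))"
      using intF int\<rho> by (subst Bochner_Integration.integral_diff[symmetric]) (auto simp: left_diff_distrib)
    finally have eq: "(1 + norm x) ^ j * cmod (fourier (fcut \<rho> d f) x - f x) =
       cmod ?c * norm (LINT y|lborel. of_real ((1 + norm x) ^ j) * ((f (x + d *\<^sub>R y) - f x) * laplace \<rho> (cvec y)))"
      unfolding integral_mult_right_zero by (simp only: norm_mult norm_of_real abs_of_nonneg zero_le_power one_plus_norm_pos mult_ac)
    have "norm (LINT y|lborel. of_real ((1 + norm x) ^ j) * ((f (x + d *\<^sub>R y) - f x) * laplace \<rho> (cvec y))) \<le>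
       (LINT y|lborel. (A * d) * decay (2 * CARD('n)) (y :: real ^ 'n))"
    proof (rule norm_integral_le)
      show "integrable lborel (\<lambda>y :: real ^ 'n. (A * d) * decay (2 * CARD('n)) y)" by (intro integrable_mult_right integrable_decay) simp
      fix y :: "real ^ 'n"
      show "norm (of_real ((1 + norm x) ^ j) * ((f (x + d *\<^sub>R y) - f x) * laplace \<rho> (cvec y))) \<le> (A * d) * decay (2 * CARD('n)) y"
      proof (cases "f (x + d *\<^sub>R y) - f x = 0")
        case True
        thus ?thesis using A d by simp
      next
        case False
        \<comment> \<open>If the difference is nonzero, one of the two points lies in
          \<open>K\<close>; since d \<le> 1 this bounds |x| by r + |y|.\<close>
        hence "x \<in> K \<or> x + d *\<^sub>R y \<in> K" using f by (auto simp: smooth_supported_def)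
        hence "norm x \<le> r + norm y"
        proof
          assume "x + d *\<^sub>R y \<in> K"
          hence "norm (x + d *\<^sub>R y) \<le> r" by (rule r)
          moreover have "norm (d *\<^sub>R y) \<le> norm y" using d by (simp add: mult_left_le_one_le)
          ultimately show ?thesis using norm_triangle_ineq4[of "x + d *\<^sub>R y" "d *\<^sub>R y"] by simp
        qed (use r in \<open>force intro: order_trans\<close>)
        hence "1 + norm x \<le> (1 + r) * (1 + norm y)"
          using mult_nonneg_nonneg[OF r(1) norm_ge_zero[of y]] by (simp only: distrib_left distrib_right mult_1 mult_1_right)
        hence "(1 + norm x) ^ j \<le> (1 + r) ^ j * (1 + norm y) ^ j"
          unfolding power_mult_distrib[symmetric] by (intro power_mono) auto
        moreover have "cmod (f (x + d *\<^sub>R y) - f x) \<le> L * (d * (1 + norm y))"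
        proof -
          have "cmod (f (x + d *\<^sub>R y) - f x) \<le> L * norm (d *\<^sub>R y)" using L(2)[of "x + d *\<^sub>R y" x] by simp
          also have "\<dots> \<le> L * (d * (1 + norm y))" using L d by (intro mult_left_mono) auto
          finally show ?thesis .
        qed
        moreover have "cmod (laplace \<rho> (cvec y)) \<le> C * decay (2 * CARD('n) + (j + 1)) y" by (rule C) simp
        ultimately have "(1 + norm x) ^ j * (cmod (f (x + d *\<^sub>R y) - f x) * cmod (laplace \<rho> (cvec y))) \<le>
           ((1 + r) ^ j * (1 + norm y) ^ j) * ((L * (d * (1 + norm y))) * (C * decay (2 * CARD('n) + (j + 1)) y))"
          using r L d C by (intro mult_mono) auto
        also have "\<dots> = (A * d) * ((1 + norm y) ^ (j + 1) * decay (2 * CARD('n) + (j + 1)) y)"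
          by (simp add: A_def mult_ac)
        also have "(1 + norm y) ^ (j + 1) * decay (2 * CARD('n) + (j + 1)) y = decay (2 * CARD('n)) y" by (rule decay_mult_power)
        finally show ?thesis by (simp only: norm_mult norm_of_real abs_of_nonneg zero_le_power one_plus_norm_pos)
      qed
    qed
    also have "\<dots> = A * ?I * d" by simp
    finally show "(1 + norm x) ^ j * cmod (fourier (fcut \<rho> d f) x - f x) \<le> cmod ?c * (A * ?I) * d"
      unfolding eq mult.assoc by (intro mult_left_mono) (auto simp: mult_ac)
  qed
qed

text \<open>Regularization commutes with differentiation, so the convergence estimate passes to all
  derivatives and thus to every Schwartz seminorm.\<close>

lemma mpartial_fourier_fcut:
  assumes f: "f \<in> smooth_supported (K :: (real ^ 'n::finite) set)" and K: "compact K"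
    and \<rho>: "\<rho> \<in> smooth_supported (K' :: (real ^ 'n) set)" and K': "compact K'" and d: "d > 0"
  shows "mpartial \<alpha> (fourier (fcut \<rho> d f)) = fourier (fcut \<rho> d (mpartial \<alpha> f))"
proof -
  have adm: "expint_adm lborel (fcut \<rho> d f) (\<lambda>x. - cvec x) 0"
    by (rule expint_adm_smooth_supported(2)[OF fcut_smooth_supported[OF f K \<rho> d] compact_scaled[OF K']])
  have 1: "cmono \<alpha> (- z) = (- 1) ^ mi_order \<alpha> * cmono \<alpha> z" for z :: "complex ^ 'n"
  proof -
    have "cmono \<alpha> (- z) = (\<Prod>i\<in>UNIV. (- 1) ^ \<alpha> i * z $ i ^ \<alpha> i)"
      unfolding cmono_def by (intro prod.cong refl) (simp add: power_minus[of "z $ i" for i])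
    thus ?thesis by (simp add: prod.distrib cmono_def mi_order_def power_sum)
  qed
  have 2: "\<i> ^ k * ((- 1) ^ k * u) = (- \<i>) ^ k * u" for k and u :: complex
    by (simp add: power_minus[of \<i>] mult_ac)
  have "fcut \<rho> d f \<xi> * (\<i> ^ mi_order \<alpha> * cmono \<alpha> (- cvec \<xi>)) = fcut \<rho> d (mpartial \<alpha> f) \<xi>" for \<xi>
    unfolding fcut_def laplace_mpartial[OF f K] 1 2 by (simp only: mult_ac)
  thus ?thesis unfolding fourier_eq_expint mpartial_expint(1)[OF adm] by (simp only:)
qed

text \<open>\<open>has_fourier\<close> tests T only on transforms of test functions, while T has to
  be evaluated at compactly supported functions. Those are limits of such transforms in the Schwartz
  seminorms, and integrability of \<open>g\<close> against a power of decay permits the limit under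
  the integral.\<close>

lemma tempered_fourier_rep:
  fixes T :: "(real ^ 'n::finite \<Rightarrow> complex) \<Rightarrow> complex"
  assumes T: "is_tempered_distribution T" and g: "has_fourier T g"
    and int: "integrable lborel (\<lambda>\<xi>. cmod (g \<xi>) * decay M \<xi>)"
    and f: "f \<in> smooth_supported K" and K: "compact K"
  shows "T f = (LINT \<xi>|lborel. g \<xi> * (inverse (of_real ((2 * pi) ^ CARD('n))) * laplace f (cvec \<xi>)))"
proof -
  let ?c = "inverse (of_real ((2 * pi) ^ CARD('n))) :: complex"
  obtain \<rho> :: "real ^ 'n \<Rightarrow> complex" and U where "\<rho> \<in> test_functions" "{0} \<subseteq> U" "\<And>x. x \<in> U \<Longrightarrow> \<rho> x = 1"
    using ex_cutoff[of "{0 :: real ^ 'n}"] by (metis compact_sing)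
  then obtain K' where \<rho>: "\<rho> \<in> smooth_supported K'" and K': "compact K'" and \<rho>0: "\<rho> 0 = 1"
    by (auto simp: test_functions_def)
  have gm[measurable]: "g \<in> borel_measurable borel" using g by (simp add: has_fourier_def)
  have fm[measurable]: "f \<in> borel_measurable borel" "\<rho> \<in> borel_measurable borel"
    using f \<rho> by (auto simp: smooth_supported_def smooth_measurable)
  obtain J c where lin: "clinear_on schwartz_functions T" and
    J: "\<And>f. f \<in> schwartz_functions \<Longrightarrow> ennreal (cmod (T f)) \<le> ennreal c * schwartz_norm J f"
    using T by (auto simp: is_tempered_distribution_def)
  have fS: "f \<in> schwartz_functions" by (rule smooth_supported_imp_schwartz[OF f K])
  let ?F = "\<lambda>d. fourier (fcut \<rho> d f)"
  have sF: "smooth (?F d)" if "d > 0" for d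
    by (rule smooth_fourier[OF fcut_smooth_supported[OF f K \<rho> that] compact_scaled[OF K']])
  have sf: "smooth f" using f by (rule smooth_supported_smooth)
  have conv: "\<exists>D\<ge>0. \<forall>d \<alpha> x. 0 < d \<longrightarrow> d \<le> 1 \<longrightarrow> mi_order \<alpha> \<le> j \<longrightarrow>
     (1 + norm x) ^ j * cmod (mpartial \<alpha> (\<lambda>x. ?F d x - f x) x) \<le> D * d" for j
  proof -
    have "\<exists>D\<ge>0. \<forall>d x. 0 < d \<longrightarrow> d \<le> 1 \<longrightarrow> (1 + norm x) ^ j * cmod (fourier (fcut \<rho> d (mpartial \<alpha> f)) x - mpartial \<alpha> f x) \<le> D * d" for \<alpha>
      using fourier_fcut_converges[where j = j, OF smooth_supported_mpartial[where \<alpha> = \<alpha>, OF f compact_imp_closed[OF K]] K \<rho> K' \<rho>0]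
      by metis
    then obtain D where D: "\<And>\<alpha>. D \<alpha> \<ge> 0" "\<And>\<alpha> d x. 0 < d \<Longrightarrow> d \<le> 1 \<Longrightarrow>
       (1 + norm x) ^ j * cmod (fourier (fcut \<rho> d (mpartial \<alpha> f)) x - mpartial \<alpha> f x) \<le> D \<alpha> * d" by metis
    show ?thesis
    proof (intro exI[of _ "\<Sum>\<alpha> | mi_order \<alpha> \<le> j. D \<alpha>"] conjI allI impI)
      show "0 \<le> (\<Sum>\<alpha> | mi_order \<alpha> \<le> j. D \<alpha>)" using D(1) by (simp add: sum_nonneg)
      fix d :: real and \<alpha> :: "'n multiindex" and x :: "real ^ 'n" assume d: "0 < d" "d \<le> 1" and \<alpha>: "mi_order \<alpha> \<le> j"
      have "D \<alpha> \<le> (\<Sum>\<alpha> | mi_order \<alpha> \<le> j. D \<alpha>)" using \<alpha> D(1) by (intro member_le_sum) (auto simp: finite_mi_order_le)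
      hence "D \<alpha> * d \<le> (\<Sum>\<alpha> | mi_order \<alpha> \<le> j. D \<alpha>) * d" using d by (intro mult_right_mono) auto
      thus "(1 + norm x) ^ j * cmod (mpartial \<alpha> (\<lambda>x. ?F d x - f x) x) \<le> (\<Sum>\<alpha> | mi_order \<alpha> \<le> j. D \<alpha>) * d"
        using D(2)[OF d, of x \<alpha>] unfolding mpartial_diff[OF sF[OF d(1)] sf] mpartial_fourier_fcut[OF f K \<rho> K' d(1)]
        by linarith
    qed
  qed
  obtain DJ where DJ: "DJ \<ge> 0" "\<And>d \<alpha> x. 0 < d \<Longrightarrow> d \<le> 1 \<Longrightarrow> mi_order \<alpha> \<le> J \<Longrightarrow>
     (1 + norm x) ^ J * cmod (mpartial \<alpha> (\<lambda>x. ?F d x - f x) x) \<le> DJ * d" using conv[of J] by blast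
  \<comment> \<open>Only the difference is shown to be a Schwartz function. The regularization is
    recovered as difference plus \<open>f\<close>, to which additivity of \<open>T\<close>
    applies.\<close>
  have diffS: "(\<lambda>x. ?F d x - f x) \<in> schwartz_functions" if d: "0 < d" "d \<le> 1" for d
    unfolding schwartz_functions_def
  proof (intro CollectI conjI allI)
    show "smooth (\<lambda>x. ?F d x - f x)" by (rule smooth_diff[OF sF[OF d(1)] sf])
    fix j
    obtain D where "\<And>\<alpha> x. mi_order \<alpha> \<le> j \<Longrightarrow> (1 + norm x) ^ j * cmod (mpartial \<alpha> (\<lambda>x. ?F d x - f x) x) \<le> D * d"
      using conv[of j] d by blast
    hence "schwartz_norm j (\<lambda>x. ?F d x - f x) \<le> ennreal (D * d)" by (rule schwartz_norm_leI)
    thus "schwartz_norm j (\<lambda>x. ?F d x - f x) < \<infinity>"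
      using ennreal_less_top order_le_less_trans infinity_ennreal_def by metis
  qed
  have Tdiff: "cmod (T (?F d) - T f) \<le> \<bar>c\<bar> * (DJ * d)" if d: "0 < d" "d \<le> 1" for d
  proof -
    have "T (\<lambda>x. (?F d x - f x) + f x) = T (\<lambda>x. ?F d x - f x) + T f"
      using conjunct1[OF lin[unfolded clinear_on_def], rule_format, OF diffS[OF d] fS] .
    hence eq: "T (?F d) - T f = T (\<lambda>x. ?F d x - f x)" by simp
    have "schwartz_norm J (\<lambda>x. ?F d x - f x) \<le> ennreal (DJ * d)" using DJ(2)[OF d] by (rule schwartz_norm_leI)
    hence "ennreal (cmod (T (?F d) - T f)) \<le> ennreal \<bar>c\<bar> * ennreal (DJ * d)"
      unfolding eq by (intro order_trans[OF J[OF diffS[OF d]]] mult_mono ennreal_leI) auto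
    also have "\<dots> = ennreal (\<bar>c\<bar> * (DJ * d))" using DJ d by (simp add: ennreal_mult)
    finally show ?thesis using DJ d by (simp add: ennreal_le_iff)
  qed
  define d where "d k = inverse (real (Suc k))" for k
  have d: "d k > 0" "d k \<le> 1" for k by (auto simp: d_def inverse_le_1_iff)
  have dlim: "d \<longlonglongrightarrow> 0" unfolding d_def using LIMSEQ_inverse_real_of_nat by simp
  have "(\<lambda>k. T (?F (d k)) - T f) \<longlonglongrightarrow> 0"
  proof (rule Lim_null_comparison)
    show "\<forall>\<^sub>F k in sequentially. norm (T (?F (d k)) - T f) \<le> \<bar>c\<bar> * (DJ * d k)"
      using Tdiff d by (intro always_eventually) auto
    have "(\<lambda>k. \<bar>c\<bar> * (DJ * d k)) \<longlonglongrightarrow> \<bar>c\<bar> * (DJ * 0)" by (intro tendsto_intros dlim)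
    thus "(\<lambda>k. \<bar>c\<bar> * (DJ * d k)) \<longlonglongrightarrow> 0" by simp
  qed
  hence lim1: "(\<lambda>k. T (?F (d k))) \<longlonglongrightarrow> T f" by (simp add: LIM_zero_iff)
  have TF: "T (?F d) = (LINT \<xi>|lborel. g \<xi> * fcut \<rho> d f \<xi>)" if "d > 0" for d
  proof -
    have "fcut \<rho> d f \<in> test_functions"
      unfolding test_functions_def using fcut_smooth_supported[OF f K \<rho> that] compact_scaled[OF K'] by blast
    thus ?thesis using g by (simp add: has_fourier_def)
  qed
  obtain B where B: "B \<ge> 0" "\<And>x. cmod (\<rho> x) \<le> B" using smooth_supported_bounded[OF \<rho> K'] by blast
  obtain C where C: "C \<ge> 0" "\<And>z \<xi>. norm (z - cvec \<xi>) \<le> 0 \<Longrightarrow> cmod (laplace f z) \<le> C * decay M \<xi>"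
    using laplace_cvec_decay[OF f K] by blast
  \<comment> \<open>The majorant uses that \<rho> is bounded and that the transform of
    \<open>f\<close> decays to the prescribed order \<open>M\<close>.\<close>
  have "(\<lambda>k. LINT \<xi>|lborel. g \<xi> * fcut \<rho> (d k) f \<xi>) \<longlonglongrightarrow> (LINT \<xi>|lborel. g \<xi> * (?c * laplace f (cvec \<xi>)))"
  proof (rule integral_dominated_convergence[where w = "\<lambda>\<xi>. (B * cmod ?c * C) * (cmod (g \<xi>) * decay M \<xi>)"])
    show "integrable lborel (\<lambda>\<xi>. (B * cmod ?c * C) * (cmod (g \<xi>) * decay M \<xi>))" using int by (rule integrable_mult_right)
    show "AE \<xi> in lborel. (\<lambda>k. g \<xi> * fcut \<rho> (d k) f \<xi>) \<longlonglongrightarrow> g \<xi> * (?c * laplace f (cvec \<xi>))"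
    proof (rule AE_I2)
      fix \<xi>
      have "(\<lambda>k. \<rho> (d k *\<^sub>R \<xi>)) \<longlonglongrightarrow> \<rho> (0 *\<^sub>R \<xi>)"
        using smooth_continuous_on[OF smooth_supported_smooth[OF \<rho>], of UNIV] tendsto_scaleR[OF dlim tendsto_const[of \<xi>]]
        by (intro isCont_tendsto_compose[where g = \<rho>]) (simp_all add: continuous_on_eq_continuous_at)
      hence "(\<lambda>k. g \<xi> * (\<rho> (d k *\<^sub>R \<xi>) * (?c * laplace f (cvec \<xi>)))) \<longlonglongrightarrow> g \<xi> * (\<rho> (0 *\<^sub>R \<xi>) * (?c * laplace f (cvec \<xi>)))"
        by (intro tendsto_intros)
      thus "(\<lambda>k. g \<xi> * fcut \<rho> (d k) f \<xi>) \<longlonglongrightarrow> g \<xi> * (?c * laplace f (cvec \<xi>))" unfolding fcut_def by (simp add: \<rho>0)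
    qed
    show "AE \<xi> in lborel. norm (g \<xi> * fcut \<rho> (d k) f \<xi>) \<le> (B * cmod ?c * C) * (cmod (g \<xi>) * decay M \<xi>)" for k
    proof (rule AE_I2)
      fix \<xi> :: "real ^ 'n"
      have "cmod (g \<xi>) * (cmod (\<rho> (d k *\<^sub>R \<xi>)) * (cmod ?c * cmod (laplace f (cvec \<xi>)))) \<le> cmod (g \<xi>) * (B * (cmod ?c * (C * decay M \<xi>)))"
        using B C by (intro mult_left_mono mult_mono) auto
      thus "norm (g \<xi> * fcut \<rho> (d k) f \<xi>) \<le> (B * cmod ?c * C) * (cmod (g \<xi>) * decay M \<xi>)"
        unfolding fcut_def norm_mult by (simp only: mult_ac)
    qed
    show "(\<lambda>\<xi>. g \<xi> * (?c * laplace f (cvec \<xi>))) \<in> borel_measurable lborel" by measurable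
    show "(\<lambda>\<xi>. g \<xi> * fcut \<rho> (d k) f \<xi>) \<in> borel_measurable lborel" for k unfolding fcut_def by measurable
  qed
  with lim1 show ?thesis unfolding TF[OF d(1)] by (rule LIMSEQ_unique)
qed

section \<open>Weighted Lebesgue norms\<close>

text \<open>The constant is moved out of the power, so that the growth can be cancelled directly
  against \<open>decay\<close>.\<close>

lemma tempered_weight_bound:
  fixes k :: "real ^ 'n::finite \<Rightarrow> real"
  assumes "k \<in> tempered_weights"
  obtains A N where "A \<ge> 1" "\<And>(\<xi> :: real ^ 'n) \<eta>. k (\<xi> + \<eta>) \<le> A * (1 + norm \<xi>) ^ N * k \<eta>" "\<And>\<xi>. k \<xi> > 0"
proof -
  obtain C N where C: "C > 0" "\<And>\<xi> \<eta>. k (\<xi> + \<eta>) \<le> (1 + C * norm \<xi>) ^ N * k \<eta>" and pos: "\<And>\<xi>. k \<xi> > 0"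
    using assms unfolding tempered_weights_def by blast
  show thesis
  proof (rule that[of "max 1 C ^ N" N])
    show "max 1 C ^ N \<ge> 1" by (rule one_le_power) simp
    fix \<xi> \<eta> :: "real ^ 'n"
    have "C * norm \<xi> \<le> max 1 C * norm \<xi>" by (rule mult_right_mono) auto
    hence "1 + C * norm \<xi> \<le> max 1 C * (1 + norm \<xi>)" by (simp add: distrib_left add_mono)
    hence "(1 + C * norm \<xi>) ^ N \<le> (max 1 C * (1 + norm \<xi>)) ^ N" using C by (intro power_mono) auto
    hence "(1 + C * norm \<xi>) ^ N * k \<eta> \<le> max 1 C ^ N * (1 + norm \<xi>) ^ N * k \<eta>"
      using pos[of \<eta>] by (intro mult_right_mono) (auto simp: power_mult_distrib)
    thus "k (\<xi> + \<eta>) \<le> max 1 C ^ N * (1 + norm \<xi>) ^ N * k \<eta>" using C(2) order_trans by blast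
    show "k \<xi> > 0" by (rule pos)
  qed
qed

text \<open>The defining inequality, used in both directions, squeezes \<open>k\<close> near a
  point. Measurability of the weight is obtained from this.\<close>

lemma tempered_weight_continuous:
  assumes "k \<in> tempered_weights"
  shows "continuous_on UNIV k"
proof -
  obtain C N where C: "C > 0" "\<And>\<xi> \<eta>. k (\<xi> + \<eta>) \<le> (1 + C * norm \<xi>) ^ N * k \<eta>" and pos: "\<And>\<xi>. k \<xi> > 0"
    using assms unfolding tempered_weights_def by blast
  have "isCont k \<eta>" for \<eta>
    unfolding isCont_def
  proof (rule tendsto_sandwich[where f = "\<lambda>x. k \<eta> / (1 + C * norm (x - \<eta>)) ^ N" and h = "\<lambda>x. (1 + C * norm (x - \<eta>)) ^ N * k \<eta>"])
    have "((\<lambda>x. (1 + C * norm (x - \<eta>)) ^ N * k \<eta>) \<longlongrightarrow> (1 + C * norm (\<eta> - \<eta>)) ^ N * k \<eta>) (at \<eta>)"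
      by (intro tendsto_intros)
    thus "((\<lambda>x. (1 + C * norm (x - \<eta>)) ^ N * k \<eta>) \<longlongrightarrow> k \<eta>) (at \<eta>)" by simp
    have "((\<lambda>x. k \<eta> / (1 + C * norm (x - \<eta>)) ^ N) \<longlongrightarrow> k \<eta> / (1 + C * norm (\<eta> - \<eta>)) ^ N) (at \<eta>)"
      by (intro tendsto_intros) auto
    thus "((\<lambda>x. k \<eta> / (1 + C * norm (x - \<eta>)) ^ N) \<longlongrightarrow> k \<eta>) (at \<eta>)" by simp
    show "\<forall>\<^sub>F x in at \<eta>. k x \<le> (1 + C * norm (x - \<eta>)) ^ N * k \<eta>"
      using C(2)[of "x - \<eta>" \<eta> for x] by (intro always_eventually) simp
    show "\<forall>\<^sub>F x in at \<eta>. k \<eta> / (1 + C * norm (x - \<eta>)) ^ N \<le> k x"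
    proof (intro always_eventually allI)
      fix x
      have "k \<eta> \<le> (1 + C * norm (\<eta> - x)) ^ N * k x" using C(2)[of "\<eta> - x" x] by simp
      moreover have "(1 + C * norm (x - \<eta>)) ^ N > 0" using C(1) by (intro zero_less_power add_pos_nonneg) auto
      ultimately show "k \<eta> / (1 + C * norm (x - \<eta>)) ^ N \<le> k x" by (simp add: divide_le_eq norm_minus_commute mult.commute)
    qed
  qed
  thus ?thesis by (simp add: continuous_on_eq_continuous_at)
qed

lemma le_1_plus_powr:
  fixes x p :: real
  assumes "x \<ge> 0" "p \<ge> 1"
  shows "x \<le> 1 + x powr p"
proof (cases "x \<le> 1")
  case False
  hence "x powr 1 \<le> x powr p" using assms by (intro powr_mono) auto
  thus ?thesis using False by simp
qed (simp add: add_increasing2)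

lemma Lp_norm_finite_p:
  assumes "p \<noteq> \<infinity>"
  shows "Lp_norm p f < \<infinity> \<longleftrightarrow> (\<integral>\<^sup>+x. ennreal (\<bar>f x\<bar> powr enn2real p) \<partial>lborel) < \<infinity>"
  using assms by (auto simp: Lp_norm_def Let_def less_top)

text \<open>Instead of Hoelder's inequality, \<open>x \<le> 1 + x\<^sup>p\<close> suffices here.\<close>

lemma integrable_of_Lp_norm:
  fixes f :: "real ^ 'n::finite \<Rightarrow> real"
  assumes fm[measurable]: "f \<in> borel_measurable borel" and p: "1 \<le> p" and fin: "Lp_norm p f < \<infinity>"
  shows "integrable lborel (\<lambda>x. \<bar>f x\<bar> * decay (2 * CARD('n)) x)"
proof (cases "p = \<infinity>")
  case True
  let ?e = "esssup lborel (\<lambda>x. ennreal \<bar>f x\<bar>)"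
  have e: "?e < \<infinity>" using fin True by (simp add: Lp_norm_def)
  have "AE x in lborel. ennreal \<bar>f x\<bar> \<le> ?e" by (rule esssup_AE)
  hence ae: "AE x in lborel. \<bar>f x\<bar> \<le> enn2real ?e"
  proof eventually_elim
    case (elim x)
    hence "enn2real (ennreal \<bar>f x\<bar>) \<le> enn2real ?e" using e by (intro enn2real_mono) auto
    thus ?case by simp
  qed
  show ?thesis
  proof (rule Bochner_Integration.integrable_bound)
    show "integrable lborel (\<lambda>x :: real ^ 'n. enn2real ?e * decay (2 * CARD('n)) x)"
      by (intro integrable_mult_right integrable_decay) simp
    show "AE x in lborel. norm (\<bar>f x\<bar> * decay (2 * CARD('n)) x) \<le> norm (enn2real ?e * decay (2 * CARD('n)) x)"
      using ae by eventually_elim (simp add: abs_mult mult_right_mono)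
  qed measurable
next
  case False
  define q where "q = enn2real p"
  have q: "q \<ge> 1"
  proof -
    have "enn2real 1 \<le> enn2real p" using p False by (intro enn2real_mono) (auto simp: less_top)
    thus ?thesis by (simp add: q_def)
  qed
  have "(\<integral>\<^sup>+x. ennreal (\<bar>f x\<bar> powr q) \<partial>lborel) < \<infinity>" using fin Lp_norm_finite_p[OF False, of f] by (simp add: q_def)
  hence i: "integrable lborel (\<lambda>x. \<bar>f x\<bar> powr q)" by (intro integrableI_nonneg) auto
  show ?thesis
  proof (rule Bochner_Integration.integrable_bound)
    show "integrable lborel (\<lambda>x :: real ^ 'n. decay (2 * CARD('n)) x + \<bar>f x\<bar> powr q)"
      by (intro Bochner_Integration.integrable_add i integrable_decay) simp
    show "AE x in lborel. norm (\<bar>f x\<bar> * decay (2 * CARD('n)) x) \<le> norm (decay (2 * CARD('n)) x + \<bar>f x\<bar> powr q)"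
    proof (rule AE_I2)
      fix x :: "real ^ 'n"
      have "\<bar>f x\<bar> * decay (2 * CARD('n)) x \<le> (1 + \<bar>f x\<bar> powr q) * decay (2 * CARD('n)) x"
        using le_1_plus_powr[of "\<bar>f x\<bar>" q] q by (intro mult_right_mono) auto
      also have "\<dots> \<le> decay (2 * CARD('n)) x + \<bar>f x\<bar> powr q"
        using mult_left_mono[OF decay_le_1[of "2 * CARD('n)" x], of "\<bar>f x\<bar> powr q"] by (simp add: distrib_right)
      finally show "norm (\<bar>f x\<bar> * decay (2 * CARD('n)) x) \<le> norm (decay (2 * CARD('n)) x + \<bar>f x\<bar> powr q)" by simp
    qed
  qed measurable
qed

section \<open>Young's inequality with a decaying kernel\<close>

text \<open>The tangent-line form of convexity. The endpoint 0 is computed by hand, since the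
  convexity argument takes place on the open half-line.\<close>

lemma powr_above_tangent:
  fixes x a q :: real
  assumes "q \<ge> 1" "a > 0" "x \<ge> 0"
  shows "x powr q \<ge> a powr q + q * a powr (q - 1) * (x - a)"
proof (cases "x = 0")
  case True
  have "a powr q = a powr (q - 1) * a" using assms(2) by (simp add: powr_diff)
  hence "a powr q + q * a powr (q - 1) * (0 - a) = (1 - q) * a powr q" by (simp add: algebra_simps)
  also have "\<dots> \<le> 0" using assms by (intro mult_nonpos_nonneg) auto
  finally show ?thesis using True assms by simp
next
  case False
  have "x powr q - a powr q \<ge> (q * a powr (q - 1)) * (x - a)"
  proof (rule convex_on_imp_above_tangent[where A = "{0<..}"])
    show "convex_on {0<..} (\<lambda>x. x powr q)" by (rule powr_convex[OF assms(1)])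
    show "((\<lambda>x. x powr q) has_field_derivative q * a powr (q - 1)) (at a within {0<..})"
      using assms by (intro has_real_derivative_powr DERIV_subset[OF has_real_derivative_powr]) auto
  qed (use assms False in \<open>auto simp: interior_open\<close>)
  thus ?thesis by simp
qed

text \<open>The tangent inequality at the weighted mean \<open>a\<close>, integrated against the
  weight. The weight is not normalized, whence the power q - 1 of its mass.\<close>

lemma jensen_powr:
  fixes f w :: "'a \<Rightarrow> real"
  assumes q: "q \<ge> 1" and w: "integrable M w" "\<And>x. w x \<ge> 0" and f: "\<And>x. f x \<ge> 0"
    and fw: "integrable M (\<lambda>x. f x * w x)" and fqw: "integrable M (\<lambda>x. f x powr q * w x)"
    and I: "integral\<^sup>L M w > 0"
  shows "(LINT x|M. f x * w x) powr q \<le> integral\<^sup>L M w powr (q - 1) * (LINT x|M. f x powr q * w x)"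
proof -
  let ?I = "integral\<^sup>L M w" and ?S = "LINT x|M. f x * w x"
  have S0: "?S \<ge> 0" using f w by simp
  show ?thesis
  proof (cases "?S = 0")
    case True
    thus ?thesis using q f w by simp
  next
    case False
    define a where "a = ?S / ?I"
    have a: "a > 0" using False S0 I by (simp add: a_def)
    have "(LINT x|M. (a powr q - q * a powr (q - 1) * a) * w x + q * a powr (q - 1) * (f x * w x)) \<le> (LINT x|M. f x powr q * w x)"
    proof (rule integral_mono)
      show "integrable M (\<lambda>x. (a powr q - q * a powr (q - 1) * a) * w x + q * a powr (q - 1) * (f x * w x))"
        by (intro Bochner_Integration.integrable_add integrable_mult_right w fw)
      fix x
      have "(a powr q + q * a powr (q - 1) * (f x - a)) * w x \<le> f x powr q * w x"
        by (intro mult_right_mono powr_above_tangent q a f w)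
      thus "(a powr q - q * a powr (q - 1) * a) * w x + q * a powr (q - 1) * (f x * w x) \<le> f x powr q * w x"
        by (simp add: algebra_simps)
    qed (rule fqw)
    also have "(LINT x|M. (a powr q - q * a powr (q - 1) * a) * w x + q * a powr (q - 1) * (f x * w x)) =
       (a powr q - q * a powr (q - 1) * a) * ?I + q * a powr (q - 1) * ?S"
      using w fw by (subst Bochner_Integration.integral_add) auto
    \<comment> \<open>By the choice of \<open>a\<close> the linear terms cancel.\<close>
    also have "\<dots> = a powr q * ?I" using I by (simp add: a_def field_simps)
    finally have *: "a powr q * ?I \<le> (LINT x|M. f x powr q * w x)" .
    have "?S powr q = (a * ?I) powr q" using I by (simp add: a_def)
    also have "\<dots> = ?I powr (q - 1) * (a powr q * ?I)"
      using a I by (simp add: powr_mult powr_diff)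
    also have "\<dots> \<le> ?I powr (q - 1) * (LINT x|M. f x powr q * w x)"
      using * by (intro mult_left_mono) auto
    finally show ?thesis .
  qed
qed

lemma decay_integral_pos: "(LINT x|lborel. decay (2 * CARD('n)) (x :: real ^ 'n::finite)) > 0"
proof -
  have "integrable lborel (decay (2 * CARD('n)) :: real ^ 'n \<Rightarrow> real)" by (rule integrable_decay) simp
  moreover have "\<not> (AE x in lborel. decay (2 * CARD('n)) (x :: real ^ 'n) = 0)"
  proof -
    have "decay (2 * CARD('n)) (x :: real ^ 'n) \<noteq> 0" for x
      by (rule less_imp_neq[OF decay_pos, symmetric])
    moreover have "emeasure lborel (UNIV :: (real ^ 'n) set) \<noteq> 0" by simp
    ultimately show ?thesis by (simp add: AE_iff_measurable[OF _ refl])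
  qed
  ultimately have "(LINT x|lborel. decay (2 * CARD('n)) (x :: real ^ 'n)) \<noteq> 0"
    by (subst integral_nonneg_eq_0_iff_AE) auto
  moreover have "(LINT x|lborel. decay (2 * CARD('n)) (x :: real ^ 'n)) \<ge> 0" by simp
  ultimately show ?thesis by linarith
qed

text \<open>Young's inequality for an integrable kernel: Jensen pointwise with the kernel as weight,
  then Tonelli. \<open>F\<close> is merely dominated by a convolution, as the weighted Fourier
  transform will be. Finiteness of the norm of \<open>f\<close> ensures that the integrals on the
  right are genuine and not default zeros.\<close>

lemma Lp_norm_decay_convolution:
  fixes f F :: "real ^ 'n::finite \<Rightarrow> real"
  assumes p: "1 \<le> p" and f[measurable]: "f \<in> borel_measurable borel" and F[measurable]: "F \<in> borel_measurable borel"
    and fin: "Lp_norm p f < \<infinity>" and A: "A \<ge> 0"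
    and le: "\<And>\<eta>. \<bar>F \<eta>\<bar> \<le> A * (LINT \<xi>|lborel. \<bar>f \<xi>\<bar> * decay (2 * CARD('n)) (\<xi> - \<eta>))"
  shows "Lp_norm p F \<le> ennreal (A * (LINT x|lborel. decay (2 * CARD('n)) (x :: real ^ 'n))) * Lp_norm p f"
proof -
  let ?D = "decay (2 * CARD('n)) :: real ^ 'n \<Rightarrow> real"
  let ?I = "LINT x|lborel. ?D x"
  have I: "?I > 0" by (rule decay_integral_pos)
  have intD: "integrable lborel (\<lambda>\<xi>. ?D (\<xi> - \<eta>))" "(LINT \<xi>|lborel. ?D (\<xi> - \<eta>)) = ?I"
    "integrable lborel (\<lambda>\<eta>. ?D (\<xi> - \<eta>))" "(LINT \<eta>|lborel. ?D (\<xi> - \<eta>)) = ?I" for \<xi> \<eta>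
    using integrable_decay_shift[OF order_refl, where 'n = 'n] by auto
  show ?thesis
  proof (cases "p = \<infinity>")
    case True
    let ?e = "esssup lborel (\<lambda>x. ennreal \<bar>f x\<bar>)"
    have e: "?e < \<infinity>" using fin True by (simp add: Lp_norm_def)
    have "AE x in lborel. ennreal \<bar>f x\<bar> \<le> ?e" by (rule esssup_AE)
    hence ae: "AE x in lborel. \<bar>f x\<bar> \<le> enn2real ?e"
    proof eventually_elim
      case (elim x)
      hence "enn2real (ennreal \<bar>f x\<bar>) \<le> enn2real ?e" using e by (intro enn2real_mono) auto
      thus ?case by simp
    qed
    have "\<bar>F \<eta>\<bar> \<le> A * ?I * enn2real ?e" for \<eta>
    proof -
      have "(LINT \<xi>|lborel. \<bar>f \<xi>\<bar> * ?D (\<xi> - \<eta>)) \<le> (LINT \<xi>|lborel. enn2real ?e * ?D (\<xi> - \<eta>))"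
      proof (rule integral_mono_AE')
        show "integrable lborel (\<lambda>\<xi>. enn2real ?e * ?D (\<xi> - \<eta>))" using intD by simp
        show "AE \<xi> in lborel. \<bar>f \<xi>\<bar> * ?D (\<xi> - \<eta>) \<le> enn2real ?e * ?D (\<xi> - \<eta>)"
          using ae by eventually_elim (simp add: mult_right_mono)
      qed simp
      also have "\<dots> = enn2real ?e * ?I" using intD by simp
      finally have "A * (LINT \<xi>|lborel. \<bar>f \<xi>\<bar> * ?D (\<xi> - \<eta>)) \<le> A * (enn2real ?e * ?I)" using A by (rule mult_left_mono)
      thus ?thesis using le[of \<eta>] by (simp add: mult_ac)
    qed
    hence "esssup lborel (\<lambda>x. ennreal \<bar>F x\<bar>) \<le> ennreal (A * ?I * enn2real ?e)"
      by (intro esssup_I AE_I2 ennreal_leI) auto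
    also have "\<dots> = ennreal (A * ?I) * ?e" using A I e by (simp add: ennreal_mult ennreal_enn2real)
    finally show ?thesis using True by (simp add: Lp_norm_def)
  next
    case False
    define q where "q = enn2real p"
    have q: "q \<ge> 1"
    proof -
      have "enn2real 1 \<le> enn2real p" using p False by (intro enn2real_mono) (auto simp: less_top)
      thus ?thesis by (simp add: q_def)
    qed
    let ?X = "\<integral>\<^sup>+x. ennreal (\<bar>f x\<bar> powr q) \<partial>lborel"
    have X: "?X < \<infinity>" using fin Lp_norm_finite_p[OF False, of f] by (simp add: q_def)
    hence intfq: "integrable lborel (\<lambda>x. \<bar>f x\<bar> powr q)" by (intro integrableI_nonneg) auto
    have intfqD: "integrable lborel (\<lambda>\<xi>. \<bar>f \<xi>\<bar> powr q * ?D (\<xi> - \<eta>))" for \<eta>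
    proof (rule Bochner_Integration.integrable_bound[OF intfq])
      show "AE \<xi> in lborel. norm (\<bar>f \<xi>\<bar> powr q * ?D (\<xi> - \<eta>)) \<le> norm (\<bar>f \<xi>\<bar> powr q)"
        by (intro AE_I2) (simp add: mult_left_le decay_le_1)
    qed measurable
    have intfD: "integrable lborel (\<lambda>\<xi>. \<bar>f \<xi>\<bar> * ?D (\<xi> - \<eta>))" for \<eta>
    proof (rule Bochner_Integration.integrable_bound)
      show "integrable lborel (\<lambda>\<xi>. ?D (\<xi> - \<eta>) + \<bar>f \<xi>\<bar> powr q * ?D (\<xi> - \<eta>))"
        by (intro Bochner_Integration.integrable_add intD intfqD)
      show "AE \<xi> in lborel. norm (\<bar>f \<xi>\<bar> * ?D (\<xi> - \<eta>)) \<le> norm (?D (\<xi> - \<eta>) + \<bar>f \<xi>\<bar> powr q * ?D (\<xi> - \<eta>))"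
      proof (rule AE_I2)
        fix \<xi>
        have "\<bar>f \<xi>\<bar> * ?D (\<xi> - \<eta>) \<le> (1 + \<bar>f \<xi>\<bar> powr q) * ?D (\<xi> - \<eta>)"
          using le_1_plus_powr[of "\<bar>f \<xi>\<bar>" q] q by (intro mult_right_mono) auto
        thus "norm (\<bar>f \<xi>\<bar> * ?D (\<xi> - \<eta>)) \<le> norm (?D (\<xi> - \<eta>) + \<bar>f \<xi>\<bar> powr q * ?D (\<xi> - \<eta>))"
          by (simp add: distrib_right)
      qed
    qed measurable
    \<comment> \<open>Jensen supplies the power q - 1 of the kernel mass, Tonelli one more; the q-th
      root of the total is then \<open>A * ?I\<close> times the norm of \<open>f\<close>.\<close>
    let ?B = "A powr q * ?I powr (q - 1)"
    have pt: "\<bar>F \<eta>\<bar> powr q \<le> ?B * (LINT \<xi>|lborel. \<bar>f \<xi>\<bar> powr q * ?D (\<xi> - \<eta>))" for \<eta>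
    proof -
      have S: "(LINT \<xi>|lborel. \<bar>f \<xi>\<bar> * ?D (\<xi> - \<eta>)) \<ge> 0" by simp
      have "\<bar>F \<eta>\<bar> powr q \<le> (A * (LINT \<xi>|lborel. \<bar>f \<xi>\<bar> * ?D (\<xi> - \<eta>))) powr q"
        using q by (intro powr_mono2 le) auto
      also have "\<dots> = A powr q * (LINT \<xi>|lborel. \<bar>f \<xi>\<bar> * ?D (\<xi> - \<eta>)) powr q"
        using A S by (simp add: powr_mult)
      also have "\<dots> \<le> A powr q * (?I powr (q - 1) * (LINT \<xi>|lborel. \<bar>f \<xi>\<bar> powr q * ?D (\<xi> - \<eta>)))"
        using jensen_powr[OF q intD(1)[of \<eta>] _ _ intfD intfqD] I intD(2)[of \<eta>] by (intro mult_left_mono) auto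
      finally show ?thesis by (simp add: mult.assoc)
    qed
    have "(\<integral>\<^sup>+\<eta>. ennreal (\<bar>F \<eta>\<bar> powr q) \<partial>lborel) \<le> (\<integral>\<^sup>+\<eta>. ennreal ?B * (\<integral>\<^sup>+\<xi>. ennreal (\<bar>f \<xi>\<bar> powr q * ?D (\<xi> - \<eta>)) \<partial>lborel) \<partial>lborel)"
    proof (rule nn_integral_mono)
      fix \<eta>
      have "(\<integral>\<^sup>+\<xi>. ennreal (\<bar>f \<xi>\<bar> powr q * ?D (\<xi> - \<eta>)) \<partial>lborel) = ennreal (LINT \<xi>|lborel. \<bar>f \<xi>\<bar> powr q * ?D (\<xi> - \<eta>))"
        by (rule nn_integral_eq_integral[OF intfqD]) simp
      thus "ennreal (\<bar>F \<eta>\<bar> powr q) \<le> ennreal ?B * (\<integral>\<^sup>+\<xi>. ennreal (\<bar>f \<xi>\<bar> powr q * ?D (\<xi> - \<eta>)) \<partial>lborel)"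
        using pt[of \<eta>] by (simp add: ennreal_mult[symmetric] ennreal_leI)
    qed
    also have "\<dots> = ennreal ?B * (\<integral>\<^sup>+\<eta>. (\<integral>\<^sup>+\<xi>. ennreal (\<bar>f \<xi>\<bar> powr q * ?D (\<xi> - \<eta>)) \<partial>lborel) \<partial>lborel)"
      by (rule nn_integral_cmult) measurable
    also have "(\<integral>\<^sup>+\<eta>. (\<integral>\<^sup>+\<xi>. ennreal (\<bar>f \<xi>\<bar> powr q * ?D (\<xi> - \<eta>)) \<partial>lborel) \<partial>lborel) =
       (\<integral>\<^sup>+\<xi>. (\<integral>\<^sup>+\<eta>. ennreal (\<bar>f \<xi>\<bar> powr q * ?D (\<xi> - \<eta>)) \<partial>lborel) \<partial>lborel)"
      by (rule lborel_pair.Fubini') measurable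
    also have "\<dots> = (\<integral>\<^sup>+\<xi>. ennreal (\<bar>f \<xi>\<bar> powr q) * ennreal ?I \<partial>lborel)"
    proof (rule nn_integral_cong)
      fix \<xi>
      have "(\<integral>\<^sup>+\<eta>. ennreal (\<bar>f \<xi>\<bar> powr q * ?D (\<xi> - \<eta>)) \<partial>lborel) = ennreal (LINT \<eta>|lborel. \<bar>f \<xi>\<bar> powr q * ?D (\<xi> - \<eta>))"
        using intD by (intro nn_integral_eq_integral) auto
      also have "\<dots> = ennreal (\<bar>f \<xi>\<bar> powr q * ?I)" using intD by simp
      also have "\<dots> = ennreal (\<bar>f \<xi>\<bar> powr q) * ennreal ?I" using I by (simp add: ennreal_mult)
      finally show "(\<integral>\<^sup>+\<eta>. ennreal (\<bar>f \<xi>\<bar> powr q * ?D (\<xi> - \<eta>)) \<partial>lborel) = ennreal (\<bar>f \<xi>\<bar> powr q) * ennreal ?I" .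
    qed
    also have "\<dots> = ?X * ennreal ?I" by (rule nn_integral_multc) measurable
    finally have main: "(\<integral>\<^sup>+\<eta>. ennreal (\<bar>F \<eta>\<bar> powr q) \<partial>lborel) \<le> ennreal ?B * (?X * ennreal ?I)" .
    obtain x where x: "?X = ennreal x" "x \<ge> 0" using X by (cases ?X) auto
    have "ennreal ?B * (?X * ennreal ?I) = ennreal ((A * ?I) powr q * x)"
    proof -
      have "?I powr (q - 1) * ?I = ?I powr q" using I by (simp add: powr_diff)
      hence "?B * (x * ?I) = (A * ?I) powr q * x" using A I by (simp add: powr_mult mult_ac)
      thus ?thesis unfolding x(1) using x(2) I A by (simp add: ennreal_mult[symmetric])
    qed
    with main have main: "(\<integral>\<^sup>+\<eta>. ennreal (\<bar>F \<eta>\<bar> powr q) \<partial>lborel) \<le> ennreal ((A * ?I) powr q * x)" by simp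
    obtain y where y: "(\<integral>\<^sup>+\<eta>. ennreal (\<bar>F \<eta>\<bar> powr q) \<partial>lborel) = ennreal y" "y \<ge> 0"
      using main by (cases "\<integral>\<^sup>+\<eta>. ennreal (\<bar>F \<eta>\<bar> powr q) \<partial>lborel") (auto simp: top_unique)
    have yx: "y \<le> (A * ?I) powr q * x" using main x unfolding y(1) by (simp add: ennreal_le_iff)
    have "y powr (1 / q) \<le> ((A * ?I) powr q * x) powr (1 / q)" using yx y q by (intro powr_mono2) auto
    also have "\<dots> = A * ?I * x powr (1 / q)" using A I x q by (simp add: powr_mult powr_powr)
    finally have "ennreal (y powr (1 / q)) \<le> ennreal (A * ?I) * ennreal (x powr (1 / q))"
      using A I by (simp add: ennreal_mult[symmetric] ennreal_leI)
    thus ?thesis using False x y by (simp add: Lp_norm_def q_def[symmetric] Let_def)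
  qed
qed

section \<open>The Fourier transform of the localized solution\<close>

lemma contour_measurable_borel:
  assumes "good_shift m R c b w"
  shows "contour w \<in> borel_measurable borel" "solker m b w \<in> borel_measurable borel"
  using measurable_contour[OF assms] measurable_solker[OF assms] by (simp_all add: lborel_prod)

text \<open>Multiplication by an exponential translates the transform, so a product with a
  superposition transforms into a superposition of translates. The general measure covers both uses
  below: the contour integral \<open>sol\<close> and the Fourier transform of a test
  function.\<close>

lemma laplace_mult_expint:
  fixes z :: "complex ^ 'n::finite"
  assumes h: "h \<in> smooth_supported K" and K: "compact K" and adm: "expint_adm M a \<zeta> R" and M: "sigma_finite_measure M"
  shows "laplace (\<lambda>x. h x * expint M a \<zeta> x) z = (LINT s|M. a s * laplace h (z + \<zeta> s))"
proof -
  interpret M: sigma_finite_measure M by (rule M)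
  interpret P: pair_sigma_finite M "lborel :: (real ^ 'n) measure" ..
  have [measurable]: "a \<in> borel_measurable M" "\<zeta> \<in> borel_measurable M" "h \<in> borel_measurable borel"
    using adm h by (auto simp: expint_adm_def smooth_supported_def smooth_measurable)
  have "integrable M (\<lambda>s. cmod (a s) * (1 + norm (\<zeta> s)) ^ 0)" using adm unfolding expint_adm_def by blast
  hence inta: "integrable M (\<lambda>s. cmod (a s))" by simp
  let ?v = "\<lambda>x. cmod (cexp x z) * cmod (h x) * exp (real CARD('n) * R * norm x)"
  have intv: "integrable lborel ?v"
  proof (rule integrable_compact_support[OF _ K])
    show "continuous_on UNIV ?v"
      by (intro continuous_intros smooth_continuous_on smooth_cexp smooth_supported_smooth[OF h])
  qed (use h in \<open>simp add: smooth_supported_def\<close>)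
  have "laplace (\<lambda>x. h x * expint M a \<zeta> x) z = (LINT x|lborel. LINT s|M. a s * (cexp x (z + \<zeta> s) * h x))"
    unfolding laplace_def expint_def
  proof (intro Bochner_Integration.integral_cong refl)
    fix x
    have "cexp x z * (h x * (LINT s|M. a s * cexp x (\<zeta> s))) = (LINT s|M. (cexp x z * h x) * (a s * cexp x (\<zeta> s)))"
      by (simp only: integral_mult_right_zero mult.assoc)
    thus "cexp x z * (h x * (LINT s|M. a s * cexp x (\<zeta> s))) = (LINT s|M. a s * (cexp x (z + \<zeta> s) * h x))"
      unfolding cexp_add by (simp only: mult_ac)
  qed
  also have "\<dots> = (LINT s|M. LINT x|lborel. a s * (cexp x (z + \<zeta> s) * h x))"
  proof (rule P.Fubini_integral)
    show "integrable (M \<Otimes>\<^sub>M lborel) (\<lambda>(s, x). a s * (cexp x (z + \<zeta> s) * h x))"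
    proof (rule P.integrable_pair_bound[OF _ inta intv])
      show "norm (case (s, x) of (s, x) \<Rightarrow> a s * (cexp x (z + \<zeta> s) * h x)) \<le> cmod (a s) * ?v x" for s x
      proof -
        have "cmod (cexp x (\<zeta> s)) \<le> exp (real CARD('n) * R * norm x)"
          using adm by (intro norm_cexp_le) (simp add: expint_adm_def)
        hence "cmod (a s) * (cmod (cexp x z) * cmod (h x) * cmod (cexp x (\<zeta> s))) \<le> cmod (a s) * ?v x"
          by (intro mult_left_mono) auto
        thus ?thesis by (simp add: norm_mult cexp_add mult_ac)
      qed
    qed measurable
  qed
  finally show ?thesis by (simp add: laplace_def)
qed

section \<open>The kernel of the localized solution operator\<close>

definition convint :: "nat \<Rightarrow> ('n::finite multiindex \<Rightarrow> complex) \<Rightarrow> (real ^ 'n \<Rightarrow> real ^ 'n) \<Rightarrow> (real ^ 'n \<Rightarrow> complex) \<Rightarrow>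
    (real ^ 'n \<Rightarrow> complex) \<Rightarrow> real ^ 'n \<Rightarrow> real ^ 'n \<Rightarrow> ((real ^ 'n) \<times> real) \<Rightarrow> complex" where
  "convint m b w h \<phi> \<eta> \<xi> s = solker m b w s * laplace h (cvec \<xi> - contour w s) * laplace \<phi> (contour w s - cvec \<eta>)"

text \<open>Up to a power of 2 pi, the kernel of the map from the transform of v to that of \<phi>
  u. The factor from \<open>h\<close> links \<xi> to the contour, the factor from \<phi> links the
  contour to \<eta>.\<close>

definition convker :: "nat \<Rightarrow> ('n::finite multiindex \<Rightarrow> complex) \<Rightarrow> (real ^ 'n \<Rightarrow> real ^ 'n) \<Rightarrow> (real ^ 'n \<Rightarrow> complex) \<Rightarrow>
    (real ^ 'n \<Rightarrow> complex) \<Rightarrow> real ^ 'n \<Rightarrow> real ^ 'n \<Rightarrow> complex" where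
  "convker m b w h \<phi> \<eta> \<xi> = (LINT s|lborel. convint m b w h \<phi> \<eta> \<xi> s)"

text \<open>The transform of \<open>h\<close> decays between \<xi> and the contour point, that of
  \<phi> between the contour point and \<eta>; the inequality of Peetre type combines the two. Slow
  variation centred at \<eta> leaves exactly the denominator that the target weight cancels.\<close>

lemma convker_bound:
  fixes h \<phi> :: "real ^ 'n::finite \<Rightarrow> complex"
  assumes h: "h \<in> smooth_supported K" "compact K" and \<phi>: "\<phi> \<in> smooth_supported K'" "compact K'"
  obtains A where "A \<ge> 0" "\<And>b w \<eta> \<xi>. good_shift m R c b w \<Longrightarrow>
    cmod (convker m b w h \<phi> \<eta> \<xi>) \<le> A * decay M (\<xi> - \<eta>) / ptilde m b \<eta>"
proof -
  obtain C1 where C1: "C1 \<ge> 0" "\<And>z \<xi>. norm (z - cvec \<xi>) \<le> R \<Longrightarrow> cmod (laplace h z) \<le> C1 * decay M \<xi>"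
    using laplace_cvec_decay[OF h] by blast
  let ?L = "2 * CARD('n)"
  \<comment> \<open>\<open>M\<close> for combining the decays, 2n for integrability along the
    contour, \<open>m\<close> for slow variation.\<close>
  obtain C2 where C2: "C2 \<ge> 0" "\<And>z \<xi>. norm (z - cvec \<xi>) \<le> R \<Longrightarrow> cmod (laplace \<phi> z) \<le> C2 * decay ((M + ?L) + m) \<xi>"
    using laplace_cvec_decay[OF \<phi>] by blast
  let ?I = "LINT x|lborel. decay ?L (x :: real ^ 'n)"
  define A where "A = (mcount TYPE('n) m)\<^sup>2 / \<bar>c\<bar> * C1 * C2"
  have A: "A \<ge> 0" using C1 C2 by (simp add: A_def)
  show thesis
  proof (rule that[of "A * ?I"])
    show "A * ?I \<ge> 0" using A by simp
    fix b and w :: "real ^ 'n \<Rightarrow> real ^ 'n" and \<eta> \<xi> :: "real ^ 'n"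
    assume g: "good_shift m R c b w"
    have c: "c > 0" "ptilde m b \<eta> > 0" using g by (auto simp: good_shift_def)
    have intD: "integrable lborel (\<lambda>x :: real ^ 'n. decay ?L (x - \<eta>))" "(LINT x|lborel. decay ?L (x - \<eta>)) = ?I"
      using integrable_decay_shift[OF order_refl, where 'n = 'n] by auto
    have "cmod (convker m b w h \<phi> \<eta> \<xi>) \<le> (LINT s|lebs. (A / ptilde m b \<eta> * decay M (\<xi> - \<eta>)) * (indicator {0..1} (snd s) * decay ?L (fst s - \<eta>)))"
      unfolding convker_def lborel_prod[symmetric]
    proof (rule norm_integral_le)
      show "integrable lebs (\<lambda>s. (A / ptilde m b \<eta> * decay M (\<xi> - \<eta>)) * (indicator {0..1} (snd s) * decay ?L (fst s - \<eta>)))"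
        by (intro integrable_mult_right lebs_integral_fst(1) intD)
      fix s
      have n: "norm (contour w s - cvec (fst s)) \<le> R" by (rule norm_contour_diff_le[OF g])
      have "cmod (convint m b w h \<phi> \<eta> \<xi> s) \<le>
        (indicator {0..1} (snd s) * ((mcount TYPE('n) m)\<^sup>2 / c * (1 + norm (fst s - \<eta>)) ^ m / ptilde m b \<eta>)) * (C1 * decay M (\<xi> - fst s)) * (C2 * decay ((M + ?L) + m) (fst s - \<eta>))"
        unfolding convint_def norm_mult
      proof (intro mult_mono norm_solker_le[OF g] C1(2) C2(2))
        show "norm (cvec \<xi> - contour w s - cvec (\<xi> - fst s)) \<le> R"
          using n by (simp add: cvec_diff norm_minus_commute)
        show "norm (contour w s - cvec \<eta> - cvec (fst s - \<eta>)) \<le> R" using n by (simp add: cvec_diff)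
      qed (use c C1 C2 in auto)
      also have "\<dots> = A / ptilde m b \<eta> * indicator {0..1} (snd s) * decay M (\<xi> - fst s) * ((1 + norm (fst s - \<eta>)) ^ m * decay ((M + ?L) + m) (fst s - \<eta>))"
        using c unfolding A_def by (simp add: mult_ac)
      also have "(1 + norm (fst s - \<eta>)) ^ m * decay ((M + ?L) + m) (fst s - \<eta>) = decay M (fst s - \<eta>) * decay ?L (fst s - \<eta>)"
        by (simp only: decay_mult_power) (simp only: decay_add_exponent)
      also have "A / ptilde m b \<eta> * indicator {0..1} (snd s) * decay M (\<xi> - fst s) * (decay M (fst s - \<eta>) * decay ?L (fst s - \<eta>)) =
        A / ptilde m b \<eta> * (indicator {0..1} (snd s) * decay ?L (fst s - \<eta>)) * (decay M (\<xi> - fst s) * decay M (fst s - \<eta>))"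
        by (simp only: mult_ac)
      also have "\<dots> \<le> A / ptilde m b \<eta> * (indicator {0..1} (snd s) * decay ?L (fst s - \<eta>)) * decay M (\<xi> - \<eta>)"
        using decay_mult_le[of M "\<xi> - fst s" "fst s - \<eta>"] A c by (intro mult_left_mono) auto
      finally show "cmod (convint m b w h \<phi> \<eta> \<xi> s) \<le> (A / ptilde m b \<eta> * decay M (\<xi> - \<eta>)) * (indicator {0..1} (snd s) * decay ?L (fst s - \<eta>))"
        by (simp only: mult_ac)
    qed
    also have "\<dots> = (A / ptilde m b \<eta> * decay M (\<xi> - \<eta>)) * ?I"
      unfolding integral_mult_right_zero lebs_integral_fst(2)[OF intD(1)] intD(2) ..
    finally show "cmod (convker m b w h \<phi> \<eta> \<xi>) \<le> A * ?I * decay M (\<xi> - \<eta>) / ptilde m b \<eta>" by (simp add: mult_ac)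
  qed
qed

lemma convint_measurable:
  assumes g: "good_shift m R c b w" and "h \<in> borel_measurable borel" "\<phi> \<in> borel_measurable borel"
    and e[measurable]: "e \<in> borel_measurable N" "x \<in> borel_measurable N" "s \<in> borel_measurable N"
  shows "(\<lambda>p. convint m b w h \<phi> (e p) (x p) (s p)) \<in> borel_measurable N"
proof -
  have [measurable]: "contour w \<in> borel_measurable borel" "solker m b w \<in> borel_measurable borel"
    using contour_measurable_borel[OF g] .
  have [measurable]: "laplace h \<in> borel_measurable borel" "laplace \<phi> \<in> borel_measurable borel" using assms by auto
  show ?thesis unfolding convint_def by measurable
qed

lemma convker_measurable:
  assumes g: "good_shift m R c b w" and "h \<in> borel_measurable borel" "\<phi> \<in> borel_measurable borel"
  shows "(\<lambda>p. convker m b w h \<phi> (fst p) (snd p)) \<in> borel_measurable (borel \<Otimes>\<^sub>M borel)"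
proof -
  have "(\<lambda>q. convint m b w h \<phi> (fst (fst q)) (snd (fst q)) (snd q)) \<in> borel_measurable ((borel \<Otimes>\<^sub>M borel) \<Otimes>\<^sub>M lborel)"
    by (rule convint_measurable[OF assms]) measurable
  hence "(\<lambda>(p, s). convint m b w h \<phi> (fst p) (snd p) s) \<in> borel_measurable ((borel \<Otimes>\<^sub>M borel) \<Otimes>\<^sub>M lborel)"
    by (simp add: case_prod_beta')
  from lborel.borel_measurable_lebesgue_integral[OF this]
  show ?thesis unfolding convker_def .
qed

text \<open>The product of \<phi> with the transform of \<theta> is the argument at which the
  Fourier transform of \<phi> u is tested. Both multiplications become translations on the Fourier
  side, and an exchange of integrals leaves \<theta> integrated against the kernel.\<close>

lemma laplace_sol_eq:
  fixes h \<phi> \<theta> :: "real ^ 'n::finite \<Rightarrow> complex"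
  assumes g: "good_shift m R c b w" and h: "h \<in> smooth_supported K" "compact K"
    and \<phi>: "\<phi> \<in> smooth_supported K'" "compact K'" and \<theta>: "\<theta> \<in> smooth_supported K''" "compact K''"
  shows "laplace (\<lambda>x. h x * sol m b w (\<lambda>y. \<phi> y * fourier \<theta> y) x) (cvec \<xi>) = (LINT \<eta>|lborel. \<theta> \<eta> * convker m b w h \<phi> \<eta> \<xi>)"
proof -
  have meas: "h \<in> borel_measurable borel" "\<phi> \<in> borel_measurable borel" "\<theta> \<in> borel_measurable borel"
    using h \<phi> \<theta> by (auto simp: smooth_supported_def smooth_measurable)
  note [measurable] = meas contour_measurable_borel[OF g]
  let ?f = "\<lambda>y. \<phi> y * fourier \<theta> y"
  have f: "?f \<in> smooth_supported K'"
    using smooth_supported_mult[OF smooth_fourier[OF \<theta>] \<phi>(1)] by (simp add: mult.commute)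
  have "laplace (\<lambda>x. h x * sol m b w ?f x) (cvec \<xi>) =
     (LINT s|lborel. solker m b w s * laplace ?f (contour w s) * laplace h (cvec \<xi> + - contour w s))"
    unfolding sol_def
    by (rule laplace_mult_expint[OF h expint_adm_sol[OF g f \<phi>(2), unfolded lborel_prod]]) (rule sigma_finite_lborel)
  also have "\<dots> = (LINT s|lborel. LINT \<eta>|lborel. \<theta> \<eta> * convint m b w h \<phi> \<eta> \<xi> s)"
  proof (intro Bochner_Integration.integral_cong refl)
    fix s
    have "laplace ?f (contour w s) = (LINT \<eta>|lborel. \<theta> \<eta> * laplace \<phi> (contour w s + - cvec \<eta>))"
      unfolding fourier_eq_expint
      by (rule laplace_mult_expint[OF \<phi> expint_adm_smooth_supported(2)[OF \<theta>]]) (rule sigma_finite_lborel)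
    hence "solker m b w s * laplace ?f (contour w s) * laplace h (cvec \<xi> + - contour w s) =
      (LINT \<eta>|lborel. (solker m b w s * laplace h (cvec \<xi> - contour w s)) * (\<theta> \<eta> * laplace \<phi> (contour w s - cvec \<eta>)))"
      unfolding integral_mult_right_zero by (simp only: add_uminus_conv_diff mult_ac)
    thus "solker m b w s * laplace ?f (contour w s) * laplace h (cvec \<xi> + - contour w s) = (LINT \<eta>|lborel. \<theta> \<eta> * convint m b w h \<phi> \<eta> \<xi> s)"
      unfolding convint_def by (simp only: mult_ac)
  qed
  also have "\<dots> = (LINT \<eta>|lborel. LINT s|lborel. \<theta> \<eta> * convint m b w h \<phi> \<eta> \<xi> s)"
  proof (rule lborel_pair.Fubini_integral)
    have c: "c > 0" "ptilde m b \<xi> > 0" using g by (auto simp: good_shift_def)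
    obtain C1 where C1: "C1 \<ge> 0" "\<And>z \<xi>. norm (z - cvec \<xi>) \<le> R \<Longrightarrow> cmod (laplace h z) \<le> C1 * decay (2 * CARD('n) + m) \<xi>"
      using laplace_cvec_decay[OF h] by blast
    obtain C2 where C2: "C2 \<ge> 0" "\<And>z \<xi>. norm (z - cvec \<xi>) \<le> R \<Longrightarrow> cmod (laplace \<phi> z) \<le> C2 * decay 0 \<xi>"
      using laplace_cvec_decay[OF \<phi>] by blast
    \<comment> \<open>Here \<xi> is fixed, so slow variation is centred at \<xi> and the decay of
      the transform of \<open>h\<close> alone gives integrability along the contour; the transform
      of \<phi> is merely bounded.\<close>
    let ?A = "(mcount TYPE('n) m)\<^sup>2 / c / ptilde m b \<xi> * C1"
    let ?u = "\<lambda>\<eta>. cmod (\<theta> \<eta>) * C2"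
    let ?v = "\<lambda>s :: (real ^ 'n) \<times> real. ?A * (indicator {0..1} (snd s) * decay (2 * CARD('n)) (fst s - \<xi>))"
    show "integrable (lborel \<Otimes>\<^sub>M lborel) (\<lambda>(\<eta>, s). \<theta> \<eta> * convint m b w h \<phi> \<eta> \<xi> s)"
    proof (rule lborel_pair.integrable_pair_bound)
      have "(\<lambda>p. \<theta> (fst p) * convint m b w h \<phi> (fst p) \<xi> (snd p)) \<in> borel_measurable (lborel \<Otimes>\<^sub>M lborel)"
        by (intro borel_measurable_times convint_measurable[OF g]) measurable
      thus "(\<lambda>(\<eta>, s). \<theta> \<eta> * convint m b w h \<phi> \<eta> \<xi> s) \<in> borel_measurable (lborel \<Otimes>\<^sub>M lborel)"
        by (simp add: case_prod_beta')
      show "integrable lborel ?u" using integrable_smooth_supported[OF \<theta>] by (intro integrable_mult_left integrable_norm)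
      have intD: "integrable lborel (\<lambda>x. decay (2 * CARD('n)) (x - \<xi>) :: real)"
        by (rule integrable_decay_shift) simp
      show "integrable lborel ?v" unfolding lborel_prod[symmetric]
        by (rule integrable_mult_right) (rule lebs_integral_fst(1)[OF intD])
      fix \<eta> s
      have n: "norm (contour w s - cvec (fst s)) \<le> R" by (rule norm_contour_diff_le[OF g])
      have "cmod (convint m b w h \<phi> \<eta> \<xi> s) \<le>
        (indicator {0..1} (snd s) * ((mcount TYPE('n) m)\<^sup>2 / c * (1 + norm (fst s - \<xi>)) ^ m / ptilde m b \<xi>)) * (C1 * decay (2 * CARD('n) + m) (\<xi> - fst s)) * (C2 * decay 0 (fst s - \<eta>))"
        unfolding convint_def norm_mult
      proof (intro mult_mono norm_solker_le[OF g] C1(2) C2(2))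
        show "norm (cvec \<xi> - contour w s - cvec (\<xi> - fst s)) \<le> R"
          using n by (simp add: cvec_diff norm_minus_commute)
        show "norm (contour w s - cvec \<eta> - cvec (fst s - \<eta>)) \<le> R" using n by (simp add: cvec_diff)
      qed (use c C1 C2 in auto)
      also have "\<dots> = C2 * (?A * (indicator {0..1} (snd s) * ((1 + norm (fst s - \<xi>)) ^ m * decay (2 * CARD('n) + m) (fst s - \<xi>))))"
        by (simp add: decay_minus_commute[of _ \<xi>] decay_def[of 0] mult_ac)
      also have "(1 + norm (fst s - \<xi>)) ^ m * decay (2 * CARD('n) + m) (fst s - \<xi>) = decay (2 * CARD('n)) (fst s - \<xi>)"
        by (rule decay_mult_power)
      finally have "cmod (\<theta> \<eta>) * cmod (convint m b w h \<phi> \<eta> \<xi> s) \<le> cmod (\<theta> \<eta>) * (C2 * ?v s)" by (rule mult_left_mono) simp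
      thus "norm (case (\<eta>, s) of (\<eta>, s) \<Rightarrow> \<theta> \<eta> * convint m b w h \<phi> \<eta> \<xi> s) \<le> ?u \<eta> * ?v s"
        by (simp only: case_prod_conv norm_mult mult.assoc)
    qed
  qed
  finally show ?thesis unfolding convker_def by (simp only: integral_mult_right_zero)
qed

text \<open>The candidate for the Fourier transform of \<phi> u when \<open>g\<close> is the
  transform of v, with the normalization of the inversion formula.\<close>

definition solhat :: "nat \<Rightarrow> ('n::finite multiindex \<Rightarrow> complex) \<Rightarrow> (real ^ 'n \<Rightarrow> real ^ 'n) \<Rightarrow> (real ^ 'n \<Rightarrow> complex) \<Rightarrow>
    (real ^ 'n \<Rightarrow> complex) \<Rightarrow> (real ^ 'n \<Rightarrow> complex) \<Rightarrow> real ^ 'n \<Rightarrow> complex" where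
  "solhat m b w h \<phi> g \<eta> = inverse (of_real ((2 * pi) ^ CARD('n))) * (LINT \<xi>|lborel. g \<xi> * convker m b w h \<phi> \<eta> \<xi>)"

lemma solhat_measurable:
  assumes g: "good_shift m R c b w" and m: "h \<in> borel_measurable borel" "\<phi> \<in> borel_measurable borel" "gg \<in> borel_measurable borel"
  shows "solhat m b w h \<phi> gg \<in> borel_measurable borel"
proof -
  have [measurable]: "(\<lambda>p. convker m b w h \<phi> (fst p) (snd p)) \<in> borel_measurable (borel \<Otimes>\<^sub>M borel)"
    by (rule convker_measurable[OF g m(1,2)])
  note [measurable] = m(3)
  have "(\<lambda>p. gg (snd p) * convker m b w h \<phi> (fst p) (snd p)) \<in> borel_measurable (borel \<Otimes>\<^sub>M lborel)" by measurable
  hence "(\<lambda>(\<eta>, \<xi>). gg \<xi> * convker m b w h \<phi> \<eta> \<xi>) \<in> borel_measurable (borel \<Otimes>\<^sub>M lborel)"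
    by (simp add: case_prod_beta')
  from lborel.borel_measurable_lebesgue_integral[OF this]
  show ?thesis unfolding solhat_def[abs_def] by measurable
qed

lemma decay_shift_le: "decay M (x - y) \<le> decay M x * (1 + norm y) ^ M"
proof -
  have "decay M (x - y) * decay M y \<le> decay M x" using decay_mult_le[of M "x - y" y] by simp
  thus ?thesis by (simp add: decay_def[of M y] field_simps)
qed

text \<open>Combines the representation of \<open>T\<close> by \<open>g\<close> with the kernel
  formula and one more exchange of integrals. The kernel bound also makes \<open>solhat\<close>
  locally bounded, hence locally integrable.\<close>

lemma has_fourier_localized_sol:
  fixes h \<phi> :: "real ^ 'n::finite \<Rightarrow> complex"
  assumes gs: "good_shift m R c b w" and h: "h \<in> smooth_supported K" "compact K"
    and \<phi>: "\<phi> \<in> smooth_supported K'" "compact K'"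
    and T: "is_tempered_distribution T" and g: "has_fourier T g"
    and int: "integrable lborel (\<lambda>\<xi>. cmod (g \<xi>) * decay M \<xi>)"
  shows "has_fourier (\<lambda>f. T (\<lambda>x. h x * sol m b w (\<lambda>y. \<phi> y * f y) x)) (solhat m b w h \<phi> g)"
proof -
  let ?c = "inverse (of_real ((2 * pi) ^ CARD('n))) :: complex"
  have gm: "g \<in> borel_measurable borel" using g by (simp add: has_fourier_def)
  have hm: "h \<in> borel_measurable borel" "\<phi> \<in> borel_measurable borel"
    using h \<phi> by (auto simp: smooth_supported_def smooth_measurable)
  obtain A where A: "A \<ge> 0" "\<And>\<eta> \<xi>. cmod (convker m b w h \<phi> \<eta> \<xi>) \<le> A * decay M (\<xi> - \<eta>) / ptilde m b \<eta>"
    using convker_bound[OF h \<phi>, of m R c M] gs by metis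
  \<comment> \<open>Separates the variables in the kernel bound. The factor in \<eta> may grow but
    is continuous, which is enough on compact sets and supports.\<close>
  let ?Q = "\<lambda>\<eta>. A * (1 + norm \<eta>) ^ M / ptilde m b \<eta>"
  have pt: "ptilde m b \<eta> > 0" for \<eta> using gs by (simp add: good_shift_def)
  have Q: "cmod (convker m b w h \<phi> \<eta> \<xi>) \<le> ?Q \<eta> * decay M \<xi>" for \<eta> \<xi>
  proof -
    have "A * decay M (\<xi> - \<eta>) / ptilde m b \<eta> \<le> A * (decay M \<xi> * (1 + norm \<eta>) ^ M) / ptilde m b \<eta>"
      using A pt[of \<eta>] by (intro divide_right_mono mult_left_mono decay_shift_le) auto
    thus ?thesis using A(2)[of \<eta> \<xi>] by (simp add: mult_ac)
  qed
  have Qc: "continuous_on S ?Q" for S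
  proof -
    have "ptilde m b \<eta> \<noteq> 0" for \<eta> using pt[of \<eta>] by simp
    thus ?thesis by (intro continuous_intros continuous_on_ptilde) auto
  qed
  have sm: "solhat m b w h \<phi> g \<in> borel_measurable borel" by (rule solhat_measurable[OF gs hm gm])
  let ?S = "LINT \<xi>|lborel. cmod (g \<xi>) * decay M \<xi>"
  have bnd: "cmod (solhat m b w h \<phi> g \<eta>) \<le> cmod ?c * (?Q \<eta> * ?S)" for \<eta>
  proof -
    have "cmod (LINT \<xi>|lborel. g \<xi> * convker m b w h \<phi> \<eta> \<xi>) \<le> (LINT \<xi>|lborel. ?Q \<eta> * (cmod (g \<xi>) * decay M \<xi>))"
    proof (rule norm_integral_le)
      show "integrable lborel (\<lambda>\<xi>. ?Q \<eta> * (cmod (g \<xi>) * decay M \<xi>))" using int by (rule integrable_mult_right)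
      fix \<xi>
      have "cmod (g \<xi>) * cmod (convker m b w h \<phi> \<eta> \<xi>) \<le> cmod (g \<xi>) * (?Q \<eta> * decay M \<xi>)" by (intro mult_left_mono Q) auto
      thus "cmod (g \<xi> * convker m b w h \<phi> \<eta> \<xi>) \<le> ?Q \<eta> * (cmod (g \<xi>) * decay M \<xi>)" by (simp only: norm_mult mult_ac)
    qed
    thus ?thesis unfolding solhat_def norm_mult by (intro mult_left_mono) (simp_all only: integral_mult_right_zero norm_ge_zero)
  qed
  show ?thesis unfolding has_fourier_def
  proof (intro conjI allI impI ballI)
    show "solhat m b w h \<phi> g \<in> borel_measurable borel" by (rule sm)
    fix L :: "(real ^ 'n) set" assume L: "compact L"
    show "set_integrable lborel L (solhat m b w h \<phi> g)"
      unfolding set_integrable_def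
    proof (rule Bochner_Integration.integrable_bound)
      show "integrable lborel (\<lambda>\<eta>. indicator L \<eta> *\<^sub>R (cmod ?c * (?Q \<eta> * ?S)))"
        by (rule borel_integrable_compact[OF L]) (intro continuous_on_mult continuous_on_const Qc)
      show "(\<lambda>x. indicat_real L x *\<^sub>R solhat m b w h \<phi> g x) \<in> borel_measurable lborel"
        using sm L by (intro borel_measurable_scaleR borel_measurable_indicator) (auto intro: borel_compact)
      show "AE \<eta> in lborel. norm (indicat_real L \<eta> *\<^sub>R solhat m b w h \<phi> g \<eta>) \<le> norm (indicator L \<eta> *\<^sub>R (cmod ?c * (?Q \<eta> * ?S)))"
      proof (rule AE_I2)
        fix \<eta>
        have "cmod (solhat m b w h \<phi> g \<eta>) \<le> \<bar>cmod ?c * (?Q \<eta> * ?S)\<bar>" using bnd[of \<eta>] abs_ge_self order_trans by blast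
        thus "norm (indicat_real L \<eta> *\<^sub>R solhat m b w h \<phi> g \<eta>) \<le> norm (indicator L \<eta> *\<^sub>R (cmod ?c * (?Q \<eta> * ?S)))"
          by (simp add: indicator_def del: of_real_power of_real_mult)
      qed
    qed
  next
    fix \<theta> :: "real ^ 'n \<Rightarrow> complex" assume "\<theta> \<in> test_functions"
    then obtain K'' where \<theta>: "\<theta> \<in> smooth_supported K''" "compact K''" by (auto simp: test_functions_def)
    have \<theta>m: "\<theta> \<in> borel_measurable borel" using \<theta> by (auto simp: smooth_supported_def smooth_measurable)
    let ?f = "\<lambda>y. \<phi> y * fourier \<theta> y"
    have f: "?f \<in> smooth_supported K'"
      using smooth_supported_mult[OF smooth_fourier[OF \<theta>] \<phi>(1)] by (simp add: mult.commute)
    have hf: "(\<lambda>x. h x * sol m b w ?f x) \<in> smooth_supported K"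
      using smooth_supported_mult[OF smooth_sol[OF gs f \<phi>(2)] h(1)] by (simp add: mult.commute)
    have "T (\<lambda>x. h x * sol m b w ?f x) = (LINT \<xi>|lborel. g \<xi> * (?c * (LINT \<eta>|lborel. \<theta> \<eta> * convker m b w h \<phi> \<eta> \<xi>)))"
      unfolding tempered_fourier_rep[OF T g int hf h(2)] laplace_sol_eq[OF gs h \<phi> \<theta>] ..
    also have "\<dots> = (LINT \<xi>|lborel. LINT \<eta>|lborel. ?c * (\<theta> \<eta> * (g \<xi> * convker m b w h \<phi> \<eta> \<xi>)))"
    proof (intro Bochner_Integration.integral_cong refl)
      fix \<xi>
      have "g \<xi> * (?c * (LINT \<eta>|lborel. \<theta> \<eta> * convker m b w h \<phi> \<eta> \<xi>)) = (LINT \<eta>|lborel. (g \<xi> * ?c) * (\<theta> \<eta> * convker m b w h \<phi> \<eta> \<xi>))"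
        by (simp only: integral_mult_right_zero mult.assoc)
      thus "g \<xi> * (?c * (LINT \<eta>|lborel. \<theta> \<eta> * convker m b w h \<phi> \<eta> \<xi>)) = (LINT \<eta>|lborel. ?c * (\<theta> \<eta> * (g \<xi> * convker m b w h \<phi> \<eta> \<xi>)))"
        by (simp only: mult_ac)
    qed
    also have "\<dots> = (LINT \<eta>|lborel. LINT \<xi>|lborel. ?c * (\<theta> \<eta> * (g \<xi> * convker m b w h \<phi> \<eta> \<xi>)))"
    proof (rule lborel_pair.Fubini_integral)
      have [measurable]: "(\<lambda>p. convker m b w h \<phi> (fst p) (snd p)) \<in> borel_measurable (borel \<Otimes>\<^sub>M borel)"
        by (rule convker_measurable[OF gs hm])
      note [measurable] = gm \<theta>m
      show "integrable (lborel \<Otimes>\<^sub>M lborel) (\<lambda>(\<eta>, \<xi>). ?c * (\<theta> \<eta> * (g \<xi> * convker m b w h \<phi> \<eta> \<xi>)))"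
      proof (rule lborel_pair.integrable_pair_bound[OF _ _ int])
        have "(\<lambda>p. ?c * (\<theta> (fst p) * (g (snd p) * convker m b w h \<phi> (fst p) (snd p)))) \<in> borel_measurable (lborel \<Otimes>\<^sub>M lborel)"
          by measurable
        thus "(\<lambda>(\<eta>, \<xi>). ?c * (\<theta> \<eta> * (g \<xi> * convker m b w h \<phi> \<eta> \<xi>))) \<in> borel_measurable (lborel \<Otimes>\<^sub>M lborel)"
          by (simp add: case_prod_beta')
        show "integrable lborel (\<lambda>\<eta>. cmod ?c * (cmod (\<theta> \<eta>) * ?Q \<eta>))"
        proof (rule integrable_compact_support[OF _ \<theta>(2)])
          show "continuous_on UNIV (\<lambda>\<eta>. cmod ?c * (cmod (\<theta> \<eta>) * ?Q \<eta>))"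
            by (intro continuous_on_mult continuous_on_const Qc continuous_on_norm smooth_continuous_on smooth_supported_smooth[OF \<theta>(1)])
        qed (use \<theta> in \<open>simp add: smooth_supported_def\<close>)
        fix \<eta> \<xi>
        have "cmod ?c * (cmod (\<theta> \<eta>) * (cmod (g \<xi>) * cmod (convker m b w h \<phi> \<eta> \<xi>))) \<le> cmod ?c * (cmod (\<theta> \<eta>) * (cmod (g \<xi>) * (?Q \<eta> * decay M \<xi>)))"
          by (intro mult_left_mono Q) auto
        thus "norm (case (\<eta>, \<xi>) of (\<eta>, \<xi>) \<Rightarrow> ?c * (\<theta> \<eta> * (g \<xi> * convker m b w h \<phi> \<eta> \<xi>))) \<le> cmod ?c * (cmod (\<theta> \<eta>) * ?Q \<eta>) * (cmod (g \<xi>) * decay M \<xi>)"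
          by (simp only: case_prod_conv norm_mult mult_ac)
      qed
    qed
    also have "\<dots> = (LINT \<eta>|lborel. solhat m b w h \<phi> g \<eta> * \<theta> \<eta>)"
    proof (intro Bochner_Integration.integral_cong refl)
      fix \<eta>
      show "(LINT \<xi>|lborel. ?c * (\<theta> \<eta> * (g \<xi> * convker m b w h \<phi> \<eta> \<xi>))) = solhat m b w h \<phi> g \<eta> * \<theta> \<eta>"
        unfolding integral_mult_right_zero solhat_def by (simp only: mult_ac)
    qed
    finally show "T (\<lambda>x. h x * sol m b w ?f x) = (LINT \<eta>|lborel. solhat m b w h \<phi> g \<eta> * \<theta> \<eta>)" .
  qed
qed

text \<open>P~(\<eta>) cancels the denominator of the kernel, and k(\<eta>) is exchanged for
  k(\<xi>) at the cost of a power of the distance; Young's inequality then applies. The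
  integrability clause, with the same \<open>M\<close>, is the hypothesis of
  \<open>has_fourier_localized_sol\<close>. \<open>D\<close> and \<open>M\<close> precede
  \<open>b\<close>, \<open>w\<close> and \<open>g\<close>.\<close>

lemma Lp_norm_solhat:
  fixes h \<phi> :: "real ^ 'n::finite \<Rightarrow> complex"
  assumes h: "h \<in> smooth_supported K" "compact K" and \<phi>: "\<phi> \<in> smooth_supported K'" "compact K'"
    and k: "k \<in> tempered_weights" and p: "1 \<le> p"
  obtains D M where "D \<ge> 0" "\<And>b w g. good_shift m R c b w \<Longrightarrow> g \<in> borel_measurable borel \<Longrightarrow>
     Lp_norm p (\<lambda>\<xi>. k \<xi> * cmod (g \<xi>)) < \<infinity> \<Longrightarrow>
     integrable lborel (\<lambda>\<xi>. cmod (g \<xi>) * decay M \<xi>) \<and>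
     Lp_norm p (\<lambda>\<xi>. k \<xi> * ptilde m b \<xi> * cmod (solhat m b w h \<phi> g \<xi>)) \<le> ennreal D * Lp_norm p (\<lambda>\<xi>. k \<xi> * cmod (g \<xi>))"
proof -
  let ?c = "inverse (of_real ((2 * pi) ^ CARD('n))) :: complex"
  let ?L = "2 * CARD('n)"
  obtain B N where B: "B \<ge> 1" "\<And>(\<xi> :: real ^ 'n) \<eta>. k (\<xi> + \<eta>) \<le> B * (1 + norm \<xi>) ^ N * k \<eta>" and kpos: "\<And>\<xi>. k \<xi> > 0"
    using tempered_weight_bound[OF k] by blast
  \<comment> \<open>\<open>N\<close> powers pay for exchanging the arguments of the weight
    \<open>k\<close>, the others form the integrable kernel.\<close>
  define M where "M = ?L + N"
  have km[measurable]: "k \<in> borel_measurable borel"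
    by (intro borel_measurable_continuous_onI tempered_weight_continuous k)
  have hm: "h \<in> borel_measurable borel" "\<phi> \<in> borel_measurable borel"
    using h \<phi> by (auto simp: smooth_supported_def smooth_measurable)
  obtain A where A: "A \<ge> 0" "\<And>b w \<eta> \<xi>. good_shift m R c b w \<Longrightarrow> cmod (convker m b w h \<phi> \<eta> \<xi>) \<le> A * decay M (\<xi> - \<eta>) / ptilde m b \<eta>"
    using convker_bound[OF h \<phi>, of m R c M] by metis
  let ?E = "cmod ?c * (A * B)"
  have E: "?E \<ge> 0" using A B by simp
  show thesis
  proof (rule that[of "?E * (LINT x|lborel. decay ?L (x :: real ^ 'n))" M])
    show "?E * (LINT x|lborel. decay ?L (x :: real ^ 'n)) \<ge> 0" using E by simp
    fix b and w :: "real ^ 'n \<Rightarrow> real ^ 'n" and g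
    assume gs: "good_shift m R c b w" and gm[measurable]: "g \<in> borel_measurable borel"
      and fin: "Lp_norm p (\<lambda>\<xi>. k \<xi> * cmod (g \<xi>)) < \<infinity>"
    have pt: "ptilde m b \<eta> > 0" for \<eta> using gs by (simp add: good_shift_def)
    let ?f = "\<lambda>\<xi>. k \<xi> * cmod (g \<xi>)"
    have f0: "\<bar>?f \<xi>\<bar> = ?f \<xi>" for \<xi> using kpos[of \<xi>] by simp
    have fm: "?f \<in> borel_measurable borel" by measurable
    have int0: "integrable lborel (\<lambda>\<xi>. ?f \<xi> * decay ?L \<xi>)"
      using integrable_of_Lp_norm[OF fm p fin] unfolding f0 .
    have intf: "integrable lborel (\<lambda>\<xi>. ?f \<xi> * decay ?L (\<xi> - \<eta>))" for \<eta>
    proof (rule Bochner_Integration.integrable_bound)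
      show "integrable lborel (\<lambda>\<xi>. (1 + norm \<eta>) ^ ?L * (?f \<xi> * decay ?L \<xi>))" using int0 by (rule integrable_mult_right)
      show "AE \<xi> in lborel. norm (?f \<xi> * decay ?L (\<xi> - \<eta>)) \<le> norm ((1 + norm \<eta>) ^ ?L * (?f \<xi> * decay ?L \<xi>))"
      proof (rule AE_I2)
        fix \<xi>
        have "?f \<xi> * decay ?L (\<xi> - \<eta>) \<le> ?f \<xi> * (decay ?L \<xi> * (1 + norm \<eta>) ^ ?L)"
          using kpos[of \<xi>] by (intro mult_left_mono decay_shift_le) simp
        thus "norm (?f \<xi> * decay ?L (\<xi> - \<eta>)) \<le> norm ((1 + norm \<eta>) ^ ?L * (?f \<xi> * decay ?L \<xi>))"
          using kpos[of \<xi>] by (simp add: abs_mult mult_ac)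
      qed
    qed measurable
    have kN: "k \<eta> * decay M (\<xi> - \<eta>) \<le> B * (k \<xi> * decay ?L (\<xi> - \<eta>))" for \<xi> \<eta>
    proof -
      have "k \<eta> * decay M (\<xi> - \<eta>) \<le> (B * (1 + norm (\<eta> - \<xi>)) ^ N * k \<xi>) * decay M (\<xi> - \<eta>)"
        using B(2)[of "\<eta> - \<xi>" \<xi>] by (intro mult_right_mono) auto
      also have "\<dots> = B * (k \<xi> * ((1 + norm (\<xi> - \<eta>)) ^ N * decay M (\<xi> - \<eta>)))"
        by (simp add: norm_minus_commute mult_ac)
      finally show ?thesis unfolding M_def decay_mult_power .
    qed
    have int: "integrable lborel (\<lambda>\<xi>. cmod (g \<xi>) * decay M (\<xi> - \<eta>))" for \<eta>
    proof (rule Bochner_Integration.integrable_bound)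
      show "integrable lborel (\<lambda>\<xi>. (B / k \<eta>) * (?f \<xi> * decay ?L (\<xi> - \<eta>)))" using intf by (rule integrable_mult_right)
      show "AE \<xi> in lborel. norm (cmod (g \<xi>) * decay M (\<xi> - \<eta>)) \<le> norm ((B / k \<eta>) * (?f \<xi> * decay ?L (\<xi> - \<eta>)))"
      proof (rule AE_I2)
        fix \<xi>
        have "decay M (\<xi> - \<eta>) \<le> (B / k \<eta>) * (k \<xi> * decay ?L (\<xi> - \<eta>))"
          using kN[of \<eta> \<xi>] kpos[of \<eta>] by (simp add: field_simps)
        hence "cmod (g \<xi>) * decay M (\<xi> - \<eta>) \<le> cmod (g \<xi>) * ((B / k \<eta>) * (k \<xi> * decay ?L (\<xi> - \<eta>)))" by (rule mult_left_mono) simp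
        also have "\<dots> = (B / k \<eta>) * (?f \<xi> * decay ?L (\<xi> - \<eta>))" by (simp only: mult_ac)
        also have "\<dots> \<le> norm ((B / k \<eta>) * (?f \<xi> * decay ?L (\<xi> - \<eta>)))" unfolding real_norm_def by (rule abs_ge_self)
        finally show "norm (cmod (g \<xi>) * decay M (\<xi> - \<eta>)) \<le> norm ((B / k \<eta>) * (?f \<xi> * decay ?L (\<xi> - \<eta>)))" by simp
      qed
    qed measurable
    have le: "\<bar>k \<eta> * ptilde m b \<eta> * cmod (solhat m b w h \<phi> g \<eta>)\<bar> \<le> ?E * (LINT \<xi>|lborel. \<bar>?f \<xi>\<bar> * decay ?L (\<xi> - \<eta>))" for \<eta>
    proof -
      have "cmod (LINT \<xi>|lborel. of_real (k \<eta> * ptilde m b \<eta>) * (g \<xi> * convker m b w h \<phi> \<eta> \<xi>)) \<le>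
         (LINT \<xi>|lborel. (A * B) * (?f \<xi> * decay ?L (\<xi> - \<eta>)))"
      proof (rule norm_integral_le)
        show "integrable lborel (\<lambda>\<xi>. (A * B) * (?f \<xi> * decay ?L (\<xi> - \<eta>)))" using intf by (rule integrable_mult_right)
        fix \<xi>
        have "cmod (of_real (k \<eta> * ptilde m b \<eta>) * (g \<xi> * convker m b w h \<phi> \<eta> \<xi>)) =
           k \<eta> * ptilde m b \<eta> * (cmod (g \<xi>) * cmod (convker m b w h \<phi> \<eta> \<xi>))"
          using kpos[of \<eta>] pt[of \<eta>] by (simp add: norm_mult)
        also have "\<dots> \<le> k \<eta> * ptilde m b \<eta> * (cmod (g \<xi>) * (A * decay M (\<xi> - \<eta>) / ptilde m b \<eta>))"
          using kpos[of \<eta>] pt[of \<eta>] by (intro mult_left_mono A(2)[OF gs]) auto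
        also have "\<dots> = A * cmod (g \<xi>) * (k \<eta> * decay M (\<xi> - \<eta>))" using pt[of \<eta>] by (simp add: mult_ac)
        also have "\<dots> \<le> A * cmod (g \<xi>) * (B * (k \<xi> * decay ?L (\<xi> - \<eta>)))" using A by (intro mult_left_mono kN) auto
        also have "\<dots> = (A * B) * (?f \<xi> * decay ?L (\<xi> - \<eta>))" by (simp only: mult_ac)
        finally show "cmod (of_real (k \<eta> * ptilde m b \<eta>) * (g \<xi> * convker m b w h \<phi> \<eta> \<xi>)) \<le> (A * B) * (?f \<xi> * decay ?L (\<xi> - \<eta>))" .
      qed
      hence "cmod ?c * cmod (of_real (k \<eta> * ptilde m b \<eta>) * (LINT \<xi>|lborel. g \<xi> * convker m b w h \<phi> \<eta> \<xi>)) \<le>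
         cmod ?c * ((A * B) * (LINT \<xi>|lborel. ?f \<xi> * decay ?L (\<xi> - \<eta>)))"
        unfolding integral_mult_right_zero by (rule mult_left_mono) simp
      moreover have "\<bar>k \<eta> * ptilde m b \<eta> * cmod (solhat m b w h \<phi> g \<eta>)\<bar> =
         cmod ?c * cmod (of_real (k \<eta> * ptilde m b \<eta>) * (LINT \<xi>|lborel. g \<xi> * convker m b w h \<phi> \<eta> \<xi>))"
        using kpos[of \<eta>] pt[of \<eta>] unfolding solhat_def by (simp add: norm_mult abs_mult mult_ac del: of_real_power)
      ultimately show ?thesis unfolding f0 by (simp only: mult.assoc)
    qed
    have Fm: "(\<lambda>\<xi>. k \<xi> * ptilde m b \<xi> * cmod (solhat m b w h \<phi> g \<xi>)) \<in> borel_measurable borel"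
    proof -
      have [measurable]: "ptilde m b \<in> borel_measurable borel"
        by (intro borel_measurable_continuous_onI continuous_on_ptilde)
      have [measurable]: "solhat m b w h \<phi> g \<in> borel_measurable borel" by (rule solhat_measurable[OF gs hm gm])
      show ?thesis by measurable
    qed
    show "integrable lborel (\<lambda>\<xi>. cmod (g \<xi>) * decay M \<xi>) \<and>
     Lp_norm p (\<lambda>\<xi>. k \<xi> * ptilde m b \<xi> * cmod (solhat m b w h \<phi> g \<xi>)) \<le> ennreal (?E * (LINT x|lborel. decay ?L (x :: real ^ 'n))) * Lp_norm p ?f"
      using int[of 0] Lp_norm_decay_convolution[OF p fm Fm fin E le] by simp
  qed
qed

section \<open>Nets and generalized functions\<close>

lemma abs_gnum_eq_iff:
  assumes "moderate_net r" "moderate_net s"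
  shows "abs_gnum r = abs_gnum s \<longleftrightarrow> negligible_net (\<lambda>\<epsilon>. r \<epsilon> - s \<epsilon>)"
  using Quotient3_rel[OF Quotient3_gnum, of r s] assms negligible_net_0 by (auto simp: gnum_rel_def)

lemma abs_gfun_eq_iff:
  assumes "moderate_fun r" "moderate_fun s"
  shows "abs_gfun r = abs_gfun s \<longleftrightarrow> negligible_fun_on UNIV (\<lambda>\<epsilon> x. r \<epsilon> x - s \<epsilon> x)"
  using Quotient3_rel[OF Quotient3_gfun, of r s] assms negligible_fun_0[of UNIV] by (auto simp: gfun_rel_def)

lemma ex_represents: "\<exists>r. represents r x"
proof -
  have "gnum_rel (rep_gnum x) (rep_gnum x)" by (rule Quotient3_rep_reflp[OF Quotient3_gnum])
  moreover have "abs_gnum (rep_gnum x) = x" by (rule Quotient3_abs_rep[OF Quotient3_gnum])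
  ultimately show ?thesis unfolding represents_def gnum_rel_def by blast
qed

lemma ex_represents_fun: "\<exists>r. represents_fun r u"
proof -
  have "gfun_rel (rep_gfun u) (rep_gfun u)" by (rule Quotient3_rep_reflp[OF Quotient3_gfun])
  moreover have "abs_gfun (rep_gfun u) = u" by (rule Quotient3_abs_rep[OF Quotient3_gfun])
  ultimately show ?thesis unfolding represents_fun_def gfun_rel_def by blast
qed

lemma net_O_eventually_le:
  assumes "net_O s b" "\<forall>\<^sub>F \<epsilon> in at_right 0. r \<epsilon> \<le> s \<epsilon>"
  shows "net_O r b"
proof -
  obtain C where "\<forall>\<^sub>F \<epsilon> in at_right 0. s \<epsilon> \<le> ennreal (C * \<epsilon> powr b)"
    using assms(1) unfolding net_O_def by blast
  with assms(2) have "\<forall>\<^sub>F \<epsilon> in at_right 0. r \<epsilon> \<le> ennreal (C * \<epsilon> powr b)"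
    by eventually_elim (rule order_trans)
  thus ?thesis unfolding net_O_def by blast
qed

lemma net_O_sum:
  "finite A \<Longrightarrow> (\<And>i. i \<in> A \<Longrightarrow> net_O (f i) b) \<Longrightarrow> net_O (\<lambda>\<epsilon>. \<Sum>i\<in>A. f i \<epsilon>) b"
  by (induction A rule: finite_induct) (auto intro: net_O_add net_O_0)

lemma moderate_net_le:
  assumes "moderate_net s" "\<forall>\<^sub>F \<epsilon> in at_right 0. norm (r \<epsilon>) \<le> norm (s \<epsilon>)"
  shows "moderate_net r"
proof -
  obtain N where "net_O (\<lambda>\<epsilon>. ennreal (norm (s \<epsilon>))) (- real N)" using assms(1) unfolding moderate_net_def by blast
  hence "net_O (\<lambda>\<epsilon>. ennreal (norm (r \<epsilon>))) (- real N)"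
    by (rule net_O_eventually_le) (use assms(2) in \<open>auto elim: eventually_mono intro: ennreal_leI\<close>)
  thus ?thesis unfolding moderate_net_def by blast
qed

text \<open>A net may be altered for large \<epsilon> without changing its class; this permits the
  value 0 where P~ may vanish.\<close>

lemma represents_cong_eventually:
  assumes "represents r x" "\<forall>\<^sub>F \<epsilon> in at_right 0. r \<epsilon> = s \<epsilon>"
  shows "represents s x"
proof -
  have r: "moderate_net r" using assms(1) by (simp add: represents_def)
  have s: "moderate_net s"
    by (rule moderate_net_le[OF r]) (use assms(2) in \<open>auto elim: eventually_mono\<close>)
  have "negligible_net (\<lambda>\<epsilon>. r \<epsilon> - s \<epsilon>)"
    unfolding negligible_net_def
  proof
    fix q show "net_O (\<lambda>\<epsilon>. ennreal (norm (r \<epsilon> - s \<epsilon>))) (real q)"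
      by (rule net_O_eventually_le[OF net_O_0]) (use assms(2) in \<open>auto elim: eventually_mono\<close>)
  qed
  with r s show ?thesis using assms(1) by (simp add: represents_def abs_gnum_eq_iff[symmetric])
qed

lemma represents_unique: "represents r x \<Longrightarrow> represents r y \<Longrightarrow> x = y"
  by (auto simp: represents_def)

section \<open>Seminorms of nets\<close>

lemma seminorm_on_le_sum: "seminorm_on K j f \<le> (\<Sum>\<alpha> | mi_order \<alpha> \<le> j. sup_on K (mpartial \<alpha> f))"
  unfolding seminorm_on_def by (intro SUP_least member_le_sum) (auto simp: finite_mi_order_le)

lemma sup_on_le_seminorm_on: "mi_order \<alpha> \<le> j \<Longrightarrow> sup_on K (mpartial \<alpha> f) \<le> seminorm_on K j f"
  unfolding seminorm_on_def by (intro SUP_upper) auto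

lemma sup_on_leI: "(\<And>x. x \<in> K \<Longrightarrow> cmod (f x) \<le> B) \<Longrightarrow> sup_on K f \<le> ennreal B"
  unfolding sup_on_def by (intro SUP_least ennreal_leI)

lemma seminorm_on_leI:
  "(\<And>\<alpha> x. mi_order \<alpha> \<le> j \<Longrightarrow> x \<in> K \<Longrightarrow> cmod (mpartial \<alpha> f x) \<le> B) \<Longrightarrow> seminorm_on K j f \<le> ennreal B"
  unfolding seminorm_on_def by (intro SUP_least sup_on_leI) auto

lemma seminorm_on_finite:
  assumes "smooth f" "compact K"
  shows "seminorm_on K j f < \<infinity>"
proof -
  have "sup_on K (mpartial \<alpha> f) < top" for \<alpha>
  proof -
    have "compact (mpartial \<alpha> f ` K)"
      using assms by (intro compact_continuous_image smooth_continuous_on smooth_mpartial)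
    then obtain B where "\<And>y. y \<in> mpartial \<alpha> f ` K \<Longrightarrow> cmod y \<le> B" using compact_imp_bounded bounded_iff by metis
    hence "sup_on K (mpartial \<alpha> f) \<le> ennreal B" by (intro sup_on_leI) auto
    thus ?thesis using ennreal_less_top order_le_less_trans by blast
  qed
  hence "(\<Sum>\<alpha> | mi_order \<alpha> \<le> j. sup_on K (mpartial \<alpha> f)) < top" by (simp add: ennreal_sum_less_top finite_mi_order_le)
  thus ?thesis using seminorm_on_le_sum[of K j f] order_le_less_trans by simp
qed

lemma mpartial_le_seminorm_on:
  assumes "smooth f" "compact K" "mi_order \<alpha> \<le> j" "x \<in> K"
  shows "cmod (mpartial \<alpha> f x) \<le> enn2real (seminorm_on K j f)"
proof -
  have "ennreal (cmod (mpartial \<alpha> f x)) \<le> sup_on K (mpartial \<alpha> f)"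
    unfolding sup_on_def by (rule SUP_upper) (rule assms)
  also have "\<dots> \<le> seminorm_on K j f" by (rule sup_on_le_seminorm_on[OF assms(3)])
  finally have "enn2real (ennreal (cmod (mpartial \<alpha> f x))) \<le> enn2real (seminorm_on K j f)"
    using seminorm_on_finite[OF assms(1,2), of j] by (intro enn2real_mono) auto
  thus ?thesis by simp
qed

lemma ennreal_enn2real_seminorm_on:
  "smooth f \<Longrightarrow> compact K \<Longrightarrow> ennreal (enn2real (seminorm_on K j f)) = seminorm_on K j f"
  using seminorm_on_finite[of f K j] by (simp add: ennreal_enn2real)

lemma smooth_supported_le_seminorm_on:
  assumes "f \<in> smooth_supported K" "compact K" "mi_order \<alpha> \<le> j"
  shows "cmod (mpartial \<alpha> f x) \<le> enn2real (seminorm_on K j f)"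
proof (cases "x \<in> K")
  case True
  thus ?thesis using assms by (intro mpartial_le_seminorm_on) (auto intro: smooth_supported_smooth)
next
  case False
  thus ?thesis using smooth_supported_mpartial[OF assms(1) compact_imp_closed[OF assms(2)], of \<alpha>]
    by (simp add: smooth_supported_def)
qed

lemma moderate_fun_seminorm:
  assumes "moderate_fun r" "compact K"
  shows "\<exists>N::nat. net_O (\<lambda>\<epsilon>. seminorm_on K j (r \<epsilon>)) (- real N)"
proof -
  have "\<exists>N::nat. net_O (\<lambda>\<epsilon>. sup_on K (mpartial \<alpha> (r \<epsilon>))) (- real N)" for \<alpha>
    using assms unfolding moderate_fun_def by blast
  then obtain N where N: "\<And>\<alpha>. net_O (\<lambda>\<epsilon>. sup_on K (mpartial \<alpha> (r \<epsilon>))) (- real (N \<alpha>))" by metis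
  define N' where "N' = (\<Sum>\<alpha> | mi_order \<alpha> \<le> j. N \<alpha>)"
  have "net_O (\<lambda>\<epsilon>. \<Sum>\<alpha> | mi_order \<alpha> \<le> j. sup_on K (mpartial \<alpha> (r \<epsilon>))) (- real N')"
  proof (rule net_O_sum[OF finite_mi_order_le])
    fix \<alpha> :: "'a multiindex" assume "\<alpha> \<in> {\<alpha>. mi_order \<alpha> \<le> j}"
    hence "N \<alpha> \<le> N'" unfolding N'_def by (intro member_le_sum) (auto simp: finite_mi_order_le)
    thus "net_O (\<lambda>\<epsilon>. sup_on K (mpartial \<alpha> (r \<epsilon>))) (- real N')" by (intro net_O_mono[OF N]) simp
  qed
  hence "net_O (\<lambda>\<epsilon>. seminorm_on K j (r \<epsilon>)) (- real N')" by (rule net_O_le) (rule seminorm_on_le_sum)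
  thus ?thesis by blast
qed

lemma negligible_fun_seminorm:
  assumes "negligible_fun_on V r" "compact K" "K \<subseteq> V"
  shows "net_O (\<lambda>\<epsilon>. seminorm_on K j (r \<epsilon>)) (real q)"
proof -
  have "net_O (\<lambda>\<epsilon>. \<Sum>\<alpha> | mi_order \<alpha> \<le> j. sup_on K (mpartial \<alpha> (r \<epsilon>))) (real q)"
    using assms unfolding negligible_fun_on_def by (intro net_O_sum finite_mi_order_le) auto
  thus ?thesis by (rule net_O_le) (rule seminorm_on_le_sum)
qed

lemma leibniz_seminorm:
  assumes h: "smooth (h :: real ^ 'n::finite \<Rightarrow> complex)" and K: "compact K"
  obtains C where "C \<ge> 0" "\<And>f. smooth f \<Longrightarrow> seminorm_on K j (\<lambda>x. h x * f x) \<le> ennreal C * seminorm_on K j f"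
proof -
  obtain C where C: "C \<ge> 0" "\<And>g x B \<alpha>. smooth g \<Longrightarrow> x \<in> K \<Longrightarrow> (\<And>\<beta>. mi_order \<beta> \<le> j \<Longrightarrow> cmod (mpartial \<beta> g x) \<le> B) \<Longrightarrow>
    mi_order \<alpha> \<le> j \<Longrightarrow> cmod (mpartial \<alpha> (\<lambda>x. h x * g x) x) \<le> C * B"
    using leibniz_bound[OF h K, of j] by blast
  show thesis
  proof (rule that[OF C(1)])
    fix f :: "real ^ 'n \<Rightarrow> complex" assume f: "smooth f"
    have "seminorm_on K j (\<lambda>x. h x * f x) \<le> ennreal (C * enn2real (seminorm_on K j f))"
      by (intro seminorm_on_leI C(2) f mpartial_le_seminorm_on K)
    also have "\<dots> = ennreal C * seminorm_on K j f"
      using C(1) by (simp add: ennreal_mult ennreal_enn2real_seminorm_on[OF f K])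
    finally show "seminorm_on K j (\<lambda>x. h x * f x) \<le> ennreal C * seminorm_on K j f" .
  qed
qed

lemma moderate_fun_multiplier:
  assumes h: "smooth h" and r: "moderate_fun r"
  shows "moderate_fun (\<lambda>\<epsilon> x. h x * r \<epsilon> x)"
  unfolding moderate_fun_def
proof (intro conjI ballI allI impI)
  fix \<epsilon> :: real assume "\<epsilon> \<in> {0<..1}"
  thus "smooth (\<lambda>x. h x * r \<epsilon> x)" by (intro smooth_mult h moderate_fun_smooth[OF r])
next
  fix K and \<alpha> :: "'a multiindex" assume K: "compact (K :: (real ^ 'a) set)"
  obtain C where C: "C \<ge> 0" "\<And>f. smooth f \<Longrightarrow> seminorm_on K (mi_order \<alpha>) (\<lambda>x. h x * f x) \<le> ennreal C * seminorm_on K (mi_order \<alpha>) f"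
    using leibniz_seminorm[OF h K] by blast
  obtain N where N: "net_O (\<lambda>\<epsilon>. seminorm_on K (mi_order \<alpha>) (r \<epsilon>)) (- real N)" using moderate_fun_seminorm[OF r K] by blast
  have "net_O (\<lambda>\<epsilon>. ennreal C * seminorm_on K (mi_order \<alpha>) (r \<epsilon>)) (0 + - real N)"
    by (rule net_O_mult[OF net_O_const N]) simp
  hence "net_O (\<lambda>\<epsilon>. sup_on K (mpartial \<alpha> (\<lambda>x. h x * r \<epsilon> x))) (0 + - real N)"
    by (rule net_O_le) (rule order_trans[OF sup_on_le_seminorm_on[OF order_refl] C(2)[OF moderate_fun_smooth[OF r]]])
  thus "\<exists>N::nat. net_O (\<lambda>\<epsilon>. sup_on K (mpartial \<alpha> (\<lambda>x. h x * r \<epsilon> x))) (- real N)" by auto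
qed

lemma negligible_fun_multiplier:
  assumes h: "smooth h" and sr: "\<And>\<epsilon>. \<epsilon> \<in> {0<..1} \<Longrightarrow> smooth (r \<epsilon>)" and r: "negligible_fun_on V r"
  shows "negligible_fun_on V (\<lambda>\<epsilon> x. h x * r \<epsilon> x)"
  unfolding negligible_fun_on_def
proof (intro allI impI)
  fix K and \<alpha> :: "'a multiindex" and q :: nat assume K: "compact (K :: (real ^ 'a) set) \<and> K \<subseteq> V"
  obtain C where C: "C \<ge> 0" "\<And>f. smooth f \<Longrightarrow> seminorm_on K (mi_order \<alpha>) (\<lambda>x. h x * f x) \<le> ennreal C * seminorm_on K (mi_order \<alpha>) f"
    using leibniz_seminorm[OF h] K by blast
  have "net_O (\<lambda>\<epsilon>. ennreal C * seminorm_on K (mi_order \<alpha>) (r \<epsilon>)) (0 + real q)"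
    by (rule net_O_mult[OF net_O_const negligible_fun_seminorm[OF r]]) (use K in auto)
  hence "net_O (\<lambda>\<epsilon>. sup_on K (mpartial \<alpha> (\<lambda>x. h x * r \<epsilon> x))) (0 + real q)"
    by (rule net_O_le) (rule order_trans[OF sup_on_le_seminorm_on[OF order_refl] C(2)[OF sr]])
  thus "net_O (\<lambda>\<epsilon>. sup_on K (mpartial \<alpha> (\<lambda>x. h x * r \<epsilon> x))) (real q)" by simp
qed

section \<open>Localization and compact supports\<close>

lemma foldr_partial_deriv_zero_on_open:
  assumes "open V" "\<And>x. x \<in> V \<Longrightarrow> f x = 0" "x \<in> V"
  shows "foldr partial_deriv is f x = 0"
  using assms(3)
proof (induction "is" arbitrary: x)
  case (Cons i js)
  have "(foldr partial_deriv js f has_derivative (\<lambda>h. 0)) (at x)"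
    by (rule has_derivative_transform_within_open[where f = "\<lambda>x. 0" and s = V])
       (use Cons assms(1) in auto)
  from partial_deriv_eqI[OF this, of i] show ?case by simp
qed (use assms in auto)

lemma mpartial_zero_on_open:
  "open V \<Longrightarrow> (\<And>x. x \<in> V \<Longrightarrow> f x = 0) \<Longrightarrow> x \<in> V \<Longrightarrow> mpartial \<alpha> f x = 0"
  unfolding mpartial_def by (rule foldr_partial_deriv_zero_on_open)

lemma negligible_fun_on_zero_open:
  assumes "open V" "\<And>\<epsilon> x. \<epsilon> \<in> {0<..1} \<Longrightarrow> x \<in> V \<Longrightarrow> r \<epsilon> x = 0"
  shows "negligible_fun_on V r"
  unfolding negligible_fun_on_def
proof (intro allI impI)
  fix K and \<alpha> :: "'a multiindex" and q :: nat assume K: "compact (K :: (real ^ 'a) set) \<and> K \<subseteq> V"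
  show "net_O (\<lambda>\<epsilon>. sup_on K (mpartial \<alpha> (r \<epsilon>))) (real q)"
  proof (rule net_O_le[OF net_O_0])
    fix \<epsilon> :: real assume "\<epsilon> \<in> {0<..1}"
    hence "sup_on K (mpartial \<alpha> (r \<epsilon>)) \<le> ennreal 0"
      using K mpartial_zero_on_open[OF assms(1), of "r \<epsilon>"] assms(2) by (intro sup_on_leI) (auto simp: subset_iff)
    thus "sup_on K (mpartial \<alpha> (r \<epsilon>)) \<le> 0" by simp
  qed
qed

text \<open>The sheaf property of negligibility: finitely many balls on which the net is negligible
  cover a given compact set, and their suprema are added.\<close>

lemma negligible_fun_on_UNIV_local:
  assumes "\<And>x. \<exists>V. open V \<and> x \<in> V \<and> negligible_fun_on V r"
  shows "negligible_fun_on UNIV r"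
  unfolding negligible_fun_on_def
proof (intro allI impI)
  fix K and \<alpha> :: "'a multiindex" and q :: nat assume K: "compact (K :: (real ^ 'a) set) \<and> K \<subseteq> UNIV"
  have "\<exists>e>0. negligible_fun_on (cball x e) r" for x
  proof -
    obtain V where V: "open V" "x \<in> V" "negligible_fun_on V r" using assms by blast
    then obtain e where "e > 0" "cball x e \<subseteq> V" using open_contains_cball by blast
    thus ?thesis using V(3) unfolding negligible_fun_on_def by (metis subset_trans)
  qed
  then obtain e where e: "\<And>x. e x > 0" "\<And>x. negligible_fun_on (cball x (e x)) r" by metis
  have "K \<subseteq> (\<Union>x\<in>K. ball x (e x))" using e(1) by auto
  then obtain F where F: "F \<subseteq> K" "finite F" "K \<subseteq> (\<Union>x\<in>F. ball x (e x))"
    using compactE_image[of K K "\<lambda>x. ball x (e x)"] K by auto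
  have "net_O (\<lambda>\<epsilon>. \<Sum>x\<in>F. sup_on (K \<inter> cball x (e x)) (mpartial \<alpha> (r \<epsilon>))) (real q)"
    using e(2) K unfolding negligible_fun_on_def by (intro net_O_sum F) (auto intro: compact_Int)
  thus "net_O (\<lambda>\<epsilon>. sup_on K (mpartial \<alpha> (r \<epsilon>))) (real q)"
  proof (rule net_O_le)
    fix \<epsilon>
    show "sup_on K (mpartial \<alpha> (r \<epsilon>)) \<le> (\<Sum>x\<in>F. sup_on (K \<inter> cball x (e x)) (mpartial \<alpha> (r \<epsilon>)))"
      unfolding sup_on_def[of K]
    proof (rule SUP_least)
      fix y assume y: "y \<in> K"
      then obtain x where x: "x \<in> F" "y \<in> ball x (e x)" using F by blast
      have "ennreal (cmod (mpartial \<alpha> (r \<epsilon>) y)) \<le> sup_on (K \<inter> cball x (e x)) (mpartial \<alpha> (r \<epsilon>))"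
        unfolding sup_on_def using x y by (intro SUP_upper) auto
      also have "\<dots> \<le> (\<Sum>x\<in>F. sup_on (K \<inter> cball x (e x)) (mpartial \<alpha> (r \<epsilon>)))"
        using x F by (intro member_le_sum) auto
      finally show "ennreal (cmod (mpartial \<alpha> (r \<epsilon>) y)) \<le> (\<Sum>x\<in>F. sup_on (K \<inter> cball x (e x)) (mpartial \<alpha> (r \<epsilon>)))" .
    qed
  qed
qed

lemma vanishes_on_abs_iff: "moderate_fun r \<Longrightarrow> vanishes_on V (abs_gfun r) \<longleftrightarrow> negligible_fun_on V r"
  by (rule vanishes_on.abs_eq) (rule gfun_rel_eqI, auto)

text \<open>\<open>Gc\<close> is defined through the support of the class, whereas functionals are
  evaluated on representatives supported in one compact set. A cutoff equal to 1 near the support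
  provides one: the change is zero near the support and negligible near every other point.\<close>

lemma Gc_representative:
  assumes "w \<in> Gc"
  shows "\<exists>r K. represents_fun r w \<and> compact K \<and> (\<forall>\<epsilon>\<in>{0<..1}. r \<epsilon> \<in> smooth_supported K)"
proof -
  obtain r0 where r0: "moderate_fun r0" "abs_gfun r0 = w" using ex_represents_fun[of w] by (auto simp: represents_fun_def)
  have "compact (gsupport w)" using assms by (simp add: Gc_def)
  then obtain h U where h: "h \<in> test_functions" "open U" "gsupport w \<subseteq> U" "\<And>x. x \<in> U \<Longrightarrow> h x = 1"
    using ex_cutoff by metis
  then obtain K where K: "compact K" "h \<in> smooth_supported K" by (auto simp: test_functions_def)
  have sh: "smooth h" using K(2) by (rule smooth_supported_smooth)
  let ?r = "\<lambda>\<epsilon> x. h x * r0 \<epsilon> x"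
  have mr: "moderate_fun ?r" by (rule moderate_fun_multiplier[OF sh r0(1)])
  have "negligible_fun_on UNIV (\<lambda>\<epsilon> x. ?r \<epsilon> x - r0 \<epsilon> x)"
  proof (rule negligible_fun_on_UNIV_local)
    fix x
    show "\<exists>V. open V \<and> x \<in> V \<and> negligible_fun_on V (\<lambda>\<epsilon> x. ?r \<epsilon> x - r0 \<epsilon> x)"
    proof (cases "x \<in> U")
      case True
      thus ?thesis using h by (intro exI[of _ U] conjI negligible_fun_on_zero_open) auto
    next
      case False
      hence "x \<notin> gsupport w" using h(3) by blast
      then obtain V where V: "open V" "x \<in> V" "vanishes_on V w" by (auto simp: gsupport_def)
      have neg: "negligible_fun_on V r0" using V(3) vanishes_on_abs_iff[OF r0(1), of V] r0(2) by simp
      have "negligible_fun_on V (\<lambda>\<epsilon> x. (h x - 1) * r0 \<epsilon> x)"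
        by (rule negligible_fun_multiplier[OF smooth_diff[OF sh smooth_const] moderate_fun_smooth[OF r0(1)] neg])
      thus ?thesis using V(1,2) by (intro exI[of _ V]) (simp add: left_diff_distrib)
    qed
  qed
  hence "abs_gfun ?r = w" using abs_gfun_eq_iff[OF mr r0(1)] r0(2) by simp
  moreover have "?r \<epsilon> \<in> smooth_supported K" if "\<epsilon> \<in> {0<..1}" for \<epsilon>
    using smooth_supported_mult[OF moderate_fun_smooth[OF r0(1) that] K(2)] by (simp add: mult.commute)
  ultimately show ?thesis using mr K(1) unfolding represents_fun_def by (intro exI[of _ ?r] exI[of _ K]) auto
qed

lemma abs_gfun_in_Gc:
  assumes "moderate_fun r" "compact K" "\<And>\<epsilon>. \<epsilon> \<in> {0<..1} \<Longrightarrow> r \<epsilon> \<in> smooth_supported K"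
  shows "abs_gfun r \<in> Gc"
proof -
  have "open (- K)" using assms(2) compact_imp_closed by blast
  moreover from this have "vanishes_on (- K) (abs_gfun r)"
    unfolding vanishes_on_abs_iff[OF assms(1)] using assms(3)
    by (intro negligible_fun_on_zero_open) (auto simp: smooth_supported_def)
  ultimately have "gsupport (abs_gfun r) \<subseteq> K" by (auto simp: gsupport_def)
  moreover have "closed (gsupport (abs_gfun r))" unfolding gsupport_def closed_def by auto
  ultimately have "compact (gsupport (abs_gfun r))"
    using compact_Int_closed[OF assms(2), of "gsupport (abs_gfun r)"] by (simp add: Int_absorb1)
  thus ?thesis by (simp add: Gc_def)
qed

section \<open>Operations on representatives\<close>

lemma represents_fun_add:
  "represents_fun r u \<Longrightarrow> represents_fun s v \<Longrightarrow> represents_fun (\<lambda>\<epsilon> x. r \<epsilon> x + s \<epsilon> x) (u + v)"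
  unfolding represents_fun_def using plus_gfun.abs_eq[of r s] moderate_fun_add[of r s]
  by (auto simp: gfun_rel_eqI)

lemma represents_fun_sum:
  "finite A \<Longrightarrow> (\<And>i. i \<in> A \<Longrightarrow> represents_fun (f i) (F i)) \<Longrightarrow> represents_fun (\<lambda>\<epsilon> x. \<Sum>i\<in>A. f i \<epsilon> x) (\<Sum>i\<in>A. F i)"
proof (induction A rule: finite_induct)
  case empty
  show ?case by (simp add: represents_fun_def moderate_fun_0 zero_gfun_def)
qed (simp add: represents_fun_add)

lemma represents_fun_scale:
  "represents a c \<Longrightarrow> represents_fun r u \<Longrightarrow> represents_fun (\<lambda>\<epsilon> x. a \<epsilon> * r \<epsilon> x) (gscale c u)"
  unfolding represents_fun_def represents_def using gscale.abs_eq[of a r] moderate_fun_scale[of a r]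
  by (auto simp: gfun_rel_eqI gnum_rel_eqI)

lemma represents_fun_gD:
  "represents_fun r u \<Longrightarrow> represents_fun (\<lambda>\<epsilon> x. (- \<i>) ^ mi_order \<alpha> * mpartial \<alpha> (r \<epsilon>) x) (gD \<alpha> u)"
  unfolding represents_fun_def using gD.abs_eq[of r \<alpha>] moderate_fun_scale[OF moderate_net_const moderate_fun_mpartial, of r]
  by (auto simp: gfun_rel_eqI)

lemma represents_sign:
  assumes "represents a c"
  shows "represents (\<lambda>\<epsilon>. (- 1) ^ k * a \<epsilon>) ((- 1) ^ k * c)"
proof -
  have "represents (\<lambda>\<epsilon>. - a \<epsilon>) (- c)"
    using assms uminus_gnum.abs_eq[of a] moderate_net_uminus[of a] unfolding represents_def by (auto simp: gnum_rel_eqI)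
  thus ?thesis using assms by (simp add: minus_one_power_iff)
qed

lemma represents_transpose_op:
  assumes "\<And>\<alpha>. mi_order \<alpha> \<le> m \<Longrightarrow> represents (a \<alpha>) (c \<alpha>)" "represents_fun r w"
  shows "represents_fun (\<lambda>\<epsilon>. transposed m (\<lambda>\<alpha>. a \<alpha> \<epsilon>) (r \<epsilon>)) (transpose_op m c w)"
  unfolding transpose_op_def transposed_def[abs_def]
  using assms by (intro represents_fun_sum finite_mi_order_le represents_fun_scale represents_fun_gD represents_sign) auto

lemma moderate_net_sum:
  "finite A \<Longrightarrow> (\<And>i. i \<in> A \<Longrightarrow> moderate_net (f i)) \<Longrightarrow> moderate_net (\<lambda>\<epsilon>. \<Sum>i\<in>A. f i \<epsilon>)"
  by (induction A rule: finite_induct) (auto intro: moderate_net_add moderate_net_const)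

text \<open>Required before invertibility of the class can be used, since \<open>abs_gnum\<close> is
  informative on moderate nets only.\<close>

lemma moderate_net_symbol_tilde:
  assumes "\<And>\<alpha>. mi_order \<alpha> \<le> m \<Longrightarrow> moderate_net (a \<alpha>)"
  shows "moderate_net (\<lambda>\<epsilon>. symbol_tilde m a \<epsilon> \<xi>)"
proof (rule moderate_net_le)
  let ?b = "\<lambda>\<epsilon>. \<Sum>\<alpha> | mi_order \<alpha> \<le> m. \<Sum>\<gamma> | mi_order \<gamma> \<le> m. cmod (a \<gamma> \<epsilon>) * cmod (mpartial \<alpha> (\<lambda>x. cmono \<gamma> (cvec x)) \<xi>)"
  have "moderate_net (\<lambda>\<epsilon>. cmod (a \<gamma> \<epsilon>))" if "mi_order \<gamma> \<le> m" for \<gamma>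
    using assms[OF that] by (simp add: moderate_net_def)
  thus "moderate_net ?b"
    by (intro moderate_net_sum finite_mi_order_le moderate_net_mult moderate_net_const) auto
  have "symbol_tilde m a \<epsilon> \<xi> \<le> ?b \<epsilon>" for \<epsilon>
  proof -
    have "cmod (mpartial \<alpha> (\<lambda>x. cpol m (\<lambda>\<alpha>. a \<alpha> \<epsilon>) (cvec x)) \<xi>) \<le>
       (\<Sum>\<gamma> | mi_order \<gamma> \<le> m. cmod (a \<gamma> \<epsilon>) * cmod (mpartial \<alpha> (\<lambda>x. cmono \<gamma> (cvec x)) \<xi>))" for \<alpha>
      unfolding mpartial_cpol by (intro sum_norm_le) (simp add: norm_mult)
    thus ?thesis unfolding symbol_tilde_eq_ptilde by (intro order_trans[OF ptilde_le_sum] sum_mono)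
  qed
  moreover have "symbol_tilde m a \<epsilon> \<xi> \<ge> 0" for \<epsilon> unfolding symbol_tilde_eq_ptilde by (rule ptilde_nonneg)
  ultimately show "\<forall>\<^sub>F \<epsilon> in at_right 0. norm (symbol_tilde m a \<epsilon> \<xi>) \<le> norm (?b \<epsilon>)"
    by (intro always_eventually allI) (simp add: order_trans[OF _ abs_ge_self])
qed

text \<open>From s t = 1 + O(\<epsilon>) the product is eventually at least 1/2, while t grows at
  most like a power of 1/\<epsilon>; dividing gives the lower bound.\<close>

lemma invertible_gnum_bound:
  fixes s :: "real \<Rightarrow> real"
  assumes s: "moderate_net s" "\<And>\<epsilon>. s \<epsilon> \<ge> 0" and inv: "abs_gnum s dvd 1"
  obtains d and N :: nat where "d > 0" "\<forall>\<^sub>F \<epsilon> in at_right 0. d * \<epsilon> ^ N \<le> s \<epsilon>"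
proof -
  obtain y where y: "1 = abs_gnum s * y" using inv by (auto simp: dvd_def)
  obtain t where t: "moderate_net t" "abs_gnum t = y" using ex_represents[of y] by (auto simp: represents_def)
  have "abs_gnum (\<lambda>\<epsilon>. s \<epsilon> * t \<epsilon>) = abs_gnum (\<lambda>_. 1)"
    using y t times_gnum.abs_eq[of s t] s(1) by (auto simp: gnum_rel_eqI one_gnum_def)
  hence "negligible_net (\<lambda>\<epsilon>. s \<epsilon> * t \<epsilon> - 1)"
    using abs_gnum_eq_iff[OF moderate_net_mult[OF s(1) t(1)] moderate_net_const[of 1]] by simp
  hence "net_O (\<lambda>\<epsilon>. ennreal (norm (s \<epsilon> * t \<epsilon> - 1))) (real 1)" unfolding negligible_net_def by blast
  then obtain C where C: "\<forall>\<^sub>F \<epsilon> in at_right 0. ennreal \<bar>s \<epsilon> * t \<epsilon> - 1\<bar> \<le> ennreal (C * \<epsilon> powr 1)"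
    unfolding net_O_def by auto
  obtain N D where D: "\<forall>\<^sub>F \<epsilon> in at_right 0. ennreal (norm (t \<epsilon>)) \<le> ennreal (D * \<epsilon> powr (- real N))"
    using t(1) unfolding moderate_net_def net_O_def by blast
  have "((\<lambda>\<epsilon>. \<bar>C\<bar> * \<epsilon>) \<longlongrightarrow> \<bar>C\<bar> * 0) (at_right 0)" by (intro tendsto_intros)
  hence "\<forall>\<^sub>F \<epsilon> in at_right 0. \<bar>C\<bar> * \<epsilon> < 1 / 2" by (rule order_tendstoD) simp
  \<comment> \<open>\<open>\<bar>D\<bar> + 1\<close> is positive whatever the constant
    \<open>D\<close> is, so it may stand in the denominator.\<close>
  with C D eventually_at_right_01 have "\<forall>\<^sub>F \<epsilon> in at_right 0. (1 / (2 * (\<bar>D\<bar> + 1))) * \<epsilon> ^ N \<le> s \<epsilon>"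
  proof eventually_elim
    case (elim \<epsilon>)
    have e: "\<epsilon> > 0" using elim by simp
    have "ennreal \<bar>s \<epsilon> * t \<epsilon> - 1\<bar> \<le> ennreal (\<bar>C\<bar> * \<epsilon>)"
      using elim(1) e by (elim order_trans) (auto intro!: ennreal_leI mult_right_mono)
    hence "\<bar>s \<epsilon> * t \<epsilon> - 1\<bar> \<le> \<bar>C\<bar> * \<epsilon>" using e by (simp add: ennreal_le_iff)
    hence "s \<epsilon> * t \<epsilon> \<ge> 1 / 2" using elim(4) by linarith
    also have "s \<epsilon> * t \<epsilon> \<le> s \<epsilon> * \<bar>t \<epsilon>\<bar>" using s(2) by (intro mult_left_mono) auto
    finally have 1: "1 / 2 \<le> s \<epsilon> * \<bar>t \<epsilon>\<bar>" .
    have "ennreal (norm (t \<epsilon>)) \<le> ennreal ((\<bar>D\<bar> + 1) * \<epsilon> powr (- real N))"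
      using elim(2) by (elim order_trans) (auto intro!: ennreal_leI mult_right_mono)
    hence "\<bar>t \<epsilon>\<bar> \<le> (\<bar>D\<bar> + 1) * \<epsilon> powr (- real N)" by (simp add: ennreal_le_iff)
    also have "\<dots> = (\<bar>D\<bar> + 1) / \<epsilon> ^ N" using e by (simp add: powr_minus powr_realpow divide_inverse)
    finally have "s \<epsilon> * \<bar>t \<epsilon>\<bar> \<le> s \<epsilon> * ((\<bar>D\<bar> + 1) / \<epsilon> ^ N)" using s(2) by (intro mult_left_mono) auto
    with 1 have "1 / 2 \<le> s \<epsilon> * ((\<bar>D\<bar> + 1) / \<epsilon> ^ N)" by linarith
    thus ?case using e by (simp add: field_simps)
  qed
  thus thesis using that[of "1 / (2 * (\<bar>D\<bar> + 1))" N] by simp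
qed

section \<open>Seminorm estimates for the solution operator\<close>

lemma sol_seminorm_bound:
  fixes K K' :: "(real ^ 'n::finite) set"
  assumes K: "compact K" and R: "R \<ge> 0" and K': "compact K'"
  obtains C M where "C \<ge> 0" "\<And>b w f. good_shift m R c b w \<Longrightarrow> f \<in> smooth_supported K \<Longrightarrow>
     seminorm_on K' j (sol m b w f) \<le> ennreal (C / ptilde m b 0) * seminorm_on K M f"
proof -
  obtain r where r: "\<And>x. x \<in> K' \<Longrightarrow> norm x \<le> r" using compactD_norm[OF K'] by metis
  obtain C M where C: "C \<ge> 0" "\<And>b w f B \<alpha> y. good_shift m R c b w \<Longrightarrow> f \<in> smooth_supported K \<Longrightarrow>
     (\<And>\<alpha> x. mi_order \<alpha> \<le> M \<Longrightarrow> cmod (mpartial \<alpha> f x) \<le> B) \<Longrightarrow> mi_order \<alpha> \<le> j \<Longrightarrow> norm y \<le> r \<Longrightarrow>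
     cmod (mpartial \<alpha> (sol m b w f) y) \<le> C * B / ptilde m b 0"
    by (rule sol_bound[OF K R, of m c j r]) blast
  show thesis
  proof (rule that[OF C(1)])
    fix b and w :: "real ^ 'n \<Rightarrow> real ^ 'n" and f
    assume g: "good_shift m R c b w" and f: "f \<in> smooth_supported K"
    have "seminorm_on K' j (sol m b w f) \<le> ennreal (C * enn2real (seminorm_on K M f) / ptilde m b 0)"
      by (intro seminorm_on_leI C(2)[OF g f] smooth_supported_le_seminorm_on f K r)
    also have "\<dots> = ennreal (C / ptilde m b 0) * ennreal (enn2real (seminorm_on K M f))"
    proof -
      have "C / ptilde m b 0 \<ge> 0" using C(1) ptilde_nonneg by (rule divide_nonneg_nonneg)
      from ennreal_mult[OF this, of "enn2real (seminorm_on K M f)"] show ?thesis by simp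
    qed
    also have "\<dots> = ennreal (C / ptilde m b 0) * seminorm_on K M f"
      by (simp only: ennreal_enn2real_seminorm_on[OF smooth_supported_smooth[OF f] K])
    finally show "seminorm_on K' j (sol m b w f) \<le> ennreal (C / ptilde m b 0) * seminorm_on K M f" .
  qed
qed

text \<open>The constant depends on \<open>T\<close>, hence on \<epsilon> along a net. The bound
  serves to show that each single member is a distribution; bounds uniform in \<epsilon> come from
  the compactly supported net.\<close>

lemma tempered_localized_sol_bound:
  fixes h :: "real ^ 'n::finite \<Rightarrow> complex"
  assumes T: "is_tempered_distribution T" and g: "good_shift m R c b w"
    and h: "h \<in> smooth_supported K'" "compact K'" and K: "compact K"
  obtains C M where "C \<ge> 0" "\<And>f B. f \<in> smooth_supported K \<Longrightarrow> (\<And>\<alpha> x. mi_order \<alpha> \<le> M \<Longrightarrow> cmod (mpartial \<alpha> f x) \<le> B) \<Longrightarrow>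
     ennreal (cmod (T (\<lambda>x. h x * sol m b w f x))) \<le> ennreal (C * B)"
proof -
  obtain j c' where T: "\<And>f. f \<in> schwartz_functions \<Longrightarrow> ennreal (cmod (T f)) \<le> ennreal c' * schwartz_norm j f"
    using T by (auto simp: is_tempered_distribution_def)
  obtain C1 where C1: "C1 \<ge> 0" "\<And>f B. f \<in> smooth_supported K' \<Longrightarrow> (\<And>\<alpha> x. mi_order \<alpha> \<le> j \<Longrightarrow> cmod (mpartial \<alpha> f x) \<le> B) \<Longrightarrow>
    schwartz_norm j f \<le> ennreal (C1 * B)" using schwartz_norm_smooth_supported[OF h(2), of j] by blast
  obtain C2 where C2: "C2 \<ge> 0" "\<And>g x B \<alpha>. smooth g \<Longrightarrow> x \<in> K' \<Longrightarrow> (\<And>\<beta>. mi_order \<beta> \<le> j \<Longrightarrow> cmod (mpartial \<beta> g x) \<le> B) \<Longrightarrow>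
    mi_order \<alpha> \<le> j \<Longrightarrow> cmod (mpartial \<alpha> (\<lambda>x. h x * g x) x) \<le> C2 * B"
    using leibniz_bound[OF smooth_supported_smooth[OF h(1)] h(2), of j] by blast
  obtain r where r: "\<And>x. x \<in> K' \<Longrightarrow> norm x \<le> r" using compactD_norm[OF h(2)] by metis
  obtain C3 M where C3: "C3 \<ge> 0" "\<And>b w f B \<alpha> y. good_shift m R c b w \<Longrightarrow> f \<in> smooth_supported K \<Longrightarrow>
     (\<And>\<alpha> x. mi_order \<alpha> \<le> M \<Longrightarrow> cmod (mpartial \<alpha> f x) \<le> B) \<Longrightarrow> mi_order \<alpha> \<le> j \<Longrightarrow> norm y \<le> r \<Longrightarrow>
     cmod (mpartial \<alpha> (sol m b w f) y) \<le> C3 * B / ptilde m b 0"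
    by (rule sol_bound[OF K good_shift_R_nonneg[OF g], of m c j r]) blast
  have p0: "ptilde m b 0 > 0" using g by (simp add: good_shift_def)
  show thesis
  proof (rule that[of "\<bar>c'\<bar> * (C1 * (C2 * (C3 / ptilde m b 0)))" M])
    show "\<bar>c'\<bar> * (C1 * (C2 * (C3 / ptilde m b 0))) \<ge> 0" using C1 C2 C3 p0 by simp
    fix f B assume f: "f \<in> smooth_supported K" and B: "\<And>\<alpha> x. mi_order \<alpha> \<le> M \<Longrightarrow> cmod (mpartial \<alpha> f x) \<le> B"
    have "cmod (mpartial (\<lambda>_. 0) f 0) \<le> B" by (rule B) (simp add: mi_order_def)
    hence B0: "B \<ge> 0" using norm_ge_zero order_trans by blast
    let ?h = "\<lambda>x. h x * sol m b w f x"
    have ss: "smooth (sol m b w f)" by (rule smooth_sol[OF g f K])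
    have hK: "?h \<in> smooth_supported K'" using smooth_supported_mult[OF ss h(1)] by (simp add: mult.commute)
    have "cmod (mpartial \<alpha> ?h x) \<le> C2 * (C3 * B / ptilde m b 0)" if \<alpha>: "mi_order \<alpha> \<le> j" for \<alpha> x
    proof (cases "x \<in> K'")
      case True
      show ?thesis by (rule C2(2)[OF ss True C3(2)[OF g f B _ r[OF True]] \<alpha>])
    next
      case False
      hence "mpartial \<alpha> ?h x = 0"
        using smooth_supported_mpartial[OF hK compact_imp_closed[OF h(2)], of \<alpha>] by (simp add: smooth_supported_def)
      thus ?thesis using C2 C3 B0 p0 by simp
    qed
    hence "schwartz_norm j ?h \<le> ennreal (C1 * (C2 * (C3 * B / ptilde m b 0)))" by (rule C1(2)[OF hK])
    hence "ennreal (cmod (T ?h)) \<le> ennreal \<bar>c'\<bar> * ennreal (C1 * (C2 * (C3 * B / ptilde m b 0)))"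
      by (intro order_trans[OF T[OF smooth_supported_imp_schwartz[OF hK h(2)]]] mult_mono ennreal_leI) auto
    also have "\<dots> = ennreal (\<bar>c'\<bar> * (C1 * (C2 * (C3 / ptilde m b 0))) * B)"
      using C1 C2 C3 B0 p0 by (simp add: ennreal_mult[symmetric] mult_ac)
    finally show "ennreal (cmod (T ?h)) \<le> ennreal (\<bar>c'\<bar> * (C1 * (C2 * (C3 / ptilde m b 0))) * B)" .
  qed
qed

lemma clinear_localized_sol:
  assumes T: "is_tempered_distribution T" and g: "good_shift m R c b w"
    and h: "h \<in> smooth_supported K'" "compact K'" and f: "f1 \<in> smooth_supported K" "f2 \<in> smooth_supported K" "compact K"
  shows "T (\<lambda>x. h x * sol m b w (\<lambda>x. f1 x + f2 x) x) = T (\<lambda>x. h x * sol m b w f1 x) + T (\<lambda>x. h x * sol m b w f2 x)"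
    and "T (\<lambda>x. h x * sol m b w (\<lambda>x. a * f1 x) x) = a * T (\<lambda>x. h x * sol m b w f1 x)"
proof -
  have S: "(\<lambda>x. h x * sol m b w f x) \<in> schwartz_functions" if "f \<in> smooth_supported K" for f
    using smooth_supported_mult[OF smooth_sol[OF g that f(3)] h(1)]
    by (intro smooth_supported_imp_schwartz[OF _ h(2)]) (simp add: mult.commute)
  have lin: "\<forall>f\<in>schwartz_functions. \<forall>g\<in>schwartz_functions. T (\<lambda>x. f x + g x) = T f + T g"
    "\<forall>f\<in>schwartz_functions. \<forall>a. T (\<lambda>x. a * f x) = a * T f"
    using T unfolding is_tempered_distribution_def clinear_on_def by blast+
  have "(\<lambda>x. h x * sol m b w (\<lambda>x. f1 x + f2 x) x) = (\<lambda>x. h x * sol m b w f1 x + h x * sol m b w f2 x)"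
    by (simp add: sol_add[OF g f] distrib_left)
  thus "T (\<lambda>x. h x * sol m b w (\<lambda>x. f1 x + f2 x) x) = T (\<lambda>x. h x * sol m b w f1 x) + T (\<lambda>x. h x * sol m b w f2 x)"
    using lin(1)[rule_format, OF S[OF f(1)] S[OF f(2)]] by simp
  have "(\<lambda>x. h x * sol m b w (\<lambda>x. a * f1 x) x) = (\<lambda>x. a * (h x * sol m b w f1 x))"
    by (simp add: sol_cmult mult.left_commute)
  thus "T (\<lambda>x. h x * sol m b w (\<lambda>x. a * f1 x) x) = a * T (\<lambda>x. h x * sol m b w f1 x)"
    using lin(2)[rule_format, OF S[OF f(1)], of a] by simp
qed

lemma smooth_supported_mono: "f \<in> smooth_supported K \<Longrightarrow> K \<subseteq> K' \<Longrightarrow> f \<in> smooth_supported K'"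
  by (auto simp: smooth_supported_def)

lemma test_functions_pair:
  assumes "f \<in> test_functions" "g \<in> test_functions"
  obtains K where "compact K" "f \<in> smooth_supported K" "g \<in> smooth_supported K"
proof -
  obtain K1 K2 where "compact K1" "f \<in> smooth_supported K1" "compact K2" "g \<in> smooth_supported K2"
    using assms by (auto simp: test_functions_def)
  thus thesis by (intro that[of "K1 \<union> K2"]) (auto intro: smooth_supported_mono)
qed

lemma is_distribution_localized_sol:
  fixes h :: "real ^ 'n::finite \<Rightarrow> complex"
  assumes T: "is_tempered_distribution T" and g: "good_shift m R c b w" and h: "h \<in> smooth_supported K'" "compact K'"
  shows "is_distribution (\<lambda>f. T (\<lambda>x. h x * sol m b w f x))"
  unfolding is_distribution_def clinear_on_def
proof (intro conjI ballI allI impI)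
  fix f1 f2 :: "real ^ 'n \<Rightarrow> complex" assume "f1 \<in> test_functions" "f2 \<in> test_functions"
  then obtain K where K: "compact K" "f1 \<in> smooth_supported K" "f2 \<in> smooth_supported K" by (rule test_functions_pair)
  show "T (\<lambda>x. h x * sol m b w (\<lambda>x. f1 x + f2 x) x) = T (\<lambda>x. h x * sol m b w f1 x) + T (\<lambda>x. h x * sol m b w f2 x)"
    by (rule clinear_localized_sol(1)[OF T g h K(2,3,1)])
next
  fix f1 :: "real ^ 'n \<Rightarrow> complex" and a assume "f1 \<in> test_functions"
  then obtain K where K: "compact K" "f1 \<in> smooth_supported K" by (auto simp: test_functions_def)
  show "T (\<lambda>x. h x * sol m b w (\<lambda>x. a * f1 x) x) = a * T (\<lambda>x. h x * sol m b w f1 x)"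
    by (rule clinear_localized_sol(2)[OF T g h K(2,2,1)])
next
  fix K :: "(real ^ 'n) set" assume K: "compact K"
  obtain C M where C: "C \<ge> 0" "\<And>f B. f \<in> smooth_supported K \<Longrightarrow> (\<And>\<alpha> x. mi_order \<alpha> \<le> M \<Longrightarrow> cmod (mpartial \<alpha> f x) \<le> B) \<Longrightarrow>
     ennreal (cmod (T (\<lambda>x. h x * sol m b w f x))) \<le> ennreal (C * B)"
    by (rule tempered_localized_sol_bound[OF T g h K]) blast
  have "ennreal (cmod (T (\<lambda>x. h x * sol m b w f x))) \<le> ennreal C * seminorm_on K M f" if f: "f \<in> smooth_supported K" for f
  proof -
    have "ennreal (cmod (T (\<lambda>x. h x * sol m b w f x))) \<le> ennreal (C * enn2real (seminorm_on K M f))"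
      by (intro C(2) f smooth_supported_le_seminorm_on K)
    thus ?thesis using C(1) by (simp add: ennreal_mult ennreal_enn2real_seminorm_on[OF smooth_supported_smooth[OF f] K])
  qed
  thus "\<exists>j c. \<forall>f\<in>smooth_supported K. ennreal (cmod (T (\<lambda>x. h x * sol m b w f x))) \<le> ennreal c * seminorm_on K j f" by blast
qed

lemma schwartz_functions_smooth: "f \<in> schwartz_functions \<Longrightarrow> smooth f"
  by (simp add: schwartz_functions_def)

lemma is_tempered_localized_sol:
  fixes h \<phi> :: "real ^ 'n::finite \<Rightarrow> complex"
  assumes T: "is_tempered_distribution T" and g: "good_shift m R c b w" and h: "h \<in> smooth_supported K'" "compact K'"
    and \<phi>: "\<phi> \<in> smooth_supported K" "compact K"
  shows "is_tempered_distribution (\<lambda>f. T (\<lambda>x. h x * sol m b w (\<lambda>y. \<phi> y * f y) x))"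
proof -
  have \<phi>f: "(\<lambda>y. \<phi> y * f y) \<in> smooth_supported K" if "f \<in> schwartz_functions" for f
    using smooth_supported_mult[OF schwartz_functions_smooth[OF that] \<phi>(1)] by (simp add: mult.commute)
  show ?thesis unfolding is_tempered_distribution_def clinear_on_def
  proof (intro conjI ballI allI impI)
    fix f1 f2 :: "real ^ 'n \<Rightarrow> complex" assume f: "f1 \<in> schwartz_functions" "f2 \<in> schwartz_functions"
    show "T (\<lambda>x. h x * sol m b w (\<lambda>y. \<phi> y * (f1 y + f2 y)) x) =
        T (\<lambda>x. h x * sol m b w (\<lambda>y. \<phi> y * f1 y) x) + T (\<lambda>x. h x * sol m b w (\<lambda>y. \<phi> y * f2 y) x)"
      unfolding distrib_left by (rule clinear_localized_sol(1)[OF T g h \<phi>f[OF f(1)] \<phi>f[OF f(2)] \<phi>(2)])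
  next
    fix f1 :: "real ^ 'n \<Rightarrow> complex" and a assume f: "f1 \<in> schwartz_functions"
    show "T (\<lambda>x. h x * sol m b w (\<lambda>y. \<phi> y * (a * f1 y)) x) = a * T (\<lambda>x. h x * sol m b w (\<lambda>y. \<phi> y * f1 y) x)"
      unfolding mult.left_commute[of "\<phi> _" a] by (rule clinear_localized_sol(2)[OF T g h \<phi>f[OF f] \<phi>f[OF f] \<phi>(2)])
  next
    obtain C M where C: "C \<ge> 0" "\<And>f B. f \<in> smooth_supported K \<Longrightarrow> (\<And>\<alpha> x. mi_order \<alpha> \<le> M \<Longrightarrow> cmod (mpartial \<alpha> f x) \<le> B) \<Longrightarrow>
       ennreal (cmod (T (\<lambda>x. h x * sol m b w f x))) \<le> ennreal (C * B)"
      by (rule tempered_localized_sol_bound[OF T g h \<phi>(2)]) blast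
    obtain C2 where C2: "C2 \<ge> 0" "\<And>g x B \<alpha>. smooth g \<Longrightarrow> x \<in> K \<Longrightarrow> (\<And>\<beta>. mi_order \<beta> \<le> M \<Longrightarrow> cmod (mpartial \<beta> g x) \<le> B) \<Longrightarrow>
      mi_order \<alpha> \<le> M \<Longrightarrow> cmod (mpartial \<alpha> (\<lambda>x. \<phi> x * g x) x) \<le> C2 * B"
      using leibniz_bound[OF smooth_supported_smooth[OF \<phi>(1)] \<phi>(2), of M] by blast
    have "ennreal (cmod (T (\<lambda>x. h x * sol m b w (\<lambda>y. \<phi> y * f y) x))) \<le> ennreal (C * C2) * schwartz_norm M f"
      if f: "f \<in> schwartz_functions" for f
    proof -
      let ?B = "enn2real (schwartz_norm M f)"
      have "cmod (mpartial \<alpha> (\<lambda>y. \<phi> y * f y) x) \<le> C2 * ?B" if \<alpha>: "mi_order \<alpha> \<le> M" for \<alpha> x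
      proof (cases "x \<in> K")
        case True
        show ?thesis by (rule C2(2)[OF schwartz_functions_smooth[OF f] True schwartz_norm_bound[OF f] \<alpha>])
      next
        case False
        hence "mpartial \<alpha> (\<lambda>y. \<phi> y * f y) x = 0"
          using smooth_supported_mpartial[OF \<phi>f[OF f] compact_imp_closed[OF \<phi>(2)], of \<alpha>] by (simp add: smooth_supported_def)
        thus ?thesis using C2 by simp
      qed
      hence "ennreal (cmod (T (\<lambda>x. h x * sol m b w (\<lambda>y. \<phi> y * f y) x))) \<le> ennreal (C * (C2 * ?B))"
        by (rule C(2)[OF \<phi>f[OF f]])
      also have "\<dots> = ennreal (C * C2) * ennreal ?B" using C C2 by (simp add: ennreal_mult[symmetric] mult.assoc)
      also have "ennreal ?B = schwartz_norm M f"
        using f by (intro ennreal_enn2real) (simp add: schwartz_functions_def)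
      finally show ?thesis .
    qed
    thus "\<exists>j c. \<forall>f\<in>schwartz_functions. ennreal (cmod (T (\<lambda>x. h x * sol m b w (\<lambda>y. \<phi> y * f y) x))) \<le> ennreal c * schwartz_norm j f"
      by blast
  qed
qed

section \<open>The theorem\<close>

lemma net_O_finite_bound:
  assumes "net_O r b"
  obtains C where "C \<ge> 0" "\<forall>\<^sub>F \<epsilon> in at_right 0. r \<epsilon> \<le> ennreal (C * \<epsilon> powr b)"
proof -
  obtain C where C: "\<forall>\<^sub>F \<epsilon> in at_right 0. r \<epsilon> \<le> ennreal (C * \<epsilon> powr b)" using assms unfolding net_O_def by blast
  have "\<forall>\<^sub>F \<epsilon> in at_right 0. r \<epsilon> \<le> ennreal (\<bar>C\<bar> * \<epsilon> powr b)"
    using C by eventually_elim (auto elim!: order_trans intro!: ennreal_leI mult_right_mono)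
  thus thesis by (rule that[rotated]) simp
qed

lemma eventually_at_right_le:
  assumes "\<forall>\<^sub>F \<epsilon> in at_right (0::real). P \<epsilon>"
  obtains \<eta> where "\<eta> \<in> {0<..1}" "\<And>\<epsilon>. 0 < \<epsilon> \<Longrightarrow> \<epsilon> \<le> \<eta> \<Longrightarrow> P \<epsilon>"
proof -
  obtain b where "b > 0" "\<And>y. 0 < y \<Longrightarrow> y < b \<Longrightarrow> P y"
    using assms unfolding eventually_at_right_field by auto
  thus thesis by (intro that[of "min (b / 2) 1"]) auto
qed

lemma eventually_le_at_right: "0 < \<eta> \<Longrightarrow> (\<And>\<epsilon>. 0 < \<epsilon> \<Longrightarrow> \<epsilon> \<le> \<eta> \<Longrightarrow> P \<epsilon>) \<Longrightarrow> \<forall>\<^sub>F \<epsilon> in at_right (0::real). P \<epsilon>"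
  unfolding eventually_at_right_field by (intro exI[of _ \<eta>]) auto

lemma schwartz_zero: "is_tempered_distribution (\<lambda>f. 0)" "has_fourier (\<lambda>f. 0) (\<lambda>\<xi>. 0)" "is_distribution (\<lambda>f. 0)"
  by (auto simp: is_tempered_distribution_def is_distribution_def has_fourier_def clinear_on_def set_integrable_def)

text \<open>The value at a class is computed from one chosen representative with a common compact
  support; the seminorm bound makes the result independent of the choice. Values outside
  \<open>Gc\<close> are arbitrary.\<close>

lemma ex_basic_functional:
  fixes U :: "real \<Rightarrow> (real ^ 'n::finite \<Rightarrow> complex) \<Rightarrow> complex"
  assumes dist: "\<And>\<epsilon>. \<epsilon> \<in> {0<..1} \<Longrightarrow> is_distribution (U \<epsilon>)" and \<eta>: "\<eta> \<in> {0<..1}"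
    and bound: "\<And>K. compact K \<Longrightarrow> \<exists>(j::nat) (N::nat). \<exists>c>0. \<forall>f\<in>smooth_supported K. \<forall>\<epsilon>\<in>{0<..\<eta>}.
       ennreal (cmod (U \<epsilon> f)) \<le> ennreal (c * \<epsilon> powr - real N) * seminorm_on K j f"
  shows "\<exists>u\<in>Lb_Gc. defined_by u U"
proof -
  define ok where "ok r K w \<longleftrightarrow> represents_fun r w \<and> compact K \<and> (\<forall>\<epsilon>\<in>{0<..1}. r \<epsilon> \<in> smooth_supported K)"
    for r and K :: "(real ^ 'n) set" and w
  define rr where "rr w = (SOME r. \<exists>K. ok r K w)" for w
  define u where "u w = abs_gnum (\<lambda>\<epsilon>. U \<epsilon> (rr w \<epsilon>))" for w
  \<comment> \<open>One estimate for every growth rate \<open>b\<close>: a negative rate gives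
    moderateness, large positive rates give negligibility of differences.\<close>
  have est: "\<exists>j (N::nat). \<forall>r b. (\<forall>\<epsilon>\<in>{0<..1}. r \<epsilon> \<in> smooth_supported K) \<longrightarrow> net_O (\<lambda>\<epsilon>. seminorm_on K j (r \<epsilon>)) b \<longrightarrow>
     net_O (\<lambda>\<epsilon>. ennreal (cmod (U \<epsilon> (r \<epsilon>)))) (- real N + b)" if K: "compact K" for K
  proof -
    obtain j N c where c: "\<And>f \<epsilon>. f \<in> smooth_supported K \<Longrightarrow> \<epsilon> \<in> {0<..\<eta>} \<Longrightarrow>
       ennreal (cmod (U \<epsilon> f)) \<le> ennreal (c * \<epsilon> powr - real N) * seminorm_on K j f"
      using bound[OF K] by blast
    show ?thesis
    proof (rule exI[of _ j], rule exI[of _ N], intro allI impI)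
      fix r b assume r: "\<forall>\<epsilon>\<in>{0<..1}. r \<epsilon> \<in> smooth_supported K" and b: "net_O (\<lambda>\<epsilon>. seminorm_on K j (r \<epsilon>)) b"
      have "net_O (\<lambda>\<epsilon>. ennreal (c * \<epsilon> powr - real N)) (- real N)"
        unfolding net_O_def by (intro exI[of _ c] always_eventually) auto
      from net_O_mult[OF this b] have m: "net_O (\<lambda>\<epsilon>. ennreal (c * \<epsilon> powr - real N) * seminorm_on K j (r \<epsilon>)) (- real N + b)" .
      show "net_O (\<lambda>\<epsilon>. ennreal (cmod (U \<epsilon> (r \<epsilon>)))) (- real N + b)"
        by (rule net_O_eventually_le[OF m], rule eventually_le_at_right[of \<eta>]) (use \<eta> r in \<open>auto intro!: c\<close>)
    qed
  qed
  have mod: "moderate_net (\<lambda>\<epsilon>. U \<epsilon> (r \<epsilon>))" if r: "ok r K w" for r K w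
  proof -
    have K: "compact K" using r by (simp add: ok_def)
    obtain j N where jN: "\<forall>r b. (\<forall>\<epsilon>\<in>{0<..1}. r \<epsilon> \<in> smooth_supported K) \<longrightarrow> net_O (\<lambda>\<epsilon>. seminorm_on K j (r \<epsilon>)) b \<longrightarrow>
     net_O (\<lambda>\<epsilon>. ennreal (cmod (U \<epsilon> (r \<epsilon>)))) (- real N + b)" using est[OF K] by blast
    obtain N' where "net_O (\<lambda>\<epsilon>. seminorm_on K j (r \<epsilon>)) (- real N')"
      using moderate_fun_seminorm[of r K j] r by (auto simp: ok_def represents_fun_def)
    moreover have "\<forall>\<epsilon>\<in>{0<..1}. r \<epsilon> \<in> smooth_supported K" using r by (simp add: ok_def)
    ultimately have "net_O (\<lambda>\<epsilon>. ennreal (cmod (U \<epsilon> (r \<epsilon>)))) (- real N + - real N')" using jN by blast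
    thus ?thesis unfolding moderate_net_def by (intro exI[of _ "N + N'"]) simp
  qed
  have neg: "negligible_net (\<lambda>\<epsilon>. U \<epsilon> (r1 \<epsilon>) - U \<epsilon> (r2 \<epsilon>))" if r1: "ok r1 K1 w" and r2: "ok r2 K2 w" for r1 K1 r2 K2 w
    unfolding negligible_net_def
  proof
    fix q :: nat
    \<comment> \<open>The two representatives may live on different compact sets; their difference
      lives on the union.\<close>
    let ?K = "K1 \<union> K2"
    have K: "compact ?K" using r1 r2 by (auto simp: ok_def)
    obtain j N where jN: "\<forall>r b. (\<forall>\<epsilon>\<in>{0<..1}. r \<epsilon> \<in> smooth_supported ?K) \<longrightarrow> net_O (\<lambda>\<epsilon>. seminorm_on ?K j (r \<epsilon>)) b \<longrightarrow>
     net_O (\<lambda>\<epsilon>. ennreal (cmod (U \<epsilon> (r \<epsilon>)))) (- real N + b)" using est[OF K] by blast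
    have rK: "r1 \<epsilon> \<in> smooth_supported ?K" "r2 \<epsilon> \<in> smooth_supported ?K" if "\<epsilon> \<in> {0<..1}" for \<epsilon>
      using r1 r2 that by (auto simp: ok_def intro: smooth_supported_mono)
    have dK: "(\<lambda>x. r1 \<epsilon> x - r2 \<epsilon> x) \<in> smooth_supported ?K" if "\<epsilon> \<in> {0<..1}" for \<epsilon>
      using rK[OF that] by (auto simp: smooth_supported_def intro: smooth_diff)
    have "negligible_fun_on UNIV (\<lambda>\<epsilon> x. r1 \<epsilon> x - r2 \<epsilon> x)"
      using r1 r2 abs_gfun_eq_iff[of r1 r2] by (simp add: ok_def represents_fun_def)
    from negligible_fun_seminorm[OF this K, of j "q + N"]
    have "net_O (\<lambda>\<epsilon>. seminorm_on ?K j (\<lambda>x. r1 \<epsilon> x - r2 \<epsilon> x)) (real (q + N))" by simp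
    from jN[THEN spec, THEN spec, THEN mp, THEN mp, OF _ this] dK
    have "net_O (\<lambda>\<epsilon>. ennreal (cmod (U \<epsilon> (\<lambda>x. r1 \<epsilon> x - r2 \<epsilon> x)))) (- real N + real (q + N))" by simp
    hence *: "net_O (\<lambda>\<epsilon>. ennreal (cmod (U \<epsilon> (\<lambda>x. r1 \<epsilon> x - r2 \<epsilon> x)))) (real q)" by simp
    show "net_O (\<lambda>\<epsilon>. ennreal (norm (U \<epsilon> (r1 \<epsilon>) - U \<epsilon> (r2 \<epsilon>)))) (real q)"
    proof (rule net_O_le[OF *])
      fix \<epsilon> :: real assume \<epsilon>: "\<epsilon> \<in> {0<..1}"
      have U: "U \<epsilon> (\<lambda>x. f x + g x) = U \<epsilon> f + U \<epsilon> g" if "f \<in> test_functions" "g \<in> test_functions" for f g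
        using dist[OF \<epsilon>] that by (simp add: is_distribution_def clinear_on_def)
      have "(\<lambda>x. r1 \<epsilon> x - r2 \<epsilon> x) \<in> test_functions" "r2 \<epsilon> \<in> test_functions"
        using dK[OF \<epsilon>] rK[OF \<epsilon>] K unfolding test_functions_def by blast+
      hence "U \<epsilon> (\<lambda>x. (r1 \<epsilon> x - r2 \<epsilon> x) + r2 \<epsilon> x) = U \<epsilon> (\<lambda>x. r1 \<epsilon> x - r2 \<epsilon> x) + U \<epsilon> (r2 \<epsilon>)" by (rule U)
      thus "ennreal (norm (U \<epsilon> (r1 \<epsilon>) - U \<epsilon> (r2 \<epsilon>))) \<le> ennreal (cmod (U \<epsilon> (\<lambda>x. r1 \<epsilon> x - r2 \<epsilon> x)))" by simp
    qed
  qed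
  have def: "defined_by u U"
    unfolding defined_by_def
  proof (intro ballI allI impI)
    fix w :: "'n gfun" and r K assume "represents_fun r w \<and> compact K \<and> (\<forall>\<epsilon>\<in>{0<..1}. r \<epsilon> \<in> smooth_supported K)"
    hence r: "ok r K w" by (simp add: ok_def)
    have "\<exists>K. ok (rr w) K w" unfolding rr_def by (rule someI[of "\<lambda>r. \<exists>K. ok r K w"]) (use r in blast)
    then obtain K' where r': "ok (rr w) K' w" by blast
    have "abs_gnum (\<lambda>\<epsilon>. U \<epsilon> (r \<epsilon>)) = u w"
      unfolding u_def abs_gnum_eq_iff[OF mod[OF r] mod[OF r']] by (rule neg[OF r r'])
    thus "represents (\<lambda>\<epsilon>. U \<epsilon> (r \<epsilon>)) (u w)" using mod[OF r] by (simp add: represents_def)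
  qed
  have "u \<in> Lb_Gc"
    unfolding Lb_Gc_def
  proof (intro CollectI exI[of _ U] conjI ballI allI impI dist def)
    fix K :: "(real ^ 'n) set" assume "compact K"
    from bound[OF this] \<eta> show "\<exists>(j::nat) (N::nat). \<exists>c>0. \<exists>\<eta>\<in>{0<..1}. \<forall>f\<in>smooth_supported K. \<forall>\<epsilon>\<in>{0<..\<eta>}.
          ennreal (cmod (U \<epsilon> f)) \<le> ennreal (c * \<epsilon> powr - real N) * seminorm_on K j f"
      by blast
  qed
  with def show ?thesis by blast
qed

theorem theoremA6:
  fixes m :: nat
    and c :: "'n::finite multiindex \<Rightarrow> complex gnum"
    and a :: "'n multiindex \<Rightarrow> real \<Rightarrow> complex"
    and k :: "real ^ 'n \<Rightarrow> real"
    and p :: ennreal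
    and v :: "'n gfun \<Rightarrow> complex gnum"
    and v_net :: "real \<Rightarrow> (real ^ 'n \<Rightarrow> complex) \<Rightarrow> complex"
  assumes "\<And>\<alpha>. mi_order \<alpha> \<le> m \<Longrightarrow> represents (a \<alpha>) (c \<alpha>)"
    and "\<exists>\<xi>0. gsymbol_tilde m a \<xi>0 dvd 1"
    and "k \<in> tempered_weights"
    and "1 \<le> p"
    and "v \<in> Lb_G"
    and "defined_by v v_net"
    and "B_moderate p (\<lambda>\<epsilon>. k) v_net"
  shows "\<exists>u\<in>Lb_Gc. (\<forall>w\<in>Gc. diff_op m c u w = v w) \<and>
    (\<exists>u_net. defined_by u u_net \<and>
       B_loc_moderate p (\<lambda>\<epsilon> \<xi>. k \<xi> * symbol_tilde m a \<epsilon> \<xi>) u_net)"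
proof -
  let ?a = "\<lambda>\<epsilon> \<alpha>. a \<alpha> \<epsilon>"
  obtain S K0 j0 N0 c0 \<eta>0 where
    S: "\<And>\<epsilon>. \<epsilon> \<in> {0<..1} \<Longrightarrow> is_compact_distribution (S \<epsilon>)"
    and K0: "compact K0" and c0: "c0 > 0" and \<eta>0: "\<eta>0 \<in> {0<..1}"
    and Sb: "\<And>f \<epsilon>. smooth f \<Longrightarrow> \<epsilon> \<in> {0<..\<eta>0} \<Longrightarrow> ennreal (cmod (S \<epsilon> f)) \<le> ennreal (c0 * \<epsilon> powr - real N0) * seminorm_on K0 j0 f"
    and Sv: "\<And>u r. represents_fun r u \<Longrightarrow> represents (\<lambda>\<epsilon>. S \<epsilon> (r \<epsilon>)) (v u)"
    using \<open>v \<in> Lb_G\<close> unfolding Lb_G_def by blast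
  obtain g b where T: "\<And>\<epsilon>. \<epsilon> \<in> {0<..1} \<Longrightarrow> is_tempered_distribution (v_net \<epsilon>)"
    and g: "\<And>\<epsilon>. \<epsilon> \<in> {0<..1} \<Longrightarrow> has_fourier (v_net \<epsilon>) (g \<epsilon>)"
    and b: "net_O (\<lambda>\<epsilon>. Lp_norm p (\<lambda>\<xi>. k \<xi> * cmod (g \<epsilon> \<xi>))) b"
    using \<open>B_moderate p (\<lambda>\<epsilon>. k) v_net\<close> unfolding B_moderate_def by blast
  obtain Cg where Cg: "Cg \<ge> 0" "\<forall>\<^sub>F \<epsilon> in at_right 0. Lp_norm p (\<lambda>\<xi>. k \<xi> * cmod (g \<epsilon> \<xi>)) \<le> ennreal (Cg * \<epsilon> powr b)"
    using net_O_finite_bound[OF b] by blast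
  obtain \<xi>0 where \<xi>0: "abs_gnum (\<lambda>\<epsilon>. symbol_tilde m a \<epsilon> \<xi>0) dvd 1"
    using assms(2) unfolding gsymbol_tilde_def by blast
  have "moderate_net (\<lambda>\<epsilon>. symbol_tilde m a \<epsilon> \<xi>0)"
    by (rule moderate_net_symbol_tilde) (use assms(1) in \<open>auto simp: represents_def\<close>)
  then obtain d N1 where d: "d > 0" "\<forall>\<^sub>F \<epsilon> in at_right 0. d * \<epsilon> ^ N1 \<le> symbol_tilde m a \<epsilon> \<xi>0"
    by (rule invertible_gnum_bound[OF _ _ \<xi>0]) (simp_all add: symbol_tilde_eq_ptilde ptilde_nonneg)
  let ?n2 = "(mcount TYPE('n) m)\<^sup>2"
  \<comment> \<open>All eventual properties are gathered below a single threshold \<eta>, after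
    which the argument is pointwise in \<epsilon>.\<close>
  have "\<forall>\<^sub>F \<epsilon> in at_right 0. Lp_norm p (\<lambda>\<xi>. k \<xi> * cmod (g \<epsilon> \<xi>)) \<le> ennreal (Cg * \<epsilon> powr b) \<and>
     d * \<epsilon> ^ N1 \<le> symbol_tilde m a \<epsilon> \<xi>0 \<and> \<epsilon> \<in> {0<..\<eta>0}"
    by (intro eventually_conj Cg(2) d(2) eventually_le_at_right[of \<eta>0]) (use \<eta>0 in auto)
  then obtain \<eta> where \<eta>: "\<eta> \<in> {0<..1}" and good: "\<And>\<epsilon>. 0 < \<epsilon> \<Longrightarrow> \<epsilon> \<le> \<eta> \<Longrightarrow>
     Lp_norm p (\<lambda>\<xi>. k \<xi> * cmod (g \<epsilon> \<xi>)) \<le> ennreal (Cg * \<epsilon> powr b) \<and> d * \<epsilon> ^ N1 \<le> symbol_tilde m a \<epsilon> \<xi>0 \<and> \<epsilon> \<in> {0<..\<eta>0}"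
    by (rule eventually_at_right_le) blast
  have \<eta>01: "\<epsilon> \<in> {0<..1}" if "0 < \<epsilon>" "\<epsilon> \<le> \<eta>" for \<epsilon> using that \<eta> by auto
  \<comment> \<open>Fixed before the coefficients, hence the same for all \<epsilon>.\<close>
  obtain R c' where c': "c' > 0" and
    sh: "\<And>b. \<exists>w :: real ^ 'n \<Rightarrow> real ^ 'n. w \<in> borel_measurable borel \<and> (\<forall>\<xi>. norm (w \<xi>) \<le> R) \<and>
      (\<forall>\<xi> z. cmod z = 1 \<longrightarrow> c' * ptilde m b \<xi> \<le> cmod (cpol m b (cvec \<xi> + z *s cvec (w \<xi>))))"
    using ex_shift[of m] by metis
  from sh obtain ww :: "('n multiindex \<Rightarrow> complex) \<Rightarrow> real ^ 'n \<Rightarrow> real ^ 'n" where ww: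
    "\<And>b. ww b \<in> borel_measurable borel \<and> (\<forall>\<xi>. norm (ww b \<xi>) \<le> R) \<and>
      (\<forall>\<xi> z. cmod z = 1 \<longrightarrow> c' * ptilde m b \<xi> \<le> cmod (cpol m b (cvec \<xi> + z *s cvec (ww b \<xi>))))" by metis
  define w where "w \<epsilon> = ww (?a \<epsilon>)" for \<epsilon>
  have R: "R \<ge> 0" using ww norm_ge_zero order_trans by metis
  \<comment> \<open>The lower bound at \<xi>0 is moved to the origin; the denominator is the price
    of slow variation.\<close>
  define d' where "d' = d / (?n2 * (1 + norm \<xi>0) ^ m)"
  have n2: "?n2 > 0"
  proof -
    have "(\<lambda>_. 0) \<in> {\<alpha> :: 'n multiindex. mi_order \<alpha> \<le> m}" by (simp add: mi_order_def)
    thus ?thesis by (auto simp: card_gt_0_iff finite_mi_order_le)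
  qed
  have d': "d' > 0" using d n2 by (simp add: d'_def)
  have p0: "d' * \<epsilon> ^ N1 \<le> ptilde m (?a \<epsilon>) 0" if "0 < \<epsilon>" "\<epsilon> \<le> \<eta>" for \<epsilon>
  proof -
    have "d * \<epsilon> ^ N1 \<le> ?n2 * (1 + norm \<xi>0) ^ m * ptilde m (?a \<epsilon>) 0"
      using good[OF that] ptilde_slowly_varying[of m "?a \<epsilon>" 0 \<xi>0] by (simp add: symbol_tilde_eq_ptilde)
    thus ?thesis using n2 by (simp add: d'_def divide_le_eq mult_ac)
  qed
  have gs: "good_shift m R c' (?a \<epsilon>) (w \<epsilon>)" if \<epsilon>: "0 < \<epsilon>" "\<epsilon> \<le> \<eta>" for \<epsilon>
  proof -
    have "ptilde m (?a \<epsilon>) \<xi> > 0" for \<xi>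
    proof -
      have "0 < d' * \<epsilon> ^ N1" using d' \<epsilon> by simp
      also have "\<dots> \<le> ptilde m (?a \<epsilon>) 0" by (rule p0[OF \<epsilon>])
      also have "\<dots> \<le> ?n2 * (1 + norm (- \<xi>)) ^ m * ptilde m (?a \<epsilon>) \<xi>"
        using ptilde_slowly_varying[of m "?a \<epsilon>" \<xi> "- \<xi>"] by simp
      finally have "ptilde m (?a \<epsilon>) \<xi> \<noteq> 0" by auto
      thus ?thesis using ptilde_nonneg[of m "?a \<epsilon>" \<xi>] by simp
    qed
    thus ?thesis using ww c' unfolding good_shift_def w_def by blast
  qed
  \<comment> \<open>\<open>h\<close> is 1 on a neighbourhood of \<open>K0\<close>, so that
    multiplying by it preserves all derivatives on \<open>K0\<close> as well.\<close>
  obtain h V where h: "h \<in> test_functions" "open V" "K0 \<subseteq> V" "\<And>x. x \<in> V \<Longrightarrow> h x = 1"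
    using ex_cutoff[OF K0] by blast
  then obtain Kh where Kh: "compact Kh" and hK: "h \<in> smooth_supported Kh" by (auto simp: test_functions_def)
  define s where "s \<epsilon> = sol m (?a \<epsilon>) (w \<epsilon>)" for \<epsilon>
  \<comment> \<open>The net that carries the bounds uniform in \<epsilon>; members of
    \<open>S\<close> accept smooth functions without decay.\<close>
  define U where "U \<epsilon> f = (if \<epsilon> \<le> \<eta> then S \<epsilon> (s \<epsilon> f) else 0)" for \<epsilon> f
  \<comment> \<open>The net that carries the regularity; the cutoff turns the argument into one that
    tempered distributions accept.\<close>
  define W where "W \<epsilon> f = (if \<epsilon> \<le> \<eta> then v_net \<epsilon> (\<lambda>x. h x * s \<epsilon> f x) else 0)" for \<epsilon> f
  have ssm: "smooth (s \<epsilon> f)" if "0 < \<epsilon>" "\<epsilon> \<le> \<eta>" "f \<in> smooth_supported K" "compact K" for \<epsilon> f K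
    unfolding s_def by (rule smooth_sol[OF gs[OF that(1,2)] that(3,4)])
  have pinv: "C / ptilde m (?a \<epsilon>) 0 \<le> C / d' * \<epsilon> powr - real N1" if "0 < \<epsilon>" "\<epsilon> \<le> \<eta>" "C \<ge> 0" for \<epsilon> C
  proof -
    have "C / ptilde m (?a \<epsilon>) 0 \<le> C / (d' * \<epsilon> ^ N1)"
      using p0[OF that(1,2)] d' that by (intro divide_left_mono mult_pos_pos) (auto intro: order_less_le_trans[of 0 "d' * \<epsilon> ^ N1"])
    thus ?thesis using that by (simp add: powr_minus powr_realpow divide_inverse)
  qed
  \<comment> \<open>\<open>L\<close> stays arbitrary: \<open>K0\<close> is needed for the bounds of
    \<open>U\<close>, every compact set for the moderateness of \<open>q\<close> below.\<close>
  have sbound: "\<exists>C (M::nat). C > 0 \<and> (\<forall>\<epsilon> f. 0 < \<epsilon> \<longrightarrow> \<epsilon> \<le> \<eta> \<longrightarrow> f \<in> smooth_supported K \<longrightarrow>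
     seminorm_on L j (s \<epsilon> f) \<le> ennreal (C * \<epsilon> powr - real N1) * seminorm_on K M f)" if K: "compact K" and L: "compact L" for K L :: "(real ^ 'n) set" and j
  proof -
    obtain C M where C: "C \<ge> 0" "\<And>b w f. good_shift m R c' b w \<Longrightarrow> f \<in> smooth_supported K \<Longrightarrow>
       seminorm_on L j (sol m b w f) \<le> ennreal (C / ptilde m b 0) * seminorm_on K M f"
      by (rule sol_seminorm_bound[OF K R L, of m c' j]) blast
    \<comment> \<open>\<open>C + 1\<close> since a basic functional requires a strictly positive
      constant and \<open>C\<close> may be 0.\<close>
    have "seminorm_on L j (s \<epsilon> f) \<le> ennreal ((C + 1) / d' * \<epsilon> powr - real N1) * seminorm_on K M f"
      if \<epsilon>: "0 < \<epsilon>" "\<epsilon> \<le> \<eta>" and f: "f \<in> smooth_supported K" for \<epsilon> f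
    proof -
      have "C / ptilde m (?a \<epsilon>) 0 \<le> (C + 1) / d' * \<epsilon> powr - real N1"
        by (rule order_trans[OF pinv[OF \<epsilon> C(1)]]) (use d' in \<open>auto intro!: mult_right_mono divide_right_mono\<close>)
      hence "ennreal (C / ptilde m (?a \<epsilon>) 0) * seminorm_on K M f \<le> ennreal ((C + 1) / d' * \<epsilon> powr - real N1) * seminorm_on K M f"
        by (intro mult_right_mono ennreal_leI) auto
      thus ?thesis using C(2)[OF gs[OF \<epsilon>] f] unfolding s_def by (rule order_trans[rotated])
    qed
    thus ?thesis using C(1) d' by (intro exI[of _ "(C + 1) / d'"] exI[of _ M]) auto
  qed
  have Ubound: "\<exists>(j::nat) (N::nat). \<exists>c>0. \<forall>f\<in>smooth_supported K. \<forall>\<epsilon>\<in>{0<..\<eta>}.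
       ennreal (cmod (U \<epsilon> f)) \<le> ennreal (c * \<epsilon> powr - real N) * seminorm_on K j f" if K: "compact K" for K
  proof -
    obtain C M where C: "C > 0" "\<And>\<epsilon> f. 0 < \<epsilon> \<Longrightarrow> \<epsilon> \<le> \<eta> \<Longrightarrow> f \<in> smooth_supported K \<Longrightarrow>
      seminorm_on K0 j0 (s \<epsilon> f) \<le> ennreal (C * \<epsilon> powr - real N1) * seminorm_on K M f"
      using sbound[OF K K0, of j0] by blast
    show ?thesis
    proof (rule exI[of _ M], rule exI[of _ "N0 + N1"], intro exI[of _ "c0 * C"] conjI ballI)
      show "c0 * C > 0" using c0 C by simp
      fix f \<epsilon> assume f: "f \<in> smooth_supported K" and "\<epsilon> \<in> {0<..\<eta>}"
      hence \<epsilon>: "0 < \<epsilon>" "\<epsilon> \<le> \<eta>" by auto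
      have "ennreal (cmod (U \<epsilon> f)) \<le> ennreal (c0 * \<epsilon> powr - real N0) * seminorm_on K0 j0 (s \<epsilon> f)"
        using \<epsilon> good[OF \<epsilon>] unfolding U_def by (simp add: Sb[OF ssm[OF \<epsilon> f K]])
      also have "\<dots> \<le> ennreal (c0 * \<epsilon> powr - real N0) * (ennreal (C * \<epsilon> powr - real N1) * seminorm_on K M f)"
        by (intro mult_left_mono C(2) \<epsilon> f) simp
      also have "\<dots> = ennreal ((c0 * \<epsilon> powr - real N0) * (C * \<epsilon> powr - real N1)) * seminorm_on K M f"
        using c0 C by (subst ennreal_mult) (simp_all add: mult.assoc)
      also have "(c0 * \<epsilon> powr - real N0) * (C * \<epsilon> powr - real N1) = c0 * C * \<epsilon> powr - real (N0 + N1)"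
        by (simp add: powr_add[symmetric])
      finally show "ennreal (cmod (U \<epsilon> f)) \<le> ennreal (c0 * C * \<epsilon> powr - real (N0 + N1)) * seminorm_on K M f" .
    qed
  qed
  have Slin: "S \<epsilon> (\<lambda>x. f1 x + f2 x) = S \<epsilon> f1 + S \<epsilon> f2" "S \<epsilon> (\<lambda>x. z * f1 x) = z * S \<epsilon> f1"
    if "\<epsilon> \<in> {0<..1}" "smooth f1" "smooth f2" for \<epsilon> f1 f2 z
    using S[OF that(1)] that(2,3) unfolding is_compact_distribution_def clinear_on_def by blast+
  have Udist: "is_distribution (U \<epsilon>)" if \<epsilon>1: "\<epsilon> \<in> {0<..1}" for \<epsilon>
  proof (cases "\<epsilon> \<le> \<eta>")
    case False
    hence "U \<epsilon> = (\<lambda>f. 0)" by (simp add: U_def fun_eq_iff)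
    thus ?thesis by (simp add: schwartz_zero)
  next
    case True
    hence \<epsilon>: "0 < \<epsilon>" "\<epsilon> \<le> \<eta>" using \<epsilon>1 by auto
    show ?thesis unfolding is_distribution_def clinear_on_def
    proof (intro conjI ballI allI impI)
      fix f1 f2 :: "real ^ 'n \<Rightarrow> complex" assume "f1 \<in> test_functions" "f2 \<in> test_functions"
      then obtain K where K: "compact K" "f1 \<in> smooth_supported K" "f2 \<in> smooth_supported K" by (rule test_functions_pair)
      show "U \<epsilon> (\<lambda>x. f1 x + f2 x) = U \<epsilon> f1 + U \<epsilon> f2"
        using True Slin(1)[OF \<epsilon>1 ssm[OF \<epsilon> K(2,1)] ssm[OF \<epsilon> K(3,1)]]
        by (simp add: U_def s_def sol_add[OF gs[OF \<epsilon>] K(2,3,1)])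
    next
      fix f :: "real ^ 'n \<Rightarrow> complex" and z assume "f \<in> test_functions"
      then obtain K where K: "compact K" "f \<in> smooth_supported K" by (auto simp: test_functions_def)
      show "U \<epsilon> (\<lambda>x. z * f x) = z * U \<epsilon> f"
        using True Slin(2)[OF \<epsilon>1 ssm[OF \<epsilon> K(2,1)] ssm[OF \<epsilon> K(2,1)]] by (simp add: U_def s_def sol_cmult)
    next
      fix K :: "(real ^ 'n) set" assume "compact K"
      from Ubound[OF this] show "\<exists>j c. \<forall>f\<in>smooth_supported K. ennreal (cmod (U \<epsilon> f)) \<le> ennreal c * seminorm_on K j f"
        using \<epsilon> by (metis greaterThanAtMost_iff)
    qed
  qed
  obtain u where u: "u \<in> Lb_Gc" and uU: "defined_by u U"
    using ex_basic_functional[of U, OF Udist \<eta> Ubound] by blast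
  have 1: "diff_op m c u y = v y" if y: "y \<in> Gc" for y
  proof -
    obtain r K where r: "represents_fun r y" and K: "compact K" and rK: "\<And>\<epsilon>. \<epsilon> \<in> {0<..1} \<Longrightarrow> r \<epsilon> \<in> smooth_supported K"
      using Gc_representative[OF y] by blast
    let ?t = "\<lambda>\<epsilon>. transposed m (?a \<epsilon>) (r \<epsilon>)"
    have t: "represents_fun ?t (transpose_op m c y)" by (rule represents_transpose_op[OF assms(1) r])
    have tK: "?t \<epsilon> \<in> smooth_supported K" if "\<epsilon> \<in> {0<..1}" for \<epsilon>
      by (rule transposed_smooth_supported[OF rK[OF that] compact_imp_closed[OF K]])
    have "transpose_op m c y \<in> Gc" using abs_gfun_in_Gc[of ?t, OF _ K tK] t by (simp add: represents_fun_def)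
    hence "represents (\<lambda>\<epsilon>. U \<epsilon> (?t \<epsilon>)) (u (transpose_op m c y))" using uU t K tK unfolding defined_by_def by blast
    moreover have "\<forall>\<^sub>F \<epsilon> in at_right 0. U \<epsilon> (?t \<epsilon>) = S \<epsilon> (r \<epsilon>)"
    proof (rule eventually_le_at_right[of \<eta>])
      fix \<epsilon> assume \<epsilon>: "0 < \<epsilon>" "\<epsilon> \<le> \<eta>"
      show "U \<epsilon> (?t \<epsilon>) = S \<epsilon> (r \<epsilon>)"
        using \<epsilon> by (simp add: U_def s_def sol_transposed[OF gs[OF \<epsilon>] rK[OF \<eta>01[OF \<epsilon>]] K])
    qed (use \<eta> in simp)
    ultimately have "represents (\<lambda>\<epsilon>. S \<epsilon> (r \<epsilon>)) (u (transpose_op m c y))" by (rule represents_cong_eventually)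
    thus ?thesis unfolding diff_op_def using Sv[OF r] represents_unique by blast
  qed
  have 2: "defined_by u W"
    unfolding defined_by_def
  proof (intro ballI allI impI)
    fix y :: "'n gfun" and r K assume y: "y \<in> Gc" and "represents_fun r y \<and> compact K \<and> (\<forall>\<epsilon>\<in>{0<..1}. r \<epsilon> \<in> smooth_supported K)"
    hence r: "represents_fun r y" and K: "compact K" and rK: "\<And>\<epsilon>. \<epsilon> \<in> {0<..1} \<Longrightarrow> r \<epsilon> \<in> smooth_supported K" by auto
    have mr: "moderate_fun r" using r by (simp add: represents_fun_def)
    \<comment> \<open>The class of \<open>q\<close> is compactly supported, so \<open>v\<close> can
      be evaluated at it through either net; this is where \<open>U\<close> and \<open>W\<close>
      meet.\<close>
    define q where "q \<epsilon> = (if \<epsilon> \<le> \<eta> then (\<lambda>x. h x * s \<epsilon> (r \<epsilon>) x) else (\<lambda>x. 0))" for \<epsilon>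
    have qK: "q \<epsilon> \<in> smooth_supported Kh" if \<epsilon>1: "\<epsilon> \<in> {0<..1}" for \<epsilon>
    proof (cases "\<epsilon> \<le> \<eta>")
      case True
      hence "smooth (s \<epsilon> (r \<epsilon>))" using ssm[OF _ _ rK[OF \<epsilon>1] K] \<epsilon>1 by simp
      from smooth_supported_mult[OF this hK] show ?thesis using True by (simp add: q_def mult.commute)
    qed (simp add: q_def smooth_supported_def smooth_0)
    have mq: "moderate_fun q"
      unfolding moderate_fun_def
    proof (intro conjI ballI allI impI)
      fix \<epsilon> :: real assume "\<epsilon> \<in> {0<..1}"
      thus "smooth (q \<epsilon>)" using qK smooth_supported_smooth by blast
    next
      fix L and \<alpha> :: "'n multiindex" assume L: "compact (L :: (real ^ 'n) set)"
      let ?j = "mi_order \<alpha>"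
      obtain C1 where C1: "C1 \<ge> 0" "\<And>f. smooth f \<Longrightarrow> seminorm_on L ?j (\<lambda>x. h x * f x) \<le> ennreal C1 * seminorm_on L ?j f"
        using leibniz_seminorm[OF smooth_supported_smooth[OF hK] L, of ?j] by blast
      obtain C M where C: "C > 0" "\<And>\<epsilon> f. 0 < \<epsilon> \<Longrightarrow> \<epsilon> \<le> \<eta> \<Longrightarrow> f \<in> smooth_supported K \<Longrightarrow>
        seminorm_on L ?j (s \<epsilon> f) \<le> ennreal (C * \<epsilon> powr - real N1) * seminorm_on K M f"
        using sbound[OF K L, of ?j] by blast
      obtain N where N: "net_O (\<lambda>\<epsilon>. seminorm_on K M (r \<epsilon>)) (- real N)" using moderate_fun_seminorm[OF mr K] by blast
      have "net_O (\<lambda>\<epsilon>. ennreal (C * \<epsilon> powr - real N1)) (- real N1)"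
        unfolding net_O_def by (intro exI[of _ C] always_eventually) auto
      from net_O_mult[OF net_O_const[of 0 C1] net_O_mult[OF this N]]
      have "net_O (\<lambda>\<epsilon>. sup_on L (mpartial \<alpha> (q \<epsilon>))) (0 + (- real N1 + - real N))"
      proof (rule net_O_eventually_le)
        show "\<forall>\<^sub>F \<epsilon> in at_right 0. sup_on L (mpartial \<alpha> (q \<epsilon>)) \<le> ennreal C1 * (ennreal (C * \<epsilon> powr - real N1) * seminorm_on K M (r \<epsilon>))"
        proof (rule eventually_le_at_right[of \<eta>])
          fix \<epsilon> assume \<epsilon>: "0 < \<epsilon>" "\<epsilon> \<le> \<eta>"
          note rK' = rK[OF \<eta>01[OF \<epsilon>]]
          have "sup_on L (mpartial \<alpha> (q \<epsilon>)) \<le> seminorm_on L ?j (q \<epsilon>)" by (rule sup_on_le_seminorm_on) simp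
          also have "\<dots> \<le> ennreal C1 * seminorm_on L ?j (s \<epsilon> (r \<epsilon>))"
            using C1(2)[OF ssm[OF \<epsilon> rK' K]] \<epsilon> by (simp add: q_def)
          also have "\<dots> \<le> ennreal C1 * (ennreal (C * \<epsilon> powr - real N1) * seminorm_on K M (r \<epsilon>))"
            by (intro mult_left_mono C(2) \<epsilon> rK') simp
          finally show "sup_on L (mpartial \<alpha> (q \<epsilon>)) \<le> ennreal C1 * (ennreal (C * \<epsilon> powr - real N1) * seminorm_on K M (r \<epsilon>))" .
        qed (use \<eta> in simp)
      qed simp
      thus "\<exists>N::nat. net_O (\<lambda>\<epsilon>. sup_on L (mpartial \<alpha> (q \<epsilon>))) (- real N)"
        by (intro exI[of _ "N1 + N"]) simp
    qed
    let ?x = "abs_gfun q"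
    have x: "represents_fun q ?x" using mq by (simp add: represents_fun_def)
    have "?x \<in> Gc" by (rule abs_gfun_in_Gc[OF mq Kh qK])
    hence "represents (\<lambda>\<epsilon>. v_net \<epsilon> (q \<epsilon>)) (v ?x)"
      using \<open>defined_by v v_net\<close> x Kh qK unfolding defined_by_def by blast
    hence Wx: "represents (\<lambda>\<epsilon>. W \<epsilon> (r \<epsilon>)) (v ?x)"
    proof (rule represents_cong_eventually)
      show "\<forall>\<^sub>F \<epsilon> in at_right 0. v_net \<epsilon> (q \<epsilon>) = W \<epsilon> (r \<epsilon>)"
        by (rule eventually_le_at_right[of \<eta>]) (use \<eta> in \<open>auto simp: q_def W_def\<close>)
    qed
    have Ux: "represents (\<lambda>\<epsilon>. U \<epsilon> (r \<epsilon>)) (v ?x)"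
    proof (rule represents_cong_eventually[OF Sv[OF x]])
      show "\<forall>\<^sub>F \<epsilon> in at_right 0. S \<epsilon> (q \<epsilon>) = U \<epsilon> (r \<epsilon>)"
      proof (rule eventually_le_at_right[of \<eta>])
        fix \<epsilon> assume \<epsilon>: "0 < \<epsilon>" "\<epsilon> \<le> \<eta>"
        note \<epsilon>1 = \<eta>01[OF \<epsilon>]
        let ?f = "s \<epsilon> (r \<epsilon>)"
        have sf: "smooth ?f" by (rule ssm[OF \<epsilon> rK[OF \<epsilon>1] K])
        have sq: "smooth (q \<epsilon>)" by (rule smooth_supported_smooth[OF qK[OF \<epsilon>1]])
        \<comment> \<open>\<open>q\<close> and \<open>s \<epsilon> (r \<epsilon>)\<close> coincide
          on the open set \<open>V\<close>, so the seminorm over \<open>K0\<close> that controls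
          \<open>S\<close> vanishes on their difference.\<close>
        have "seminorm_on K0 j0 (\<lambda>x. q \<epsilon> x - ?f x) \<le> ennreal 0"
        proof (rule seminorm_on_leI)
          fix \<alpha> x assume "x \<in> K0"
          hence "mpartial \<alpha> (\<lambda>x. q \<epsilon> x - ?f x) x = 0"
            using h \<epsilon> by (intro mpartial_zero_on_open[of V]) (auto simp: q_def)
          thus "cmod (mpartial \<alpha> (\<lambda>x. q \<epsilon> x - ?f x) x) \<le> 0" by simp
        qed
        hence "ennreal (cmod (S \<epsilon> (\<lambda>x. q \<epsilon> x - ?f x))) \<le> 0"
          using Sb[OF smooth_diff[OF sq sf], of \<epsilon>] good[OF \<epsilon>] by simp
        hence "S \<epsilon> (\<lambda>x. q \<epsilon> x - ?f x) = 0" by simp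
        moreover have "S \<epsilon> (\<lambda>x. (q \<epsilon> x - ?f x) + ?f x) = S \<epsilon> (\<lambda>x. q \<epsilon> x - ?f x) + S \<epsilon> ?f"
          by (rule Slin(1)[OF \<epsilon>1 smooth_diff[OF sq sf] sf])
        ultimately show "S \<epsilon> (q \<epsilon>) = U \<epsilon> (r \<epsilon>)" using \<epsilon> by (simp add: U_def)
      qed (use \<eta> in simp)
    qed
    have "represents (\<lambda>\<epsilon>. U \<epsilon> (r \<epsilon>)) (u y)" using uU y r K rK unfolding defined_by_def by blast
    hence "u y = v ?x" using Ux by (rule represents_unique)
    thus "represents (\<lambda>\<epsilon>. W \<epsilon> (r \<epsilon>)) (u y)" using Wx by simp
  qed
  have 3: "B_loc_moderate p (\<lambda>\<epsilon> \<xi>. k \<xi> * symbol_tilde m a \<epsilon> \<xi>) W"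
    unfolding B_loc_moderate_def
  proof (intro conjI ballI)
    fix \<epsilon> :: real assume \<epsilon>1: "\<epsilon> \<in> {0<..1}"
    show "is_distribution (W \<epsilon>)"
    proof (cases "\<epsilon> \<le> \<eta>")
      case True
      hence "W \<epsilon> = (\<lambda>f. v_net \<epsilon> (\<lambda>x. h x * sol m (?a \<epsilon>) (w \<epsilon>) f x))" by (simp add: W_def s_def fun_eq_iff)
      thus ?thesis using is_distribution_localized_sol[OF T[OF \<epsilon>1] gs hK Kh] True \<epsilon>1 by simp
    next
      case False
      hence "W \<epsilon> = (\<lambda>f. 0)" by (simp add: W_def fun_eq_iff)
      thus ?thesis by (simp add: schwartz_zero)
    qed
  next
    fix \<phi> :: "real ^ 'n \<Rightarrow> complex" assume "\<phi> \<in> test_functions"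
    then obtain K where K: "compact K" and \<phi>: "\<phi> \<in> smooth_supported K" by (auto simp: test_functions_def)
    obtain D M where D: "D \<ge> 0" "\<And>b w g. good_shift m R c' b w \<Longrightarrow> g \<in> borel_measurable borel \<Longrightarrow>
       Lp_norm p (\<lambda>\<xi>. k \<xi> * cmod (g \<xi>)) < \<infinity> \<Longrightarrow> integrable lborel (\<lambda>\<xi>. cmod (g \<xi>) * decay M \<xi>) \<and>
       Lp_norm p (\<lambda>\<xi>. k \<xi> * ptilde m b \<xi> * cmod (solhat m b w h \<phi> g \<xi>)) \<le> ennreal D * Lp_norm p (\<lambda>\<xi>. k \<xi> * cmod (g \<xi>))"
      by (rule Lp_norm_solhat[OF hK Kh \<phi> K assms(3,4), of m R c']) blast
    \<comment> \<open>Above \<eta> the functional is 0, and so is its transform.\<close>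
    define G where "G \<epsilon> = (if \<epsilon> \<le> \<eta> then solhat m (?a \<epsilon>) (w \<epsilon>) h \<phi> (g \<epsilon>) else (\<lambda>_. 0))" for \<epsilon>
    have fin: "Lp_norm p (\<lambda>\<xi>. k \<xi> * cmod (g \<epsilon> \<xi>)) < \<infinity>" if "0 < \<epsilon>" "\<epsilon> \<le> \<eta>" for \<epsilon>
      using good[OF that] ennreal_less_top order_le_less_trans infinity_ennreal_def by metis
    have gm: "g \<epsilon> \<in> borel_measurable borel" if "\<epsilon> \<in> {0<..1}" for \<epsilon>
      using g[OF that] by (simp add: has_fourier_def)
    have eqW: "(\<lambda>f. W \<epsilon> (\<lambda>x. \<phi> x * f x)) = (if \<epsilon> \<le> \<eta> then (\<lambda>f. v_net \<epsilon> (\<lambda>x. h x * sol m (?a \<epsilon>) (w \<epsilon>) (\<lambda>y. \<phi> y * f y) x)) else (\<lambda>f. 0))" for \<epsilon>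
      by (simp add: W_def s_def fun_eq_iff)
    show "B_moderate p (\<lambda>\<epsilon> \<xi>. k \<xi> * symbol_tilde m a \<epsilon> \<xi>) (\<lambda>\<epsilon> f. W \<epsilon> (\<lambda>x. \<phi> x * f x))"
      unfolding B_moderate_def
    proof (intro conjI ballI exI[of _ G] exI[of _ b])
      fix \<epsilon> :: real assume \<epsilon>1: "\<epsilon> \<in> {0<..1}"
      show "is_tempered_distribution (\<lambda>f. W \<epsilon> (\<lambda>x. \<phi> x * f x))"
        using is_tempered_localized_sol[OF T[OF \<epsilon>1] gs hK Kh \<phi> K] \<epsilon>1 unfolding eqW by (simp add: schwartz_zero)
    next
      fix \<epsilon> :: real assume \<epsilon>1: "\<epsilon> \<in> {0<..1}"
      show "has_fourier (\<lambda>f. W \<epsilon> (\<lambda>x. \<phi> x * f x)) (G \<epsilon>)"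
      proof (cases "\<epsilon> \<le> \<eta>")
        case True
        hence \<epsilon>: "0 < \<epsilon>" "\<epsilon> \<le> \<eta>" using \<epsilon>1 by auto
        have "integrable lborel (\<lambda>\<xi>. cmod (g \<epsilon> \<xi>) * decay M \<xi>)" using D(2)[OF gs[OF \<epsilon>] gm[OF \<epsilon>1] fin[OF \<epsilon>]] by blast
        from has_fourier_localized_sol[OF gs[OF \<epsilon>] hK Kh \<phi> K T[OF \<epsilon>1] g[OF \<epsilon>1] this]
        show ?thesis using True unfolding eqW by (simp add: G_def)
      next
        case False
        thus ?thesis unfolding eqW by (simp add: G_def schwartz_zero)
      qed
    next
      \<comment> \<open>\<open>D\<close> does not depend on \<epsilon>, so the growth exponent
        \<open>b\<close> of the given net is inherited unchanged.\<close>
      have "net_O (\<lambda>\<epsilon>. ennreal D * Lp_norm p (\<lambda>\<xi>. k \<xi> * cmod (g \<epsilon> \<xi>))) (0 + b)"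
        by (rule net_O_mult[OF net_O_const b]) simp
      hence "net_O (\<lambda>\<epsilon>. Lp_norm p (\<lambda>\<xi>. k \<xi> * symbol_tilde m a \<epsilon> \<xi> * cmod (G \<epsilon> \<xi>))) (0 + b)"
      proof (rule net_O_eventually_le)
        show "\<forall>\<^sub>F \<epsilon> in at_right 0. Lp_norm p (\<lambda>\<xi>. k \<xi> * symbol_tilde m a \<epsilon> \<xi> * cmod (G \<epsilon> \<xi>)) \<le> ennreal D * Lp_norm p (\<lambda>\<xi>. k \<xi> * cmod (g \<epsilon> \<xi>))"
        proof (rule eventually_le_at_right[of \<eta>])
          fix \<epsilon> assume \<epsilon>: "0 < \<epsilon>" "\<epsilon> \<le> \<eta>"
          show "Lp_norm p (\<lambda>\<xi>. k \<xi> * symbol_tilde m a \<epsilon> \<xi> * cmod (G \<epsilon> \<xi>)) \<le> ennreal D * Lp_norm p (\<lambda>\<xi>. k \<xi> * cmod (g \<epsilon> \<xi>))"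
            using D(2)[OF gs[OF \<epsilon>] gm[OF \<eta>01[OF \<epsilon>]] fin[OF \<epsilon>]] \<epsilon> by (simp add: G_def symbol_tilde_eq_ptilde)
        qed (use \<eta> in simp)
      qed
      thus "net_O (\<lambda>\<epsilon>. Lp_norm p (\<lambda>\<xi>. k \<xi> * symbol_tilde m a \<epsilon> \<xi> * cmod (G \<epsilon> \<xi>))) b" by simp
    qed
  qed
  from 1 2 3 u show ?thesis by blast
qed

end
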